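(* Let $W$ be a compact connected oriented smooth manifold of dimension $m$ without boundary, let $\mathfrak p$ be a perversity, $C(W)$ the cone over $W$, and $V$ a finite dimensional real vector space with the trivial representation $\rho_0$. Then for every $q$ there is an isomorphism $$I^{\mathfrak p}H_q(C(W);V_{\rho_0})\;\cong\;\big(I^{\mathfrak p^c}H_{m+1-q}(C(W),W;V_{\rho_0})\big)^\dagger,$$ where $\dagger$ denotes the dual vector space.
   Context: A perversity is a sequence of integers $\mathfrak p=\{\mathfrak p_j\}_{j=2}^n$ with $\mathfrak p_2=0$ and $\mathfrak p_{j+1}\in\{\mathfrak p_j,\mathfrak p_j+1\}$; $n=m+1$, $\mathfrak a=n-\mathfrak p_n$; the complementary perversity is $\mathfrak p^c_j=j-\mathfrak p_j-2$. Let $N$ be any regular cellular decomposition of $W$, and $C(N)$ the cone complex with vertex $v$ (cells $v$, $e$, $[v,e]$ for $e$ a cell of $N$). $I^{\mathfrak p}C(N)_{(q)}$ is the subcomplex of the $q$-skeleton of cells $e$ with $\dim(\bar e\cap\{v\})\le q-n+\mathfrak p_n$; it is $N_{(q)}$ for $q<\mathfrak a$, $C(N)_{(q)}$ for $q\ge\mathfrak a$. The intersection chain complex has $I^{\mathfrak p}C_q(C(N))=H_q(I^{\mathfrak p}C(N)_{(q)},I^{\mathfrak p}C(N)_{(q-1)})$, and the relative one $I^{\mathfrak p}C_q(C(N),N)=H_q(I^{\mathfrak p}C(N)_{(q)}\cup N,I^{\mathfrak p}C(N)_{(q-1)}\cup N)$, with the boundary operators of the filtrations, tensored with $V$. $I^{\mathfrak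 p}H_q(C(W);V_{\rho_0})$ and $I^{\mathfrak p}H_q(C(W),W;V_{\rho_0})$ are their homologies, which do not depend on $N$. *)

theory Defs
  imports "HOL-Analysis.Analysis" "HOL-Algebra.Module" "HOL-Algebra.AbelCoset" "HOL-Homology.Homology"
begin

section \<open>Oriented smooth manifolds\<close>

text \<open>\<open>C_k_on k f S\<close> is the notion of a \<open>k\<close> times continuously differentiable map for open \<open>S\<close>.\<close>

primrec C_k_on ::
  "nat \<Rightarrow> ('a::euclidean_space \<Rightarrow> 'b::euclidean_space) \<Rightarrow> 'a set \<Rightarrow> bool" where
  "C_k_on 0 f S \<longleftrightarrow> continuous_on S f"
| "C_k_on (Suc k) f S \<longleftrightarrow>
     (\<forall>x\<in>S. f differentiable (at x)) \<and> (\<forall>v. C_k_on k (\<lambda>x. frechet_derivative f (at x) v) S)"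

definition smooth_map_on :: "('a::euclidean_space \<Rightarrow> 'b::euclidean_space) \<Rightarrow> 'a set \<Rightarrow> bool" where
  "smooth_map_on f S \<longleftrightarrow> (\<forall>k. C_k_on k f S)"

definition chart :: "'a topology \<Rightarrow> 'a set \<times> ('a \<Rightarrow> real^'m) \<Rightarrow> bool" where
  "chart W = (\<lambda>(U, \<phi>). openin W U \<and> open (\<phi> ` U) \<and>
     homeomorphic_map (subtopology W U) (top_of_set (\<phi> ` U)) \<phi>)"

definition oriented_compatible ::
  "'a set \<times> ('a \<Rightarrow> real^'m) \<Rightarrow> 'a set \<times> ('a \<Rightarrow> real^'m) \<Rightarrow> bool" where
  "oriented_compatible = (\<lambda>(U, \<phi>) (U', \<psi>).
     let \<tau> = \<psi> \<circ> inv_into U \<phi>; S = \<phi> ` (U \<inter> U') in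
       smooth_map_on \<tau> S \<and> (\<forall>x\<in>S. 0 < det (matrix (frechet_derivative \<tau> (at x)))))"

text \<open>The dimension is \<open>CARD('m)\<close>. The orientation is part of the atlas. Charts are open
  subsets of \<open>real ^ 'm\<close>, so the manifold has no boundary.\<close>

definition oriented_smooth_manifold ::
  "'a topology \<Rightarrow> ('a set \<times> ('a \<Rightarrow> real^'m)) set \<Rightarrow> bool" where
  "oriented_smooth_manifold W \<A> \<longleftrightarrow>
     Hausdorff_space W \<and> second_countable W \<and>
     (\<forall>c\<in>\<A>. chart W c) \<and> \<Union> (fst ` \<A>) = topspace W \<and>
     (\<forall>c\<in>\<A>. \<forall>c'\<in>\<A>. oriented_compatible c c')"

section \<open>Regular cellular decompositions\<close>

definition closed_ball_space :: "nat \<Rightarrow> (nat \<Rightarrow> real) topology" where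
  "closed_ball_space k = subtopology (Euclidean_space k) {x. (\<Sum>i<k. (x i)\<^sup>2) \<le> 1}"

definition open_ball_set :: "nat \<Rightarrow> (nat \<Rightarrow> real) set" where
  "open_ball_set k = {x \<in> topspace (Euclidean_space k). (\<Sum>i<k. (x i)\<^sup>2) < 1}"

text \<open>Cells are open cells; \<open>N k\<close> is the set of \<open>k\<close>-dimensional cells.\<close>

definition regular_cell :: "'a topology \<Rightarrow> nat \<Rightarrow> 'a set \<Rightarrow> bool" where
  "regular_cell X k e \<longleftrightarrow> e \<subseteq> topspace X \<and>
     (\<exists>f. homeomorphic_map (closed_ball_space k) (subtopology X (X closure_of e)) f \<and>
          f ` open_ball_set k = e)"

definition regular_cell_decomposition :: "'a topology \<Rightarrow> (nat \<Rightarrow> 'a set set) \<Rightarrow> bool" where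
  "regular_cell_decomposition X N \<longleftrightarrow>
     Hausdorff_space X \<and>
     (\<forall>k. \<forall>e\<in>N k. regular_cell X k e) \<and>
     (\<forall>k l. \<forall>e\<in>N k. \<forall>e'\<in>N l. (k, e) \<noteq> (l, e') \<longrightarrow> e \<inter> e' = {}) \<and>
     (\<Union>k. \<Union> (N k)) = topspace X \<and>
     (\<forall>k. \<forall>e\<in>N k. X closure_of e - e \<subseteq> (\<Union>l<k. \<Union> (N l))) \<and>
     (\<forall>k. \<forall>e\<in>N k. finite {(l, e'). e' \<in> N l \<and> e' \<inter> X closure_of e \<noteq> {}}) \<and>
     (\<forall>A\<subseteq>topspace X.
        (\<forall>k. \<forall>e\<in>N k. closedin X (A \<inter> X closure_of e)) \<longrightarrow> closedin X A)"

section \<open>The cone and its cellular decomposition\<close>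

datatype 'a cone = Apex | Pt 'a real

definition cone_proj :: "'a \<times> real \<Rightarrow> 'a cone" where
  "cone_proj = (\<lambda>(x, t). if t = 0 then Apex else Pt x t)"

definition cylinder :: "'a topology \<Rightarrow> ('a \<times> real) topology" where
  "cylinder W = prod_topology W (top_of_set {0..1})"

text \<open>\<open>W \<times> [0,1]\<close> with \<open>W \<times> {0}\<close> collapsed to the vertex, in the quotient topology.\<close>

definition cone_space :: "'a topology \<Rightarrow> 'a cone topology" where
  "cone_space W = topology (\<lambda>U. U \<subseteq> cone_proj ` topspace (cylinder W) \<and>
     openin (cylinder W) {z \<in> topspace (cylinder W). cone_proj z \<in> U})"

lemma openin_cone_space:
  "openin (cone_space W) U \<longleftrightarrow> U \<subseteq> cone_proj ` topspace (cylinder W) \<and>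
     openin (cylinder W) {z \<in> topspace (cylinder W). cone_proj z \<in> U}"
proof -
  let ?T = "topspace (cylinder W)"
  have "istopology (\<lambda>U. U \<subseteq> cone_proj ` ?T \<and> openin (cylinder W) {z \<in> ?T. cone_proj z \<in> U})"
    unfolding istopology_def
  proof (intro conjI allI impI)
    fix S T
    assume "S \<subseteq> cone_proj ` ?T \<and> openin (cylinder W) {z \<in> ?T. cone_proj z \<in> S}"
      and "T \<subseteq> cone_proj ` ?T \<and> openin (cylinder W) {z \<in> ?T. cone_proj z \<in> T}"
    moreover have "{z \<in> ?T. cone_proj z \<in> S \<inter> T} =
        {z \<in> ?T. cone_proj z \<in> S} \<inter> {z \<in> ?T. cone_proj z \<in> T}" by blast
    ultimately show "S \<inter> T \<subseteq> cone_proj ` ?T"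
      and "openin (cylinder W) {z \<in> ?T. cone_proj z \<in> S \<inter> T}" by auto
  next
    fix \<K>
    assume *: "\<forall>K\<in>\<K>. K \<subseteq> cone_proj ` ?T \<and> openin (cylinder W) {z \<in> ?T. cone_proj z \<in> K}"
    then show "\<Union>\<K> \<subseteq> cone_proj ` ?T" by blast
    have "{z \<in> ?T. cone_proj z \<in> \<Union>\<K>} = (\<Union>K\<in>\<K>. {z \<in> ?T. cone_proj z \<in> K})" by blast
    with * show "openin (cylinder W) {z \<in> ?T. cone_proj z \<in> \<Union>\<K>}" by auto
  qed
  then show ?thesis unfolding cone_space_def by simp
qed

lemma topspace_cone_space: "topspace (cone_space W) = cone_proj ` topspace (cylinder W)"
proof
  show "topspace (cone_space W) \<subseteq> cone_proj ` topspace (cylinder W)"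
    using openin_cone_space by blast
  have "{z \<in> topspace (cylinder W). cone_proj z \<in> cone_proj ` topspace (cylinder W)}
      = topspace (cylinder W)" by blast
  then have "openin (cone_space W) (cone_proj ` topspace (cylinder W))"
    by (simp add: openin_cone_space)
  then show "cone_proj ` topspace (cylinder W) \<subseteq> topspace (cone_space W)"
    by (rule openin_subset)
qed

lemma quotient_map_cone_proj: "quotient_map (cylinder W) (cone_space W) cone_proj"
  by (auto simp: quotient_map_def openin_cone_space topspace_cone_space)

definition cone_base :: "'a topology \<Rightarrow> 'a cone set" where
  "cone_base W = cone_proj ` (topspace W \<times> {1})"

text \<open>The cells of the cone complex: the vertex, the cells \<open>e\<close> of \<open>N\<close> (in the base), and the
  open cells \<open>[v,e]\<close>.\<close>

definition cone_cells :: "(nat \<Rightarrow> 'a set set) \<Rightarrow> nat \<Rightarrow> 'a cone set set" where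
  "cone_cells N k =
     (if k = 0 then {{Apex}} else {cone_proj ` (e \<times> {0<..<1}) | e. e \<in> N (k - 1)}) \<union>
     {cone_proj ` (e \<times> {1}) | e. e \<in> N k}"

section \<open>Perversities and the intersection filtration\<close>

definition perversity :: "nat \<Rightarrow> (nat \<Rightarrow> int) \<Rightarrow> bool" where
  "perversity n p \<longleftrightarrow>
     p 2 = 0 \<and> (\<forall>j. 2 \<le> j \<and> j < n \<longrightarrow> p (Suc j) \<in> {p j, p j + 1})"

definition complementary_perversity :: "(nat \<Rightarrow> int) \<Rightarrow> nat \<Rightarrow> int" where
  "complementary_perversity p = (\<lambda>j. int j - p j - 2)"

text \<open>The union of the cells \<open>e\<close> of dimension at most \<open>q\<close> such that the dimension of the part of
  the closed cell lying in \<open>{v}\<close> is at most \<open>q - n + p n\<close>. That dimension is \<open>0\<close> if the closed cell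
  contains \<open>v\<close>; otherwise it is the dimension of the empty set, which is minus infinity.\<close>

definition ic_skeleton ::
  "nat \<Rightarrow> (nat \<Rightarrow> int) \<Rightarrow> 'a topology \<Rightarrow> (nat \<Rightarrow> 'a set set) \<Rightarrow> int \<Rightarrow> 'a cone set" where
  "ic_skeleton n p W N q =
     \<Union> {e. (\<exists>k. int k \<le> q \<and> e \<in> cone_cells N k) \<and>
           (cone_space W closure_of e \<inter> {Apex} \<noteq> {} \<longrightarrow> 0 \<le> q - int n + p n)}"

section \<open>Real vector spaces on carrier sets\<close>

text \<open>Real vector spaces are modules in the sense of \<open>HOL-Algebra\<close> over the ring of reals. The
  multiplicative fields \<open>mult\<close> and \<open>one\<close> of the module record play no role.\<close>

definition real_ring :: "real ring" where
  "real_ring = \<lparr>carrier = UNIV, mult = (*), one = 1, zero = 0, add = (+)\<rparr>"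

definition linear_maps ::
  "(real, 'a) module \<Rightarrow> (real, 'b) module \<Rightarrow> ('a \<Rightarrow> 'b) set" where
  "linear_maps M N = {f \<in> carrier M \<rightarrow> carrier N.
     (\<forall>x\<in>carrier M. \<forall>y\<in>carrier M. f (x \<oplus>\<^bsub>M\<^esub> y) = f x \<oplus>\<^bsub>N\<^esub> f y) \<and>
     (\<forall>r. \<forall>x\<in>carrier M. f (r \<odot>\<^bsub>M\<^esub> x) = r \<odot>\<^bsub>N\<^esub> f x)}"

definition linearly_isomorphic :: "(real, 'a) module \<Rightarrow> (real, 'b) module \<Rightarrow> bool" where
  "linearly_isomorphic M N \<longleftrightarrow> (\<exists>f\<in>linear_maps M N. bij_betw f (carrier M) (carrier N))"

definition real_line :: "(real, real) module" where
  "real_line = \<lparr>carrier = UNIV, mult = undefined, one = undefined, zero = 0, add = (+), smult = (*)\<rparr>"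

definition dual_space :: "(real, 'a) module \<Rightarrow> (real, 'a \<Rightarrow> real) module" where
  "dual_space M = \<lparr>carrier = linear_maps M real_line \<inter> extensional (carrier M),
     mult = undefined, one = undefined,
     zero = (\<lambda>x\<in>carrier M. 0),
     add = (\<lambda>f g. \<lambda>x\<in>carrier M. f x + g x),
     smult = (\<lambda>r f. \<lambda>x\<in>carrier M. r * f x)\<rparr>"

definition quotient_space :: "(real, 'a) module \<Rightarrow> 'a set \<Rightarrow> (real, 'a set) module" where
  "quotient_space M S = \<lparr>carrier = a_rcosets\<^bsub>M\<^esub> S,
     mult = undefined, one = undefined,
     zero = S,
     add = (\<lambda>A B. A <+>\<^bsub>M\<^esub> B),
     smult = (\<lambda>r A. \<Union>x\<in>A. S +>\<^bsub>M\<^esub> (r \<odot>\<^bsub>M\<^esub> x))\<rparr>"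

definition homology_space ::
  "(int \<Rightarrow> (real, 'a) module) \<Rightarrow> (int \<Rightarrow> 'a \<Rightarrow> 'a) \<Rightarrow> int \<Rightarrow> (real, 'a set) module" where
  "homology_space C d q =
     quotient_space (C q\<lparr>carrier := {x \<in> carrier (C q). d q x = \<zero>\<^bsub>C (q - 1)\<^esub>}\<rparr>)
       (d (q + 1) ` carrier (C (q + 1)))"

section \<open>Tensoring an abelian group with a real vector space\<close>

text \<open>The tensor product over the integers: the free abelian group on pairs \<open>(x, v)\<close> modulo the
  subgroup generated by the biadditivity relations. Real scalars act on the second factor.\<close>

definition tensor_free :: "'g monoid \<Rightarrow> (('g \<times> 'v::real_vector) \<Rightarrow>\<^sub>0 int) monoid" where
  "tensor_free G = free_Abelian_group (carrier G \<times> UNIV)"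

definition tensor_relations :: "'g monoid \<Rightarrow> (('g \<times> 'v::real_vector) \<Rightarrow>\<^sub>0 int) set" where
  "tensor_relations G = generate (tensor_free G)
     ({frag_of (x \<otimes>\<^bsub>G\<^esub> y, v) - frag_of (x, v) - frag_of (y, v) | x y v.
         x \<in> carrier G \<and> y \<in> carrier G} \<union>
      {frag_of (x, v + w) - frag_of (x, v) - frag_of (x, w) | x v w. x \<in> carrier G})"

definition tensor_space ::
  "'g monoid \<Rightarrow> (real, (('g \<times> 'v::real_vector) \<Rightarrow>\<^sub>0 int) set) module" where
  "tensor_space G = (let T = tensor_free G Mod tensor_relations G in
     \<lparr>carrier = carrier T,
      mult = undefined, one = undefined,
      zero = \<one>\<^bsub>T\<^esub>,
      add = monoid.mult T,
      smult = (\<lambda>r A. \<Union>c\<in>A. tensor_relations G #>\<^bsub>tensor_free G\<^esub>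
                 frag_extend (\<lambda>(x, v). frag_of (x, r *\<^sub>R v)) c)\<rparr>)"

text \<open>\<open>tensor_map H d\<close> is \<open>d \<otimes> id\<close> for a homomorphism \<open>d\<close> with target \<open>H\<close>.\<close>

definition tensor_map ::
  "'h monoid \<Rightarrow> ('g \<Rightarrow> 'h) \<Rightarrow> (('g \<times> 'v::real_vector) \<Rightarrow>\<^sub>0 int) set \<Rightarrow> (('h \<times> 'v) \<Rightarrow>\<^sub>0 int) set" where
  "tensor_map H d A = (\<Union>c\<in>A. tensor_relations H #>\<^bsub>tensor_free H\<^esub>
     frag_extend (\<lambda>(x, v). frag_of (d x, v)) c)"

section \<open>Intersection homology of the cone\<close>

text \<open>For an increasing filtration \<open>F\<close> of \<open>X\<close>: the chain complex with \<open>q\<close>-th group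
  \<open>H_q(F q, F (q - 1))\<close> and the boundary operator of the triple \<open>(F q, F (q - 1), F (q - 2))\<close>.\<close>

definition filtration_chain_group ::
  "'a topology \<Rightarrow> (int \<Rightarrow> 'a set) \<Rightarrow> int \<Rightarrow> 'a chain set monoid" where
  "filtration_chain_group X F q = relative_homology_group q (subtopology X (F q)) (F (q - 1))"

definition filtration_boundary ::
  "'a topology \<Rightarrow> (int \<Rightarrow> 'a set) \<Rightarrow> int \<Rightarrow> 'a chain set \<Rightarrow> 'a chain set" where
  "filtration_boundary X F q =
     hom_relboundary q (subtopology X (F q)) (F (q - 1)) (F (q - 2))"

type_synonym ('a, 'v) tensor_chain = "(('a chain set \<times> 'v) \<Rightarrow>\<^sub>0 int) set"

definition filtration_homology ::
  "'v::real_vector itself \<Rightarrow> 'a topology \<Rightarrow> (int \<Rightarrow> 'a set) \<Rightarrow> int \<Rightarrow>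
     (real, ('a, 'v) tensor_chain set) module" where
  "filtration_homology V X F =
     homology_space (\<lambda>q. tensor_space (filtration_chain_group X F q))
       (\<lambda>q. tensor_map (filtration_chain_group X F (q - 1)) (filtration_boundary X F q))"

text \<open>The coefficient space is the type \<open>'v\<close>; since the representation is trivial, the twisted
  chain complex is the tensor product of the chain complex with \<open>'v\<close>. The parameter \<open>n\<close> is the
  dimension of the cone.\<close>

definition intersection_homology_cone ::
  "'v::real_vector itself \<Rightarrow> nat \<Rightarrow> (nat \<Rightarrow> int) \<Rightarrow> 'a topology \<Rightarrow> (nat \<Rightarrow> 'a set set) \<Rightarrow> int \<Rightarrow>
     (real, ('a cone, 'v) tensor_chain set) module" where
  "intersection_homology_cone V n p W N =
     filtration_homology V (cone_space W) (ic_skeleton n p W N)"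

definition relative_intersection_homology_cone ::
  "'v::real_vector itself \<Rightarrow> nat \<Rightarrow> (nat \<Rightarrow> int) \<Rightarrow> 'a topology \<Rightarrow> (nat \<Rightarrow> 'a set set) \<Rightarrow> int \<Rightarrow>
     (real, ('a cone, 'v) tensor_chain set) module" where
  "relative_intersection_homology_cone V n p W N =
     filtration_homology V (cone_space W) (\<lambda>q. ic_skeleton n p W N q \<union> cone_base W)"

end

theory Submission
 imports Defs "HOL-Library.Function_Algebras"
begin

text \<open>The cells of a regular decomposition of \<open>W\<close> give free cellular chain groups, and the local
 orientations turn the incidence numbers into a matrix \<open>a\<close> with \<open>a a = 0\<close> on the face poset. Poincare
 duality for \<open>W\<close> comes from the double complex on pairs \<open>s <= t\<close> of cells: its rows are cellular chain
 complexes of closed cells, which are acyclic, and its columns compute the local homology of \<open>W\<close> at a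
 cell, which is concentrated in degree \<open>m\<close>. Both edges thus have the same homology, so chains of one
 decomposition correspond to cochains, hence to the dual space of the homology, of any other.
 In the cone the perversity only truncates: the intersection homology of \<open>C(W)\<close> is the homology of \<open>W\<close>
 in low degrees and vanishes above because the cone is contractible, and the complementary perversity
 truncates the relative complex exactly in the dual degrees.\<close>

abbreviation big_union ("&&_" [900] 900) where "&&L == \<Union>L"
abbreviation equivalent (infixr "<->" 25) where "P <-> Q == (P::bool) = Q"
abbreviation set_product (infixr "><" 80) where "A >< B == A \<times> B"
type_notation prod (infixr "><" 20)
notation scaleR (infixr "*R" 75)
abbreviation module_add ("_ +[_] _" [65, 0, 66] 65) where "x +[M] y == x \<oplus>\<^bsub>M\<^esub> y"
abbreviation module_diff ("_ -[_] _" [65, 0, 66] 65) where "x -[M] y == x \<ominus>\<^bsub>M\<^esub> y"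
abbreviation module_neg ("-[_] _" [0, 81] 80) where "-[M] x == \<ominus>\<^bsub>M\<^esub> x"
abbreviation module_smult ("_ .[_] _" [71, 0, 70] 70) where "r .[M] x == r \<odot>\<^bsub>M\<^esub> x"
abbreviation group_mult ("_ *[_] _" [70, 0, 71] 70) where "x *[G] y == x \<otimes>\<^bsub>G\<^esub> y"
abbreviation group_inv ("inv[_] _" [0, 81] 80) where "inv[G] x == inv\<^bsub>G\<^esub> x"
abbreviation group_pow ("_ ^[_] _" [75, 0, 75] 75) where "x ^[G] k == x [^]\<^bsub>G\<^esub> k"
abbreviation "subtop == subtopology"
abbreviation "tsp == topspace"
abbreviation "cmap == continuous_map"
abbreviation "CB == closed_ball_space"
abbreviation "OB == open_ball_set"
abbreviation "CS == cone_space"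
abbreviation "RHG == relative_homology_group"
abbreviation "ptop == prod_topology"
abbreviation clo_of (infixr "clo" 80) where "X clo A == X closure_of A"
abbreviation car :: "('a, 'b) partial_object_scheme => 'a set" where "car == carrier"
abbreviation e1 :: "('a, 'b) monoid_scheme => 'a" where "e1 G == one G"
abbreviation e0 :: "('a, 'b) ring_scheme => 'a" where "e0 R == zero R"
abbreviation pkeys :: "('a \<Rightarrow>\<^sub>0 'b::zero) => 'a set" where "pkeys == Poly_Mapping.keys"
abbreviation EU :: "nat => (nat => real) topology" where "EU == Euclidean_space"
abbreviation int_scale :: "int => 'v::real_vector => 'v" (infixr "*z" 75) where "k *z v == of_int k *R v"
abbreviation trel :: "'g monoid => (('g >< 'v::real_vector) \<Rightarrow>\<^sub>0 int) set" where "trel == tensor_relations"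
type_synonym ('g, 'v) tfrag = "('g >< 'v) \<Rightarrow>\<^sub>0 int"
type_synonym ('g, 'v) tmod = "(real, ('g, 'v) tfrag set) module"

definition addi :: "('a, 'b) monoid_scheme => ('a => 'v::ab_group_add) => bool" where
 "addi G f <-> (ALL x:car G. ALL y:car G. f (x *[G] y) = f x + f y)"

lemma additive_onD:
 "addi G f ==> x : car G ==> y : car G ==> f (x *[G] y) = f x + f y"
 by (simp add: addi_def)

lemma additive_on_one:
 assumes "group G" "addi G f" shows "f (e1 G) = 0"
proof -
 interpret group G by fact
 have "f (e1 G) = f (e1 G) + f (e1 G)"
  using additive_onD[OF assms(2), of "e1 G" "e1 G"] by simp
 thus ?thesis by simp
qed

lemma additive_on_inv:
 assumes "group G" "addi G f" "x : car G" shows "f (inv[G] x) = - f x"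
proof -
 interpret group G by fact
 have "f (inv[G] x) + f x = 0"
  using additive_onD[OF assms(2), of "inv[G] x" x] assms additive_on_one[OF assms(1,2)] by simp
 thus ?thesis by (simp add: eq_neg_iff_add_eq_0)
qed

lemma additive_on_compose:
 assumes "addi H f" "h : hom G H" shows "addi G (%x. f (h x))"
 using assms by (auto simp: addi_def hom_def Pi_iff)

lemma additive_on_int_pow:
 fixes f :: "'a => 'v::real_vector"
 assumes "group G" "addi G f" "x : car G"
 shows "f (x ^[G] (k::int)) = k *z f x"
proof -
 interpret group G by fact
 have n: "f (x ^[G] (n::nat)) = of_nat n *R f x" for n
  by (induction n)
   (use assms in "auto simp: additive_on_one additive_onD scaleR_left_distrib")
 show ?thesis
 proof (cases "k >= 0")
  case True
  then obtain j where k: "k = int j" using zero_le_imp_eq_int by blast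
  have "x ^[G] k = x ^[G] j" unfolding k by (rule int_pow_int)
  thus ?thesis using n[of j] by (metis k of_int_of_nat_eq)
 next
  case False
  hence "x ^[G] k = inv[G] (x ^[G] (nat (- k)))" by (subst int_pow_def2) (simp only: not_le if_True)
  moreover have "real (nat (-k)) = - real_of_int k" using False by simp
  ultimately show ?thesis using n[of "nat (-k)"] assms by (simp add: additive_on_inv)
 qed
qed

definition int_separated :: "'g monoid => bool" where
 "int_separated G <-> (ALL x:car G. (ALL f :: 'g => int. addi G f --> f x = 0) --> x = e1 G)"

text \<open>A separated group embeds into a rational vector space of functions, where linear maps extend.\<close>

lemma additive_factor_extend:
 fixes F :: "'g => 'v::real_vector" and G' :: "'h monoid"
 assumes G: "comm_group G" and G': "comm_group G'" and sep: "int_separated G'" and d: "d : hom G G'"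
  and F: "addi G F" and ker: "!!z. z : car G ==> d z = e1 G' ==> F z = 0"
 obtains F' where "addi G' F'" "!!z. z : car G ==> F' (d z) = F z"
proof -
 interpret G: comm_group G by fact
 interpret G': comm_group G' by fact
 interpret group_hom G G' d by (simp add: group_hom_def group_hom_axioms_def d G.is_group G'.is_group)
 interpret p: vector_space_pair "%(q::rat) (h::('h => int) => real) f. of_rat q * h f" "%(q::rat) (v::'v). real_of_rat q *R v"
  by unfold_locales (auto simp: fun_eq_iff of_rat_add of_rat_mult algebra_simps)
 define i where "i x f = (if addi G' f then real_of_int (f x) else 0)" for x f
 have add: "addi G' (%x. i x f)" for f by (cases "addi G' f") (auto simp: addi_def i_def)
 have mult: "i (x *[G'] y) f = i x f + i y f" if "x : car G'" "y : car G'" for x y f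
  using additive_onD[OF add that] by simp
 have pow: "i (x ^[G'] (k::int)) f = of_int k * i x f" if "x : car G'" for x f k
  using additive_on_int_pow[OF G'.is_group add that] by simp
 have inj: "F x = F y" if xy: "x : car G" "y : car G" "i (d x) = i (d y)" for x y
 proof -
  have "f (d (x *[G] inv[G] y)) = 0" if "addi G' f" for f :: "'h => int"
   using fun_cong[OF xy(3), of f] xy(1,2) that additive_onD[OF that, of "d x" "inv[G'] d y"] additive_on_inv[OF G'.is_group that, of "d y"]
   by (simp add: i_def)
  hence "d (x *[G] inv[G] y) = e1 G'" using sep xy unfolding int_separated_def by (meson G.inv_closed G.m_closed hom_closed)
  hence "F (x *[G] inv[G] y) = 0" using ker xy by simp
  thus ?thesis using additive_onD[OF F xy(1), of "inv[G] y"] additive_on_inv[OF G.is_group F xy(2)] xy by simp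
 qed
 note Fpow = additive_on_int_pow[OF G.is_group F]
 obtain B where B: "B <= (%x. i (d x)) ` car G" "p.vs1.independent B" "(%x. i (d x)) ` car G <= p.vs1.span B"
  by (rule p.vs1.maximal_independent_subset)
 have "ALL b:B. EX x. x : car G & i (d x) = b" using B(1) by blast
 from bchoice[OF this] obtain s where s: "!!b. b : B ==> s b : car G" "!!b. b : B ==> i (d (s b)) = b" by blast
 define g where "g = p.construct B (%b. F (s b))"
 interpret g: Vector_Spaces.linear "%(q::rat) (h::('h => int) => real) f. of_rat q * h f" "%(q::rat) (v::'v). real_of_rat q *R v" g
  unfolding g_def by (rule p.linear_construct[OF B(2)])
 have gB: "g b = F (s b)" if "b : B" for b unfolding g_def by (rule p.construct_basis[OF B(2) that])
 have span: "EX n>0. EX x:car G. i (d x) = (%f. of_int n * v f) & F x = n *z g v" if "v : p.vs1.span B" for v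
  using that
 proof (induction rule: p.vs1.span_induct_alt)
  case base
  show ?case using additive_on_one[OF G'.is_group add] additive_on_one[OF G.is_group F]
   by (intro exI[of _ 1] conjI bexI[of _ "e1 G"]) (auto simp: g.zero[unfolded zero_fun_def] zero_fun_def)
 next
  case (step c b v)
  then obtain n x where x: "n > 0" "x : car G" "i (d x) = (%f. of_int n * v f)" "F x = n *z g v" by blast
  obtain k l where kl: "quotient_of c = (k, l)" by fastforce
  have l: "l > 0" "real_of_rat c = of_int k / of_int l"
   using quotient_of_denom_pos[OF kl] quotient_of_div[OF kl] by (simp_all add: of_rat_divide)
  let ?y = "s b ^[G] (k * n) *[G] x ^[G] l"
  have "i (d ?y) f = of_int (n * l) * (of_rat c * b f + v f)" for f
   using step(1) x l s by (simp add: mult pow hom_int_pow field_simps)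
  moreover have "g (%f. of_rat c * b f + v f) = (of_int k / of_int l) *R F (s b) + g v"
   using g.add[unfolded plus_fun_def, of "%f. of_rat c * b f" v] g.scale[of c b] gB[OF step(1)] l(2) by simp
  hence "F ?y = (n * l) *z g (%f. of_rat c * b f + v f)"
   using additive_onD[OF F, of "s b ^[G] (k * n)" "x ^[G] l"] x s[OF step(1)] l(1)
   by (simp add: Fpow scaleR_right_distrib mult.commute)
  ultimately show ?case using x(1,2) l(1) s[OF step(1)]
   by (intro exI[of _ "n * l"] conjI bexI[of _ ?y]) (auto simp: plus_fun_def)
 qed
 show ?thesis
 proof (rule that[of "%x. g (i x)"])
  show "addi G' (%x. g (i x))" using g.add[unfolded plus_fun_def] by (simp add: addi_def ext[OF mult])
  fix x assume x: "x : car G"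
  then obtain n y where y: "n > 0" "y : car G" "i (d y) = (%f. of_int n * i (d x) f)" "F y = n *z g (i (d x))"
   using span B(3) by blast
  have "F y = F (x ^[G] n)" by (rule inj) (use x y in "auto simp: pow hom_int_pow fun_eq_iff")
  thus "g (i (d x)) = F x" using y x by (simp add: Fpow)
 qed
qed

subsection \<open>Integral spans of finitely many vectors\<close>

lemma finite_Z_span:
 fixes X :: "'v::real_vector set"
 assumes "finite X"
 obtains E c where "finite E" "!!x. x : X ==> x = (SUM e:E. c x e *z e)"
  "!!n :: 'v => int. (SUM e:E. n e *z e) = 0 ==> ALL e:E. n e = 0"
proof -
 interpret Q: vector_space "%(q::rat) (v::'v). real_of_rat q *R v"
  by unfold_locales (auto simp: scaleR_right_distrib scaleR_left_distrib of_rat_add of_rat_mult)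
 obtain B where B: "B <= X" "Q.independent B" "X <= Q.span B"
  by (rule Q.maximal_independent_subset)
 have fB: "finite B" using B assms finite_subset by blast
 have "EX u. x = (SUM b:B. real_of_rat (u b) *R b)" if "x : X" for x
  using B(3) that Q.span_finite[OF fB] by auto
 then obtain u where u: "!!x. x : X ==> x = (SUM b:B. real_of_rat (u x b) *R b)" by metis
 define D where "D = (PROD x:X. PROD b:B. snd (quotient_of (u x b)))"
 have pos: "snd (quotient_of q) > 0" for q by (simp add: quotient_of_denom_pos')
 have D: "D > 0" unfolding D_def by (intro prod_pos) (use pos in auto)
 have dv: "snd (quotient_of (u x b)) dvd D" if "x : X" and "b : B" for x b
  unfolding D_def using that assms fB
  by (metis (no_types, lifting) dvd_prodI dvd_trans)
 have "EX k. of_rat (u x b) * real_of_int D = real_of_int k" if xb: "x : X" "b : B" for x b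
 proof -
  obtain p q where pq: "quotient_of (u x b) = (p, q)" by fastforce
  hence q: "q > 0" "u x b = of_int p / of_int q"
   using quotient_of_div quotient_of_denom_pos by blast+
  obtain k where k: "D = q * k" using dv[OF xb] pq by (auto elim: dvdE)
  have "of_rat (u x b) * real_of_int D = real_of_int (p * k)"
   using q k by (simp add: of_rat_divide)
  thus ?thesis by blast
 qed
 then obtain c where c: "!!x b. x : X ==> b : B ==> of_rat (u x b) * real_of_int D = real_of_int (c x b)"
  by metis
 define g where "g b = (inverse (real_of_int D)) *R b" for b :: 'v
 have injg: "inj g" unfolding g_def using D by (auto simp: inj_def)
 show ?thesis
 proof (rule that[of "g ` B" "%x e. c x (inv_into UNIV g e)"])
  show "finite (g ` B)" using fB by simp
  show "x = (SUM e:g ` B. c x (inv_into UNIV g e) *z e)" if "x : X" for x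
  proof -
   have "(SUM e:g ` B. c x (inv_into UNIV g e) *z e) = (SUM b:B. c x b *z g b)"
    using injg by (subst sum.reindex) (auto simp: inj_on_def)
   also have "... = (SUM b:B. real_of_rat (u x b) *R b)"
    by (rule sum.cong) (use D c[OF that] in "auto simp: g_def simp flip: c[OF that]")
   finally show ?thesis using u[OF that] by simp
  qed
  fix n :: "'v => int" assume 0: "(SUM e:g ` B. n e *z e) = 0"
  have "(SUM e:g ` B. n e *z e) = (SUM b:B. n (g b) *z g b)"
   using injg by (subst sum.reindex) (auto simp: inj_on_def)
  also have "... = inverse (real_of_int D) *R (SUM b:B. real_of_rat (of_int (n (g b))) *R b)"
   unfolding g_def scaleR_sum_right by (rule sum.cong) auto
  finally have "(SUM b:B. real_of_rat (of_int (n (g b))) *R b) = 0" using 0 D by simp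
  hence "ALL b:B. of_int (n (g b)) = (0::rat)"
   using Q.independentD[OF B(2) fB order_refl, of "%b. of_int (n (g b))"] by blast
  thus "ALL e:g ` B. n e = 0" by auto
 qed
qed

definition lin_corr_by ::
 "(real, 'a) module => 'a set => 'a set => (real, 'b) module => 'b set => 'b set =>
  ('a => 'b => bool) => bool" where
 "lin_corr_by M Z B M' Z' B' R <->
   (ALL x x'. R x x' --> x : Z & x' : Z' & (x : B <-> x' : B')) &
   (ALL x x' y y'. R x x' --> R y y' --> R (x +[M] y) (x' +[M'] y')) &
   (ALL r x x'. R x x' --> R (r .[M] x) (r .[M'] x')) &
   (ALL x:Z. EX x'. R x x') & (ALL x':Z'. EX x. R x x')"

definition lin_corr ::
 "(real, 'a) module => 'a set => 'a set => (real, 'b) module => 'b set => 'b set => bool" where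
 "lin_corr M Z B M' Z' B' <-> (EX R. lin_corr_by M Z B M' Z' B' R)"

lemma lin_corr_byI:
 assumes "!!x x'. R x x' ==> x : Z" "!!x x'. R x x' ==> x' : Z'"
  "!!x x'. R x x' ==> x : B ==> x' : B'" "!!x x'. R x x' ==> x' : B' ==> x : B"
  "!!x x' y y'. R x x' ==> R y y' ==> R (x +[M] y) (x' +[M'] y')"
  "!!r x x'. R x x' ==> R (r .[M] x) (r .[M'] x')"
  "!!x. x : Z ==> EX x'. R x x'" "!!x'. x' : Z' ==> EX x. R x x'"
 shows "lin_corr_by M Z B M' Z' B' R"
 unfolding lin_corr_by_def
proof (intro conjI allI impI ballI)
 fix x x' assume "R x x'"
 thus "x : Z" "x' : Z'" "(x : B) = (x' : B')" using assms(1-4) by blast+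
qed (fact assms | erule (1) assms)+

lemma lin_corr_byD:
 assumes "lin_corr_by M Z B M' Z' B' R"
 shows "R x x' ==> x : Z" "R x x' ==> x' : Z'" "R x x' ==> x : B <-> x' : B'"
  "R x x' ==> R y y' ==> R (x +[M] y) (x' +[M'] y')"
  "R x x' ==> R (r .[M] x) (r .[M'] x')"
  "x : Z ==> EX x'. R x x'" "x' : Z' ==> EX x. R x x'"
 using assms unfolding lin_corr_by_def by blast+

lemma lin_corr_trans:
 assumes "lin_corr M Z B M' Z' B'" "lin_corr M' Z' B' M'' Z'' B''"
 shows "lin_corr M Z B M'' Z'' B''"
proof -
 obtain R S where "lin_corr_by M Z B M' Z' B' R" "lin_corr_by M' Z' B' M'' Z'' B'' S"
  using assms unfolding lin_corr_def by blast
 note R = lin_corr_byD[OF this(1)] and S = lin_corr_byD[OF this(2)]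
 have "lin_corr_by M Z B M'' Z'' B'' (%x y. EX z. R x z & S z y)"
 proof (rule lin_corr_byI)
  show "EX z. R (x +[M] y) z & S z (x' +[M''] y')"
   if "EX z. R x z & S z x'" "EX z. R y z & S z y'" for x x' y y'
   using that R(4) S(4) by blast
  show "EX z. R (r .[M] x) z & S z (r .[M''] x')" if "EX z. R x z & S z x'" for r x x'
   using that R(5) S(5) by blast
  show "EX x' z. R x z & S z x'" if "x : Z" for x using that R(2,6) S(6) by blast
  show "EX x z. R x z & S z x'" if "x' : Z''" for x' using that S(1,7) R(7) by blast
 qed (use R(1,2,3) S(1,2,3) in blast)+
 thus ?thesis unfolding lin_corr_def by blast
qed

lemma cring_real_ring: "cring real_ring"
proof -
 have "EX y. y + x = 0" for x :: real by (intro exI[of _ "- x"]) simp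
 thus ?thesis
  by unfold_locales (auto simp: real_ring_def algebra_simps Units_def add_eq_0_iff)
qed

lemma real_ring_simps [simp]:
 "car real_ring = UNIV" "e1 real_ring = 1" "e0 real_ring = 0"
 "x +[real_ring] y = x + y" "x *[real_ring] y = x * y"
 by (simp_all add: real_ring_def)

lemma real_ring_minus [simp]: "-[real_ring] x = - x"
proof -
 interpret cring real_ring by (rule cring_real_ring)
 have "(- x) +[real_ring] x = e0 real_ring" by simp
 thus ?thesis by (metis minus_equality real_ring_simps(1) UNIV_I)
qed

lemma dual_space_simps:
 "car (dual_space M) = linear_maps M real_line Int extensional (car M)"
 "e0 (dual_space M) = (\<lambda>x\<in>car M. 0)"
 "f +[dual_space M] g = (\<lambda>x\<in>car M. f x + g x)"
 "r .[dual_space M] f = (\<lambda>x\<in>car M. r * f x)"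
 by (simp_all add: dual_space_def)

lemma linear_maps_real_line:
 "f : linear_maps M real_line <->
  (ALL x:car M. ALL y:car M. f (x +[M] y) = f x + f y) &
  (ALL r. ALL x:car M. f (r .[M] x) = r * f x)"
 by (auto simp: linear_maps_def real_line_def)

lemma abelian_group_dual_space:
 assumes "!!x y. x : car M ==> y : car M ==> x +[M] y : car M"
  and "!!r x. x : car M ==> r .[M] x : car M"
 shows "abelian_group (dual_space M)"
proof (rule abelian_groupI)
 let ?D = "dual_space M"
 have D: "f : car ?D <-> (ALL x:car M. ALL y:car M. f (x +[M] y) = f x + f y) &
  (ALL r. ALL x:car M. f (r .[M] x) = r * f x) & f : extensional (car M)" for f
  by (auto simp: dual_space_simps linear_maps_real_line)
 show "f +[?D] g : car ?D" if "f : car ?D" "g : car ?D" for f g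
  using that assms unfolding D by (auto simp: dual_space_simps(3) algebra_simps)
 show "e0 ?D : car ?D"
  using assms unfolding D by (auto simp: dual_space_simps(2))
 show "f +[?D] g +[?D] h = f +[?D] (g +[?D] h)" for f g h
  by (auto simp: dual_space_simps algebra_simps)
 show "f +[?D] g = g +[?D] f" for f g
  by (auto simp: dual_space_simps algebra_simps)
 show "(e0 ?D) +[?D] f = f" if "f : car ?D" for f
  using that unfolding D by (auto simp: dual_space_simps(2,3) extensional_def fun_eq_iff)
 show "EX g:car ?D. g +[?D] f = e0 ?D" if "f : car ?D" for f
 proof (intro bexI[of _ "\<lambda>x\<in>car M. - f x"])
  show "(\<lambda>x\<in>car M. - f x) +[?D] f = e0 ?D" by (auto simp: dual_space_simps)
  show "(\<lambda>x\<in>car M. - f x) : car ?D" using that assms unfolding D by auto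
 qed
qed

definition quotient_class :: "(real, 'a) module => 'a set => 'a => 'a set" where
 "quotient_class M B x = {b +[M] x | b. b : B}"

locale subquotient =
 fixes M :: "(real, 'a) module" (structure) and Z B :: "'a set"
 assumes M: "module real_ring M" and Z: "submodule Z real_ring M" and B: "submodule B real_ring M"
  and BZ: "B <= Z"
begin

sublocale M: module real_ring M by (rule M)
sublocale Z: submodule Z real_ring M by (rule Z)
sublocale B: submodule B real_ring M by (rule B)

abbreviation "K == quotient_class M B"
abbreviation "Q == quotient_space (M\<lparr>carrier := Z\<rparr>) B"

lemma ZM: "x : Z ==> x : car M" using Z.subset by auto
lemma BM: "x : B ==> x : car M" using B.subset by auto
lemma B0: "e0 M : B" and Z0: "e0 M : Z" using B.one_closed Z.one_closed by simp_all
lemma Badd: "x : B ==> y : B ==> x \<oplus> y : B" using B.m_closed by simp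
lemma Zadd: "x : Z ==> y : Z ==> x \<oplus> y : Z" using Z.m_closed by simp
lemma Bneg: "x : B ==> \<ominus> x : B" using B.m_inv_closed by (simp add: a_inv_def)
lemma Zneg: "x : Z ==> \<ominus> x : Z" using Z.m_inv_closed by (simp add: a_inv_def)
lemma Bsm: "x : B ==> r \<odot> x : B" and Zsm: "x : Z ==> r \<odot> x : Z"
 using B.smult_closed Z.smult_closed by simp_all

lemma K_self: assumes "x : Z" shows "x : K x"
 unfolding quotient_class_def using B0 ZM[OF assms] by force

lemma K_eq: assumes h: "x : Z" "y : K x" shows "K x = K y"
proof -
 obtain b where b: "b : B" "y = b \<oplus> x" using h by (auto simp: quotient_class_def)
 have x: "x : car M" using ZM h by auto
 have bc: "b : car M" using BM b(1) by blast
 have 1: "c \<oplus> y = (c \<oplus> b) \<oplus> x" if "c : B" for c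
  unfolding b(2) by (rule M.M.a_assoc[symmetric]) (use BM[OF that] bc x in auto)
 have 2: "c \<oplus> x = (c \<oplus> \<ominus> b) \<oplus> y" if "c : B" for c
 proof -
  have "(c \<oplus> \<ominus> b) \<oplus> y = c \<oplus> (\<ominus> b \<oplus> (b \<oplus> x))"
   unfolding b(2) by (rule M.M.a_assoc) (use BM[OF that] bc x in auto)
  also have "\<ominus> b \<oplus> (b \<oplus> x) = x" by (rule M.M.r_neg1[OF bc x])
  finally show ?thesis by simp
 qed
 show ?thesis
 proof (intro equalityI subsetI)
  fix z assume "z : K x"
  then obtain c where c: "c : B" "z = c \<oplus> x" by (auto simp: quotient_class_def)
  show "z : K y" using 2[OF c(1)] Badd[OF c(1) Bneg[OF b(1)]] c(2) by (auto simp: quotient_class_def)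
 next
  fix z assume "z : K y"
  then obtain c where c: "c : B" "z = c \<oplus> y" by (auto simp: quotient_class_def)
  show "z : K x" using 1[OF c(1)] Badd[OF c(1) b(1)] c(2) by (auto simp: quotient_class_def)
 qed
qed
lemma quotient_carrier: "car Q = K ` Z"
 by (auto simp: quotient_space_def A_RCOSETS_def' a_r_coset_def' quotient_class_def)

lemma quotient_add: assumes "x : Z" "y : Z" shows "K x +[Q] K y = K (x \<oplus> y)"
proof -
 have "K x +[Q] K y = {(b \<oplus> x) \<oplus> (c \<oplus> y) | b c. b : B & c : B}"
  by (auto simp: quotient_space_def set_add_def' quotient_class_def)
 also have "... = {(b \<oplus> c) \<oplus> (x \<oplus> y) | b c. b : B & c : B}"
 proof -
  have "(b \<oplus> x) \<oplus> (c \<oplus> y) = (b \<oplus> c) \<oplus> (x \<oplus> y)" if "b : B" "c : B" for b c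
   using BM[OF that(1)] BM[OF that(2)] ZM[OF `x : Z`] ZM[OF `y : Z`]
   by (simp only: M.M.a_assoc M.M.a_lcomm[of x c y] M.M.a_closed)
  note eq = this
  show ?thesis by (intro Collect_cong ex_cong1) (use eq in metis)
 qed
 also have "... = K (x \<oplus> y)"
 proof (intro equalityI subsetI)
  fix z assume "z : K (x \<oplus> y)"
  then obtain b where b: "b : B" "z = b \<oplus> (x \<oplus> y)" by (auto simp: quotient_class_def)
  have "z = (b \<oplus> (e0 M)) \<oplus> (x \<oplus> y)" using b BM by simp
  thus "z : {(b \<oplus> c) \<oplus> (x \<oplus> y) | b c. b : B & c : B}" using b(1) B0 by blast
 qed (auto simp: quotient_class_def intro: Badd)
 finally show ?thesis .
qed

lemma quotient_smult: assumes x: "x : Z" shows "r .[Q] K x = K (r \<odot> x)"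
proof -
 have "r .[Q] K x = (UN a:K x. K (r \<odot> a))"
  by (auto simp: quotient_space_def a_r_coset_def' quotient_class_def)
 also have "... = (UN a:K x. K (r \<odot> x))"
 proof (rule SUP_cong[OF refl])
  fix a assume a: "a : K x"
  show "K (r \<odot> a) = K (r \<odot> x)"
 proof (rule K_eq[symmetric])
  show "r \<odot> x : Z" using Zsm x by blast
  obtain b where b: "b : B" "a = b \<oplus> x" using a by (auto simp: quotient_class_def)
  have "r \<odot> a = r \<odot> b \<oplus> r \<odot> x"
   unfolding b(2) by (rule M.smult_r_distr) (use BM[OF b(1)] ZM[OF x] in auto)
  thus "r \<odot> a : K (r \<odot> x)" using Bsm[OF b(1)] by (auto simp: quotient_class_def)
 qed
 qed
 also have "... = K (r \<odot> x)" using K_self[OF x] by blast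
 finally show ?thesis .
qed

lemma linearly_isomorphic_quotientI:
 assumes M': "abelian_group M'"
  and corr: "lin_corr M Z B M' (car M') {e0 M'}"
 shows "linearly_isomorphic Q M'"
proof -
 interpret M': abelian_group M' by fact
 obtain R where "lin_corr_by M Z B M' (car M') {e0 M'} R"
  using corr unfolding lin_corr_def by blast
 note R0 = lin_corr_byD[OF this]
 have R1: "x : Z & x' : car M' & (x : B <-> x' = e0 M')" if "R x x'" for x x'
  using R0(1-3)[OF that] by blast
 note R = R1 R0(4-7)
 have R_fun: "x' = y'" if h: "R x x'" "R y y'" "y : K x" for x x' y y'
 proof -
  obtain b where b: "b : B" "y = b \<oplus> x" using h(3) by (auto simp: quotient_class_def)
  have x: "x : Z" "x : car M" using R(1)[OF h(1)] ZM by auto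
  obtain t where t: "R (\<ominus> x) t" using R(4) Zneg x by blast
  have "R (x \<oplus> \<ominus> x) (x' +[M'] t)" "R (y \<oplus> \<ominus> x) (y' +[M'] t)"
   using R(2) h t by blast+
  moreover have "x \<oplus> \<ominus> x = e0 M" "y \<oplus> \<ominus> x = b"
   using b BM x by (simp_all add: M.M.r_neg M.M.a_assoc)
  ultimately have "x' +[M'] t = e0 M'" "y' +[M'] t = e0 M'"
   using R(1) B0 b by metis+
  moreover have "x' : car M'" "y' : car M'" "t : car M'" using R(1) h t by blast+
  ultimately show ?thesis by (metis M'.add.right_cancel)
 qed
 define f where "f A = (THE x'. EX x:A. R x x')" for A
 have f: "f (K x) = x'" if "R x x'" for x x'
 proof -
  have x: "x : Z" using R(1) that by blast
  show ?thesis unfolding f_def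
  proof (rule the_equality)
   show "EX x:K x. R x x'" using K_self[OF x] that by blast
   show "z = x'" if "EX x:K x. R x z" for z using that R_fun `R x x'` by metis
  qed
 qed
 have "f : linear_maps Q M'"
  unfolding linear_maps_def quotient_carrier
 proof (intro CollectI conjI ballI allI)
  show "f : K ` Z \<rightarrow> car M'" using f R(1,4) by fastforce
  fix A assume "A : K ` Z"
  then obtain x where x: "A = K x" "x : Z" by blast
  obtain x' where x': "R x x'" using R(4) x by blast
  show "f (r .[Q] A) = r .[M'] f A" for r
   using f[OF R(3)[OF x']] f[OF x'] by (simp add: x quotient_smult)
  fix A' assume "A' : K ` Z"
  then obtain y where y: "A' = K y" "y : Z" by blast
  obtain y' where y': "R y y'" using R(4) y by blast
  show "f (A +[Q] A') = f A +[M'] f A'"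
   using f[OF R(2)[OF x' y']] f[OF x'] f[OF y'] by (simp add: x y quotient_add)
 qed
 moreover have "bij_betw f (car Q) (car M')"
  unfolding quotient_carrier bij_betw_def
 proof
  show "inj_on f (K ` Z)"
  proof (rule inj_onI)
   fix A A' assume "A : K ` Z" "A' : K ` Z" and eq: "f A = f A'"
   then obtain x y where x: "A = K x" "x : Z" and y: "A' = K y" "y : Z" by blast
   obtain x' where x': "R x x'" using R(4) x by blast
   obtain y' where y': "R y y'" using R(4) y by blast
   have "x' = y'" using eq f[OF x'] f[OF y'] x y by simp
   obtain t where t: "R (\<ominus> x) t" using R(4) Zneg x by blast
   have xc: "x : car M" "y : car M" using ZM x y by auto
   have "R (x \<oplus> \<ominus> x) (x' +[M'] t)" "R (y \<oplus> \<ominus> x) (x' +[M'] t)"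
    using R(2) x' y' t `x' = y'` by blast+
   hence "R (e0 M) (x' +[M'] t)" using M.M.r_neg[OF xc(1)] by metis
   hence "x' +[M'] t = e0 M'" using R(1) B0 by blast
   hence "y \<oplus> \<ominus> x : B"
    using R(1)[OF `R (y \<oplus> \<ominus> x) (x' +[M'] t)`] by blast
   moreover have "y = (y \<oplus> \<ominus> x) \<oplus> x" using xc by (simp add: M.M.a_assoc M.M.l_neg)
   ultimately have "y : K x" by (auto simp: quotient_class_def)
   thus "A = A'" using K_eq x y by blast
  qed
  show "f ` K ` Z = car M'"
  proof (intro equalityI subsetI)
   fix z assume "z : f ` K ` Z"
   then obtain x where x: "x : Z" "z = f (K x)" by blast
   obtain x' where "R x x'" using R(4) x by blast
   thus "z : car M'" using f R(1) x by auto
  next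
   fix z assume "z : car M'"
   then obtain x where "R x z" using R(5) by blast
   thus "z : f ` K ` Z" using f R(1) by (metis image_eqI)
  qed
 qed
 ultimately show ?thesis unfolding linearly_isomorphic_def by blast
qed

lemma dual_quotientD:
 assumes "L : car (dual_space Q)"
 shows "x : Z ==> y : Z ==> L (K (x \<oplus> y)) = L (K x) + L (K y)"
  and "x : Z ==> L (K (r \<odot> x)) = r * L (K x)"
  and "x : B ==> L (K x) = 0"
  and "L = e0 (dual_space Q) <-> (ALL x:Z. L (K x) = 0)"
proof -
 have L: "ALL x:car Q. ALL y:car Q. L (x +[Q] y) = L x + L y"
  "ALL r. ALL x:car Q. L (r .[Q] x) = r * L x" "L : extensional (car Q)"
  using assms by (auto simp: dual_space_simps linear_maps_real_line)
 have car: "K x : car Q" if "x : Z" for x using that by (simp add: quotient_carrier)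
 show add: "L (K (x \<oplus> y)) = L (K x) + L (K y)" if "x : Z" "y : Z" for x y
  using L(1) car[OF that(1)] car[OF that(2)] quotient_add[OF that] by metis
 show "L (K (r \<odot> x)) = r * L (K x)" if "x : Z" for x r
  using L(2) car[OF that] quotient_smult[OF that] by metis
 show "L (K x) = 0" if x: "x : B" for x
 proof -
  have "x \<oplus> (e0 M) : K (e0 M)" using x by (auto simp: quotient_class_def)
  hence "K (e0 M) = K x" using K_eq[OF Z0] BM[OF x] by simp
  moreover have "L (K (e0 M)) = 0" using add[OF Z0 Z0] by simp
  ultimately show ?thesis by simp
 qed
 show "L = e0 (dual_space Q) <-> (ALL x:Z. L (K x) = 0)"
  using L(3) by (auto simp: dual_space_simps(2) quotient_carrier extensional_def fun_eq_iff)
qed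

lemma dual_quotientI:
 assumes "!!x y. x : Z ==> y : Z ==> l (x \<oplus> y) = l x + l y"
  and "!!r x. x : Z ==> l (r \<odot> x) = r * l x" and "!!x. x : B ==> l x = (0::real)"
 obtains L where "L : car (dual_space Q)" "!!x. x : Z ==> L (K x) = l x"
proof -
 define L where "L = (\<lambda>A\<in>car Q. l (SOME x. x : A))"
 have L: "L (K x) = l x" if x: "x : Z" for x
 proof -
  have "(SOME y. y : K x) : K x" using K_self[OF x] by (rule someI)
  then obtain b where b: "b : B" "(SOME y. y : K x) = b \<oplus> x" by (auto simp: quotient_class_def)
  have "l (b \<oplus> x) = l x" using assms(1)[of b x] assms(3)[OF b(1)] BZ b(1) x by auto
  thus ?thesis using x b(2) by (simp add: L_def quotient_carrier)
 qed
 have "L : car (dual_space Q)"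
  unfolding dual_space_simps linear_maps_real_line Int_iff
 proof (intro conjI ballI allI)
  fix A A' assume "A : car Q" "A' : car Q"
  then obtain x y where xy: "x : Z" "y : Z" "A = K x" "A' = K y" by (auto simp: quotient_carrier)
  show "L (A +[Q] A') = L A + L A'"
   using xy L assms(1) Zadd by (simp add: quotient_add)
 next
  fix A and r :: real assume "A : car Q"
  then obtain x where x: "x : Z" "A = K x" by (auto simp: quotient_carrier)
  show "L (r .[Q] A) = r * L A" using x L assms(2) Zsm by (simp add: quotient_smult)
 qed (auto simp: L_def)
 thus ?thesis using that L by blast
qed

lemma abelian_group_dual_quotient: "abelian_group (dual_space Q)"
proof (rule abelian_group_dual_space)
 fix A A' assume "A : car Q" "A' : car Q"
 thus "A +[Q] A' : car Q" by (auto simp: quotient_carrier quotient_add Zadd)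
next
 fix A and r :: real assume "A : car Q"
 thus "r .[Q] A : car Q" by (auto simp: quotient_carrier quotient_smult Zsm)
qed

end

definition tcl :: "'g monoid => ('g, 'v::real_vector) tfrag => ('g, 'v) tfrag set" where
 "tcl G c = {h + c | h. h : trel G}"

lemma r_coset_tensor_relations:
 "trel G #>\<^bsub>tensor_free G\<^esub> c = tcl G c"
 by (auto simp: r_coset_def tcl_def tensor_free_def)

abbreviation tensor_gens :: "'g monoid => ('g, 'v::real_vector) tfrag set" where
 "tensor_gens G == {frag_of (x *[G] y, v) - frag_of (x, v) - frag_of (y, v) | x y v.
     x : car G & y : car G} Un
   {frag_of (x, v + w) - frag_of (x, v) - frag_of (x, w) | x v w. x : car G}"

lemma tensor_gens_keys: assumes "comm_group G" "h : tensor_gens G" shows "pkeys h <= car G >< UNIV"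
proof -
 interpret comm_group G by fact
 have k: "pkeys (frag_of p - frag_of q - frag_of r) <= {p, q, r}" for p q r :: "'a >< 'b"
  using keys_diff[of "frag_of p - frag_of q" "frag_of r"] keys_diff[of "frag_of p" "frag_of q"]
  by (auto simp: keys_frag_of)
 from assms(2) consider (1) x y v where "h = frag_of (x *[G] y, v) - frag_of (x, v) - frag_of (y, v)"
   "x : car G" "y : car G"
  | (2) x v w where "h = frag_of (x, v + w) - frag_of (x, v) - frag_of (x, w)" "x : car G"
  by blast
 thus ?thesis
 proof cases
  case (1 x y v)
  thus ?thesis using k[of "(x *[G] y, v)" "(x, v)" "(y, v)"] by auto
 next
  case (2 x v w)
  thus ?thesis using k[of "(x, v + w)" "(x, v)" "(x, w)"] by auto
 qed
qed

lemma tensor_relations_induct [consumes 2, case_names zero left right add minus]: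
 fixes c :: "('g, 'v::real_vector) tfrag"
 assumes G: "comm_group G" and c: "c : trel G"
  and "P 0"
  and "!!x y (v :: 'v). x : car G ==> y : car G ==>
   P (frag_of (x *[G] y, v) - frag_of (x, v) - frag_of (y, v))"
  and "!!x v w. x : car G ==> P (frag_of (x, v + w) - frag_of (x, v) - frag_of (x, w))"
  and "!!a b. P a ==> P b ==> P (a + b)" and "!!a. P a ==> P (- a)"
 shows "P c"
proof -
 have PS: "P h" if "h : tensor_gens G" for h using that assms(4,5) by auto
 have "c : generate (tensor_free G) (tensor_gens G)" using c by (simp add: tensor_relations_def)
 thus ?thesis
 proof induction
  case one
  thus ?case using assms(3) by (simp add: tensor_free_def)
 next
  case (incl h)
  thus ?case by (rule PS)
 next
  case (inv h)
  thus ?case using tensor_gens_keys[OF G inv] PS[OF inv] assms(7) by (simp add: tensor_free_def)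
 next
  case (eng h1 h2)
  thus ?case using assms(6) by (simp add: tensor_free_def)
 qed
qed

definition tensor_scale :: "real => ('g, 'v::real_vector) tfrag => ('g >< 'v) \<Rightarrow>\<^sub>0 int" where
 "tensor_scale r = frag_extend (%(x, v). frag_of (x, r *R v))"

lemma tensor_scale_simps [simp]:
 "tensor_scale r 0 = 0" "tensor_scale r (frag_of (x, v)) = frag_of (x, r *R v)"
 "tensor_scale r (a + b) = tensor_scale r a + tensor_scale r b"
 "tensor_scale r (a - b) = tensor_scale r a - tensor_scale r b"
 "tensor_scale r (- a) = - tensor_scale r a"
 by (simp_all add: tensor_scale_def frag_extend_add frag_extend_diff frag_extend_minus)

lemma tensor_scale_scale [simp]: "tensor_scale r (tensor_scale s c) = tensor_scale (r * s) c"
proof -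
 have "pkeys c <= UNIV" by simp
 thus ?thesis by (induction c rule: frag_induction) auto
qed

lemma tensor_scale_one [simp]: "tensor_scale 1 c = c"
proof -
 have "pkeys c <= UNIV" by simp
 thus ?thesis by (induction c rule: frag_induction) auto
qed

context
 fixes G :: "'g monoid"
 assumes G: "comm_group G"
begin

interpretation G: comm_group G by (rule G)

lemma tensor_relations_zero [simp]: "0 : trel G"
 using generate.one[of "tensor_free G"] by (simp add: tensor_relations_def tensor_free_def)

lemma tensor_relations_add: "a : trel G ==> b : trel G ==> a + b : trel G"
 using generate.eng[of a "tensor_free G" _ b] by (simp add: tensor_relations_def tensor_free_def)

lemma tensor_relations_left:
 "x : car G ==> y : car G ==>
  frag_of (x *[G] y, v) - frag_of (x, v) - frag_of (y, v) : trel G"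
 unfolding tensor_relations_def by (rule generate.incl) blast

lemma tensor_relations_right:
 "x : car G ==> frag_of (x, v + w) - frag_of (x, v) - frag_of (x, w) : trel G"
 unfolding tensor_relations_def by (rule generate.incl) blast

lemma tensor_relations_minus:
 assumes "c : trel G" shows "- c : trel G"
proof -
 interpret F: group "tensor_free G" by (simp add: tensor_free_def)
 have S: "tensor_gens G <= car (tensor_free G)"
 proof
  fix h assume "h : tensor_gens G"
  hence "pkeys h <= car G >< UNIV" by (rule tensor_gens_keys[OF G])
  thus "h : car (tensor_free G)" by (simp add: tensor_free_def carrier_free_Abelian_group_iff)
 qed
 have c: "c : generate (tensor_free G) (tensor_gens G)" using assms by (simp add: tensor_relations_def)
 show ?thesis using F.generate_m_inv_closed[OF S c] F.generate_in_carrier[OF S c]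
  by (simp add: tensor_relations_def tensor_free_def)
qed

lemma tensor_relations_diff: "a : trel G ==> b : trel G ==> a - b : trel G"
 using tensor_relations_add[OF _ tensor_relations_minus] by force

lemma tensor_class_self: "c : tcl G c"
 unfolding tcl_def using tensor_relations_zero by force

lemma tensor_class_eq_iff: "tcl G c = tcl G c' <-> c - c' : trel G"
proof
 assume "tcl G c = tcl G c'"
 hence "c : tcl G c'" using tensor_class_self by blast
 thus "c - c' : trel G" by (auto simp: tcl_def)
next
 assume h: "c - c' : trel G"
 have sub: "tcl G a <= tcl G b" if "a - b : trel G" for a b
 proof
  fix z assume "z : tcl G a"
  then obtain k where k: "k : trel G" "z = k + a" by (auto simp: tcl_def)
  hence "z = (k + (a - b)) + b" by simp
  thus "z : tcl G b" unfolding tcl_def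
   using tensor_relations_add[OF k(1) that] by blast
 qed
 show "tcl G c = tcl G c'"
  using sub[OF h] sub[of c' c] tensor_relations_minus[OF h] by auto
qed

lemma tensor_class_UN:
 fixes F :: "('g, 'v::real_vector) tfrag => ('h >< 'w::real_vector) \<Rightarrow>\<^sub>0 int"
 assumes "!!h. h : trel G ==> F h : trel H" "!!a b. F (a + b) = F a + F b"
  and H: "!!c c' :: ('h >< 'w) \<Rightarrow>\<^sub>0 int. c - c' : trel H ==> tcl H c = tcl H c'"
 shows "(UN c':tcl G c. tcl H (F c')) = tcl H (F c)"
proof -
 have "tcl H (F c') = tcl H (F c)" if c': "c' : tcl G c" for c'
 proof -
  obtain h where h: "h : trel G" "c' = h + c" using c' by (auto simp: tcl_def)
  hence "F c' - F c = F h" using assms(2) by simp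
  thus ?thesis using H[of "F c'" "F c"] assms(1)[OF h(1)] by simp
 qed
 thus ?thesis using tensor_class_self by auto
qed

subsection \<open>The module structure\<close>

lemma tensor_scale_relations:
 assumes "c : trel G" shows "tensor_scale r c : trel G"
 using G assms
proof (induction rule: tensor_relations_induct)
 case (left x y v)
 thus ?case using tensor_relations_left[of x y "r *R v"] by simp
next
 case (right x v w)
 thus ?case using tensor_relations_right[of x "r *R v" "r *R w"] by (simp add: scaleR_right_distrib)
qed (auto simp: tensor_relations_add tensor_relations_minus)

lemma tensor_space_carrier:
 "car (tensor_space G) = tcl G ` {c. pkeys c <= car G >< UNIV}"
proof -
 have "car (tensor_space G) = {trel G #>\<^bsub>tensor_free G\<^esub> c | c. c : car (tensor_free G)}"
  by (auto simp: tensor_space_def FactGroup_def RCOSETS_def Let_def)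
 thus ?thesis unfolding r_coset_tensor_relations by (auto simp: tensor_free_def)
qed

lemma tensor_space_zero: "e0 (tensor_space G) = tcl G 0"
 by (simp add: tensor_space_def FactGroup_def Let_def tcl_def)

lemma tensor_space_add:
 "tcl G c +[tensor_space G] tcl G c' = tcl G (c + c')"
proof -
 have "tcl G c +[tensor_space G] tcl G c' =
   {a + b | a b. a : tcl G c & b : tcl G c'}"
  by (auto simp: tensor_space_def FactGroup_def Let_def set_mult_def tensor_free_def)
 also have "... = tcl G (c + c')"
 proof (intro equalityI subsetI)
  fix z assume "z : {a + b | a b. a : tcl G c & b : tcl G c'}"
  then obtain h k where "h : trel G" "k : trel G" "z = (h + c) + (k + c')"
   by (auto simp: tcl_def)
  thus "z : tcl G (c + c')" unfolding tcl_def
   using tensor_relations_add[of h k] by (auto intro!: exI[of _ "h + k"])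
 next
  fix z assume "z : tcl G (c + c')"
  then obtain h where "h : trel G" "z = (h + c) + c'"
   by (auto simp: tcl_def add.assoc)
  thus "z : {a + b | a b. a : tcl G c & b : tcl G c'}"
   using tensor_class_self[of c'] unfolding tcl_def[of G c] by blast
 qed
 finally show ?thesis .
qed

lemma tensor_space_smult: "r .[tensor_space G] tcl G c = tcl G (tensor_scale r c)"
proof -
 have "r .[tensor_space G] tcl G c = (UN c':tcl G c. tcl G (tensor_scale r c'))"
  by (simp add: tensor_space_def Let_def tensor_scale_def r_coset_tensor_relations)
 also have "... = tcl G (tensor_scale r c)"
  by (rule tensor_class_UN) (simp_all add: tensor_scale_relations tensor_class_eq_iff)
 finally show ?thesis .
qed

lemma tensor_scale_keys:
 assumes "pkeys c <= car G >< UNIV"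
 shows "pkeys (tensor_scale r c) <= car G >< UNIV"
 using assms keys_frag_extend[of "%(x, v). frag_of (x, r *R v)" c]
 by (fastforce simp: tensor_scale_def keys_frag_of)

lemma tensor_scale_add_left:
 assumes "pkeys c <= car G >< UNIV"
 shows "tensor_scale (r + s) c - (tensor_scale r c + tensor_scale s c) : trel G"
 using assms
proof (induction c rule: frag_induction)
 case (one p)
 thus ?case using tensor_relations_right[of "fst p" "r *R snd p" "s *R snd p"]
  by (cases p) (simp add: scaleR_left_distrib diff_diff_eq)
next
 case (diff a b)
 thus ?case using tensor_relations_diff[OF diff] by (simp add: algebra_simps)
qed simp

lemma module_tensor_space: "module real_ring (tensor_space G :: ('g, 'v::real_vector) tmod)"
proof (rule moduleI[OF cring_real_ring])
 let ?T = "tensor_space G :: ('g, 'v::real_vector) tmod"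
 let ?K = "{c :: ('g >< 'v) \<Rightarrow>\<^sub>0 int. pkeys c <= car G >< UNIV}"
 have Kadd: "a + b : ?K" if "a : ?K" "b : ?K" for a b using keys_add[of a b] that by auto
 have Kneg: "- a : ?K" if "a : ?K" for a using that by simp
 have carE: "EX c:?K. A = tcl G c" if "A : car ?T" for A
  using that by (auto simp: tensor_space_carrier)
 have carI: "tcl G c : car ?T" if "c : ?K" for c
  using that by (auto simp: tensor_space_carrier)
 show "abelian_group ?T"
 proof (rule abelian_groupI)
  fix A B C assume "A : car ?T" "B : car ?T" "C : car ?T"
  then obtain a b c where abc: "a : ?K" "b : ?K" "c : ?K"
   "A = tcl G a" "B = tcl G b" "C = tcl G c" using carE by metis
  show "A +[?T] B : car ?T" using abc Kadd by (simp add: tensor_space_add carI)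
  show "A +[?T] B +[?T] C = A +[?T] (B +[?T] C)" using abc by (simp add: tensor_space_add add.assoc)
  show "A +[?T] B = B +[?T] A" using abc by (simp add: tensor_space_add add.commute)
  show "(e0 ?T) +[?T] A = A" using abc by (simp add: tensor_space_add tensor_space_zero)
  show "EX y:car ?T. y +[?T] A = e0 ?T"
   using abc Kneg carI by (intro bexI[of _ "tcl G (- a)"]) (auto simp: tensor_space_add tensor_space_zero)
 next
  show "e0 ?T : car ?T" by (simp add: tensor_space_zero carI)
 qed
 fix r s :: real and A B assume "A : car ?T" "B : car ?T"
 then obtain a b where ab: "a : ?K" "b : ?K" "A = tcl G a" "B = tcl G b"
  using carE by metis
 show "r .[?T] A : car ?T"
  using ab tensor_scale_keys[of a r] by (simp add: tensor_space_smult carI)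
 show "(r +[real_ring] s) .[?T] A = r .[?T] A +[?T] s .[?T] A"
  using ab tensor_scale_add_left[of a r s]
  by (simp add: tensor_space_smult tensor_space_add tensor_class_eq_iff)
 show "r .[?T] (A +[?T] B) = r .[?T] A +[?T] r .[?T] B"
  using ab by (simp add: tensor_space_smult tensor_space_add)
 show "(r *[real_ring] s) .[?T] A = r .[?T] (s .[?T] A)"
  using ab by (simp add: tensor_space_smult)
 show "(e1 real_ring) .[?T] A = A" using ab by (simp add: tensor_space_smult)
qed

subsection \<open>Simple tensors and representations\<close>

lemma tensor_relations_one: "frag_of (e1 G, v) : trel G"
 using tensor_relations_minus[OF tensor_relations_left[of "e1 G" "e1 G" v]] by simp

lemma tensor_relations_inv:
 assumes "x : car G"
 shows "frag_of (inv[G] x, v) + frag_of (x, v) : trel G"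
proof -
 have "frag_of (e1 G, v) - frag_of (inv[G] x, v) - frag_of (x, v) : trel G"
  using tensor_relations_left[of "inv[G] x" x v] assms by simp
 from tensor_relations_diff[OF tensor_relations_one[of v] this] show ?thesis by (simp add: algebra_simps)
qed

lemma tensor_relations_zero_right: "x : car G ==> frag_of (x, 0) : trel G"
 using tensor_relations_minus[OF tensor_relations_right[of x 0 0]] by simp

lemma tensor_relations_minus_right:
 assumes "x : car G"
 shows "frag_of (x, - v) + frag_of (x, v) : trel G"
 using tensor_relations_diff[OF tensor_relations_zero_right[of x] tensor_relations_right[of x "- v" v]] assms
 by (simp add: algebra_simps)

definition tensor_rep :: "'v set => ('g, 'v::real_vector) tfrag => bool" where
 "tensor_rep E c <-> (EX y. (ALL e. y e : car G) & c - (SUM e:E. frag_of (y e, e)) : trel G)"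

lemma tensor_rep_zero: "tensor_rep E 0"
proof -
 have "(SUM e:E. frag_of (e1 G, e)) : trel G"
  by (induction E rule: infinite_finite_induct) (auto intro: tensor_relations_add tensor_relations_one)
 thus ?thesis unfolding tensor_rep_def
  by (intro exI[of _ "%e. (e1 G)"]) (use tensor_relations_minus in force)
qed

lemma tensor_rep_diff:
 assumes "finite E" "tensor_rep E a" "tensor_rep E b" shows "tensor_rep E (a - b)"
proof -
 obtain y z where y: "!!e. y e : car G" "a - (SUM e:E. frag_of (y e, e)) : trel G"
  and z: "!!e. z e : car G" "b - (SUM e:E. frag_of (z e, e)) : trel G"
  using assms unfolding tensor_rep_def by blast
 have 1: "frag_of (y e, e) - frag_of (z e, e) - frag_of (y e *[G] inv[G] z e, e) : trel G" for e
 proof -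
  have "frag_of (y e *[G] inv[G] z e, e) - frag_of (y e, e) - frag_of (inv[G] z e, e) : trel G"
   using tensor_relations_left[of "y e" "inv[G] z e" e] y z by simp
  from tensor_relations_add[OF this tensor_relations_inv[OF z(1)[of e], of e]]
  have "frag_of (y e *[G] inv[G] z e, e) - frag_of (y e, e) + frag_of (z e, e) : trel G"
   by (simp add: algebra_simps)
  from tensor_relations_minus[OF this] show ?thesis by (simp add: algebra_simps)
 qed
 have 2: "(SUM e:E. frag_of (y e, e)) - (SUM e:E. frag_of (z e, e)) -
   (SUM e:E. frag_of (y e *[G] inv[G] z e, e)) : trel G"
  using assms(1)
 proof induction
  case (insert e F)
  thus ?case using tensor_relations_add[OF 1[of e] insert.IH] by (simp add: algebra_simps)
 qed simp
 have "a - b - (SUM e:E. frag_of (y e *[G] inv[G] z e, e)) : trel G"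
  using tensor_relations_add[OF tensor_relations_diff[OF y(2) z(2)] 2] by (simp add: algebra_simps)
 thus ?thesis unfolding tensor_rep_def
  using y(1) z(1) by (intro exI[of _ "%e. y e *[G] inv[G] z e"]) simp
qed

lemma tensor_relations_nat_right:
 assumes "x : car G"
 shows "frag_of (x, of_nat n *R v) - frag_of (x ^[G] n, v) : trel G"
proof (induction n)
 case 0
 have "frag_of (x, 0) - frag_of (e1 G, v) : trel G"
  by (intro tensor_relations_diff tensor_relations_zero_right assms tensor_relations_one)
 thus ?case by simp
next
 case (Suc n)
 have a: "frag_of (x, of_nat n *R v + v) - frag_of (x, of_nat n *R v) - frag_of (x, v) : trel G"
  by (rule tensor_relations_right[OF assms])
 have b: "frag_of (x ^[G] n *[G] x, v) - frag_of (x ^[G] n, v) - frag_of (x, v) : trel G"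
  by (rule tensor_relations_left) (use assms in auto)
 have "frag_of (x, of_nat n *R v + v) - frag_of (x ^[G] n *[G] x, v) : trel G"
  using tensor_relations_add[OF tensor_relations_diff[OF a b] Suc] by (simp add: algebra_simps)
 thus ?case by (simp add: scaleR_left_distrib add.commute)
qed

lemma tensor_relations_int_right:
 assumes x: "x : car G"
 shows "EX y:car G. frag_of (x, n *z v) - frag_of (y, v) : trel G"
proof (cases "n >= 0")
 case True
 then obtain j where j: "n = int j" using zero_le_imp_eq_int by blast
 show ?thesis using tensor_relations_nat_right[OF x, of j v] x
  by (intro bexI[of _ "x ^[G] j"]) (auto simp: j)
next
 case False
 hence "0 <= - n" by simp
 then obtain j where "- n = int j" using zero_le_imp_eq_int by blast
 hence j: "n = - int j" by simp
 let ?v = "of_nat j *R v" and ?y = "x ^[G] j"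
 have y: "?y : car G" using x by simp
 have "frag_of (x, - ?v) - frag_of (inv[G] ?y, v) : trel G"
  using tensor_relations_diff[OF tensor_relations_diff[OF tensor_relations_minus_right[OF x, of ?v]
   tensor_relations_inv[OF y, of v]] tensor_relations_nat_right[OF x, of j v]]
  by (simp add: algebra_simps)
 moreover have "n *z v = - ?v" by (simp add: j)
 ultimately show ?thesis using y by (intro bexI[of _ "inv[G] ?y"]) auto
qed

lemma tensor_rep_single:
 assumes E: "finite E" and x: "x : car G" and v: "v = (SUM e:E. n e *z e)"
 shows "tensor_rep E (frag_of (x, v))"
proof -
 have "ALL e. EX y. y : car G & frag_of (x, n e *z e) - frag_of (y, e) : trel G"
  using tensor_relations_int_right[OF x] by blast
 from choice[OF this]
 obtain y where y: "!!e. y e : car G"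
   "!!e. frag_of (x, n e *z e) - frag_of (y e, e) : trel G"
  by blast
 have "frag_of (x, SUM e:E. n e *z e) - (SUM e:E. frag_of (y e, e)) : trel G"
  using E
 proof induction
  case empty
  thus ?case using tensor_relations_zero_right[OF x] by simp
 next
  case (insert e F)
  show ?case using tensor_relations_add[OF tensor_relations_add[OF tensor_relations_right[OF x, of
    "n e *z e" "SUM e:F. n e *z e"] insert.IH] y(2)[of e]] insert(1,2)
   by (simp add: algebra_simps)
 qed
 thus ?thesis unfolding tensor_rep_def v using y(1) by blast
qed

lemma tensor_rep_exists:
 fixes c :: "('g >< 'v::real_vector) \<Rightarrow>\<^sub>0 int"
 assumes c: "pkeys c <= car G >< UNIV"
 obtains E y where "finite E" "!!n :: 'v => int. (SUM e:E. n e *z e) = 0 ==> ALL e:E. n e = 0"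
  "!!e. y e : car G" "tcl G c = tcl G (SUM e:E. frag_of (y e, e))"
proof -
 have "finite (snd ` pkeys c)" by simp
 then obtain E m where E: "finite E"
   "!!x. x : snd ` pkeys c ==> x = (SUM e:E. m x e *z e)"
   "!!n :: 'v => int. (SUM e:E. n e *z e) = 0 ==> ALL e:E. n e = 0"
  by (rule finite_Z_span) blast
 have "pkeys c <= pkeys c" by simp
 hence "tensor_rep E c"
 proof (induction c rule: frag_induction)
  case (one p)
  thus ?case using tensor_rep_single[OF E(1), of "fst p" "snd p" "m (snd p)"] E(2)[of "snd p"] c by auto
 qed (auto intro: tensor_rep_zero tensor_rep_diff E(1))
 thus ?thesis using that E(1,3) by (auto simp: tensor_rep_def tensor_class_eq_iff)
qed

end

definition tensor_push :: "('g => 'h) => ('g, 'v::real_vector) tfrag => ('h >< 'v) \<Rightarrow>\<^sub>0 int" where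
 "tensor_push d = frag_extend (%(x, v). frag_of (d x, v))"

lemma tensor_push_simps [simp]:
 "tensor_push d 0 = 0" "tensor_push d (frag_of (x, v)) = frag_of (d x, v)"
 "tensor_push d (a + b) = tensor_push d a + tensor_push d b"
 "tensor_push d (a - b) = tensor_push d a - tensor_push d b"
 "tensor_push d (- a) = - tensor_push d a"
 by (simp_all add: tensor_push_def frag_extend_add frag_extend_diff frag_extend_minus)

lemma tensor_push_sum [simp]: "tensor_push d (SUM i:I. f i) = (SUM i:I. tensor_push d (f i))"
 by (induction I rule: infinite_finite_induct) auto

lemma tensor_push_relations:
 assumes G: "comm_group G" and H: "comm_group H" and d: "d : hom G H"
  and c: "c : trel G"
 shows "tensor_push d c : trel H"
 using G c
proof (induction rule: tensor_relations_induct)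
 case (left x y v)
 thus ?case using tensor_relations_left[OF H, of "d x" "d y" v] d by (simp add: hom_def Pi_iff)
next
 case (right x v w)
 thus ?case using tensor_relations_right[OF H, of "d x" v w] d by (simp add: hom_def Pi_iff)
qed (auto simp: tensor_relations_add[OF H] tensor_relations_minus[OF H] tensor_relations_zero[OF H])

lemma tensor_push_keys:
 assumes "d : hom G H" "pkeys c <= car G >< UNIV"
 shows "pkeys (tensor_push d c) <= car H >< UNIV"
proof
 fix p assume "p : pkeys (tensor_push d c)"
 then obtain x v where "(x, v) : pkeys c" "p = (d x, v)"
  using keys_frag_extend[of "%(x, v). frag_of (d x, v)" c]
  by (fastforce simp: tensor_push_def keys_frag_of)
 thus "p : car H >< UNIV" using assms by (auto simp: hom_def)
qed

lemma tensor_map_class: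
 assumes G: "comm_group G" and H: "comm_group H" and d: "d : hom G H"
 shows "tensor_map H d (tcl G c) = tcl H (tensor_push d c)"
proof -
 have "tensor_map H d (tcl G c) = (UN c':tcl G c. tcl H (tensor_push d c'))"
  by (simp add: tensor_map_def tensor_push_def r_coset_tensor_relations)
 also have "... = tcl H (tensor_push d c)"
  by (rule tensor_class_UN[OF G]) (auto simp: tensor_push_relations[OF G H d] tensor_class_eq_iff[OF H])
 finally show ?thesis .
qed

lemma tensor_push_scale: "tensor_push d (tensor_scale r c) = tensor_scale r (tensor_push d c)"
proof -
 have "pkeys c <= UNIV" by simp
 thus ?thesis by (induction c rule: frag_induction) auto
qed

lemma tensor_space_carrierE:
 assumes "comm_group G" "A : car (tensor_space G)"
 obtains c where "pkeys c <= car G >< UNIV" "A = tcl G c"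
proof -
 have "A : tcl G ` {c. pkeys c <= car G >< UNIV}"
  using assms(2) by (simp add: tensor_space_carrier[OF assms(1)])
 thus ?thesis using that by blast
qed

lemma tensor_space_carrierI:
 assumes "comm_group G" "pkeys c <= car G >< UNIV"
 shows "tcl G c : car (tensor_space G)"
 using assms by (auto simp: tensor_space_carrier)

subsection \<open>Bilinear maps\<close>

definition frag_sum :: "('a => 'w::real_vector) => ('a \<Rightarrow>\<^sub>0 int) => 'w" where
 "frag_sum f c = (SUM p:pkeys c. Poly_Mapping.lookup c p *z f p)"

lemma frag_sum_superset:
 assumes "finite S" "pkeys c <= S"
 shows "frag_sum f c = (SUM p:S. Poly_Mapping.lookup c p *z f p)"
 unfolding frag_sum_def
 by (rule sum.mono_neutral_left) (use assms in "auto simp: in_keys_iff")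

lemma frag_sum_simps [simp]:
 "frag_sum f 0 = 0" "frag_sum f (frag_of p) = f p"
 "frag_sum f (a + b) = frag_sum f a + frag_sum f b"
 "frag_sum f (- a) = - frag_sum f a"
 "frag_sum f (a - b) = frag_sum f a - frag_sum f b"
proof -
 show "frag_sum f 0 = 0" "frag_sum f (frag_of p) = f p"
  by (simp_all add: frag_sum_def keys_frag_of)
 have add: "frag_sum f (a + b) = frag_sum f a + frag_sum f b" for a b
 proof -
  let ?S = "pkeys a Un pkeys b"
  have "pkeys (a + b) <= ?S" by (rule keys_add)
  thus ?thesis
   using frag_sum_superset[of ?S "a + b" f] frag_sum_superset[of ?S a f] frag_sum_superset[of ?S b f]
   by (simp add: lookup_add scaleR_left_distrib sum.distrib)
 qed
 show "frag_sum f (a + b) = frag_sum f a + frag_sum f b" by (rule add)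
 have neg: "frag_sum f (- a) = - frag_sum f a" for a
  by (simp add: frag_sum_def sum_negf)
 show "frag_sum f (- a) = - frag_sum f a" by (rule neg)
 show "frag_sum f (a - b) = frag_sum f a - frag_sum f b"
  using add[of a "- b"] neg[of b] by simp
qed

lemma frag_sum_sum [simp]: "frag_sum g (SUM i:I. f i) = (SUM i:I. frag_sum g (f i))"
 by (induction I rule: infinite_finite_induct) auto

definition biadditive :: "'g monoid => ('g => 'v::real_vector => 'w::real_vector) => bool" where
 "biadditive G f <->
   (ALL x:car G. ALL y:car G. ALL v. f (x *[G] y) v = f x v + f y v) &
   (ALL x:car G. ALL v w. f x (v + w) = f x v + f x w)"

definition tensor_lift ::
 "('g => 'v::real_vector => 'w::real_vector) => ('g, 'v) tfrag set => 'w" where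
 "tensor_lift f A = frag_sum (%(x, v). f x v) (SOME c. c : A)"

lemma frag_sum_relations:
 assumes G: "comm_group G" and f: "biadditive G f" and c: "c : trel G"
 shows "frag_sum (%(x, v). f x v) c = 0"
 using G c
proof (induction rule: tensor_relations_induct)
 case (left x y v)
 thus ?case using f by (simp add: biadditive_def)
next
 case (right x v w)
 thus ?case using f by (simp add: biadditive_def)
qed auto

lemma tensor_lift_class:
 assumes G: "comm_group G" and f: "biadditive G f"
 shows "tensor_lift f (tcl G c) = frag_sum (%(x, v). f x v) c"
proof -
 have "(SOME c'. c' : tcl G c) : tcl G c"
  using tensor_class_self[OF G] by (rule someI)
 then obtain h where "h : trel G" "(SOME c'. c' : tcl G c) = h + c"
  by (auto simp: tcl_def)
 thus ?thesis using frag_sum_relations[OF G f] by (simp add: tensor_lift_def)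
qed

lemma tensor_lift_add:
 assumes G: "comm_group G" and f: "biadditive G f"
  and "A : car (tensor_space G)" "B : car (tensor_space G)"
 shows "tensor_lift f (A +[tensor_space G] B) = tensor_lift f A + tensor_lift f B"
proof -
 obtain a b where "A = tcl G a" "B = tcl G b"
  using assms tensor_space_carrierE[OF G] by metis
 thus ?thesis by (simp add: tensor_space_add[OF G] tensor_lift_class[OF G f])
qed

lemma tensor_lift_smult:
 assumes G: "comm_group G" and f: "biadditive G f"
  and s: "!!x v r. x : car G ==> f x (r *R v) = r *R f x v"
  and A: "A : car (tensor_space G)"
 shows "tensor_lift f (r .[tensor_space G] A) = r *R tensor_lift f A"
proof -
 obtain a where a: "A = tcl G a" "pkeys a <= car G >< UNIV"
  using A tensor_space_carrierE[OF G] by metis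
 have "frag_sum (%(x, v). f x v) (tensor_scale r a) = r *R frag_sum (%(x, v). f x v) a"
  using a(2) by (induction a rule: frag_induction) (auto simp: s scaleR_right_diff_distrib)
 thus ?thesis by (simp add: a tensor_space_smult[OF G] tensor_lift_class[OF G f])
qed

subsection \<open>Flatness\<close>

lemma tensor_independent_zero:
 fixes E :: "'v::real_vector set"
 assumes G: "comm_group G" and sep: "int_separated G" and E: "finite E"
  "!!n :: 'v => int. (SUM e:E. n e *z e) = 0 ==> ALL e:E. n e = 0"
  and y: "!!e. e : E ==> y e : car G"
  and 0: "(SUM e:E. frag_of (y e, e)) : trel G"
 shows "ALL e:E. y e = e1 G"
proof
 fix e assume e: "e : E"
 have "f (y e) = 0" if f: "addi G f" for f :: "'a => int"
 proof -
  have bi: "biadditive G (%x (v::'v). f x *z v)"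
   using f by (auto simp: biadditive_def addi_def scaleR_left_distrib scaleR_right_distrib)
  have "(SUM e:E. f (y e) *z e) = 0"
   using frag_sum_relations[OF G bi 0] by simp
  thus ?thesis using E(2)[of "%e. f (y e)"] e by blast
 qed
 thus "y e = e1 G" using sep y[OF e] unfolding int_separated_def by blast
qed

lemma tensor_map_kernel:
 assumes G: "comm_group G" and H: "comm_group H" and d: "d : hom G H" and sep: "int_separated H"
  and A: "A : car (tensor_space G)" and 0: "tensor_map H d A = e0 (tensor_space H)"
 obtains E y where "finite E" "!!e. y e : car G" "!!e. e : E ==> d (y e) = e1 H"
  "A = tcl G (SUM e:E. frag_of (y e, e))"
proof -
 obtain c where c: "pkeys c <= car G >< UNIV" "A = tcl G c"
  using A tensor_space_carrierE[OF G] by metis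
 obtain E y where E: "finite E" "!!n :: 'c => int. (SUM e:E. n e *z e) = 0 ==> ALL e:E. n e = 0"
  and y: "!!e. y e : car G" and eq: "tcl G c = tcl G (SUM e:E. frag_of (y e, e))"
  by (rule tensor_rep_exists[OF G c(1)]) blast
 have "tcl H (SUM e:E. frag_of (d (y e), e)) = tcl H 0"
  using 0 by (simp add: c eq tensor_map_class[OF G H d] tensor_space_zero[OF H])
 hence "(SUM e:E. frag_of (d (y e), e)) : trel H"
  by (simp add: tensor_class_eq_iff[OF H])
 moreover have "d (y e) : car H" for e using d y by (auto simp: hom_def)
 ultimately have "ALL e:E. d (y e) = e1 H" by (intro tensor_independent_zero[OF H sep E]) auto
 thus ?thesis by (intro that[OF E(1) y]) (use c eq in auto)
qed

subsection \<open>Chain complexes of abelian groups\<close>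

locale group_complex =
 fixes C :: "int => 'g monoid" and d :: "int => 'g => 'g"
 assumes comm: "!!q. comm_group (C q)" and d_hom: "!!q. d q : hom (C q) (C (q - 1))"
  and dd: "!!q x. x : car (C (q + 1)) ==> d q (d (q + 1) x) = e1 (C (q - 1))"
begin

abbreviation T :: "int => ('g, 'v::real_vector) tmod" where
 "T q == tensor_space (C q)"

abbreviation D :: "int => ('g, 'v::real_vector) tfrag set => ('g, 'v) tfrag set" where
 "D q == tensor_map (C (q - 1)) (d q)"

definition ZT :: "int => ('g, 'v::real_vector) tfrag set set" where
 "ZT q = {A : car (T q). D q A = e0 (T (q - 1))}"

definition BT :: "int => ('g, 'v::real_vector) tfrag set set" where
 "BT q = D (q + 1) ` car (T (q + 1))"

lemma d_hom': "d (q + 1) : hom (C (q + 1)) (C q)" using d_hom[of "q + 1"] by simp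

lemma d_one [simp]: "d q (e1 (C q)) = e1 (C (q - 1))"
 using d_hom[of q] comm[of q] comm[of "q - 1"] by (meson comm_group.axioms(2) hom_one)

lemma D_class: "D q (tcl (C q) c) = tcl (C (q - 1)) (tensor_push (d q) c)"
 by (rule tensor_map_class[OF comm comm d_hom])

lemma D_class': "tensor_map (C q) (d (q + 1)) (tcl (C (q + 1)) c) = tcl (C q) (tensor_push (d (q + 1)) c)"
 using D_class[of "q + 1" c] by simp

lemma D_closed: "A : car (T q) ==> D q A : car (T (q - 1))"
 by (auto elim!: tensor_space_carrierE[OF comm] simp: D_class intro!: tensor_space_carrierI[OF comm] tensor_push_keys[OF d_hom])

lemma D_add: "A : car (T q) ==> B : car (T q) ==>
  D q (A +[T q] B) = D q A +[T (q - 1)] D q B"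
 by (auto elim!: tensor_space_carrierE[OF comm] simp: D_class tensor_space_add[OF comm])

lemma D_smult: "A : car (T q) ==> D q (r .[T q] A) = r .[T (q - 1)] D q A"
 by (auto elim!: tensor_space_carrierE[OF comm] simp: D_class tensor_space_smult[OF comm] tensor_push_scale)

lemma DD: assumes "A : car (T (q + 1))" shows "D q (D (q + 1) A) = e0 (T (q - 1))"
proof -
 obtain c where c: "pkeys c <= car (C (q + 1)) >< UNIV" "A = tcl (C (q + 1)) c"
  using assms tensor_space_carrierE[OF comm] by metis
 have "tensor_push (d q) (tensor_push (d (q + 1)) c) : trel (C (q - 1))"
  using c(1)
 proof (induction c rule: frag_induction)
  case (one p)
  thus ?case by (cases p) (auto simp: dd tensor_relations_one[OF comm])
 qed (auto simp: tensor_relations_zero[OF comm] tensor_relations_diff[OF comm])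
 thus ?thesis
  by (simp add: c(2) D_class D_class' tensor_space_zero[OF comm] tensor_class_eq_iff[OF comm])
qed

lemma subquotient:
 "subquotient (T q :: ('g, 'v::real_vector) tmod) (ZT q) (BT q)"
proof -
 let ?T = "T :: int => ('g, 'v) tmod"
 interpret Tq: module real_ring "?T q" by (rule module_tensor_space[OF comm])
 interpret Tm: module real_ring "?T (q - 1)" by (rule module_tensor_space[OF comm])
 interpret Tp: module real_ring "?T (q + 1)" by (rule module_tensor_space[OF comm])
 have D_add': "D (q + 1) (A +[?T (q + 1)] B) = D (q + 1) A +[?T q] D (q + 1) B"
  if "A : car (?T (q + 1))" "B : car (?T (q + 1))" for A B
  using D_add[OF that] by simp
 have D_smult': "D (q + 1) (r .[?T (q + 1)] A) = r .[?T q] D (q + 1) A"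
  if "A : car (?T (q + 1))" for A r
  using D_smult[OF that] by simp
 have neg: "-[?T q] A = (- 1) .[?T q] A" if "A : car (?T q)" for A
  using Tq.smult_l_minus[of 1 A] Tq.smult_one[of A] that by simp
 have D0: "D (q + 1) (e0 (?T (q + 1))) = e0 (?T q)" "D q (e0 (?T q)) = e0 (?T (q - 1))"
  by (simp_all add: tensor_space_zero[OF comm] D_class D_class')
 have cl: "D (q + 1) A : car (?T q)" if "A : car (?T (q + 1))" for A
  using D_closed[OF that] by simp
 have Zsm: "r .[?T q] x : ZT q" if "x : ZT q" for r x
  using that by (auto simp: ZT_def D_smult)
 have Zneg: "-[?T q] x : ZT q" if x: "x : ZT q" for x
 proof -
  have "x : car (?T q)" using x by (simp add: ZT_def)
  from neg[OF this] show "-[?T q] x : ZT q" using Zsm[OF x, of "-1"] by simp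
 qed
 show ?thesis
 proof (rule subquotient.intro)
  show Zs: "submodule (ZT q) real_ring (?T q)"
  proof (rule Tq.submoduleI)
   show "r .[?T q] x : ZT q" if "x : ZT q" for r x by (rule Zsm[OF that])
   show "-[?T q] x : ZT q" if "x : ZT q" for x by (rule Zneg[OF that])
  qed (auto simp: ZT_def D_add D0)
  show Bs: "submodule (BT q) real_ring (?T q)"
  proof (rule Tq.submoduleI)
   show sub: "BT q <= car (?T q)" using cl by (auto simp: BT_def)
   show sm: "r .[?T q] x : BT q" if "x : BT q" for r x
   proof -
    obtain A where A: "A : car (?T (q + 1))" "x = D (q + 1) A"
     using `x : BT q` unfolding BT_def by blast
    show "r .[?T q] x : BT q"
     unfolding BT_def A(2) D_smult'[OF A(1), symmetric] by (intro imageI Tp.smult_closed) (simp_all add: A(1))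
   qed
   show "-[?T q] x : BT q" if "x : BT q" for x
   proof -
    have "x : car (?T q)" using sub that by blast
    from neg[OF this] show "-[?T q] x : BT q" using sm[OF that, of "-1"] by simp
   qed
   show "e0 (?T q) : BT q" unfolding BT_def using D0(1) Tp.M.zero_closed by (metis image_eqI)
   show "x +[?T q] y : BT q" if "x : BT q" "y : BT q" for x y
   proof -
    obtain A where A: "A : car (?T (q + 1))" "x = D (q + 1) A"
     using `x : BT q` unfolding BT_def by blast
    obtain A' where A': "A' : car (?T (q + 1))" "y = D (q + 1) A'"
     using `y : BT q` unfolding BT_def by blast
    show "x +[?T q] y : BT q"
     unfolding BT_def A(2) A'(2) D_add'[OF A(1) A'(1), symmetric]
     by (intro imageI Tp.M.a_closed A(1) A'(1))
   qed
  qed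
  show "(BT q :: ('g, 'v) tfrag set set) <= ZT q" using cl DD by (auto simp: BT_def ZT_def)
  show "module real_ring (?T q)" by (rule Tq.module_axioms)
 qed
qed

lemma homology_space_eq: "homology_space T D q = quotient_space ((T q)\<lparr>carrier := ZT q\<rparr>) (BT q)"
 by (simp add: homology_space_def ZT_def BT_def)

lemma tensor_exact:
 assumes ex: "!!z. z : car (C q) ==> d q z = e1 (C (q - 1)) ==> EX w:car (C (q + 1)). z = d (q + 1) w"
  and sep: "int_separated (C (q - 1))"
 shows "ZT q = BT q"
proof
 show "BT q <= ZT q" by (rule subquotient.BZ[OF subquotient])
 show "ZT q <= BT q"
 proof
  fix A assume A: "A : ZT q"
  obtain E y where E: "finite E" and y: "!!e. y e : car (C q)" "!!e. e : E ==> d q (y e) = e1 (C (q - 1))"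
   and A': "A = tcl (C q) (SUM e:E. frag_of (y e, e))"
   by (rule tensor_map_kernel[OF comm comm d_hom sep, of A]) (use A in "auto simp: ZT_def")
  have "ALL e. EX w. e : E --> w : car (C (q + 1)) & y e = d (q + 1) w" using ex y by blast
  from choice[OF this] obtain w where w: "!!e. e : E ==> w e : car (C (q + 1))"
   "!!e. e : E ==> y e = d (q + 1) (w e)" by blast
  let ?c = "SUM e:E. frag_of (w e, e)"
  have "pkeys ?c <= car (C (q + 1)) >< UNIV"
   using E w(1) by (induction E) (auto simp: keys_frag_of dest!: subsetD[OF keys_add])
  moreover have "A = tensor_map (C q) (d (q + 1)) (tcl (C (q + 1)) ?c)"
   using w(2) by (simp add: A' D_class')
  ultimately show "A : BT q" unfolding BT_def using tensor_space_carrierI[OF comm] by auto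
 qed
qed

end

lemma finite_dimensional_self_dual:
 fixes B :: "'v::real_vector set"
 assumes "finite_dimensional_vector_space ((*R) :: real => 'v => 'v) B"
 obtains ip :: "'v => 'v => real"
 where "!!u v w. ip (u + v) w = ip u w + ip v w" "!!u v w. ip u (v + w) = ip u v + ip u w"
  "!!r v w. ip (r *R v) w = r * ip v w" "!!r v w. ip v (r *R w) = r * ip v w"
  "!!l. (!!v w. l (v + w) = l v + l w) ==> (!!r v. l (r *R v) = r * l v) ==> EX v. ALL w. l w = ip v w"
  "!!v. (!!w. ip v w = 0) ==> v = 0"
proof -
 interpret V: finite_dimensional_vector_space "(*R) :: real => 'v => 'v" B by fact
 have indep: "independent B" using V.independent_Basis by (simp flip: dependent_raw_def)
 have sp: "v : span B" for v using V.span_Basis by (simp flip: span_raw_def)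
 define rep where "rep = representation B"
 have add: "rep (v + w) b = rep v b + rep w b" for v w b
  unfolding rep_def by (rule real_vector.representation_add[OF indep sp sp, THEN fun_cong])
 have sc: "rep (r *R v) b = r * rep v b" for v r b
  unfolding rep_def by (rule real_vector.representation_scale[OF indep sp, THEN fun_cong])
 have basis: "rep b c = (if c = b then 1 else 0)" if "b : B" for b c
  unfolding rep_def using real_vector.representation_basis[OF indep that] by simp
 have exp: "(SUM b:B. rep v b *R b) = v" for v
  unfolding rep_def by (rule real_vector.sum_representation_eq[OF indep sp V.finite_Basis order_refl])
 define ip where "ip v w = (SUM b:B. rep v b * rep w b)" for v w
 have ipb: "ip v b = rep v b" if "b : B" for v b
 proof -
  have "ip v b = (SUM c:B. if c = b then rep v c else 0)"
   unfolding ip_def by (rule sum.cong) (auto simp: basis[OF that])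
  thus ?thesis using that V.finite_Basis by simp
 qed
 show ?thesis
 proof (rule that[of ip])
  show a1: "ip (u + v) w = ip u w + ip v w" for u v w
   by (simp add: ip_def add sum.distrib algebra_simps)
  show a2: "ip u (v + w) = ip u v + ip u w" for u v w
   by (simp add: ip_def add sum.distrib algebra_simps)
  show s1: "ip (r *R v) w = r * ip v w" for r v w
   by (simp add: ip_def sc sum_distrib_left algebra_simps)
  show s2: "ip v (r *R w) = r * ip v w" for r v w
   by (simp add: ip_def sc sum_distrib_left algebra_simps)
  show "v = 0" if "!!w. ip v w = 0" for v
   using exp[of v] ipb[of _ v] that by simp
  fix l :: "'v => real"
  assume l: "!!v w. l (v + w) = l v + l w" "!!r v. l (r *R v) = r * l v"
  have l0: "l 0 = 0" using l(1)[of 0 0] by simp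
  have lsum: "l (SUM b:X. f b) = (SUM b:X. l (f b))" for X and f :: "'v => 'v"
   by (induction X rule: infinite_finite_induct) (auto simp: l0 l(1))
  define v where "v = (SUM b:B. l b *R b)"
  have ip0: "ip 0 w = 0" for w using a1[of 0 0 w] by simp
  have ipsum: "ip (SUM b:X. f b) w = (SUM b:X. ip (f b) w)" for X w and f :: "'v => 'v"
   by (induction X rule: infinite_finite_induct) (auto simp: ip0 a1)
  have ipb': "ip b w = rep w b" if "b : B" for b w
   using ipb[OF that, of w] by (simp add: ip_def mult.commute)
  have "l w = ip v w" for w
  proof -
   have "l w = l (SUM b:B. rep w b *R b)" by (simp add: exp)
   also have "... = (SUM b:B. rep w b * l b)" by (simp add: lsum l(2))
   also have "... = (SUM b:B. l b * ip b w)"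
    by (rule sum.cong) (auto simp: ipb')
   also have "... = ip v w" by (simp add: v_def ipsum s1)
   finally show ?thesis .
  qed
  thus "EX v. ALL w. l w = ip v w" by blast
 qed
qed

definition FS :: "(real, 'c => 'v::real_vector) module" where
 "FS = \<lparr>carrier = UNIV, mult = undefined, one = undefined, zero = (%_. 0),
   add = (%f g x. f x + g x), smult = (%r f x. r *R f x)\<rparr>"

lemma function_space_simps [simp]:
 "f +[FS] g = (%x. f x + g x)" "r .[FS] f = (%x. r *R f x)"
 by (simp_all add: FS_def)

subsection \<open>Integral coordinates\<close>

definition int_coords :: "'g monoid => 'c set => ('g => 'c => int) => bool" where
 "int_coords G S F <-> finite S & (ALL t. addi G (%x. F x t)) &
   (ALL x:car G. ALL t. t ~: S --> F x t = 0) &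
   (ALL x:car G. (ALL t:S. F x t = 0) --> x = e1 G) &
   (ALL n. EX x:car G. ALL t:S. F x t = n t)"

lemma int_coordsD:
 assumes "int_coords G S F"
 shows "finite S" "addi G (%x. F x t)" "x : car G ==> t ~: S ==> F x t = 0"
  "x : car G ==> (!!t. t : S ==> F x t = 0) ==> x = e1 G"
  "EX x:car G. ALL t:S. F x t = n t"
 using assms unfolding int_coords_def by blast+

lemma int_coords_separated: "int_coords G S F ==> int_separated G"
 unfolding int_separated_def by (metis int_coordsD(2,4))

lemma int_coords_basis:
 assumes "int_coords G S F"
 obtains g where "!!t. t : S ==> g t : car G"
  "!!t s. t : S ==> F (g t) s = (if s = t then 1 else 0)"
proof -
 have "ALL t. EX x. x : car G & (ALL s:S. F x s = (if s = t then 1 else 0))"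
 proof
  fix t show "EX x. x : car G & (ALL s:S. F x s = (if s = t then 1 else 0))"
   using int_coordsD(5)[OF assms, of "%s. if s = t then 1 else 0"] by blast
 qed
 from choice[OF this] obtain g where g: "!!t. g t : car G"
  "!!t s. s : S ==> F (g t) s = (if s = t then 1 else 0)" by blast
 show ?thesis
 proof (rule that[of g])
  show "F (g t) s = (if s = t then 1 else 0)" if "t : S" for t s
   using g int_coordsD(3)[OF assms g(1), of s t] that by (cases "s : S") auto
 qed (use g in auto)
qed

lemma int_coords_expand:
 fixes F :: "'g => 'v::real_vector"
 assumes G: "comm_group G" and co: "int_coords G S H" and F: "addi G F"
  and g: "!!u. u : S ==> g u : car G"
   "!!u s. u : S ==> H (g u) s = (if s = u then 1 else 0)"
  and x: "x : car G"
 shows "F x = (SUM u:S. H x u *z F (g u))"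
proof -
 interpret comm_group G by fact
 have fin: "finite S" by (rule int_coordsD(1)[OF co])
 have ex: "EX p:car G. (ALL s. H p s = (if s : X then H x s else 0)) &
   F p = (SUM u:X. H x u *z F (g u))" if "X <= S" for X
  using finite_subset[OF that fin] that
 proof (induction X)
  case empty
  show ?case
   using additive_on_one[OF is_group int_coordsD(2)[OF co]] additive_on_one[OF is_group F]
   by (intro bexI[of _ "e1 G"]) auto
 next
  case (insert u X)
  then obtain p where p: "p : car G" "!!s. H p s = (if s : X then H x s else 0)"
   "F p = (SUM u:X. H x u *z F (g u))" by auto
  have t: "u : S" using insert by auto
  let ?h = "g u ^[G] (H x u)"
  have h: "?h : car G" using g(1)[OF t] by simp
  have "addi G (%y. real_of_int (H y s))" for s
   using int_coordsD(2)[OF co, of s] by (simp add: addi_def)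
  from additive_on_int_pow[OF is_group this g(1)[OF t]]
  have "real_of_int (H ?h s) = real_of_int (H x u * H (g u) s)" for s by simp
  hence Gh: "H ?h s = H x u * H (g u) s" for s using of_int_eq_iff by blast
  have Fh: "F ?h = H x u *z F (g u)"
   by (rule additive_on_int_pow[OF is_group F g(1)[OF t]])
  show ?case
  proof (intro bexI[of _ "?h *[G] p"] conjI allI)
   show "H (?h *[G] p) s = (if s : insert u X then H x s else 0)" for s
    using additive_onD[OF int_coordsD(2)[OF co, of s] h p(1)] insert(2)
    by (auto simp: Gh p(2) g(2)[OF t])
   show "F (?h *[G] p) = (SUM u:insert u X. H x u *z F (g u))"
    using additive_onD[OF F h p(1)] insert(1,2) by (simp add: Fh p(3))
   show "?h *[G] p : car G" using h p(1) by simp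
  qed
 qed
 obtain p where p: "p : car G" "!!s. H p s = (if s : S then H x s else 0)"
   "F p = (SUM u:S. H x u *z F (g u))" using ex[OF order_refl] by blast
 have "x *[G] inv[G] p = e1 G"
 proof (rule int_coordsD(4)[OF co])
  show "H (x *[G] inv[G] p) u = 0" if "u : S" for u
   using additive_onD[OF int_coordsD(2)[OF co, of u] x, of "inv[G] p"]
    additive_on_inv[OF is_group int_coordsD(2)[OF co, of u] p(1)] p that by simp
 qed (use x p in auto)
 hence "x = p" using x p(1) by (metis inv_closed inv_equality inv_inv m_comm)
 thus ?thesis using p(3) by simp
qed

definition tco :: "('g => 'c => int) => ('g, 'v::real_vector) tfrag set => 'c => 'v" where
 "tco F A t = tensor_lift (%x v. F x t *z v) A"

context
 fixes G :: "'g monoid" and S :: "'c set" and F :: "'g => 'c => int"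
 assumes G: "comm_group G" and co: "int_coords G S F"
begin

lemma biadditive_coords: "biadditive G (%x (v::'v::real_vector). F x t *z v)"
 using int_coordsD(2)[OF co, of t]
 by (auto simp: biadditive_def addi_def scaleR_left_distrib scaleR_right_distrib)

lemma tensor_coords_class:
 "tco F (tcl G c) t = frag_sum (%(x, v). F x t *z v) c"
 unfolding tco_def by (rule tensor_lift_class[OF G biadditive_coords])

lemma tensor_coords_add:
 "A : car (tensor_space G) ==> B : car (tensor_space G) ==>
  tco F (A +[tensor_space G] B) = (%t. tco F A t + tco F B t)"
 by (rule ext) (simp add: tco_def tensor_lift_add[OF G biadditive_coords])

lemma tensor_coords_smult:
 "A : car (tensor_space G) ==>
  tco F (r .[tensor_space G] A) = (%t. r *R tco F A t)"
 by (rule ext) (simp add: tco_def tensor_lift_smult[OF G biadditive_coords] mult.commute)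

lemma tensor_coords_supp:
 assumes "A : car (tensor_space G)" "t ~: S" shows "tco F A t = 0"
proof -
 obtain c where c: "pkeys c <= car G >< UNIV" "A = tcl G c"
  using assms tensor_space_carrierE[OF G] by metis
 have "frag_sum (%(x, v). F x t *z v) c = 0" using c(1)
  by (induction c rule: frag_induction) (use int_coordsD(3)[OF co _ assms(2)] in auto)
 thus ?thesis by (simp add: c(2) tensor_coords_class)
qed

lemma tensor_coords_inj:
 assumes "A : car (tensor_space G)" "!!t. tco F A t = (0::'v::real_vector)"
 shows "A = e0 (tensor_space G)"
proof -
 obtain c where c: "pkeys c <= car G >< UNIV" "A = tcl G c"
  using assms tensor_space_carrierE[OF G] by metis
 obtain E y where E: "finite E" "!!n :: 'v => int. (SUM e:E. n e *z e) = 0 ==> ALL e:E. n e = 0"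
  and y: "!!e. y e : car G" and eq: "tcl G c = tcl G (SUM e:E. frag_of (y e, e))"
  by (rule tensor_rep_exists[OF G c(1)]) blast
 have "y e = e1 G" if e: "e : E" for e
 proof (rule int_coordsD(4)[OF co y])
  fix t
  have "(SUM e:E. F (y e) t *z e) = 0"
   using assms(2)[of t] by (simp add: c(2) eq tensor_coords_class)
  thus "F (y e) t = 0" using E(2)[of "%e. F (y e) t"] e by blast
 qed
 hence "(SUM e:E. frag_of (y e, e)) = (SUM e:E. frag_of (e1 G, e))" by (intro sum.cong) auto
 moreover have "(SUM e:E. frag_of (e1 G, e)) : trel G"
  using E(1) by (induction E) (auto intro: tensor_relations_add[OF G] tensor_relations_one[OF G] tensor_relations_zero[OF G])
 ultimately show ?thesis
  by (simp add: c(2) eq tensor_space_zero[OF G] tensor_class_eq_iff[OF G])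
qed

lemma tensor_coords_surj:
 fixes f :: "'c => 'v::real_vector"
 assumes "!!t. t ~: S ==> f t = 0"
 shows "EX A:car (tensor_space G). tco F A = f"
proof -
 obtain g where g: "!!t. t : S ==> g t : car G"
  "!!t s. t : S ==> F (g t) s = (if s = t then 1 else 0)"
  using int_coords_basis[OF co] by metis
 have fin: "finite S" by (rule int_coordsD(1)[OF co])
 let ?c = "SUM t:S. frag_of (g t, f t)"
 have "pkeys (SUM t:X. frag_of (g t, f t)) <= car G >< UNIV" if "X <= S" for X
  using finite_subset[OF that fin] that
  by (induction X) (use g(1) in "auto simp: keys_frag_of dest!: subsetD[OF keys_add]")
 hence "pkeys ?c <= car G >< UNIV" by blast
 moreover have "tco F (tcl G ?c) s = f s" for s
 proof -
  have "tco F (tcl G ?c) s = (SUM t:S. if t = s then f t else 0)"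
   unfolding tensor_coords_class frag_sum_sum by (rule sum.cong) (auto simp: g(2))
  thus ?thesis using fin assms by (cases "s : S") auto
 qed
 ultimately show ?thesis using tensor_space_carrierI[OF G] by blast
qed

end

context group_complex
begin

lemma tensor_coords_D:
 assumes co: "int_coords (C q) S F" and co': "int_coords (C (q - 1)) S' F'"
  and a: "!!x. x : car (C q) ==> F' (d q x) s = (SUM t:S. a t * F x t)"
  and A: "A : car (T q)"
 shows "tco F' (D q A) s = (SUM t:S. a t *z tco F A t)"
proof -
 obtain c where c: "pkeys c <= car (C q) >< UNIV" "A = tcl (C q) c"
  using A tensor_space_carrierE[OF comm] by metis
 have "frag_sum (%(x, v). F' x s *z v) (tensor_push (d q) c) =
   (SUM t:S. a t *z frag_sum (%(x, v). F x t *z v) c)"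
  using c(1)
 proof (induction c rule: frag_induction)
  case (one p)
  thus ?case by (cases p) (simp add: a scaleR_sum_left)
 next
  case (diff x y)
  thus ?case by (simp add: scaleR_right_diff_distrib sum_subtractf)
 qed simp
 thus ?thesis
  by (simp add: c(2) D_class tensor_coords_class[OF comm co] tensor_coords_class[OF comm co'])
qed

lemma tensor_homology_coords:
 fixes a :: "'c => 'c => int"
 assumes co: "int_coords (C q) S F" "int_coords (C (q - 1)) S0 F0" "int_coords (C (q + 1)) S1 F1"
  and a0: "!!x t. x : car (C q) ==> t : S0 ==> F0 (d q x) t = (SUM u:S. a u t * F x u)"
  and a1: "!!x u. x : car (C (q + 1)) ==> u : S ==> F (d (q + 1) x) u = (SUM s:S1. a s u * F1 x s)"
 shows "lin_corr (T q :: ('g, 'v::real_vector) tmod) (ZT q) (BT q) FS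
   {f. (ALL u. u ~: S --> f u = 0) & (ALL t:S0. (SUM u:S. a u t *z f u) = 0)}
   {f. EX g. f = (%u. if u : S then SUM s:S1. a s u *z g s else (0::'v))}"
  (is "lin_corr ?T ?ZT ?BT _ ?Z ?B")
proof -
 define R where "R A f <-> A : ?ZT & f = tco F A" for A and f :: "'c => 'v"
 interpret sq: subquotient ?T ?ZT ?BT by (rule subquotient)
 note co1' = co(3)
 have D0: "tco F0 (D q A) t = (SUM u:S. a u t *z tco F A u)"
  if "A : car ?T" "t : S0" for A t
  by (rule tensor_coords_D[OF co(1,2) a0 that(1)]) (use that in auto)
 have D1: "tco F (D (q + 1) A) u = (SUM s:S1. a s u *z tco F1 A s)"
  if "A : car (T (q + 1))" "u : S" for A :: "('g, 'v) tfrag set" and u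
  by (rule tensor_coords_D[OF co(3) _ a1 that(1)]) (use that co in auto)
 have "lin_corr_by ?T ?ZT ?BT FS ?Z ?B R"
 proof (rule lin_corr_byI)
  fix A f assume "R A f"
  hence A: "A : ?ZT" "A : car ?T" "f = tco F A" by (auto simp: R_def ZT_def)
  show "A : ?ZT" by fact
  have z0: "tco F0 (e0 (T (q - 1))) t = (0::'v)" for t
   by (simp add: tensor_space_zero[OF comm] tensor_coords_class[OF comm co(2)])
  show "f : ?Z"
   using A tensor_coords_supp[OF comm co(1) A(2)] D0[OF A(2)] z0 by (auto simp: ZT_def)
  show "f : ?B" if "A : ?BT"
  proof -
   obtain A1 where A1: "A1 : car (T (q + 1))" "A = D (q + 1) A1"
    using `A : ?BT` unfolding BT_def by blast
   have "f = (%u. if u : S then SUM s:S1. a s u *z tco F1 A1 s else 0)"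
    using D1[OF A1(1)] A1(2) A(3) tensor_coords_supp[OF comm co(1) A(2)] by (auto simp: fun_eq_iff)
   thus ?thesis by blast
  qed
  show "A : ?BT" if "f : ?B"
  proof -
   obtain g where g: "f = (%u. if u : S then SUM s:S1. a s u *z g s else 0)"
    using `f : ?B` by blast
   let ?g = "%s. if s : S1 then g s else 0"
   obtain A1 where A1: "A1 : car (T (q + 1))" "tco F1 A1 = ?g"
    using tensor_coords_surj[OF comm co(3), of ?g] by auto
   let ?A = "D (q + 1) A1"
   have cA: "?A : car ?T" using D_closed[OF A1(1)] by simp
   have sum: "(SUM s:S1. a s u *z ?g s) = (SUM s:S1. a s u *z g s)" for u
    by (rule sum.cong) auto
   have "tco F ?A = f"
    using D1[OF A1(1)] tensor_coords_supp[OF comm co(1) cA] unfolding A1(2) sum by (auto simp: fun_eq_iff g)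
   hence "tco F (A +[?T] (- 1) .[?T] ?A) u = 0" for u
    using A cA by (simp add: tensor_coords_add[OF comm co(1)] tensor_coords_smult[OF comm co(1)])
   from tensor_coords_inj[OF comm co(1) _ this]
   have z: "A +[?T] (- 1) .[?T] ?A = e0 ?T" using A(2) cA by simp
   have "?A : ?BT" unfolding BT_def using A1(1) by blast
   have "A = (A +[?T] (- 1) .[?T] ?A) +[?T] ?A"
   proof -
    have "(- 1) .[?T] ?A +[?T] ?A = e0 ?T"
     using sq.M.smult_l_distr[of "-1" 1 ?A] sq.M.smult_one[of ?A] sq.M.smult_l_null[of ?A] cA by simp
    thus ?thesis using A(2) cA by (simp add: sq.M.M.a_assoc)
   qed
   hence "A = ?A" using z cA by simp
   thus ?thesis using `?A : ?BT` by simp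
  qed
  show "R (r .[?T] A) (r .[FS] f)" for r
   using A sq.Zsm by (simp add: R_def tensor_coords_smult[OF comm co(1)])
  fix A' f' assume "R A' f'"
  hence A': "A' : ?ZT" "A' : car ?T" "f' = tco F A'" by (auto simp: R_def ZT_def)
  show "R (A +[?T] A') (f +[FS] f')"
   using A A' sq.Zadd by (simp add: R_def tensor_coords_add[OF comm co(1)])
 next
  show "EX f. R A f" if "A : ?ZT" for A using that by (simp add: R_def)
  fix f assume f: "f : ?Z"
  obtain A where A: "A : car ?T" "tco F A = f"
   using tensor_coords_surj[OF comm co(1), of f] f by auto
  have cA: "D q A : car (T (q - 1))" by (rule D_closed[OF A(1)])
  have "tco F0 (D q A) t = 0" for t
   using D0[OF A(1)] f A(2) tensor_coords_supp[OF comm co(2) cA] by (cases "t : S0") auto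
  hence "D q A = e0 (T (q - 1))" by (intro tensor_coords_inj[OF comm co(2) cA])
  thus "EX A. R A f" using A by (auto simp: R_def ZT_def)
 qed
 thus ?thesis unfolding lin_corr_def by blast
qed

end

definition group_corr ::
 "'g monoid => 'g set => 'g set => 'h monoid => 'h set => 'h set => ('g => 'h => bool) => bool" where
 "group_corr G Z B G' Z' B' R <->
   (ALL x x'. R x x' --> x : Z & x' : Z' & (x : B <-> x' : B')) &
   (ALL x x' y y'. R x x' --> R y y' --> R (x *[G] y) (x' *[G'] y')) &
   (ALL x:Z. EX x'. R x x') & (ALL x':Z'. EX x. R x x')"

lemma group_corrI:
 assumes "!!x x'. R x x' ==> x : Z" "!!x x'. R x x' ==> x' : Z'"
  "!!x x'. R x x' ==> x : B ==> x' : B'" "!!x x'. R x x' ==> x' : B' ==> x : B"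
  "!!x x' y y'. R x x' ==> R y y' ==> R (x *[G] y) (x' *[G'] y')"
  "!!x. x : Z ==> EX x'. R x x'" "!!x'. x' : Z' ==> EX x. R x x'"
 shows "group_corr G Z B G' Z' B' R"
 unfolding group_corr_def
proof (intro conjI allI impI ballI)
 fix x x' assume "R x x'"
 thus "x : Z" "x' : Z'" "(x : B) = (x' : B')" using assms(1-4) by blast+
qed (fact assms | erule (1) assms)+

abbreviation "corr_grp G Z B H == group_corr G Z B H (car H) {e1 H}"

lemma group_corrD:
 assumes "group_corr G Z B G' Z' B' R"
 shows "R x x' ==> x : Z" "R x x' ==> x' : Z'" "R x x' ==> x : B <-> x' : B'"
  "R x x' ==> R y y' ==> R (x *[G] y) (x' *[G'] y')"
  "x : Z ==> EX x'. R x x'" "x' : Z' ==> EX x. R x x'"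
 using assms unfolding group_corr_def by blast+

lemma group_corr_trans:
 assumes "group_corr G Z B G' Z' B' R" "group_corr G' Z' B' G'' Z'' B'' S"
 shows "group_corr G Z B G'' Z'' B'' (%x y. EX z. R x z & S z y)"
proof -
 note R = group_corrD[OF assms(1)] and S = group_corrD[OF assms(2)]
 show ?thesis
 proof (rule group_corrI)
  show "EX z. R (x *[G] y) z & S z (x' *[G''] y')"
   if "EX z. R x z & S z x'" "EX z. R y z & S z y'" for x x' y y'
   using that R(4) S(4) by blast
  show "EX x' z. R x z & S z x'" if "x : Z" for x using that R(2,5) S(5) by blast
  show "EX x z. R x z & S z x'" if "x' : Z''" for x' using that S(1,6) R(6) by blast
 qed (use R(1,2,3) S(1,2,3) in blast)+
qed

lemma group_corr_sym:
 assumes "group_corr G Z B G' Z' B' R" shows "group_corr G' Z' B' G Z B (%x y. R y x)"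
proof -
 note R = group_corrD[OF assms]
 show ?thesis by (rule group_corrI) (use R(1,2,3) in blast, use R(1,2,3) in blast, use R(3) in blast,
  use R(3) in blast, rule R(4), assumption+, rule R(6), assumption, rule R(5))
qed

lemma group_corr_eq:
 assumes corr: "group_corr G Z B G' Z' B' R" and G: "group G" and Z: "subgroup Z G" and B: "subgroup B G"
  and f: "!!x y. x : Z ==> y : Z ==> f (x *[G] y) = f x + (f y :: 'v::real_vector)"
  and fB: "!!x. x : B ==> f x = 0" and R: "R x z" "R y z"
 shows "f x = f y"
proof -
 interpret group G by fact
 interpret Z: subgroup Z G by fact
 note c = group_corrD[OF corr]
 have xy: "x : Z" "y : Z" using c(1) R by blast+
 obtain t where t: "R (inv[G] y) t" using c(5)[of "inv[G] y"] xy by auto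
 have "R (y *[G] inv[G] y) (z *[G'] t)" by (rule c(4)[OF R(2) t])
 moreover have 1: "y *[G] inv[G] y = e1 G" using xy by auto
 ultimately have "z *[G'] t : B'" using c(3)[of "e1 G"] subgroup.one_closed[OF B] by simp
 hence "x *[G] inv[G] y : B" using c(3)[OF c(4)[OF R(1) t]] by blast
 hence "f x + f (inv[G] y) = 0" using fB f[of x "inv[G] y"] xy by simp
 moreover have "f y + f (inv[G] y) = 0"
  using f[of y "inv[G] y"] fB[of "e1 G"] subgroup.one_closed[OF B] xy 1 by simp
 ultimately show ?thesis by (metis add_right_cancel)
qed

lemma group_corr_transport:
 fixes f :: "'g => 'v::real_vector"
 assumes corr: "group_corr G Z B G' Z' B' R" and G: "group G" and Z: "subgroup Z G" and B: "subgroup B G"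
  and G': "comm_group G'" and sep: "int_separated G'" and Z': "subgroup Z' G'"
  and f: "!!x y. x : Z ==> y : Z ==> f (x *[G] y) = f x + f y"
  and fB: "!!x. x : B ==> f x = 0"
 obtains h where "addi G' h" "!!x x'. R x x' ==> h x' = f x"
proof -
 note c = group_corrD[OF corr]
 define k where "k x' = f (SOME x. R x x')" for x'
 have k: "k x' = f x" if "R x x'" for x x'
  unfolding k_def using group_corr_eq[OF corr G Z B f fB someI[of "%x. R x x'", OF that] that] by simp
 interpret Z: subgroup Z' G' by fact
 interpret G'': comm_group "G'\<lparr>carrier := Z'\<rparr>" by (rule group.group_comm_groupI[OF Z.subgroup_is_group[OF comm_group.axioms(2)[OF G']]])
   (use comm_groupE(4)[OF G'] Z.subset in auto)
 have ad: "addi (G'\<lparr>carrier := Z'\<rparr>) k" unfolding addi_def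
 proof (intro ballI)
  fix x y assume "x : car (G'\<lparr>carrier := Z'\<rparr>)" "y : car (G'\<lparr>carrier := Z'\<rparr>)"
  hence "EX a. R a x" "EX b. R b y" using c(6) by simp_all
  then obtain a b where ab: "R a x" "R b y" by blast
  show "k (x *[G'\<lparr>carrier := Z'\<rparr>] y) = k x + k y" using k[OF c(4)[OF ab]] k[OF ab(1)] k[OF ab(2)] f c(1) ab by simp
 qed
 obtain h where "addi G' h" "!!x. x : Z' ==> h x = k x"
 proof (rule additive_factor_extend[OF G''.comm_group_axioms G' sep, of id k])
  show "id : hom (G'\<lparr>carrier := Z'\<rparr>) G'" using Z.subset by (auto simp: hom_def)
  show "k z = 0" if "z : car (G'\<lparr>carrier := Z'\<rparr>)" "id z = e1 G'" for z
   using that additive_on_one[OF G''.is_group ad] by simp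
 qed (rule ad, rule that, assumption, simp)
 thus ?thesis using that k c(2) by simp
qed

context group_complex
begin

definition ZC :: "int => 'g set" where "ZC q = {x : car (C q). d q x = e1 (C (q - 1))}"

definition BC :: "int => 'g set" where "BC q = d (q + 1) ` car (C (q + 1))"

lemma subgroup_ZC: "subgroup (ZC q) (C q)"
proof -
 interpret group_hom "C q" "C (q - 1)" "d q"
  using comm d_hom by (simp add: group_hom_def group_hom_axioms_def comm_group.axioms)
 show ?thesis using subgroup_kernel by (simp add: ZC_def kernel_def)
qed

lemma subgroup_BC: "subgroup (BC q) (C q)"
proof -
 interpret group_hom "C (q + 1)" "C q" "d (q + 1)"
  using comm d_hom' by (simp add: group_hom_def group_hom_axioms_def comm_group.axioms)
 show ?thesis using img_is_subgroup by (simp add: BC_def)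
qed

lemma BC_subset_ZC: "BC q <= ZC q"
 using d_hom'[of q] dd by (auto simp: BC_def ZC_def hom_def)

lemma tensor_class_ZT:
 assumes "z : ZC q" shows "tcl (C q) (frag_of (z, v)) : ZT q"
proof -
 have "D q (tcl (C q) (frag_of (z, v))) = e0 (T (q - 1))"
  using assms tensor_relations_one[OF comm]
  by (simp add: ZC_def D_class tensor_space_zero[OF comm] tensor_class_eq_iff[OF comm])
 thus ?thesis using assms by (auto simp: ZT_def ZC_def keys_frag_of intro!: tensor_space_carrierI[OF comm])
qed

text \<open>A linear functional on the homology with coefficients in V is the same as an additive map
  from the cycles to \<open>V\<close> that vanishes on the boundaries; the pairing \<open>ip\<close> identifies \<open>V\<close> with its
  dual. On the cellular side such a map is a cocycle up to coboundaries.\<close>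

lemma cochain_dual_corr:
 fixes a :: "'c => 'c => int" and ip :: "'v::real_vector => 'v => real"
  and C' :: "int => 'h monoid"
 assumes ip: "!!u v w. ip (u + v) w = ip u w + ip v w" "!!u v w. ip u (v + w) = ip u v + ip u w"
  "!!r v w. ip (r *R v) w = r * ip v w" "!!r v w. ip v (r *R w) = r * ip v w"
  "!!l. (!!v w. l (v + w) = l v + l w) ==> (!!r v. l (r *R v) = r * l v) ==> EX v. ALL w. l w = ip v w"
  "!!v. (!!w. ip v w = 0) ==> v = 0"
  and C': "group_complex C' d'"
  and co: "int_coords (C' k) S G" "int_coords (C' (k - 1)) S0 F0" "int_coords (C' (k + 1)) S1 F1"
  and a0: "!!x t. x : car (C' k) ==> t : S0 ==> F0 (d' k x) t = (SUM ta:S. a ta t * G x ta)"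
  and a1: "!!x ta. x : car (C' (k + 1)) ==> ta : S ==> G (d' (k + 1) x) ta = (SUM \<rho>:S1. a \<rho> ta * F1 x \<rho>)"
  and sep: "int_separated (C (r - 1))" and sep': "int_separated (C r)"
  and corr: "group_corr (C' k) (group_complex.ZC C' d' k) (group_complex.BC C' d' k) (C r) (ZC r) (BC r) R"
 shows "lin_corr FS
   {y :: 'c => 'v. (ALL ta. ta ~: S --> y ta = 0) & (ALL \<rho>:S1. (SUM ta:S. a \<rho> ta *z y ta) = 0)}
   {y. EX y'. y = (%ta. if ta : S then SUM t:S0. a ta t *z y' t else 0)}
   (dual_space (homology_space (T :: int => ('g, 'v) tmod) D r))
   (car (dual_space (homology_space (T :: int => ('g, 'v) tmod) D r)))
   {e0 (dual_space (homology_space (T :: int => ('g, 'v) tmod) D r))}"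
  (is "lin_corr _ ?Z ?B ?Dual _ _")
proof -
 interpret C': group_complex C' d' by fact
 let ?T = "T r :: ('g, 'v) tmod"
 interpret sq: subquotient ?T "ZT r" "BT r" by (rule subquotient)
 have H: "homology_space (T :: int => ('g, 'v) tmod) D r = sq.Q"
  by (rule homology_space_eq)
 note c = group_corrD[OF corr]
 define K where "K z v = sq.K (tcl (C r) (frag_of (z, v)))" for z and v :: 'v
 define pr where "pr y x = (SUM ta:S. G x ta *z (y ta :: 'v))" for y x
 have pr_add: "addi (C' k) (pr y)" for y
  using int_coordsD(2)[OF co(1)] by (auto simp: addi_def pr_def scaleR_left_distrib sum.distrib)
 have gC: "group (C' j)" for j using C'.comm comm_group.axioms(2) by blast
 have pr_plus: "pr (%ta. y ta + y' ta) x = pr y x + pr y' x" for y y' x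
  by (simp add: pr_def scaleR_right_distrib sum.distrib)
 have pr_sc: "pr (%ta. s *R y ta) x = s *R pr y x" for y x s
  by (simp add: pr_def scaleR_sum_right mult.commute)
 have pr_B: "pr y x = 0" if y: "y : ?Z" and x: "x : C'.BC k" for y x
 proof -
  obtain w where w: "w : car (C' (k + 1))" "x = d' (k + 1) w" using x by (auto simp: C'.BC_def)
  have "pr y x = (SUM ta:S. SUM \<rho>:S1. (of_int (F1 w \<rho>)) *R (a \<rho> ta *z y ta))"
   unfolding pr_def w(2) by (rule sum.cong) (auto simp: a1[OF w(1)] scaleR_sum_left mult.commute)
  also have "... = (SUM \<rho>:S1. F1 w \<rho> *z (SUM ta:S. a \<rho> ta *z y ta))"
   by (subst sum.swap) (simp add: scaleR_sum_right)
  also have "... = 0" using y by simp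
  finally show ?thesis .
 qed
 have pr_cobd: "pr (%ta. if ta : S then SUM t:S0. a ta t *z y' t else 0) x =
   (SUM t:S0. F0 (d' k x) t *z y' t)" if x: "x : car (C' k)" for y' x
 proof -
  have "pr (%ta. if ta : S then SUM t:S0. a ta t *z y' t else 0) x =
    (SUM ta:S. SUM t:S0. (a ta t * G x ta) *z y' t)"
   unfolding pr_def by (rule sum.cong) (auto simp: scaleR_sum_right mult.commute)
  also have "... = (SUM t:S0. F0 (d' k x) t *z y' t)"
   by (subst sum.swap) (simp add: a0[OF x] scaleR_sum_left)
  finally show ?thesis .
 qed
 obtain g where g: "!!ta. ta : S ==> g ta : car (C' k)"
  "!!ta t. ta : S ==> G (g ta) t = (if t = ta then 1 else 0)"
  using int_coords_basis[OF co(1)] by metis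
 have pr_g: "pr y (g ta) = y ta" if "ta : S" for y ta
 proof -
  have "pr y (g ta) = (SUM t:S. if t = ta then y t else 0)"
   unfolding pr_def by (rule sum.cong) (auto simp: g(2)[OF that])
  thus ?thesis using that int_coordsD(1)[OF co(1)] by simp
 qed
 have pr_F: "pr (%ta. if ta : S then F (g ta) else 0) x = F x"
  if F: "addi (C' k) F" and x: "x : car (C' k)" for F x
 proof -
  have "pr (%ta. if ta : S then F (g ta) else 0) x = (SUM ta:S. G x ta *z F (g ta))"
   unfolding pr_def by (rule sum.cong) auto
  also have "... = F x" by (rule int_coords_expand[OF C'.comm co(1) F g x, symmetric])
  finally show ?thesis .
 qed
 have LK: "addi ((C r)\<lparr>carrier := ZC r\<rparr>) (%z. L (K z v))"
  "L (K z (v + w)) = L (K z v) + L (K z w)" "L (K z (s *R v)) = s * L (K z v)"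
  if L: "L : car ?Dual" and z: "z : ZC r" for L z v w s
 proof -
  have L': "L : car (dual_space sq.Q)" using L unfolding H .
  note D = sq.dual_quotientD[OF L']
  have cz: "z : car (C r)" if "z : ZC r" for z using that by (simp add: ZC_def)
  show "addi ((C r)\<lparr>carrier := ZC r\<rparr>) (%z. L (K z v))"
   unfolding addi_def
  proof (intro ballI)
   fix x y assume "x : car ((C r)\<lparr>carrier := ZC r\<rparr>)" "y : car ((C r)\<lparr>carrier := ZC r\<rparr>)"
   hence xy: "x : ZC r" "y : ZC r" by simp_all
   have "tcl (C r) (frag_of (x *[C r] y, v)) =
     tcl (C r) (frag_of (x, v)) +[?T] tcl (C r) (frag_of (y, v))"
    using tensor_relations_left[OF comm, of x r y v] cz[OF xy(1)] cz[OF xy(2)]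
    by (simp add: tensor_space_add[OF comm] tensor_class_eq_iff[OF comm] diff_diff_eq)
   thus "L (K (x *[(C r)\<lparr>carrier := ZC r\<rparr>] y) v) = L (K x v) + L (K y v)"
    using D(1)[OF tensor_class_ZT[OF xy(1)] tensor_class_ZT[OF xy(2)]] by (simp add: K_def)
  qed
  have "tcl (C r) (frag_of (z, v + w)) =
     tcl (C r) (frag_of (z, v)) +[?T] tcl (C r) (frag_of (z, w))"
   using tensor_relations_right[OF comm, of z r v w] cz[OF z]
   by (simp add: tensor_space_add[OF comm] tensor_class_eq_iff[OF comm] diff_diff_eq)
  thus "L (K z (v + w)) = L (K z v) + L (K z w)"
   using D(1)[OF tensor_class_ZT[OF z] tensor_class_ZT[OF z]] by (simp add: K_def)
  have "tcl (C r) (frag_of (z, s *R v)) = s .[?T] tcl (C r) (frag_of (z, v))"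
   by (simp add: tensor_space_smult[OF comm])
  thus "L (K z (s *R v)) = s * L (K z v)"
   using D(2)[OF tensor_class_ZT[OF z]] by (simp add: K_def)
 qed
 have LB: "L (K z v) = 0" if L: "L : car ?Dual" and z: "z : BC r" for L z v
 proof -
  obtain w where w: "w : car (C (r + 1))" "z = d (r + 1) w" using z by (auto simp: BC_def)
  have "tcl (C (r + 1)) (frag_of (w, v)) : car (T (r + 1))"
   using w by (intro tensor_space_carrierI[OF comm]) (simp add: keys_frag_of)
  moreover have "tcl (C r) (frag_of (z, v)) = D (r + 1) (tcl (C (r + 1)) (frag_of (w, v)))"
   by (simp add: D_class' w)
  ultimately have "tcl (C r) (frag_of (z, v)) : BT r" unfolding BT_def by blast
  thus ?thesis using sq.dual_quotientD(3) L unfolding H K_def by blast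
 qed
 have L0: "L = e0 ?Dual <-> (ALL z:ZC r. ALL v. L (K z v) = 0)" if L: "L : car ?Dual" for L
 proof
  assume "L = e0 ?Dual"
  thus "ALL z:ZC r. ALL v. L (K z v) = 0"
   using sq.dual_quotientD(4)[of L] L tensor_class_ZT unfolding H K_def by blast
 next
  assume h: "ALL z:ZC r. ALL v. L (K z v) = 0"
  have "L (sq.K A) = 0" if A: "A : ZT r" for A
  proof -
   obtain E y where E: "finite E" and y: "!!e. y e : car (C r)" "!!e. e : E ==> d r (y e) = e1 (C (r - 1))"
    and A': "A = tcl (C r) (SUM e:E. frag_of (y e, e))"
    by (rule tensor_map_kernel[OF comm comm d_hom sep, of A]) (use A in "auto simp: ZT_def")
   have z: "tcl (C r) 0 = e0 ?T" by (simp add: tensor_space_zero[OF comm])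
   have "tcl (C r) (SUM e:X. frag_of (y e, e)) : ZT r &
     L (sq.K (tcl (C r) (SUM e:X. frag_of (y e, e)))) = 0" if "X <= E" for X
    using finite_subset[OF that E] that
   proof (induction X)
    case empty
    thus ?case using sq.Z0 sq.dual_quotientD(3)[of L "e0 ?T"] sq.B0 L unfolding H by (simp add: z)
   next
    case (insert e X)
    have ze: "y e : ZC r" using y insert by (auto simp: ZC_def)
    have eq: "tcl (C r) (SUM e:insert e X. frag_of (y e, e)) =
      tcl (C r) (frag_of (y e, e)) +[?T] tcl (C r) (SUM e:X. frag_of (y e, e))"
     using insert by (simp add: tensor_space_add[OF comm])
    have IH: "tcl (C r) (SUM e:X. frag_of (y e, e)) : ZT r"
      "L (sq.K (tcl (C r) (SUM e:X. frag_of (y e, e)))) = 0" using insert by auto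
    have "L (sq.K (tcl (C r) (frag_of (y e, e)))) = 0" using h ze by (simp add: K_def)
    thus ?case unfolding eq
     using sq.dual_quotientD(1)[of L, OF _ tensor_class_ZT[OF ze] IH(1), of e] IH L sq.Zadd[OF tensor_class_ZT[OF ze] IH(1), of e]
     unfolding H by simp
   qed
   thus ?thesis using A' by blast
  qed
  thus "L = e0 ?Dual" using sq.dual_quotientD(4)[of L] L unfolding H by blast
 qed
 define Rel where "Rel y L <-> y : ?Z & L : car ?Dual &
  (ALL z z' v. R z z' --> ip (pr y z) v = L (K z' v))" for y L
 have Zin: "z : car (C' k)" "d' k z = e1 (C' (k - 1))" if "R z z'" for z z'
  using c(1)[OF that] by (auto simp: C'.ZC_def)
 have "lin_corr_by FS ?Z ?B ?Dual (car ?Dual) {e0 ?Dual} Rel"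
 proof (rule lin_corr_byI)
  fix y L assume yL: "Rel y L"
  thus "y : ?Z" "L : car ?Dual" unfolding Rel_def by blast+
  have pair: "ip (pr y z) v = L (K z' v)" if "R z z'" for z z' v using yL that unfolding Rel_def by blast
  show "L : {e0 ?Dual}" if "y : ?B"
  proof -
   obtain y' where y': "y = (%ta. if ta : S then SUM t:S0. a ta t *z y' t else 0)"
    using `y : ?B` by blast
   have "L (K z' v) = 0" if z': "z' : ZC r" for z' v
   proof -
    obtain z where z: "R z z'" using c(6)[OF z'] by blast
    have "pr y z = 0" unfolding y' pr_cobd[OF Zin(1)[OF z]] Zin(2)[OF z]
     using additive_on_one[OF gC int_coordsD(2)[OF co(2)]] by simp
    thus ?thesis using pair[OF z, of v] ip(1)[of 0 0 v] by simp
   qed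
   thus ?thesis using L0[OF `L : car ?Dual`] by simp
  qed
  show "y : ?B" if "L : {e0 ?Dual}"
  proof -
   have LK0: "L (K z' v) = 0" if "z' : ZC r" for z' v
    using L0[OF `L : car ?Dual`] `L : {e0 ?Dual}` that by blast
   have prZ: "pr y z = 0" if z: "z : C'.ZC k" for z
   proof -
    obtain z' where z': "R z z'" using c(5)[OF z] by blast
    show ?thesis by (rule ip(6)) (use pair[OF z'] LK0 c(2)[OF z'] in simp)
   qed
   obtain U where U: "addi (C' (k - 1)) U" "!!x. x : car (C' k) ==> U (d' k x) = pr y x"
    by (rule additive_factor_extend[OF C'.comm C'.comm int_coords_separated[OF co(2)] C'.d_hom pr_add]) (use prZ in "auto simp: C'.ZC_def")
   obtain g0 where g0: "!!t. t : S0 ==> g0 t : car (C' (k - 1))"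
    "!!t ta. t : S0 ==> F0 (g0 t) ta = (if ta = t then 1 else 0)"
    using int_coords_basis[OF co(2)] by metis
   have "y = (%ta. if ta : S then SUM t:S0. a ta t *z U (g0 t) else 0)"
   proof
    fix ta
    show "y ta = (if ta : S then SUM t:S0. a ta t *z U (g0 t) else 0)"
    proof (cases "ta : S")
     case True
     have "y ta = U (d' k (g ta))" using pr_g[OF True, of y] U(2) g(1)[OF True] by simp
     also have "... = (SUM t:S0. F0 (d' k (g ta)) t *z U (g0 t))"
      by (rule int_coords_expand[OF C'.comm co(2) U(1) g0]) (use g(1)[OF True] C'.d_hom[of k] in "auto simp: hom_def")
     also have "... = (SUM t:S0. a ta t *z U (g0 t))"
     proof (rule sum.cong[OF refl])
      fix t assume t: "t : S0"
      have "F0 (d' k (g ta)) t = (SUM t':S. if t' = ta then a t' t else 0)"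
       unfolding a0[OF g(1)[OF True] t] by (rule sum.cong) (auto simp: g(2)[OF True])
      thus "F0 (d' k (g ta)) t *z U (g0 t) = a ta t *z U (g0 t)"
       using True int_coordsD(1)[OF co(1)] by simp
     qed
     finally show ?thesis using True by simp
    next
     case False
     thus ?thesis using `y : ?Z` by auto
    qed
   qed
   thus ?thesis unfolding mem_Collect_eq by (intro exI[of _ "%t. U (g0 t)"])
  qed
  have addD: "(L +[?Dual] L') (K z' v) = L (K z' v) + L' (K z' v)"
   and scD: "(s .[?Dual] L) (K z' v) = s * L (K z' v)" if "z' : ZC r" for z' v L' s
   using tensor_class_ZT[OF that, of v] unfolding H by (simp_all add: dual_space_simps K_def sq.quotient_carrier)
  interpret Dg: abelian_group "dual_space sq.Q" by (rule sq.abelian_group_dual_quotient)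
  show "Rel (s .[FS] y) (s .[?Dual] L)" for s
   unfolding Rel_def
  proof (intro conjI allI impI)
   show "s .[FS] y : ?Z"
   proof -
    have "(SUM ta:S. a \<rho> ta *z s *R y ta) = s *R (SUM ta:S. a \<rho> ta *z y ta)" for \<rho>
     by (simp add: scaleR_sum_right mult.commute)
    thus ?thesis using `y : ?Z` by auto
   qed
   show "s .[?Dual] L : car ?Dual"
    using `L : car ?Dual` sq.Zadd sq.Zsm unfolding H
    by (auto simp: dual_space_simps linear_maps_real_line sq.quotient_carrier sq.quotient_add sq.quotient_smult algebra_simps)
   show "ip (pr (s .[FS] y) z) v = (s .[?Dual] L) (K z' v)" if "R z z'" for z z' v
    using pair[OF that, of v] scD[OF c(2)[OF that]] by (simp add: pr_sc ip(3))
  qed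
  fix y' L' assume yL': "Rel y' L'"
  hence y': "y' : ?Z" "L' : car ?Dual" unfolding Rel_def by blast+
  have pair': "ip (pr y' z) v = L' (K z' v)" if "R z z'" for z z' v using yL' that unfolding Rel_def by blast
  show "Rel (y +[FS] y') (L +[?Dual] L')"
   unfolding Rel_def
  proof (intro conjI allI impI)
   show "y +[FS] y' : ?Z"
    using `y : ?Z` y'(1) by (auto simp: scaleR_right_distrib sum.distrib)
   show "L +[?Dual] L' : car ?Dual"
    using `L : car ?Dual` y'(2) Dg.a_closed unfolding H by blast
   show "ip (pr (y +[FS] y') z) v = (L +[?Dual] L') (K z' v)" if "R z z'" for z z' v
    using pair[OF that, of v] pair'[OF that, of v] addD[OF c(2)[OF that]] by (simp add: pr_plus ip(1))
  qed
 next
  fix y assume y: "y : ?Z"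
  have pr1: "pr y (x *[C' k] x') = pr y x + pr y x'" if "x : C'.ZC k" "x' : C'.ZC k" for x x'
   using additive_onD[OF pr_add] that by (simp add: C'.ZC_def)
  obtain F where F: "addi (C r) F" "!!z z'. R z z' ==> F z' = pr y z"
   by (rule group_corr_transport[OF corr gC C'.subgroup_ZC C'.subgroup_BC comm sep' subgroup_ZC pr1 pr_B[OF y]]) auto
  define f where "f x v = ip (F x) v" for x v
  have f: "biadditive (C r) f" using F(1) by (auto simp: biadditive_def f_def addi_def ip)
  have fs: "f x (s *R v) = s *R f x v" for x v s by (simp add: f_def ip)
  have FB: "F z' = 0" if z': "z' : BC r" for z'
  proof -
   obtain z where z: "R z z'" using c(6) z' BC_subset_ZC by blast
   thus ?thesis using F(2)[OF z] c(3)[OF z] z' pr_B[OF y] by simp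
  qed
  have l1: "tensor_lift f (A +[?T] B) = tensor_lift f A + tensor_lift f B" if "A : ZT r" "B : ZT r" for A B
    using that by (intro tensor_lift_add[OF comm f]) (auto simp: ZT_def)
  have l2: "tensor_lift f (s .[?T] A) = s * tensor_lift f A" if "A : ZT r" for A s
    using tensor_lift_smult[OF comm f fs, of A s] that by (auto simp: ZT_def)
  have l3: "tensor_lift f A = 0" if A: "A : BT r" for A
   proof -
    obtain A1 where A1: "A1 : car (T (r + 1))" "A = D (r + 1) A1" using A unfolding BT_def by blast
    obtain cc where cc: "pkeys cc <= car (C (r + 1)) >< UNIV" "A1 = tcl (C (r + 1)) cc"
     using A1(1) tensor_space_carrierE[OF comm] by metis
    have "frag_sum (%(x, v). f x v) (tensor_push (d (r + 1)) cc) = 0" using cc(1)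
    proof (induction cc rule: frag_induction)
     case (one p)
     hence "d (r + 1) (fst p) : BC r" by (auto simp: BC_def)
     thus ?case using FB ip(1)[of 0 0] by (cases p) (simp add: f_def)
    qed auto
    thus ?thesis by (simp add: A1 cc D_class' tensor_lift_class[OF comm f])
   qed
  obtain L where L: "L : car (dual_space sq.Q)" "!!A. A : ZT r ==> L (sq.K A) = tensor_lift f A"
   by (rule sq.dual_quotientI[of "tensor_lift f", OF l1 l2 l3]) auto
  have "Rel y L" unfolding Rel_def
  proof (intro conjI allI impI)
   show "L : car ?Dual" using L(1) unfolding H .
   show "ip (pr y z) v = L (K z' v)" if "R z z'" for z z' v
    using L(2)[OF tensor_class_ZT[OF c(2)[OF that]], of v] F(2)[OF that]
    by (simp add: K_def tensor_lift_class[OF comm f] f_def)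
  qed (fact y)
  thus "EX L. Rel y L" by blast
 next
  fix L assume L: "L : car ?Dual"
  have "EX u. ALL v. L (K z' v) = ip u v" if "z' : ZC r" for z'
   by (rule ip(5)) (use LK(2,3)[OF L that] in auto)
  then obtain h where h: "!!z' v. z' : ZC r ==> L (K z' v) = ip (h z') v" by metis
  have ip_inj: "u = u'" if "!!v. ip u v = ip u' v" for u u'
  proof -
   have "ip (u - u') v = 0" for v using that[of v] ip(1)[of "u - u'" u' v] by simp
   thus ?thesis using ip(6)[of "u - u'"] by simp
  qed
  have h_add: "h (x *[C r] y) = h x + h y" if xy: "x : ZC r" "y : ZC r" for x y
  proof (rule ip_inj)
   fix v
   have m: "x *[C r] y : ZC r" using subgroup.m_closed[OF subgroup_ZC xy] .
   show "ip (h (x *[C r] y)) v = ip (h x + h y) v"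
    using LK(1)[OF L xy(1), of v] xy h[OF m, of v] h[OF xy(1), of v] h[OF xy(2), of v]
    by (simp add: addi_def ip(1))
  qed
  have hB: "h x = 0" if "x : BC r" for x
   by (rule ip(6)) (use LB[OF L that] h that BC_subset_ZC in force)
  have gCr: "group (C r)" using comm comm_group.axioms(2) by blast
  obtain F where F: "addi (C' k) F" "!!z' z. R z z' ==> F z = h z'"
   by (rule group_corr_transport[OF group_corr_sym[OF corr] gCr subgroup_ZC subgroup_BC C'.comm int_coords_separated[OF co(1)] C'.subgroup_ZC h_add hB]) auto
  define y where "y = (%ta. if ta : S then F (g ta) else 0)"
  have pry: "pr y x = F x" if "x : car (C' k)" for x unfolding y_def by (rule pr_F[OF F(1) that])
  obtain g1 where g1: "!!\<rho>. \<rho> : S1 ==> g1 \<rho> : car (C' (k + 1))"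
    "!!\<rho> ta. \<rho> : S1 ==> F1 (g1 \<rho>) ta = (if ta = \<rho> then 1 else 0)"
   using int_coords_basis[OF co(3)] by metis
  have "(SUM ta:S. a \<rho> ta *z y ta) = 0" if \<rho>: "\<rho> : S1" for \<rho>
  proof -
   let ?b = "d' (k + 1) (g1 \<rho>)"
   have b: "?b : C'.BC k" unfolding C'.BC_def using g1(1)[OF \<rho>] by blast
   have Fb: "G ?b ta = a \<rho> ta" if "ta : S" for ta
   proof -
    have "G ?b ta = (SUM r':S1. if r' = \<rho> then a r' ta else 0)"
     unfolding a1[OF g1(1)[OF \<rho>] that] by (rule sum.cong) (auto simp: g1(2)[OF \<rho>])
    thus ?thesis using \<rho> int_coordsD(1)[OF co(3)] by simp
   qed
   obtain z' where z': "R ?b z'" using c(5) b C'.BC_subset_ZC by blast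
   have "(SUM ta:S. a \<rho> ta *z y ta) = pr y ?b"
    unfolding pr_def by (rule sum.cong) (auto simp: Fb)
   also have "... = h z'" using pry[OF Zin(1)[OF z']] F(2)[OF z'] by simp
   also have "... = 0" using hB c(3)[OF z'] b by blast
   finally show ?thesis .
  qed
  hence yZ: "y : ?Z" by (auto simp: y_def)
  have "Rel y L" unfolding Rel_def
  proof (intro conjI allI impI)
   show "ip (pr y z) v = L (K z' v)" if "R z z'" for z z' v
    using pry[OF Zin(1)[OF that]] F(2)[OF that] h[OF c(2)[OF that]] by simp
  qed (use yZ L in auto)
  thus "EX y. Rel y L" by blast
 qed
 thus ?thesis unfolding lin_corr_def by blast
qed

end

locale dual_cells =
 fixes S :: "'c set" and dm :: "'c => nat" and le :: "'c => 'c => bool" and a :: "'c => 'c => int"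
  and u ov :: "'c => int" and m :: nat and V :: "'v::real_vector itself"
 assumes finS: "finite S"
  and le_trans: "!!x y z. le x y ==> le y z ==> le x z"
  and a_supp: "!!t s. a t s ~= 0 ==> t : S & s : S & le s t & dm t = Suc (dm s)"
  and u_supp: "!!s. u s ~= 0 ==> s : S & dm s = 0"
  and o_supp: "!!t. ov t ~= 0 ==> t : S & dm t = m"
  and aa: "!!r s. (SUM t:S. a r t * a t s) = 0"
  and u_cocycle: "!!r. (SUM s:S. a r s * u s) = 0"
  and o_cycle: "!!s. (SUM t:S. a t s * ov t) = 0"
  and u_nonzero: "!!t. t : S ==> EX s. le s t & u s ~= 0"
  and o_nonzero: "!!s. s : S ==> EX t. le s t & ov t ~= 0"
  and star_exact: "!!s j (f :: 'c => 'v). s : S ==> j ~= m ==>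
   (!!t. f t ~= 0 ==> t : S & le s t & dm t = j) ==>
   (!!t. t : S ==> le s t ==> (SUM r:S. a r t *z f r) = 0) ==>
   EX w. (ALL t. w t ~= 0 --> t : S & le s t & dm t = Suc j) &
    (ALL t:S. le s t --> f t = (SUM r:S. a r t *z w r))"
  and star_top: "!!s (f :: 'c => 'v). s : S ==>
   (!!t. f t ~= 0 ==> t : S & le s t & dm t = m) ==>
   (!!t. t : S ==> le s t ==> (SUM r:S. a r t *z f r) = 0) ==>
   EX v. ALL t:S. le s t --> f t = ov t *z v"
  and closed_exact: "!!t i (f :: 'c => 'v). t : S ==>
   (!!s. f s ~= 0 ==> s : S & le s t & dm s = Suc i) ==>
   (!!s. s : S ==> le s t ==> (SUM r:S. a s r *z f r) = 0) ==>
   EX w. (ALL s. w s ~= 0 --> s : S & le s t & dm s = i) &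
    (ALL s:S. le s t --> f s = (SUM r:S. a s r *z w r))"
  and closed_bot: "!!t (f :: 'c => 'v). t : S ==>
   (!!s. f s ~= 0 ==> s : S & le s t & dm s = 0) ==>
   (!!s. s : S ==> le s t ==> (SUM r:S. a s r *z f r) = 0) ==>
   EX v. ALL s:S. le s t --> f s = u s *z v"
begin

definition bd :: "('c => 'v) => 'c => 'v" where
 "bd f t = (SUM r:S. a r t *z f r)"

definition cobd :: "('c => 'v) => 'c => 'v" where
 "cobd f s = (SUM r:S. a s r *z f r)"

lemma bd_linear: "bd (%x. f x + g x) t = bd f t + bd g t" "bd (%x. r *R f x) t = r *R bd f t"
  "bd (%x. f x - g x) t = bd f t - bd g t"
 by (simp_all add: bd_def scaleR_right_distrib sum.distrib scaleR_sum_right mult.commute scaleR_right_diff_distrib sum_subtractf)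

lemma cobd_linear: "cobd (%x. f x + g x) t = cobd f t + cobd g t" "cobd (%x. r *R f x) t = r *R cobd f t"
  "cobd (%x. f x - g x) t = cobd f t - cobd g t"
 by (simp_all add: cobd_def scaleR_right_distrib sum.distrib scaleR_sum_right mult.commute scaleR_right_diff_distrib sum_subtractf)

definition ok :: "'c => 'c => bool" where "ok s t <-> s : S & t : S & le s t"

definition K :: "nat => nat => ('c >< 'c => 'v) set" where
 "K i j = {z. ALL s t. z (s, t) ~= 0 --> ok s t & dm s = i & dm t = j}"

definition dd :: "('c >< 'c => 'v) => 'c >< 'c => 'v" where
 "dd z = (%(s, t). if ok s t then bd (%r. z (s, r)) t else 0)"

definition del :: "('c >< 'c => 'v) => 'c >< 'c => 'v" where
 "del z = (%(s, t). if ok s t then cobd (%r. z (r, t)) s else 0)"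

lemma dd_linear: "dd (%x. f x + g x) = (%x. dd f x + dd g x)" "dd (%x. r *R f x) = (%x. r *R dd f x)"
  "dd (%x. f x - g x) = (%x. dd f x - dd g x)"
 by (auto simp: dd_def bd_linear fun_eq_iff)

lemma del_linear: "del (%x. f x + g x) = (%x. del f x + del g x)" "del (%x. r *R f x) = (%x. r *R del f x)"
  "del (%x. f x - g x) = (%x. del f x - del g x)"
 by (auto simp: del_def cobd_linear fun_eq_iff)

lemma K_linear: "f : K i j ==> g : K i j ==> (%x. f x + g x) : K i j" "f : K i j ==> (%x. r *R f x) : K i j"
  "f : K i j ==> g : K i j ==> (%x. f x - g x) : K i j"
proof -
 show "(%x. f x + g x) : K i j" if "f : K i j" "g : K i j"
  using that unfolding K_def mem_Collect_eq by (metis add.left_neutral)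
 show "(%x. f x - g x) : K i j" if "f : K i j" "g : K i j"
  using that unfolding K_def mem_Collect_eq by (metis diff_zero)
 show "(%x. r *R f x) : K i j" if "f : K i j"
  using that unfolding K_def mem_Collect_eq by (metis scaleR_zero_right)
qed

lemma bd_nonzero: "bd f t ~= 0 ==> EX r:S. a r t ~= 0 & f r ~= 0"
 unfolding bd_def by (metis (no_types, lifting) of_int_0 scaleR_zero_left scaleR_zero_right sum.neutral)

lemma cobd_nonzero: "cobd f s ~= 0 ==> EX r:S. a s r ~= 0 & f r ~= 0"
 unfolding cobd_def by (metis (no_types, lifting) of_int_0 scaleR_zero_left scaleR_zero_right sum.neutral)

lemma dd_K:
 assumes "z : K i (Suc j)" shows "dd z : K i j"
 unfolding K_def
proof (intro CollectI allI impI)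
 fix s t assume h: "dd z (s, t) ~= 0"
 hence ok: "ok s t" and "bd (%r. z (s, r)) t ~= 0" by (auto simp: dd_def split: if_splits)
 then obtain r where "a r t ~= 0" "z (s, r) ~= 0" using bd_nonzero by blast
 thus "ok s t & dm s = i & dm t = j" using assms ok a_supp[of r t] by (auto simp: K_def)
qed

lemma del_K:
 assumes "z : K i j" shows "del z : K (Suc i) j"
 unfolding K_def
proof (intro CollectI allI impI)
 fix s t assume h: "del z (s, t) ~= 0"
 hence ok: "ok s t" and "cobd (%r. z (r, t)) s ~= 0" by (auto simp: del_def split: if_splits)
 then obtain r where "a s r ~= 0" "z (r, t) ~= 0" using cobd_nonzero by blast
 thus "ok s t & dm s = Suc i & dm t = j" using assms ok a_supp[of s r] by (auto simp: K_def)
qed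

lemma pairI: "(!!s t. ok s t ==> f (s, t) = g (s, t)) ==> (!!s t. ~ ok s t ==> f (s, t) = g (s, t)) ==> f = g"
 by (rule ext) (metis surj_pair)

lemma bd_cong: assumes "ok s t" "!!r. ok s r ==> f r = g r" shows "bd f t = bd g t"
proof -
 have "a r t *z f r = a r t *z g r" for r
  using a_supp[of r t] le_trans[of s t r] assms by (cases "a r t = 0") (auto simp: ok_def)
 thus ?thesis by (simp only: bd_def)
qed

lemma cobd_cong: assumes "ok s t" "!!r. ok r t ==> f r = g r" shows "cobd f s = cobd g s"
proof -
 have "a s r *z f r = a s r *z g r" for r
  using a_supp[of s r] le_trans[of r s t] assms by (cases "a s r = 0") (auto simp: ok_def)
 thus ?thesis by (simp only: cobd_def)
qed

lemma dd_ok: "ok s t ==> (!!r. ok s r ==> z (s, r) = f r) ==> dd z (s, t) = bd f t"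
 by (simp add: dd_def) (rule bd_cong)

lemma del_ok: "ok s t ==> (!!r. ok r t ==> z (r, t) = f r) ==> del z (s, t) = cobd f s"
 by (simp add: del_def) (rule cobd_cong)

lemma dd_del: "dd (del z) = del (dd z)"
proof (rule pairI)
 fix s t assume ok: "ok s t"
 have "dd (del z) (s, t) = bd (%r. cobd (%r'. z (r', r)) s) t" by (rule dd_ok[OF ok]) (simp add: del_def)
 also have "... = cobd (%r'. bd (%r. z (r', r)) t) s"
  unfolding bd_def cobd_def scaleR_sum_right by (subst sum.swap) (simp add: mult.commute)
 also have "... = del (dd z) (s, t)" by (rule del_ok[OF ok, symmetric]) (simp add: dd_def)
 finally show "dd (del z) (s, t) = del (dd z) (s, t)" .
qed (simp add: dd_def del_def)

lemma bd_bd: "bd (bd f) t = 0"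
proof -
 have "bd (bd f) t = (SUM r':S. (SUM r:S. a r' r * a r t) *z f r')"
  unfolding bd_def scaleR_sum_right by (subst sum.swap) (simp add: scaleR_sum_left mult.commute)
 thus ?thesis by (simp add: aa)
qed

lemma cobd_cobd: "cobd (cobd f) s = 0"
proof -
 have "cobd (cobd f) s = (SUM r':S. (SUM r:S. a s r * a r r') *z f r')"
  unfolding cobd_def scaleR_sum_right by (subst sum.swap) (simp add: scaleR_sum_left)
 thus ?thesis by (simp add: aa)
qed

lemma dd_dd: "dd (dd z) = (%_. 0)"
proof (rule pairI)
 fix s t assume "ok s t"
 hence "dd (dd z) (s, t) = bd (bd (%r. z (s, r))) t" by (rule dd_ok) (simp add: dd_def)
 thus "dd (dd z) (s, t) = 0" by (simp add: bd_bd)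
qed (simp add: dd_def)

lemma del_del: "del (del z) = (%_. 0)"
proof (rule pairI)
 fix s t assume "ok s t"
 hence "del (del z) (s, t) = cobd (cobd (%r. z (r, t))) s" by (rule del_ok) (simp add: del_def)
 thus "del (del z) (s, t) = 0" by (simp add: cobd_cobd)
qed (simp add: del_def)

definition eta :: "('c => 'v) => 'c >< 'c => 'v" where
 "eta x = (%(s, t). if ok s t then u s *z x t else 0)"

definition zeta :: "('c => 'v) => 'c >< 'c => 'v" where
 "zeta y = (%(s, t). if ok s t then ov t *z y s else 0)"

definition coch :: "nat => ('c => 'v) set" where
 "coch j = {x. ALL t. x t ~= 0 --> t : S & dm t = j}"

lemma bd_chains: "x : coch (Suc j) ==> bd x : coch j"
 unfolding coch_def using bd_nonzero a_supp by fastforce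

lemma cobd_chains: "x : coch j ==> cobd x : coch (Suc j)"
 unfolding coch_def using cobd_nonzero a_supp by fastforce

lemma eta_linear: "eta (%x. f x + g x) = (%x. eta f x + eta g x)" "eta (%x. r *R f x) = (%x. r *R eta f x)"
 by (auto simp: eta_def fun_eq_iff scaleR_right_distrib)

lemma zeta_linear: "zeta (%x. f x + g x) = (%x. zeta f x + zeta g x)" "zeta (%x. r *R f x) = (%x. r *R zeta f x)"
 by (auto simp: zeta_def fun_eq_iff scaleR_right_distrib)

lemma eta_K: "x : coch j ==> eta x : K 0 j"
 using u_supp by (auto simp: eta_def K_def coch_def split: if_splits)

lemma zeta_K: "y : coch i ==> zeta y : K i m"
 using o_supp by (auto simp: zeta_def K_def coch_def split: if_splits)

lemma dd_eta: "dd (eta x) = eta (bd x)"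
proof (rule pairI)
 fix s t assume ok: "ok s t"
 have "dd (eta x) (s, t) = bd (%r. u s *z x r) t" by (rule dd_ok[OF ok]) (simp add: eta_def)
 thus "dd (eta x) (s, t) = eta (bd x) (s, t)" using ok by (simp add: eta_def bd_linear)
qed (simp add: dd_def eta_def)

lemma del_zeta: "del (zeta y) = zeta (cobd y)"
proof (rule pairI)
 fix s t assume ok: "ok s t"
 have "del (zeta y) (s, t) = cobd (%r. ov t *z y r) s" by (rule del_ok[OF ok]) (simp add: zeta_def)
 thus "del (zeta y) (s, t) = zeta (cobd y) (s, t)" using ok by (simp add: zeta_def cobd_linear)
qed (simp add: del_def zeta_def)

lemma del_eta: "del (eta x) = (%_. 0)"
proof (rule pairI)
 fix s t assume ok: "ok s t"
 have "del (eta x) (s, t) = cobd (%r. u r *z x t) s" by (rule del_ok[OF ok]) (simp add: eta_def)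
 also have "... = (SUM r:S. a s r * u r) *z x t" by (simp add: cobd_def scaleR_sum_left)
 finally show "del (eta x) (s, t) = 0" by (simp add: u_cocycle)
qed (simp add: del_def)

lemma dd_zeta: "dd (zeta y) = (%_. 0)"
proof (rule pairI)
 fix s t assume ok: "ok s t"
 have "dd (zeta y) (s, t) = bd (%r. ov r *z y s) t" by (rule dd_ok[OF ok]) (simp add: zeta_def)
 also have "... = (SUM r:S. a r t * ov r) *z y s" by (simp add: bd_def scaleR_sum_left)
 finally show "dd (zeta y) (s, t) = 0" by (simp add: o_cycle)
qed (simp add: dd_def)

lemma eta_inj: assumes "x : coch j" "x' : coch j" "eta x = eta x'" shows "x = x'"
proof
 fix t
 show "x t = x' t"
 proof (cases "t : S")
  case True
  then obtain s where "le s t" "u s ~= 0" using u_nonzero by blast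
  thus ?thesis using fun_cong[OF assms(3), of "(s, t)"] True u_supp[of s] by (simp add: eta_def ok_def)
 next
  case False
  hence "x t = 0" "x' t = 0" using assms by (auto simp: coch_def)
  thus ?thesis by simp
 qed
qed

lemma zeta_inj: assumes "x : coch j" "x' : coch j" "zeta x = zeta x'" shows "x = x'"
proof
 fix s
 show "x s = x' s"
 proof (cases "s : S")
  case True
  then obtain t where "le s t" "ov t ~= 0" using o_nonzero by blast
  thus ?thesis using fun_cong[OF assms(3), of "(s, t)"] True o_supp[of t] by (simp add: zeta_def ok_def)
 next
  case False
  hence "x s = 0" "x' s = 0" using assms by (auto simp: coch_def)
  thus ?thesis by simp
 qed
qed

lemma K_row: "z : K i j ==> z (s, t) ~= 0 ==> s : S & t : S & le s t & dm s = i & dm t = j"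
 by (auto simp: K_def ok_def)

lemma dd_row: "dd z = (%_. 0) ==> s : S ==> t : S ==> le s t ==>
  (SUM r:S. a r t *z z (s, r)) = 0"
 by (drule fun_cong[of _ _ "(s, t)"]) (simp add: dd_def bd_def ok_def)

lemma del_row: "del z = (%_. 0) ==> s : S ==> t : S ==> le s t ==>
  (SUM r:S. a s r *z z (r, t)) = 0"
 by (drule fun_cong[of _ _ "(s, t)"]) (simp add: del_def cobd_def ok_def)

lemma dd_exact:
 assumes z: "z : K i j" and 0: "dd z = (%_. 0)" and j: "j ~= m"
 shows "EX w:K i (Suc j). z = dd w"
proof -
 have "EX w. (ALL t. w t ~= 0 --> t : S & le s t & dm t = Suc j) &
    (ALL t:S. le s t --> z (s, t) = (SUM r:S. a r t *z w r))" if "s : S" for s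
  by (rule star_exact[OF that j]) (use K_row[OF z] dd_row[OF 0 that] in blast)+
 then obtain w where w: "!!s t. s : S ==> w s t ~= 0 ==> t : S & le s t & dm t = Suc j"
  "!!s t. s : S ==> t : S ==> le s t ==> z (s, t) = (SUM r:S. a r t *z w s r)" by metis
 let ?w = "%(s, t). if s : S & dm s = i then w s t else 0"
 have "?w : K i (Suc j)" using w(1) by (auto simp: K_def ok_def)
 moreover have "z (s, t) = dd ?w (s, t)" for s t
 proof (cases "ok s t & dm s = i")
  case True
  thus ?thesis using w(2)[of s t] by (simp add: dd_def bd_def ok_def)
 next
  case False
  hence "z (s, t) = 0" using K_row[OF z, of s t] by (auto simp: ok_def)
  thus ?thesis using False by (auto simp: dd_def bd_def)
 qed
 ultimately show ?thesis by (intro bexI[of _ ?w] ext) auto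
qed

lemma dd_top:
 assumes z: "z : K i m" and 0: "dd z = (%_. 0)"
 shows "EX y:coch i. z = zeta y"
proof -
 have "EX v. ALL t:S. le s t --> z (s, t) = ov t *z v" if "s : S" for s
  by (rule star_top[OF that]) (use K_row[OF z] dd_row[OF 0 that] in blast)+
 then obtain v where v: "!!s t. s : S ==> t : S ==> le s t ==> z (s, t) = ov t *z v s" by metis
 let ?y = "%s. if s : S & dm s = i then v s else 0"
 have "?y : coch i" by (auto simp: coch_def)
 moreover have "z (s, t) = zeta ?y (s, t)" for s t
  using v[of s t] K_row[OF z, of s t] by (cases "z (s, t) = 0") (auto simp: zeta_def ok_def)
 ultimately show ?thesis by (intro bexI[of _ ?y] ext) auto
qed

lemma del_exact:
 assumes z: "z : K (Suc i) j" and 0: "del z = (%_. 0)"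
 shows "EX w:K i j. z = del w"
proof -
 have "EX w. (ALL s. w s ~= 0 --> s : S & le s t & dm s = i) &
    (ALL s:S. le s t --> z (s, t) = (SUM r:S. a s r *z w r))" if "t : S" for t
  by (rule closed_exact[OF that]) (use K_row[OF z] del_row[OF 0 _ that] in blast)+
 then obtain w where w: "!!s t. t : S ==> w t s ~= 0 ==> s : S & le s t & dm s = i"
  "!!s t. s : S ==> t : S ==> le s t ==> z (s, t) = (SUM r:S. a s r *z w t r)" by metis
 let ?w = "%(s, t). if t : S & dm t = j then w t s else 0"
 have "?w : K i j" using w(1) by (auto simp: K_def ok_def)
 moreover have "z (s, t) = del ?w (s, t)" for s t
 proof (cases "ok s t & dm t = j")
  case True
  thus ?thesis using w(2)[of s t] by (simp add: del_def cobd_def ok_def)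
 next
  case False
  hence "z (s, t) = 0" using K_row[OF z, of s t] by (auto simp: ok_def)
  thus ?thesis using False by (auto simp: del_def cobd_def)
 qed
 ultimately show ?thesis by (intro bexI[of _ ?w] ext) auto
qed

lemma del_bot:
 assumes z: "z : K 0 j" and 0: "del z = (%_. 0)"
 shows "EX x:coch j. z = eta x"
proof -
 have "EX v. ALL s:S. le s t --> z (s, t) = u s *z v" if "t : S" for t
  by (rule closed_bot[OF that]) (use K_row[OF z] del_row[OF 0 _ that] in blast)+
 then obtain v where v: "!!s t. s : S ==> t : S ==> le s t ==> z (s, t) = u s *z v t" by metis
 let ?y = "%t. if t : S & dm t = j then v t else 0"
 have "?y : coch j" by (auto simp: coch_def)
 moreover have "z (s, t) = eta ?y (s, t)" for s t
  using v[of s t] K_row[OF z, of s t] by (cases "z (s, t) = 0") (auto simp: eta_def ok_def)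
 ultimately show ?thesis by (intro bexI[of _ ?y] ext) auto
qed

definition ZK :: "nat => nat => ('c >< 'c => 'v) set" where
 "ZK i j = {z : K i j. dd z = (%_. 0) & del z = (%_. 0)}"

definition BK :: "nat => nat => ('c >< 'c => 'v) set" where
 "BK i j = dd ` {w : K i (Suc j). del w = (%_. 0)}"

definition BK' :: "nat => nat => ('c >< 'c => 'v) set" where
 "BK' i j = del ` {w : K i j. dd w = (%_. 0)}"

lemma bicomplex_step:
 assumes j: "j ~= m"
 shows "lin_corr FS (ZK i j) (BK i j) FS (ZK (Suc i) (Suc j)) (BK' i (Suc j))"
proof -
 define R where "R z z' <-> (EX w:K i (Suc j). z = dd w & z' = del w & del z = (%_. 0) & dd z = (%_. 0)
   & dd z' = (%_. 0) & del z' = (%_. 0))" for z z'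
 have "lin_corr_by FS (ZK i j) (BK i j) FS (ZK (Suc i) (Suc j)) (BK' i (Suc j)) R"
 proof (rule lin_corr_byI)
  fix z z' assume "R z z'"
  then obtain w where w: "w : K i (Suc j)" "z = dd w" "z' = del w" "del z = (%_. 0)" "dd z = (%_. 0)"
   "dd z' = (%_. 0)" "del z' = (%_. 0)" by (auto simp: R_def)
  show "z : ZK i j" using w dd_K by (simp add: ZK_def)
  show "z' : ZK (Suc i) (Suc j)" using w del_K by (simp add: ZK_def)
  show "z' : BK' i (Suc j)" if "z : BK i j"
  proof -
   obtain w0 where w0: "w0 : K i (Suc j)" "del w0 = (%_. 0)" "z = dd w0"
    using `z : BK i j` by (auto simp: BK_def)
   have "dd (%x. w x - w0 x) = (%_. 0)" "del (%x. w x - w0 x) = z'"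
    using w w0 by (auto simp: dd_linear del_linear fun_eq_iff)
   thus ?thesis unfolding BK'_def using K_linear(3)[OF w(1) w0(1)] by blast
  qed
  show "z : BK i j" if "z' : BK' i (Suc j)"
  proof -
   obtain w0 where w0: "w0 : K i (Suc j)" "dd w0 = (%_. 0)" "z' = del w0"
    using `z' : BK' i (Suc j)` by (auto simp: BK'_def)
   have "del (%x. w x - w0 x) = (%_. 0)" "dd (%x. w x - w0 x) = z"
    using w w0 by (auto simp: dd_linear del_linear fun_eq_iff)
   thus ?thesis unfolding BK_def using K_linear(3)[OF w(1) w0(1)] by blast
  qed
  show "R (r .[FS] z) (r .[FS] z')" for r
   unfolding R_def
   by (rule bexI[of _ "%x. r *R w x"]) (use w K_linear(2)[OF w(1)] in "auto simp: dd_linear del_linear")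
  fix y y' assume "R y y'"
  then obtain v where v: "v : K i (Suc j)" "y = dd v" "y' = del v" "del y = (%_. 0)" "dd y = (%_. 0)"
   "dd y' = (%_. 0)" "del y' = (%_. 0)" by (auto simp: R_def)
  show "R (z +[FS] y) (z' +[FS] y')"
   unfolding R_def
   by (rule bexI[of _ "%x. w x + v x"]) (use w v K_linear(1)[OF w(1) v(1)] in "auto simp: dd_linear del_linear")
 next
  fix z assume z: "z : ZK i j"
  then obtain w where w: "w : K i (Suc j)" "z = dd w" using dd_exact[OF _ _ j] by (auto simp: ZK_def)
  have "dd (del w) = (%_. 0)" using z w by (simp add: dd_del ZK_def)
  moreover note del_del[of w]
  ultimately show "EX z'. R z z'" unfolding R_def using z w by (auto simp: ZK_def)
 next
  fix z' assume z': "z' : ZK (Suc i) (Suc j)"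
  hence "EX w:K i (Suc j). z' = del w" by (intro del_exact) (auto simp: ZK_def)
  then obtain w where w: "w : K i (Suc j)" "z' = del w" by blast
  have "del (dd w) = (%_. 0)" using z' w by (simp add: dd_del[symmetric] ZK_def)
  moreover note dd_dd[of w]
  ultimately show "EX z. R z z'" unfolding R_def using z' w by (auto simp: ZK_def)
 qed
 thus ?thesis unfolding lin_corr_def by blast
qed

lemma BK'_eq_BK:
 assumes j: "j ~= m" shows "BK' i j = BK (Suc i) j"
proof
 show "BK' i j <= BK (Suc i) j"
 proof
  fix x assume "x : BK' i j"
  then obtain w where w: "w : K i j" "dd w = (%_. 0)" "x = del w" by (auto simp: BK'_def)
  then obtain v where v: "v : K i (Suc j)" "w = dd v" using dd_exact[OF w(1,2) j] by blast
  have "x = dd (del v)" using w v by (simp add: dd_del)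
  thus "x : BK (Suc i) j" using del_K[OF v(1)] del_del[of v] by (auto simp: BK_def)
 qed
 show "BK (Suc i) j <= BK' i j"
 proof
  fix x assume "x : BK (Suc i) j"
  then obtain w where w: "w : K (Suc i) (Suc j)" "del w = (%_. 0)" "x = dd w" by (auto simp: BK_def)
  then obtain v where v: "v : K i (Suc j)" "w = del v" using del_exact[OF w(1,2)] by blast
  have "x = del (dd v)" using w v by (simp add: dd_del)
  thus "x : BK' i j" using dd_K[OF v(1)] dd_dd[of v] by (auto simp: BK'_def)
 qed
qed

lemma lin_corr_function_spaceI:
 fixes h :: "('c => 'v) => ('d => 'v)"
 assumes "!!f g. h (%x. f x + g x) = (%x. h f x + h g x)" "!!r f. h (%x. r *R f x) = (%x. r *R h f x)"
  and "Z' = h ` Z" and "!!x. x : Z ==> h x : B' <-> x : B"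
  and "!!x y. x : Z ==> y : Z ==> (%t. x t + y t) : Z" "!!r x. x : Z ==> (%t. r *R x t) : Z"
 shows "lin_corr FS Z B FS Z' B'"
proof -
 have "lin_corr_by FS Z B FS Z' B' (%x y. x : Z & y = h x)"
  by (rule lin_corr_byI) (use assms in auto)
 thus ?thesis unfolding lin_corr_def by blast
qed

lemma chains_linear: "x : coch j ==> y : coch j ==> (%t. x t + y t) : coch j"
  "x : coch j ==> (%t. r *R x t) : coch j"
proof -
 show "(%t. x t + y t) : coch j" if "x : coch j" "y : coch j"
  using that unfolding coch_def mem_Collect_eq by (metis add.left_neutral)
 show "(%t. r *R x t) : coch j" if "x : coch j"
  using that unfolding coch_def mem_Collect_eq by (metis scaleR_zero_right)
qed

lemma eta_zero: "eta (%_. 0) = (%_. 0)" and zeta_zero: "zeta (%_. 0) = (%_. 0)"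
 by (auto simp: eta_def zeta_def fun_eq_iff)

lemma eta_zero_iff: "x : coch j ==> eta x = (%_. 0) <-> x = (%_. 0)"
 using eta_inj[of x j "%_. 0"] by (auto simp: coch_def eta_def fun_eq_iff)

lemma zeta_zero_iff: "x : coch j ==> zeta x = (%_. 0) <-> x = (%_. 0)"
 using zeta_inj[of x j "%_. 0"] by (auto simp: coch_def zeta_def fun_eq_iff)

lemma bd_zero_chains: "x : coch 0 ==> bd x = (%_. 0)"
proof (rule ext, rule ccontr)
 fix t assume x: "x : coch 0" and "bd x t ~= 0"
 then obtain r where "a r t ~= 0" "x r ~= 0" using bd_nonzero by blast
 thus False using x a_supp[of r t] by (auto simp: coch_def)
qed

lemma bicomplex_start:
 "lin_corr FS {x : coch q. bd x = (%_. 0)} (bd ` coch (Suc q)) FS (ZK 0 q) (BK 0 q)"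
proof (rule lin_corr_function_spaceI[of eta])
 have bdc: "EX j. bd x : coch j" if "x : coch q" for x
 proof (cases q)
  case 0
  hence "bd x = (%_. 0)" using bd_zero_chains[of x] that by simp
  moreover have "(%_. 0) : coch 0" by (simp add: coch_def)
  ultimately show ?thesis by metis
 next
  case (Suc j)
  thus ?thesis using bd_chains[of x j] that by blast
 qed
 show "ZK 0 q = eta ` {x : coch q. bd x = (%_. 0)}"
 proof (intro equalityI subsetI)
  fix z assume z: "z : ZK 0 q"
  then obtain x where x: "x : coch q" "z = eta x" using del_bot[of z q] by (auto simp: ZK_def)
  have "eta (bd x) = (%_. 0)" using z x by (simp add: ZK_def dd_eta)
  hence "bd x = (%_. 0)" using bdc[OF x(1)] eta_zero_iff by blast
  thus "z : eta ` {x : coch q. bd x = (%_. 0)}" using x by blast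
 next
  fix z assume "z : eta ` {x : coch q. bd x = (%_. 0)}"
  thus "z : ZK 0 q" using eta_K by (auto simp: ZK_def dd_eta del_eta eta_zero)
 qed
 fix x assume x: "x : {x : coch q. bd x = (%_. 0)}"
 show "eta x : BK 0 q <-> x : bd ` coch (Suc q)"
 proof
  assume "eta x : BK 0 q"
  then obtain w where w: "w : K 0 (Suc q)" "del w = (%_. 0)" "eta x = dd w" by (auto simp: BK_def)
  then obtain y where y: "y : coch (Suc q)" "w = eta y" using del_bot by blast
  hence "eta x = eta (bd y)" using w by (simp add: dd_eta)
  hence "x = bd y" using eta_inj[of x q "bd y"] x bd_chains[OF y(1)] by simp
  thus "x : bd ` coch (Suc q)" using y by blast
 next
  assume "x : bd ` coch (Suc q)"
  then obtain y where "y : coch (Suc q)" "x = bd y" by blast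
  thus "eta x : BK 0 q" using eta_K[of y "Suc q"] del_eta[of y] dd_eta[of y] unfolding BK_def
   by (intro image_eqI[of _ _ "eta y"]) auto
 qed
qed (auto simp: eta_linear chains_linear bd_linear fun_eq_iff)

lemma bicomplex_end:
 "lin_corr FS {y : coch (Suc i). cobd y = (%_. 0)} (cobd ` coch i)
   FS (ZK (Suc i) m) (BK' i m)"
proof (rule lin_corr_function_spaceI[of zeta])
 show "ZK (Suc i) m = zeta ` {x : coch (Suc i). cobd x = (%_. 0)}"
 proof (intro equalityI subsetI)
  fix z assume z: "z : ZK (Suc i) m"
  then obtain x where x: "x : coch (Suc i)" "z = zeta x" using dd_top[of z "Suc i"] by (auto simp: ZK_def)
  have "zeta (cobd x) = (%_. 0)" using z x by (simp add: ZK_def del_zeta)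
  hence "cobd x = (%_. 0)" using cobd_chains[OF x(1)] zeta_zero_iff by blast
  thus "z : zeta ` {x : coch (Suc i). cobd x = (%_. 0)}" using x by blast
 next
  fix z assume "z : zeta ` {x : coch (Suc i). cobd x = (%_. 0)}"
  thus "z : ZK (Suc i) m" using zeta_K by (auto simp: ZK_def del_zeta dd_zeta zeta_zero)
 qed
 fix x assume x: "x : {x : coch (Suc i). cobd x = (%_. 0)}"
 show "zeta x : BK' i m <-> x : cobd ` coch i"
 proof
  assume "zeta x : BK' i m"
  then obtain w where w: "w : K i m" "dd w = (%_. 0)" "zeta x = del w" by (auto simp: BK'_def)
  then obtain y where y: "y : coch i" "w = zeta y" using dd_top by blast
  hence "zeta x = zeta (cobd y)" using w by (simp add: del_zeta)
  hence "x = cobd y" using zeta_inj[of x "Suc i" "cobd y"] x cobd_chains[OF y(1)] by simp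
  thus "x : cobd ` coch i" using y by blast
 next
  assume "x : cobd ` coch i"
  then obtain y where "y : coch i" "x = cobd y" by blast
  thus "zeta x : BK' i m" using zeta_K[of y i] dd_zeta[of y] del_zeta[of y] unfolding BK'_def
   by (intro image_eqI[of _ _ "zeta y"]) auto
 qed
qed (auto simp: zeta_linear chains_linear cobd_linear fun_eq_iff)

lemma lin_corr_function_space_sym:
 assumes "lin_corr FS Z B FS Z' B'"
 shows "lin_corr FS Z' B' FS Z B"
proof -
 obtain R where "lin_corr_by FS Z B FS Z' B' R" using assms unfolding lin_corr_def by blast
 note R = lin_corr_byD[OF this]
 have "lin_corr_by FS Z' B' FS Z B (%x y. R y x)"
  by (rule lin_corr_byI) (use R(1,2) in blast, use R(1,2) in blast, use R(3) in blast, use R(3) in blast,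
   rule R(4), assumption+, rule R(5), assumption, rule R(7), assumption, rule R(6), assumption)
 thus ?thesis unfolding lin_corr_def by blast
qed

theorem chain_cochain_corr:
 assumes "q < m"
 shows "lin_corr FS {x : coch q. bd x = (%_. 0)} (bd ` coch (Suc q))
  FS {y : coch (m - q). cobd y = (%_. 0)} (cobd ` coch (m - q - 1))"
proof -
 have steps: "lin_corr FS (ZK 0 q) (BK 0 q) FS (ZK (Suc i) (q + Suc i)) (BK' i (q + Suc i))"
  if "q + Suc i <= m" for i using that
 proof (induction i)
  case 0
  thus ?case using bicomplex_step[of q 0] by simp
 next
  case (Suc i)
  have "lin_corr FS (ZK 0 q) (BK 0 q) FS (ZK (Suc i) (q + Suc i)) (BK' i (q + Suc i))"
   using Suc by simp
  moreover have "BK' i (q + Suc i) = BK (Suc i) (q + Suc i)" using BK'_eq_BK[of "q + Suc i" i] Suc.prems by simp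
  ultimately show ?case
   using lin_corr_trans bicomplex_step[of "q + Suc i" "Suc i"] Suc.prems by fastforce
 qed
 obtain i where i: "m - q = Suc i" "q + Suc i = m" using assms by (metis Suc_diff_Suc add_diff_inverse_nat less_imp_not_less)
 have "lin_corr FS (ZK 0 q) (BK 0 q) FS (ZK (Suc i) m) (BK' i m)"
  using steps[of i] i by simp
 from lin_corr_trans[OF lin_corr_trans[OF bicomplex_start this] lin_corr_function_space_sym[OF bicomplex_end]]
 show ?thesis using i by simp
qed

end

definition UB :: "nat => (nat => real) set" where
 "UB k = {x. (ALL i>=k. x i = 0) & (SUM i<k. (x i)\<^sup>2) <= 1}"

definition unit_sphere :: "nat => (nat => real) set" where
 "unit_sphere k = {x. (ALL i>=k. x i = 0) & (SUM i<k. (x i)\<^sup>2) = 1}"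

lemma Euclidean_space_eu: "EU k = top_of_set {x. ALL i>=k. x i = 0}"
 by (simp add: Euclidean_space_def euclidean_product_topology)

lemma closed_ball_space_eu: "CB k = top_of_set (UB k)"
 by (auto simp: closed_ball_space_def Euclidean_space_eu subtopology_subtopology UB_def intro: arg_cong)

lemma open_ball_set_eq: "OB k = UB k - unit_sphere k"
 by (auto simp: open_ball_set_def topspace_Euclidean_space UB_def unit_sphere_def)

lemma unit_sphere_subset: "unit_sphere k <= UB k"
 by (auto simp: UB_def unit_sphere_def)

lemma convex_square: "0 <= s ==> s <= 1 ==> ((1 - s) * a + s * b)\<^sup>2 <= (1 - s) * a\<^sup>2 + s * b\<^sup>2" for s a b :: real
proof -
 assume s: "0 <= s" "s <= 1"
 have "(1 - s) * a\<^sup>2 + s * b\<^sup>2 - ((1 - s) * a + s * b)\<^sup>2 = s * (1 - s) * (a - b)\<^sup>2"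
  by (simp add: power2_eq_square algebra_simps)
 moreover have "0 <= s * (1 - s) * (a - b)\<^sup>2" using s by simp
 ultimately show ?thesis by linarith
qed

lemma unit_ball_convex:
 assumes "x : UB k" "y : UB k" "0 <= s" "s <= 1"
 shows "(%i. (1 - s) * x i + s * y i) : UB k"
proof -
 have "(SUM i<k. ((1 - s) * x i + s * y i)\<^sup>2) <= (SUM i<k. (1 - s) * (x i)\<^sup>2 + s * (y i)\<^sup>2)"
  by (rule sum_mono) (use convex_square assms in auto)
 also have "... = (1 - s) * (SUM i<k. (x i)\<^sup>2) + s * (SUM i<k. (y i)\<^sup>2)"
  by (simp add: sum.distrib sum_distrib_left)
 also have "... <= (1 - s) * 1 + s * 1"
  using assms by (intro add_mono mult_left_mono) (auto simp: UB_def)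
 finally show ?thesis using assms by (auto simp: UB_def)
qed

text \<open>The homotopy moves a point \<open>y\<close> along the ray from \<open>c\<close> through \<open>y\<close> until it hits the sphere;
  \<open>c\<close> may itself lie on the sphere.\<close>

lemma ball_projection:
 assumes c: "c : UB k"
 shows "EX H :: real >< (nat => real) => nat => real.
  continuous_on ({0..1} >< (UB k - {c})) H &
  (ALL s:{0..1}. ALL y:UB k - {c}. H (s, y) : UB k - {c}) &
  (ALL y:UB k - {c}. H (0, y) = y & H (1, y) : unit_sphere k) &
  (ALL s:{0..1}. ALL y:unit_sphere k - {c}. H (s, y) = y)"
proof -
 define p where "p = (SUM i<k. (c i)\<^sup>2)"
 define b where "b y = (SUM i<k. c i * (y i - c i))" for y
 define D where "D y = (SUM i<k. (y i - c i)\<^sup>2)" for y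
 define t where "t y = (sqrt ((b y)\<^sup>2 + (1 - p) * D y) - b y) / D y" for y
 define H where "H = (%(s, y) i. c i + (1 - s + s * t y) * (y i - c i))"
 have p: "p <= 1" and c0: "!!i. i >= k ==> c i = 0" using c by (auto simp: p_def UB_def)
 have nrm: "(SUM i<k. (c i + r * (y i - c i))\<^sup>2) = p + 2 * r * b y + r\<^sup>2 * D y" for r y
 proof -
  have "(c i + r * (y i - c i))\<^sup>2 = (c i)\<^sup>2 + 2 * r * (c i * (y i - c i)) + r\<^sup>2 * (y i - c i)\<^sup>2" for i
   by (simp add: power2_eq_square algebra_simps)
  thus ?thesis by (simp add: p_def b_def D_def sum.distrib sum_distrib_left)
 qed
 have nrm1: "(SUM i<k. (y i)\<^sup>2) = p + 2 * b y + D y" for y using nrm[of 1 y] by simp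
 have Dpos: "D y > 0" if "y : UB k - {c}" for y
 proof -
  have "EX i. y i ~= c i" using that by auto
  then obtain i where i: "y i ~= c i" by blast
  hence "i < k" using that c0 by (intro linorder_class.not_le_imp_less notI) (auto simp: UB_def)
  hence "(y i - c i)\<^sup>2 <= D y" unfolding D_def by (intro member_le_sum) auto
  moreover have "(y i - c i)\<^sup>2 > 0" using i by simp
  ultimately show ?thesis by linarith
 qed
 have t1: "t y >= 1" if y: "y : UB k - {c}" for y
 proof -
  have "D y + 2 * b y <= 1 - p" using y nrm1[of y] by (auto simp: UB_def)
  hence "D y * (D y + 2 * b y) <= (1 - p) * D y" using Dpos[OF y] by (metis mult.commute mult_le_cancel_left_pos)
  hence "(D y + b y)\<^sup>2 <= (b y)\<^sup>2 + (1 - p) * D y" by (simp add: power2_eq_square algebra_simps)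
  hence "D y + b y <= sqrt ((b y)\<^sup>2 + (1 - p) * D y)" by (rule real_le_rsqrt)
  thus ?thesis unfolding t_def using Dpos[OF y] by (simp add: le_divide_eq)
 qed
 have tS: "t y = 1" if y: "y : unit_sphere k - {c}" for y
 proof -
  have yb: "y : UB k - {c}" using y unit_sphere_subset by blast
  have e: "D y + 2 * b y = 1 - p" using y nrm1[of y] by (auto simp: unit_sphere_def)
  hence "(b y)\<^sup>2 + (1 - p) * D y = (D y + b y)\<^sup>2" by (simp flip: e add: power2_eq_square algebra_simps)
  moreover have "D y + b y >= 0" using e p Dpos[OF yb] by linarith
  ultimately have "sqrt ((b y)\<^sup>2 + (1 - p) * D y) = D y + b y" by simp
  thus ?thesis unfolding t_def using Dpos[OF yb] by simp
 qed
 have root: "p + 2 * t y * b y + (t y)\<^sup>2 * D y = 1" if y: "y : UB k - {c}" for y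
 proof -
  let ?s = "sqrt ((b y)\<^sup>2 + (1 - p) * D y)"
  have s2: "?s\<^sup>2 = (b y)\<^sup>2 + (1 - p) * D y" using p Dpos[OF y] by simp
  have D0: "D y ~= 0" using Dpos[OF y] by simp
  have tD: "t y * D y = ?s - b y" unfolding t_def using D0 by simp
  have "(2 * t y * b y + (t y)\<^sup>2 * D y) * D y = 2 * (t y * D y) * b y + (t y * D y)\<^sup>2"
   by (simp add: power2_eq_square algebra_simps)
  also have "... = ?s\<^sup>2 - (b y)\<^sup>2" unfolding tD by (simp add: power2_eq_square algebra_simps)
  also have "... = (1 - p) * D y" using s2 by simp
  finally show ?thesis using D0 by (metis add.assoc add_diff_cancel_left' diff_add_cancel mult_right_cancel)
 qed
 have H1: "H (1, y) : unit_sphere k" if y: "y : UB k - {c}" for y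
  using nrm[of "t y" y] root[OF y] c0 y by (auto simp: H_def unit_sphere_def UB_def)
 have H0: "H (0, y) = y" for y by (simp add: H_def)
 have Hconv: "H (s, y) = (%i. (1 - s) * y i + s * H (1, y) i)" for s y
  by (auto simp: H_def fun_eq_iff algebra_simps)
 show ?thesis
 proof (intro exI[of _ H] conjI ballI)
  show "H (s, y) : UB k - {c}" if s: "s : {0..1}" and y: "y : UB k - {c}" for s y
  proof -
   have "H (s, y) : UB k"
    unfolding Hconv[of s y] by (rule unit_ball_convex) (use y s H1[OF y] unit_sphere_subset in auto)
   moreover have "H (s, y) ~= c"
   proof
    assume h: "H (s, y) = c"
    obtain i where i: "y i ~= c i" using y by auto
    have "s * (t y - 1) >= 0" using s t1[OF y] by simp
    hence "1 - s + s * t y >= 1" by (simp add: algebra_simps)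
    thus False using fun_cong[OF h, of i] i by (simp add: H_def)
   qed
   ultimately show ?thesis by blast
  qed
  show "H (s, y) = y" if "s : {0..1}" "y : unit_sphere k - {c}" for s y
   using tS[OF that(2)] by (auto simp: H_def fun_eq_iff)
  have cb: "continuous_on A b" and cD: "continuous_on A D" for A
   unfolding b_def D_def
   by (intro continuous_intros continuous_on_product_then_coordinatewise[OF continuous_on_id])+
  have ct: "continuous_on (UB k - {c}) t"
   unfolding t_def by (intro continuous_intros cb cD) (use Dpos in force)
  show "continuous_on ({0..1} >< (UB k - {c})) H"
  proof (rule continuous_on_coordinatewise_then_product)
   fix i
   have "continuous_on ({0..1} >< (UB k - {c})) (%z. t (snd z))"
    by (rule continuous_on_compose2[OF ct]) (auto intro: continuous_intros)
   moreover have "continuous_on ({0..1} >< (UB k - {c})) (%z. snd z i)"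
    by (rule continuous_on_product_then_coordinatewise) (intro continuous_intros)
   ultimately show "continuous_on ({0..1} >< (UB k - {c})) (%z. H z i)"
    unfolding H_def case_prod_unfold by (intro continuous_intros)
  qed
 qed (use H0 H1 in auto)
qed

lemma compact_unit_ball: "compact_space (CB k)"
proof -
 have "CB k = subtop (product_topology (%i. euclideanreal) UNIV) (UB k)"
  by (simp add: closed_ball_space_eu euclidean_product_topology)
 moreover have "compactin (product_topology (%i. euclideanreal) UNIV) (UB k)"
 proof (rule closed_compactin)
  show "compactin (product_topology (%i. euclideanreal) UNIV) (PiE UNIV (%i::nat. {-1..1::real}))"
   by (simp add: compactin_PiE)
  show "UB k <= (PiE UNIV (%i::nat. {-1..1::real}))"
  proof
   fix x assume x: "x : UB k"
   have "\<bar>x i\<bar> <= 1" for i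
   proof (cases "i < k")
    case True
    hence "(x i)\<^sup>2 <= (SUM i<k. (x i)\<^sup>2)" by (intro member_le_sum) auto
    hence "(x i)\<^sup>2 <= 1" using x by (auto simp: UB_def)
    thus ?thesis by (simp add: abs_square_le_1)
   next
    case False
    thus ?thesis using x by (auto simp: UB_def)
   qed
   thus "x : (PiE UNIV (%i::nat. {-1..1::real}))" by (auto simp: abs_le_iff)
  qed
  have "closed (UB k)"
  proof -
   have c: "continuous_on UNIV (%x::nat => real. SUM i<k. (x i)\<^sup>2)" by (intro continuous_intros continuous_on_product_coordinates)
   have "UB k = (INT i:{k..}. {x. x i = 0}) Int {x. (SUM i<k. (x i)\<^sup>2) <= 1}"
    by (auto simp: UB_def)
   moreover have "closed {x::nat => real. x i = 0}" for i
    by (intro closed_Collect_eq continuous_on_product_coordinates continuous_on_const)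
   moreover have "closed {x::nat => real. (SUM i<k. (x i)\<^sup>2) <= 1}"
    by (intro closed_Collect_le c continuous_on_const)
   ultimately show ?thesis by (auto intro!: closed_Int closed_INT)
  qed
  thus "closedin (product_topology (%i. euclideanreal) UNIV) (UB k)"
   by (simp add: euclidean_product_topology)
 qed
 ultimately show ?thesis by (simp add: compact_space_subtopology)
qed

lemma topspace_closed_ball [simp]: "tsp (CB k) = UB k"
 by (simp add: closed_ball_space_eu)

lemma attach_deformation:
 assumes Z: "tsp Z = Y Un E" and Y: "closedin Z Y" and E: "closedin Z E"
  and f: "homeomorphic_map (CB k) (subtop Z E) f"
  and YE: "Y Int E = f ` unit_sphere k" and x: "x : E"
 shows "trivial_group (RHG p (subtop Z (- {x})) (Y - {x}))"
proof -
 have topE: "tsp (subtop Z E) = E" using E closedin_subset by (auto simp: topspace_subtopology)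
 obtain g where fg: "homeomorphic_maps (CB k) (subtop Z E) f g"
  using f homeomorphic_map_maps by blast
 hence cf: "cmap (CB k) (subtop Z E) f"
  and cg: "cmap (subtop Z E) (CB k) g"
  and gf: "!!y. y : UB k ==> g (f y) = y" and fg': "!!z. z : E ==> f (g z) = z"
  using topE by (auto simp: homeomorphic_maps_def)
 have gE: "g z : UB k" if "z : E" for z using continuous_map_image_subset_topspace[OF cg] topE that by auto
 have fE: "f y : E" if "y : UB k" for y using continuous_map_image_subset_topspace[OF cf] topE that by auto
 define c where "c = g x"
 have c: "c : UB k" "f c = x" using gE[OF x] fg'[OF x] by (auto simp: c_def)
 obtain H :: "real >< (nat => real) => nat => real" where H: "continuous_on ({0..1} >< (UB k - {c})) H"
  "ALL s:{0..1}. ALL y:UB k - {c}. H (s, y) : UB k - {c}"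
  "ALL y:UB k - {c}. H (0, y) = y & H (1, y) : unit_sphere k"
  "ALL s:{0..1}. ALL y:unit_sphere k - {c}. H (s, y) = y"
  using ball_projection[OF c(1)] by blast
 let ?Z = "subtop Z (- {x})"
 let ?I = "top_of_set {0..1::real}"
 define h where "h = (%(s, z). if z : E then f (H (s, g z)) else z)"
 have gx: "g z : UB k - {c}" if "z : E" "z ~= x" for z
  using gE[OF that(1)] fg'[OF that(1)] that c by auto
 have sph: "g z : unit_sphere k - {c}" if "z : E" "z : Y" "z ~= x" for z
 proof -
  obtain y where "y : unit_sphere k" "z = f y" using YE `z : E` `z : Y` by blast
  hence "g z = y" using gf unit_sphere_subset by blast
  thus ?thesis using `y : unit_sphere k` gx that by auto
 qed
 have hY: "h (s, z) = z" if "s : {0..1}" "z : Y" "z ~= x" for s z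
  using H(4) that(1) sph[OF _ that(2,3)] fg' that by (auto simp: h_def)
 have hin: "h (s, z) : tsp ?Z" if s: "s : {0..1}" and z: "z : tsp ?Z" for s z
 proof (cases "z : E")
  case True
  hence 1: "H (s, g z) : UB k - {c}" using H(2) s gx[OF True] z by auto
  hence "f (H (s, g z)) : E" using fE by blast
  moreover have "f (H (s, g z)) ~= x" using 1 gf c(1) c(2) by (metis Diff_iff singletonI)
  ultimately show ?thesis using True Z by (auto simp: h_def)
 next
  case False
  thus ?thesis using z by (simp add: h_def)
 qed
 have cont: "cmap (ptop ?I ?Z) ?Z h"
 proof (rule continuous_map_into_subtopology)
  show "h : tsp (ptop ?I ?Z) \<rightarrow> - {x}" using hin by fastforce
  let ?P = "ptop ?I ?Z"
  show "cmap ?P Z h"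
  proof (rule pasting_lemma_closed[where I = "UNIV :: bool set" and T = "%b. if b then {0..1} >< (E - {x}) else {0..1} >< (Y - {x})"
     and f = "%b. if b then (%(s, z). f (H (s, g z))) else snd"])
   show "closedin ?P (if b then {0..1} >< (E - {x}) else {0..1} >< (Y - {x}))" for b
   proof -
    have 1: "closedin ?Z (A - {x})" if "closedin Z A" for A
    proof -
     have "A - {x} = A Int - {x}" by blast
     thus ?thesis using that by (metis closedin_subtopology)
    qed
    have 2: "closedin ?I {0..1}" by (metis closedin_topspace topspace_euclidean_subtopology)
    show ?thesis using 1[OF Y] 1[OF E] 2 by (simp add: closedin_prod_Times_iff)
   qed
   show "cmap (subtop ?P (if b then {0..1} >< (E - {x}) else {0..1} >< (Y - {x}))) Z
     (if b then (%(s, z). f (H (s, g z))) else snd)" for b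
   proof (cases b)
    case False
    have "cmap ?P Z snd"
     by (rule continuous_map_into_fulltopology[OF continuous_map_snd])
    thus ?thesis using False by (simp add: continuous_map_from_subtopology)
   next
    case True
    have sub: "subtop ?P ({0..1} >< (E - {x})) = ptop ?I (subtop (subtop Z E) (- {x}))"
    proof -
     have "subtop ?P ({0..1} >< (E - {x})) = ptop (subtop ?I {0..1}) (subtop ?Z (E - {x}))"
      by (simp add: prod_topology_subtopology(2) prod_topology_subtopology subtopology_subtopology Times_Int_Times inf_aci)
     moreover have "subtop ?Z (E - {x}) = subtop (subtop Z E) (- {x})"
      by (simp add: subtopology_subtopology Int_Diff Diff_eq inf_commute inf_left_commute)
     ultimately show ?thesis by (simp add: subtopology_subtopology)
    qed
    have tE: "tsp (subtop (subtop Z E) (- {x})) = E - {x}"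
     using topE by (auto simp: topspace_subtopology)
    have 1: "cmap (ptop ?I (subtop (subtop Z E) (- {x}))) (top_of_set ({0..1} >< (UB k - {c}))) (%z. (fst z, g (snd z)))"
    proof -
     have "cmap (subtop (subtop Z E) (- {x})) (top_of_set (UB k - {c})) g"
     proof -
      have "cmap (subtop (subtop Z E) (- {x})) (subtop (CB k) (- {c})) g"
       by (rule continuous_map_into_subtopology)
        (use continuous_map_from_subtopology[OF cg] gx tE in auto)
      thus ?thesis by (simp add: closed_ball_space_eu subtopology_subtopology Diff_eq)
     qed
     from continuous_map_compose[OF continuous_map_snd this]
     have "cmap (ptop ?I (subtop (subtop Z E) (- {x}))) (top_of_set (UB k - {c})) (g o snd)" .
     from continuous_map_pairedI[OF continuous_map_fst this]
     show ?thesis by (simp only: prod_topology_subtopology_eu comp_def)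
    qed
    have 2: "cmap (top_of_set ({0..1} >< (UB k - {c}))) (CB k) H"
     using H(1,2) by (auto simp: closed_ball_space_eu continuous_map_in_subtopology)
    have 3: "cmap (CB k) Z f" using cf by (simp add: continuous_map_in_subtopology)
    have "cmap (ptop ?I (subtop (subtop Z E) (- {x}))) Z (f o H o (%z. (fst z, g (snd z))))"
     using continuous_map_compose[OF 1 continuous_map_compose[OF 2 3]] by (simp add: comp_assoc)
    moreover have "f o H o (%z. (fst z, g (snd z))) = (%(s, z). f (H (s, g z)))" by auto
    ultimately show ?thesis using True sub by simp
   qed
   show "(if b then (%(s, z). f (H (s, g z))) else snd) w = (if b' then (%(s, z). f (H (s, g z))) else snd) w"
    if w: "w : tsp ?P Int (if b then {0..1} >< (E - {x}) else {0..1} >< (Y - {x})) Int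
     (if b' then {0..1} >< (E - {x}) else {0..1} >< (Y - {x}))" for b b' w
   proof (cases "b = b'")
    case False
    hence "snd w : E" "snd w : Y" "snd w ~= x" "fst w : {0..1}"
     using w by (cases b; cases b'; auto)+
    thus ?thesis using hY[of "fst w" "snd w"] False by (cases w; cases b; cases b'; auto simp: h_def)
   qed simp
   show "EX b. b : UNIV & w : (if b then {0..1} >< (E - {x}) else {0..1} >< (Y - {x})) &
     h w = (if b then (%(s, z). f (H (s, g z))) else snd) w" if w: "w : tsp ?P" for w
   proof (cases "snd w : E")
    case True
    thus ?thesis using w by (intro exI[of _ True]) (auto simp: h_def)
   next
    case False
    thus ?thesis using w Z by (intro exI[of _ False]) (auto simp: h_def)
   qed
  qed simp
 qed
 show ?thesis
 proof (rule trivial_relative_homology_group_alt)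
  have h1: "h (1, z) : Y - {x}" if "z : tsp ?Z" for z
  proof (cases "z : E")
   case True
   hence "H (1, g z) : unit_sphere k" using H(3) gx[OF True] that by auto
   hence "h (1, z) : Y" using True YE by (auto simp: h_def)
   thus ?thesis using hin[of 1 z] that by auto
  next
   case False
   thus ?thesis using that Z by (auto simp: h_def)
  qed
  have "cmap ?Z ?Z (h o (%z. (1, z)))"
   by (rule continuous_map_compose[OF _ cont]) (simp add: continuous_map_pairwise comp_def)
  hence "cmap ?Z ?Z (%z. h (1, z))" by (simp add: comp_def)
  thus "cmap ?Z (subtop ?Z (Y - {x})) (%z. h (1, z))"
   by (rule continuous_map_into_subtopology) (use h1 in auto)
  have "homotopic_with (%k. k ` (Y - {x}) <= Y - {x}) ?Z ?Z (%z. h (0, z)) (%z. h (1, z))"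
   unfolding homotopic_with_def
  proof (intro exI[of _ h] conjI ballI allI)
   fix s :: real assume "s : {0..1}"
   thus "(%z. h (s, z)) ` (Y - {x}) <= Y - {x}" using hY by auto
  qed (use cont in auto)
  moreover have "homotopic_with (%k. k ` (Y - {x}) <= Y - {x}) ?Z ?Z (%z. h (0, z)) id"
  proof (rule homotopic_with_equal)
   show "h (0, z) = id z" if "z : tsp ?Z" for z
    using that H(3) gx fg' by (auto simp: h_def)
   show "(%z. h (0, z)) ` (Y - {x}) <= Y - {x}" using hY by auto
   have "cmap ?Z ?Z (h o (%z. (0, z)))"
    by (rule continuous_map_compose[OF _ cont]) (simp add: continuous_map_pairwise comp_def)
   thus "cmap ?Z ?Z (%z. h (0, z))" by (simp add: comp_def)
  qed auto
  ultimately show "homotopic_with (%k. k ` (Y - {x}) <= Y - {x}) ?Z ?Z (%z. h (1, z)) id"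
   by (meson homotopic_with_symD homotopic_with_trans)
 qed
qed

definition RH :: "'a topology => int => 'a set => 'a set => 'a chain set monoid" where
 "RH X p A B = RHG p (subtop X A) B"

definition incl :: "'a topology => int => 'a set => 'a set => 'a set => 'a set => 'a chain set => 'a chain set" where
 "incl X p A B A' B' = hom_induced p (subtop X A) B (subtop X A') B' id"

definition bdry :: "'a topology => int => 'a set => 'a set => 'a set => 'a chain set => 'a chain set" where
 "bdry X p A B C = hom_relboundary p (subtop X A) B C"

lemma comm_group_rel_hom [simp]: "comm_group (RH X p A B)"
 by (simp add: RH_def)

lemma group_rel_hom [simp]: "group (RH X p A B)"
 by (simp add: RH_def)

lemma RH_one [simp]: "e1 (RH X p A B) : car (RH X p A B)"
 by (simp add: group.is_monoid)

lemma RH_mult [simp]: "x : car (RH X p A B) ==> y : car (RH X p A B) ==> x *[RH X p A B] y : car (RH X p A B)"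
 by (simp add: group.is_monoid monoid.m_closed)

lemma incl_hom: "incl X p A B A' B' : hom (RH X p A B) (RH X p A' B')"
 by (simp add: incl_def RH_def hom_induced_hom)

lemma incl_closed [simp]: "incl X p A B A' B' x : car (RH X p A' B')"
 by (simp add: incl_def RH_def hom_induced_carrier)

lemma bdry_hom: "B <= A ==> bdry X p A B C : hom (RH X p A B) (RH X (p - 1) B C)"
 using group_homomorphism_hom_relboundary[of p "subtop X A" B C]
 by (simp add: bdry_def RH_def subtopology_subtopology inf.absorb2)

lemma bdry_closed [simp]: "B <= A ==> bdry X p A B C x : car (RH X (p - 1) B C)"
 using hom_relboundary[of p "subtop X A" B C x]
 by (simp add: bdry_def RH_def subtopology_subtopology inf.absorb2)

lemma incl_mult: "x : car (RH X p A B) ==> y : car (RH X p A B) ==>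
  incl X p A B A' B' (x *[RH X p A B] y) = incl X p A B A' B' x *[RH X p A' B'] incl X p A B A' B' y"
 using incl_hom[of X p A B A' B'] by (simp add: hom_def)

lemma incl_one [simp]: "incl X p A B A' B' (e1 (RH X p A B)) = e1 (RH X p A' B')"
 by (rule hom_one[OF incl_hom]) simp_all

lemma bdry_one [simp]: "B <= A ==> bdry X p A B C (e1 (RH X p A B)) = e1 (RH X (p - 1) B C)"
 by (rule hom_one[OF bdry_hom]) simp_all

lemma incl_id [simp]: "x : car (RH X p A B) ==> incl X p A B A B x = x"
 by (simp add: incl_def RH_def hom_induced_id)

lemma continuous_id_sub: "A <= B ==> cmap (subtop X A) (subtop X B) id"
 by (rule continuous_map_into_subtopology[OF continuous_map_from_subtopology[OF continuous_map_id]]) auto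

lemma incl_incl:
 assumes "A <= A'" "B <= B'" "A' <= A''" "B' <= B''"
 shows "incl X p A' B' A'' B'' (incl X p A B A' B' x) = incl X p A B A'' B'' x"
proof -
 have "cmap (subtop X A) (subtop X A') id" "cmap (subtop X A') (subtop X A'') id"
  using assms by (simp_all add: continuous_id_sub)
 thus ?thesis unfolding incl_def
  using hom_induced_compose'[of "subtop X A" "subtop X A'" id B B' "subtop X A''" id B'' p x] assms by (simp add: Pi_iff subset_iff)
qed

lemma bdry_incl:
 assumes "A <= A'" "B <= B'" "C <= C'" "B <= A" "B' <= A'"
 shows "bdry X p A' B' C' (incl X p A B A' B' x) = incl X (p - 1) B C B' C' (bdry X p A B C x)"
proof -
 have c: "cmap (subtop X A) (subtop X A') id"
  using assms by (simp add: continuous_id_sub)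
 have "id : B \<rightarrow> B'" "id : C \<rightarrow> C'" using assms by auto
 from fun_cong[OF naturality_hom_induced_relboundary[OF c this, of p], of x]
 show ?thesis using assms by (simp add: bdry_def incl_def subtopology_subtopology inf.absorb2)
qed

lemma triple_exact_1:
 assumes "C <= B" "B <= A"
 shows "x : car (RH X p A C) ==> bdry X p A B C (incl X p A C A B x) = e1 (RH X (p - 1) B C)"
  and "y : car (RH X p A B) ==> bdry X p A B C y = e1 (RH X (p - 1) B C) ==>
   EX x:car (RH X p A C). y = incl X p A C A B x"
proof -
 have "kernel (RH X p A B) (RH X (p - 1) B C) (bdry X p A B C) = incl X p A C A B ` car (RH X p A C)"
  using homology_exactness_triple_1[OF assms(1), of p "subtop X A"] assms(2)
  by (simp add: RH_def incl_def bdry_def subtopology_subtopology inf.absorb2)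
 thus "x : car (RH X p A C) ==> bdry X p A B C (incl X p A C A B x) = e1 (RH X (p - 1) B C)"
  and "y : car (RH X p A B) ==> bdry X p A B C y = e1 (RH X (p - 1) B C) ==>
   EX x:car (RH X p A C). y = incl X p A C A B x"
  unfolding kernel_def by blast+
qed

lemma triple_exact_2:
 assumes "C <= B" "B <= A"
 shows "y : car (RH X p A B) ==> incl X (p - 1) B C A C (bdry X p A B C y) = e1 (RH X (p - 1) A C)"
  and "z : car (RH X (p - 1) B C) ==> incl X (p - 1) B C A C z = e1 (RH X (p - 1) A C) ==>
   EX y:car (RH X p A B). z = bdry X p A B C y"
proof -
 have "kernel (RH X (p - 1) B C) (RH X (p - 1) A C) (incl X (p - 1) B C A C) = bdry X p A B C ` car (RH X p A B)"
  using homology_exactness_triple_2[OF assms(1), of p "subtop X A"] assms(2)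
  by (simp add: RH_def incl_def bdry_def subtopology_subtopology inf.absorb2)
 thus "y : car (RH X p A B) ==> incl X (p - 1) B C A C (bdry X p A B C y) = e1 (RH X (p - 1) A C)"
  and "z : car (RH X (p - 1) B C) ==> incl X (p - 1) B C A C z = e1 (RH X (p - 1) A C) ==>
   EX y:car (RH X p A B). z = bdry X p A B C y"
  unfolding kernel_def by blast+
qed

lemma triple_exact_3:
 assumes "C <= B" "B <= A"
 shows "w : car (RH X p B C) ==> incl X p A C A B (incl X p B C A C w) = e1 (RH X p A B)"
  and "x : car (RH X p A C) ==> incl X p A C A B x = e1 (RH X p A B) ==>
   EX w:car (RH X p B C). x = incl X p B C A C w"
proof -
 have "kernel (RH X p A C) (RH X p A B) (incl X p A C A B) = incl X p B C A C ` car (RH X p B C)"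
  using homology_exactness_triple_3[OF assms(1), of p "subtop X A"] assms(2)
  by (simp add: RH_def incl_def subtopology_subtopology inf.absorb2)
 thus "w : car (RH X p B C) ==> incl X p A C A B (incl X p B C A C w) = e1 (RH X p A B)"
  and "x : car (RH X p A C) ==> incl X p A C A B x = e1 (RH X p A B) ==>
   EX w:car (RH X p B C). x = incl X p B C A C w"
  unfolding kernel_def by blast+
qed

definition vanishes :: "'a topology => int => 'a set => 'a set => bool" where
 "vanishes X p A B <-> car (RH X p A B) = {e1 (RH X p A B)}"

lemma vanishesD: "vanishes X p A B ==> x : car (RH X p A B) ==> x = e1 (RH X p A B)"
 by (auto simp: vanishes_def)

lemma vanishesI: "(!!x. x : car (RH X p A B) ==> x = e1 (RH X p A B)) ==> vanishes X p A B"
 using RH_one by (auto simp: vanishes_def)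

lemma vanishes_iff_trivial: "vanishes X p A B <-> trivial_group (RHG p (subtop X A) B)"
 by (simp add: vanishes_def trivial_group_def RH_def)

lemma vanishes_triple:
 assumes "C <= B" "B <= A" "vanishes X p A B" "vanishes X p B C"
 shows "vanishes X p A C"
proof (rule vanishesI)
 fix x assume x: "x : car (RH X p A C)"
 obtain w where "w : car (RH X p B C)" "x = incl X p B C A C w"
  using triple_exact_3(2)[OF assms(1,2) x] vanishesD[OF assms(3) incl_closed] by blast
 thus "x = e1 (RH X p A C)" using vanishesD[OF assms(4)] incl_one by metis
qed

lemma incl_inj:
 assumes "C <= B" "B <= A" "vanishes X p B C"
 shows "inj_on (incl X p A C A B) (car (RH X p A C))"
proof -
 interpret group_hom "RH X p A C" "RH X p A B" "incl X p A C A B"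
  by (simp add: group_hom_def group_hom_axioms_def incl_hom)
 show ?thesis
 proof (rule inj_onI)
  have "x = e1 (RH X p A C)" if x: "x : car (RH X p A C)" "incl X p A C A B x = e1 (RH X p A B)" for x
  proof -
   obtain w where "w : car (RH X p B C)" "x = incl X p B C A C w"
    using triple_exact_3(2)[OF assms(1,2) x] by blast
   thus ?thesis using vanishesD[OF assms(3)] incl_one by metis
  qed
  thus "x = y" if "x : car (RH X p A C)" "y : car (RH X p A C)"
   "incl X p A C A B x = incl X p A C A B y" for x y
   using that inj_on_one_iff by (metis inj_onD)
 qed
qed

lemma incl_surj:
 assumes "C <= B" "B <= A" "vanishes X (p - 1) B C" "y : car (RH X p A B)"
 shows "EX x:car (RH X p A C). y = incl X p A C A B x"
 by (rule triple_exact_1(2)[OF assms(1,2,4) vanishesD[OF assms(3) bdry_closed[OF assms(2)]]])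

lemma incl_inj':
 assumes "C <= B" "B <= A" "vanishes X (p + 1) A B"
 shows "inj_on (incl X p B C A C) (car (RH X p B C))"
proof -
 interpret group_hom "RH X p B C" "RH X p A C" "incl X p B C A C"
  by (simp add: group_hom_def group_hom_axioms_def incl_hom)
 have "x = e1 (RH X p B C)" if x: "x : car (RH X p B C)" "incl X p B C A C x = e1 (RH X p A C)" for x
 proof -
  obtain w where "w : car (RH X (p + 1) A B)" "x = bdry X (p + 1) A B C w"
   using triple_exact_2(2)[OF assms(1,2), of x X "p + 1"] x by auto
  moreover from this have "w = e1 (RH X (p + 1) A B)" using vanishesD[OF assms(3)] by blast
  ultimately show ?thesis using bdry_one[OF assms(2), of X "p + 1" C] by simp
 qed
 thus ?thesis using inj_on_one_iff by blast
qed

lemma incl_surj':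
 assumes "C <= B" "B <= A" "vanishes X p A B" "y : car (RH X p A C)"
 shows "EX x:car (RH X p B C). y = incl X p B C A C x"
 by (rule triple_exact_3(2)[OF assms(1,2,4) vanishesD[OF assms(3) incl_closed]])

lemma vanishes_self: "vanishes X p A A"
proof -
 have "RHG p (subtop X A) A = RHG p (subtop X A) (tsp (subtop X A))"
  by (metis relative_homology_group_restrict topspace_subtopology inf.right_idem inf.commute)
 thus ?thesis unfolding vanishes_iff_trivial using trivial_relative_homology_group_topspace by metis
qed

lemma vanishes_neg: "p < 0 ==> vanishes X p A B"
 by (simp add: vanishes_iff_trivial)

lemma incl_iso_absolute:
 assumes "C <= B" "B <= A" "!!p. vanishes X p B C"
 shows "bij_betw (incl X p A C A B) (car (RH X p A C)) (car (RH X p A B))"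
proof (rule bij_betw_imageI[OF incl_inj[OF assms]])
 show "incl X p A C A B ` car (RH X p A C) = car (RH X p A B)"
  using incl_surj[OF assms(1,2) assms(3)] by (intro equalityI subsetI) (auto simp del: incl_id simp: image_iff Bex_def)
qed

lemma excision:
 assumes "subtop X P clo Y <= subtop X P interior_of Q" "Q <= P"
 shows "bij_betw (incl X p (P - Y) (Q - Y) P Q) (car (RH X p (P - Y) (Q - Y))) (car (RH X p P Q))"
proof -
 have "subtop (subtop X P) (P - Y) = subtop X (P - Y)"
  by (simp add: subtopology_subtopology inf.absorb2)
 moreover have "subtop (subtop X P) P = subtop X P"
  by (simp add: subtopology_subtopology)
 ultimately show ?thesis
  using homology_excision_axiom[OF assms, of p] by (simp add: incl_def RH_def iso_def)
qed

lemma excision_closed: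
 assumes "closedin (subtop X P) Y" "openin (subtop X P) Q" "Y <= Q"
 shows "bij_betw (incl X p (P - Y) (Q - Y) P Q) (car (RH X p (P - Y) (Q - Y))) (car (RH X p P Q))"
proof (rule excision)
 show "Q <= P" using openin_subset[OF assms(2)] by auto
 show "subtop X P clo Y <= subtop X P interior_of Q"
  by (metis assms closure_of_closedin interior_of_openin)
qed

definition infinite_cyclic :: "'a monoid => bool" where
 "infinite_cyclic G <-> (EX ps :: 'a => int. addi G ps & bij_betw ps (car G) UNIV)"

lemma infinite_cyclic_iso:
 assumes "h : hom G H" "bij_betw h (car G) (car H)" "group G" "group H"
 shows "infinite_cyclic G <-> infinite_cyclic H"
proof
 assume "infinite_cyclic H"
 then obtain ps :: "_ => int" where p: "addi H ps" "bij_betw ps (car H) UNIV" by (auto simp: infinite_cyclic_def)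
 have "addi G (ps o h)" using p(1) assms(1) by (auto simp: addi_def hom_def Pi_iff)
 thus "infinite_cyclic G" unfolding infinite_cyclic_def using bij_betw_trans[OF assms(2) p(2)] by blast
next
 assume "infinite_cyclic G"
 then obtain ps :: "_ => int" where p: "addi G ps" "bij_betw ps (car G) UNIV" by (auto simp: infinite_cyclic_def)
 have "h : iso G H" using assms by (simp add: iso_def)
 hence i: "inv_into (car G) h : iso H G" by (rule group.iso_set_sym[OF assms(3)])
 have "addi H (ps o inv_into (car G) h)" using p(1) i by (auto simp: addi_def iso_def hom_def Pi_iff)
 moreover have "bij_betw (ps o inv_into (car G) h) (car H) UNIV" using i bij_betw_trans[OF _ p(2), of "inv_into (car G) h"] by (simp add: iso_def)
 ultimately show "infinite_cyclic H" unfolding infinite_cyclic_def by blast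
qed

lemma vanishes_iso:
 assumes "bij_betw h (car (RH X p A B)) (car (RH Y q C D))"
 shows "vanishes X p A B <-> vanishes Y q C D"
proof -
 have "vanishes X p A B <-> card (car (RH X p A B)) = 1" for X :: "'c topology" and p A B
 proof
  show "card (car (RH X p A B)) = 1" if "vanishes X p A B" using that by (simp add: vanishes_def)
  assume "card (car (RH X p A B)) = 1"
  then obtain y where "car (RH X p A B) = {y}" by (rule card_1_singletonE)
  thus "vanishes X p A B" using monoid.one_closed[OF group.is_monoid[OF group_rel_hom[of X p A B]]] unfolding vanishes_def by simp
 qed
 thus ?thesis using bij_betw_same_card[OF assms] by metis
qed

lemma incl_bij_infinite_cyclic:
 assumes "bij_betw (incl X p A B A' B') (car (RH X p A B)) (car (RH X p A' B'))"
 shows "infinite_cyclic (RH X p A B) <-> infinite_cyclic (RH X p A' B')"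
 by (rule infinite_cyclic_iso[OF incl_hom assms]) simp_all

lemma rel_hom_homeo:
 assumes f: "homeomorphic_map (subtop X A) (subtop Y A') f" and B: "B <= A Int tsp X" "f ` B = B'"
 shows "hom_induced p (subtop X A) B (subtop Y A') B' f : hom (RH X p A B) (RH Y p A' B')"
  "bij_betw (hom_induced p (subtop X A) B (subtop Y A') B' f) (car (RH X p A B)) (car (RH Y p A' B'))"
 using homeomorphic_map_relative_homology_iso[OF f _ B(2), of p] B(1) by (auto simp: RH_def iso_def topspace_subtopology)

lemma euclidean_local:
 "vanishes (EU k) j UNIV (tsp (EU k) - {%_. 0}) <-> j ~= int k"
 "infinite_cyclic (RH (EU k) (int k) UNIV (tsp (EU k) - {%_. 0}))"
proof -
 let ?z = "%_::nat. 0::real"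
 have t0: "tsp (EU 0) = {?z}" by (auto simp: topspace_Euclidean_space)
 have c: "closedin (EU 0) {?z}" using closedin_topspace[of "EU 0"] by (simp add: t0)
 have i: "RHG p (EU 0) {} \<cong>
   RHG (p + int k) (EU k) (tsp (EU k) - {?z})" for p
  using relative_homology_group_Euclidean_complement_step[OF c, of p k] by (simp add: t0)
 have e: "RH (EU k) j UNIV (tsp (EU k) - {?z}) =
   RHG ((j - int k) + int k) (EU k) (tsp (EU k) - {?z})" for j
  by (simp add: RH_def)
 have z: "RHG 0 (EU 0) {} \<cong> integer_group"
  by (rule isomorphic_integer_zeroth_homology_group, metis t0 path_connectedin_singleton path_connectedin_topspace singletonI, simp add: t0)
 hence "integer_group \<cong> RHG 0 (EU 0) {}" by (simp add: group.iso_sym)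
 from iso_trans[OF this i] obtain h where h: "h : iso integer_group (RH (EU k) (int k) UNIV (tsp (EU k) - {?z}))"
  by (auto simp: is_iso_def RH_def)
 have "addi integer_group (%x. x)" "bij_betw (%x. x) (car integer_group) (UNIV :: int set)"
  by (auto simp: addi_def bij_betw_def)
 hence "infinite_cyclic integer_group" unfolding infinite_cyclic_def by blast
 thus Z: "infinite_cyclic (RH (EU k) (int k) UNIV (tsp (EU k) - {?z}))"
  using infinite_cyclic_iso[of h integer_group "RH (EU k) (int k) UNIV (tsp (EU k) - {?z})"] h
  by (simp add: iso_def)
 show "vanishes (EU k) j UNIV (tsp (EU k) - {?z}) <-> j ~= int k"
 proof
  assume "j ~= int k"
  hence "trivial_group (RHG (j - int k) (EU 0) {})" using homology_dimension_axiom[OF t0] by simp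
  hence "trivial_group (RH (EU k) j UNIV (tsp (EU k) - {?z}))"
   using isomorphic_group_triviality[OF i] unfolding e by simp
  thus "vanishes (EU k) j UNIV (tsp (EU k) - {?z})"
   by (simp add: vanishes_def trivial_group_def)
 next
  assume v: "vanishes (EU k) j UNIV (tsp (EU k) - {?z})"
  show "j ~= int k"
  proof
   assume "j = int k"
   then obtain ps :: "_ => int" where "bij_betw ps {e1 (RH (EU k) j UNIV (tsp (EU k) - {?z}))} UNIV"
    using Z v unfolding infinite_cyclic_def vanishes_def by auto
   thus False by (metis bij_betw_finite finite.emptyI finite_insert infinite_UNIV_int)
  qed
 qed
qed

lemma continuous_on_coordinate: "continuous_on A (%x :: nat => real. x i)"
 by (rule continuous_on_subset[OF continuous_on_product_coordinates]) simp

lemma sphere_invariance_of_domain: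
 assumes O: "openin (top_of_set (unit_sphere k)) U" "U ~= {}" and j: "j < k"
  and g: "continuous_on U g" "inj_on g U" "g ` U <= {x. ALL i>=j. x i = 0}"
 shows "Suc j = k & openin (EU j) (g ` U)"
proof -
 define nrm where "nrm x = sqrt (SUM i<k. (x i)\<^sup>2)" for x :: "nat => real"
 define pr where "pr x = (%i. x i / nrm x)" for x :: "nat => real"
 define E0 where "E0 = {x :: nat => real. (ALL i>=k. x i = 0) & nrm x ~= 0}"
 define T where "T = {x : E0. pr x : U}"
 define G where "G x = (%i. if i = j then nrm x else g (pr x) i)" for x
 have nrm_cont: "continuous_on A nrm" for A
  unfolding nrm_def by (intro continuous_intros continuous_on_coordinate)
 have nrm_scale: "nrm (%i. r * x i) = \<bar>r\<bar> * nrm x" for r x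
  by (simp add: nrm_def power_mult_distrib flip: sum_distrib_left add: real_sqrt_mult)
 have pr_cont: "continuous_on E0 pr"
  unfolding pr_def E0_def by (intro continuous_on_coordinatewise_then_product continuous_intros nrm_cont continuous_on_coordinate) auto
 have nrm_pr: "nrm (pr x) = 1" if "x : E0" for x
  using nrm_scale[of "1 / nrm x" x] that by (simp add: pr_def E0_def nrm_def sum_nonneg)
 have sphere: "unit_sphere k = {x. (ALL i>=k. x i = 0) & nrm x = 1}"
  by (auto simp: unit_sphere_def nrm_def)
 have pr_sphere: "pr : E0 \<rightarrow> unit_sphere k"
  using nrm_pr by (auto simp: sphere) (auto simp: pr_def E0_def)
 have E0_open: "openin (EU k) E0"
 proof -
  have "open {x. nrm x ~= 0}" using nrm_cont[of UNIV] by (intro open_Collect_neq continuous_on_const) auto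
  thus ?thesis unfolding Euclidean_space_eu openin_open E0_def by blast
 qed
 have U_sub: "U <= unit_sphere k" using openin_subset[OF O(1)] by simp
 have pr_id: "pr x = x" "x : T" if "x : U" for x
 proof -
  have "nrm x = 1" "ALL i>=k. x i = 0" using that U_sub by (auto simp: sphere)
  moreover from this show "pr x = x" by (simp add: pr_def)
  ultimately show "x : T" using that by (simp add: T_def E0_def)
 qed
 have Teq: "T = E0 Int pr -` U" by (auto simp: T_def)
 have "openin (top_of_set E0) T"
  using continuous_openin_preimage[OF pr_cont pr_sphere O(1)] Teq by metis
 moreover have "top_of_set E0 = subtop (EU k) E0"
  by (auto simp: Euclidean_space_eu subtopology_subtopology E0_def intro!: arg_cong[where f = top_of_set])
 ultimately have T_open: "openin (EU k) T" using E0_open openin_trans_full by metis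
 have T_sub: "T <= E0" by (auto simp: T_def)
 have gz: "g y i = 0" if "y : U" "i >= j" for y i using g(3) that by auto
 have "continuous_on T (%x. g (pr x))"
  by (rule continuous_on_compose2[OF g(1) continuous_on_subset[OF pr_cont T_sub]]) (auto simp: T_def)
 hence "continuous_on T (%x. g (pr x) i)" for i
  by (rule continuous_on_product_then_coordinatewise[of T "%x. g (pr x)"])
 hence "continuous_on T (%x. G x i)" for i
  by (cases "i = j") (simp_all add: G_def nrm_cont)
 hence "continuous_on T G" by (rule continuous_on_coordinatewise_then_product)
 moreover have G_im: "G x i = 0" if "x : T" "i >= Suc j" for x i
  using that gz[of "pr x" i] by (auto simp: G_def T_def)
 moreover have "subtop (EU k) T = top_of_set T"
  using T_sub by (auto simp: Euclidean_space_eu subtopology_subtopology E0_def intro!: arg_cong[where f = top_of_set])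
 ultimately have "cmap (subtop (EU k) T) (EU k) G"
  using j by (auto simp: Euclidean_space_eu)
 moreover have "inj_on G T"
 proof (rule inj_onI)
  fix x y assume x: "x : T" and y: "y : T" and e: "G x = G y"
  have n: "nrm x = nrm y" using fun_cong[OF e, of j] by (simp add: G_def)
  have "g (pr x) i = g (pr y) i" for i
   using fun_cong[OF e, of i] x y gz[of _ j] by (cases "i = j") (auto simp: G_def T_def)
  hence "pr x = pr y" using g(2) x y unfolding T_def inj_on_def by blast
  thus "x = y" using n x by (auto simp: pr_def T_def E0_def fun_eq_iff)
 qed
 ultimately have GT: "openin (EU k) (G ` T)" using invariance_of_domain_Euclidean_space[OF T_open] by blast
 have "Suc j = k"
 proof (rule ccontr)
  assume "Suc j ~= k"
  hence jk: "Suc j <= k - 1" "k - 1 < k" using j by auto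
  obtain x where x: "x : T" using O(2) pr_id by blast
  obtain V where V: "open V" "G ` T = {x. ALL i>=k. x i = 0} Int V" using GT by (auto simp: Euclidean_space_eu openin_open)
  define w where "w t = (%i. if i = k - 1 then t else G x i)" for t :: real
  have "continuous_on UNIV (%t. w t i)" for i
   by (cases "i = k - 1") (simp_all add: w_def)
  hence "continuous_on UNIV w" by (rule continuous_on_coordinatewise_then_product)
  hence "open (w -` V)" using V(1) open_vimage by blast
  moreover have "w 0 = G x" using G_im[OF x, of "k - 1"] jk by (auto simp: w_def)
  hence "0 : w -` V" using V(2) x by auto
  ultimately obtain e where e: "e > 0" "ball 0 e <= w -` V" using open_contains_ball by blast
  hence "w (e / 2) : V" by (auto simp: subset_iff dist_norm)
  moreover have "ALL i>=k. w (e / 2) i = 0" using G_im[OF x] j jk by (auto simp: w_def)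
  ultimately have "w (e / 2) : G ` T" using V(2) by auto
  hence "w (e / 2) (k - 1) = 0" using G_im jk by auto
  thus False using e by (simp add: w_def)
 qed
 moreover have "openin (EU j) (g ` U)"
 proof -
  define c where "c y = (%i. if i = j then 1 else y i)" for y :: "nat => real"
  have "continuous_on {x. ALL i>=j. x i = 0} (%y. c y i)" for i
   by (cases "i = j") (simp_all add: c_def continuous_on_coordinate)
  hence "continuous_on {x. ALL i>=j. x i = 0} c" by (rule continuous_on_coordinatewise_then_product)
  hence cm: "cmap (EU j) (EU k) c"
   using j by (auto simp: Euclidean_space_eu c_def)
  have "g ` U = {y : tsp (EU j). c y : G ` T}"
  proof (intro equalityI subsetI)
   fix y assume "y : g ` U"
   then obtain x where x: "x : U" "y = g x" by blast
   have "nrm x = 1" using x(1) U_sub by (auto simp: sphere)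
   hence "c y = G x" unfolding c_def G_def pr_id(1)[OF x(1)] x(2) by (intro ext) auto
   thus "y : {y : tsp (EU j). c y : G ` T}" using pr_id(2)[OF x(1)] g(3) x by (auto simp: topspace_Euclidean_space)
  next
   fix y assume "y : {y : tsp (EU j). c y : G ` T}"
   then obtain x where x: "x : T" "c y = G x" "ALL i>=j. y i = 0" by (auto simp: topspace_Euclidean_space)
   have "y i = g (pr x) i" for i
    using fun_cong[OF x(2), of i] x(3) gz[of "pr x" j] x(1) by (cases "i = j") (auto simp: c_def G_def T_def)
   thus "y : g ` U" using x(1) by (auto simp: T_def fun_eq_iff image_iff)
  qed
  thus ?thesis using openin_continuous_map_preimage[OF cm GT] by simp
 qed
 ultimately show ?thesis by blast
qed

locale finite_cells =
 fixes X :: "'a topology" and S :: "'a set set" and dm :: "'a set => nat"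
 assumes Hausdorff: "Hausdorff_space X" and finS: "finite S"
  and regular: "!!e. e : S ==> regular_cell X (dm e) e"
  and disjoint: "!!e e'. e : S ==> e' : S ==> e ~= e' ==> e Int e' = {}"
  and cover: "&&S = tsp X"
  and frontier: "!!e. e : S ==> X clo e - e <= &&{e' : S. dm e' < dm e}"
begin

abbreviation cl :: "'a set => 'a set" where "cl e == X clo e"
abbreviation "TX == tsp X"
abbreviation "RU q L A == RH X q (&&L) (&&A)"
abbreviation "VU q L A == vanishes X q (&&L) (&&A)"
abbreviation "IU q L A M B == incl X q (&&L) (&&A) (&&M) (&&B)"
abbreviation "BU q L A B == bdry X q (&&L) (&&A) (&&B)"

definition cell_map :: "'a set => (nat => real) => 'a" where
 "cell_map e = (SOME f. homeomorphic_map (CB (dm e)) (subtop X (cl e)) f & f ` OB (dm e) = e)"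

lemma cell_map:
 assumes "e : S"
 shows "homeomorphic_map (CB (dm e)) (subtop X (cl e)) (cell_map e)"
  "cell_map e ` (UB (dm e) - unit_sphere (dm e)) = e" "cell_map e ` UB (dm e) = cl e"
  "inj_on (cell_map e) (UB (dm e))" "cell_map e ` unit_sphere (dm e) = cl e - e"
proof -
 have *: "homeomorphic_map (CB (dm e)) (subtop X (cl e)) (cell_map e) & cell_map e ` OB (dm e) = e"
  using regular[OF assms] unfolding regular_cell_def cell_map_def by (metis (mono_tags, lifting) someI_ex)
 thus h: "homeomorphic_map (CB (dm e)) (subtop X (cl e)) (cell_map e)"
  and o: "cell_map e ` (UB (dm e) - unit_sphere (dm e)) = e" by (auto simp: open_ball_set_eq)
 have "tsp (subtop X (cl e)) = cl e" using closure_of_subset_topspace[of X e] by (auto simp: topspace_subtopology)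
 thus b: "cell_map e ` UB (dm e) = cl e" and i: "inj_on (cell_map e) (UB (dm e))"
  using h homeomorphic_imp_surjective_map[OF h] homeomorphic_imp_injective_map[OF h] by auto
 show "cell_map e ` unit_sphere (dm e) = cl e - e"
 proof -
  have "cell_map e ` unit_sphere (dm e) = cell_map e ` UB (dm e) - cell_map e ` (UB (dm e) - unit_sphere (dm e))"
   using inj_on_image_set_diff[OF i, of "UB (dm e)" "UB (dm e) - unit_sphere (dm e)"] unit_sphere_subset[of "dm e"]
   by (simp add: Diff_Diff_Int inf.absorb2)
  thus ?thesis by (simp add: b o)
 qed
qed

lemma cell_sub: "e : S ==> e <= TX" using cover by auto

lemma cell_sub_cl: "e : S ==> e <= cl e" using cell_sub closure_of_subset by metis

lemma closed_cl: "closedin X (cl e)" by simp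

lemma cl_sub: "cl e <= TX" by (rule closure_of_subset_topspace)

lemma cell_of_point: "x : TX ==> EX c:S. x : c" using cover by blast

lemma cell_unique: "c : S ==> c' : S ==> x : c ==> x : c' ==> c = c'" using disjoint by blast

lemma point_in_cl: "c : S ==> c' : S ==> x : c ==> x : cl c' ==> c' = c \<or> dm c < dm c'"
 using frontier[of c'] cell_unique by blast

lemma cell_neighbourhood:
 assumes "x : TX"
 shows "EX V. openin X V & x : V & (ALL c':S. c' Int V ~= {} --> x : cl c')"
proof (intro exI conjI ballI impI)
 let ?V = "TX - &&{cl c' | c'. c' : S & x ~: cl c'}"
 show "openin X ?V" using finS by (intro openin_diff closedin_Union) auto
 show "x : ?V" using assms by auto
 show "x : cl c'" if h: "c' : S" "c' Int ?V ~= {}" for c' using h cell_sub_cl[OF h(1)] by blast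
qed

lemma frontier_open_part:
 assumes e: "e : S" and V: "openin X V" and c: "c : S" and U: "U = (cl e - e) Int V" "U ~= {}" "U <= c"
 shows "Suc (dm c) = dm e & openin (subtop X c) U"
proof -
 let ?k = "dm e" and ?j = "dm c" and ?f = "cell_map e"
 have dc: "?j < ?k" using U frontier[OF e] cell_unique[OF c] by blast
 obtain h where h: "homeomorphic_maps (CB ?j) (subtop X (cl c)) (cell_map c) h"
  using cell_map(1)[OF c] homeomorphic_map_maps by blast
 have hc: "cmap (subtop X (cl c)) (top_of_set (UB ?j)) h"
  and hi: "!!y. y : cl c ==> cell_map c (h y) = y" and hi': "!!x. x : UB ?j ==> h (cell_map c x) = x"
  using h cl_sub[of c] by (auto simp: homeomorphic_maps_def closed_ball_space_eu)
 have fc: "cmap (top_of_set (UB ?k)) X ?f"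
  using homeomorphic_imp_continuous_map[OF cell_map(1)[OF e]] continuous_map_in_subtopology by (auto simp: closed_ball_space_eu)
 define P where "P = {x : unit_sphere ?k. ?f x : V}"
 have fs: "?f ` unit_sphere ?k = cl e - e" by (rule cell_map(5)[OF e])
 have fP: "?f ` P = U" using fs U(1) unfolding P_def by auto
 have "cmap (top_of_set (unit_sphere ?k)) X ?f"
  by (rule continuous_map_from_subtopology_mono[OF fc[unfolded closed_ball_space_eu] unit_sphere_subset])
 from openin_continuous_map_preimage[OF this V] have Po: "openin (top_of_set (unit_sphere ?k)) P" by (simp add: P_def)
 have Psub: "P <= UB ?k" using unit_sphere_subset by (auto simp: P_def)
 have "cmap (top_of_set P) (subtop X (cl c)) ?f"
  using continuous_map_from_subtopology_mono[OF fc Psub] fP U(3) cell_sub_cl[OF c] by (intro continuous_map_into_subtopology) auto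
 from continuous_map_compose[OF this hc] have cP: "continuous_on P (h o ?f)" by auto
 have iP: "inj_on (h o ?f) P"
 proof (rule comp_inj_on)
  show "inj_on ?f P" using cell_map(4)[OF e] Psub inj_on_subset by blast
  show "inj_on h (?f ` P)" unfolding fP using U(3) cell_sub_cl[OF c] hi by (metis inj_onI subsetD)
 qed
 have im: "h y : UB ?j" if "y : cl c" for y
  using continuous_map_image_subset_topspace[OF hc] that cl_sub[of c] by auto
 hence mP: "(h o ?f) ` P <= {x. ALL i>=?j. x i = 0}" using fP U(3) cell_sub_cl[OF c] by (fastforce simp: UB_def)
 have "P ~= {}" using fP U(2) by auto
 hence R: "Suc ?j = ?k" "openin (EU ?j) ((h o ?f) ` P)"
  using sphere_invariance_of_domain[OF Po _ dc cP iP mP] by auto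
 have hU: "(h o ?f) ` P = h ` U" using fP by auto
 have "cmap (subtop X c) (EU ?j) h"
  using continuous_map_from_subtopology_mono[OF hc cell_sub_cl[OF c]] im cell_sub_cl[OF c]
  by (auto simp: Euclidean_space_eu continuous_map_in_subtopology UB_def)
 from openin_continuous_map_preimage[OF this R(2)[unfolded hU]]
 have "openin (subtop X c) {x : tsp (subtop X c). h x : h ` U}" .
 moreover have "{x : tsp (subtop X c). h x : h ` U} = U"
 proof (intro equalityI subsetI)
  fix x assume "x : {x : tsp (subtop X c). h x : h ` U}"
  then obtain y where "x : c" "y : U" "h x = h y" by auto
  thus "x : U" using hi U(3) cell_sub_cl[OF c] by (metis subsetD)
 qed (use U(3) cell_sub[OF c] in auto)
 ultimately show ?thesis using R(1) by simp
qed

lemma connected_cell: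
 assumes c: "c : S"
 shows "connectedin X c"
proof -
 let ?O = "UB (dm c) - unit_sphere (dm c)"
 define seg where "seg x = (%t i. t * x i) ` {0..1}" for x :: "nat => real"
 have sub: "seg x <= ?O" if x: "x : ?O" for x
 proof
  fix y assume "y : seg x"
  then obtain t where t: "0 <= t" "t <= 1" "y = (%i. t * x i)" by (auto simp: seg_def)
  have "(SUM i<dm c. (y i)\<^sup>2) = t\<^sup>2 * (SUM i<dm c. (x i)\<^sup>2)" by (simp add: t(3) power_mult_distrib sum_distrib_left)
  also have "... <= 1 * (SUM i<dm c. (x i)\<^sup>2)" using t by (intro mult_right_mono sum_nonneg) (auto simp: power_le_one)
  also have "... < 1" using x by (auto simp: UB_def unit_sphere_def)
  finally show "y : ?O" using x t(3) by (auto simp: UB_def unit_sphere_def)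
 qed
 have "connected (&&(seg ` ?O))"
 proof (rule connected_Union)
  show "connected T" if "T : seg ` ?O" for T
  proof -
   obtain x where "T = seg x" using \<open>T : seg ` ?O\<close> by blast
   moreover have "continuous_on {0..1} (%t i. t * x i)"
    by (intro continuous_on_coordinatewise_then_product continuous_intros)
   ultimately show ?thesis unfolding seg_def by (simp add: connected_continuous_image)
  qed
  have "(%_. 0) : seg x" for x by (auto simp: seg_def image_iff intro!: bexI[of _ 0])
  thus "\<Inter>(seg ` ?O) ~= {}" by blast
 qed
 moreover have "x : seg x" for x by (auto simp: seg_def image_iff intro!: bexI[of _ 1])
 hence "&&(seg ` ?O) = ?O" using sub by blast
 ultimately have "connected ?O" by simp
 hence "connectedin (CB (dm c)) ?O" by (simp add: closed_ball_space_eu connectedin_subtopology)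
 from connectedin_continuous_map_image[OF homeomorphic_imp_continuous_map[OF cell_map(1)[OF c]] this]
 show ?thesis by (simp add: cell_map(2)[OF c] connectedin_subtopology)
qed

lemma closed_frontier:
 assumes e: "e : S"
 shows "closedin X (cl e - e)"
proof -
 have "cmap (CB (dm e)) euclideanreal (%x. SUM i<dm e. (x i)\<^sup>2)"
  unfolding closed_ball_space_eu by (simp, intro continuous_intros continuous_on_coordinate)
 hence "closedin (CB (dm e)) {x : UB (dm e). (SUM i<dm e. (x i)\<^sup>2) : {1}}"
  using closedin_continuous_map_preimage[of _ _ _ "{1}"] by fastforce
 moreover have "{x : UB (dm e). (SUM i<dm e. (x i)\<^sup>2) : {1}} = unit_sphere (dm e)"
  by (auto simp: UB_def unit_sphere_def)
 ultimately have "closedin (subtop X (cl e)) (cell_map e ` unit_sphere (dm e))"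
  using homeomorphic_map_closedness_eq[OF cell_map(1)[OF e]] by simp
 thus ?thesis using closedin_trans_full[OF _ closed_cl] by (simp add: cell_map(5)[OF e])
qed

lemma normal:
 assumes "e : S" "e' : S" "e' Int cl e ~= {}"
 shows "e' <= cl e"
 using assms
proof (induction "dm e" arbitrary: e rule: less_induct)
 case less
 let ?F = "cl e - e"
 have Fc: "closedin X ?F" using closed_frontier less.prems by blast
 define K where "K = {c : S. Suc (dm c) = dm e & c Int ?F ~= {}}"
 have K_sub: "c <= ?F" if c: "c : K" for c
 proof -
  have cS: "c : S" "Suc (dm c) = dm e" using c by (auto simp: K_def)
  have "openin (subtop X c) (c Int ?F)"
  proof (subst openin_subopen, rule ballI)
   fix x assume x: "x : c Int ?F"
   hence "x : TX" using cl_sub by auto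
   then obtain V where V: "openin X V" "x : V" "!!c'. c' : S ==> c' Int V ~= {} ==> x : cl c'"
    using cell_neighbourhood[of x] by metis
   have "?F Int V <= c"
   proof
    fix y assume y: "y : ?F Int V"
    then obtain c' where c': "c' : S" "dm c' < dm e" "y : c'" using frontier[OF less.prems(1)] by blast
    hence "x : cl c'" using V(3)[of c'] y by blast
    hence "c' = c" using point_in_cl[OF cS(1) c'(1)] x c'(2) cS(2) by auto
    thus "y : c" using c' by simp
   qed
   hence "openin (subtop X c) (?F Int V)"
    using frontier_open_part[OF less.prems(1) V(1) cS(1)] x V(2) by blast
   thus "EX T. openin (subtop X c) T & x : T & T <= c Int ?F"
    using x V(2) `?F Int V <= c` by blast
  qed
  moreover have "closedin (subtop X c) (c Int ?F)" using Fc closedin_subtopology by fastforce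
  moreover have "connected_space (subtop X c)" using connected_cell[OF cS(1)] by (simp add: connectedin_def)
  ultimately have "c Int ?F = {} \<or> c Int ?F = tsp (subtop X c)" unfolding connected_space_clopen_in by blast
  thus ?thesis using c cell_sub[OF cS(1)] by (auto simp: K_def topspace_subtopology)
 qed
 have F_eq: "?F <= &&(cl ` K)"
 proof (rule ccontr)
  assume "~ ?thesis"
  then obtain x0 where x0: "x0 : ?F" "x0 ~: &&(cl ` K)" by blast
  define Om where "Om = TX - &&(cl ` K)"
  have "finite K" using finS by (simp add: K_def)
  hence Om: "openin X Om" unfolding Om_def by (intro openin_diff closedin_Union) auto
  have ne: "?F Int Om ~= {}" using x0 subsetD[OF cl_sub[of e], of x0] by (auto simp: Om_def)
  define M where "M = {c : S. c Int (?F Int Om) ~= {}}"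
  have M: "finite M" "M ~= {}" using finS ne cell_of_point cl_sub[of e] by (auto simp: M_def)
  obtain c where c: "c : M" "!!c'. c' : M ==> dm c' <= dm c"
   using obtains_MAX[OF M, of dm] Max_ge[of "dm ` M"] M by (metis finite_imageI imageI)
  have cS: "c : S" using c by (auto simp: M_def)
  obtain x where x: "x : c" "x : ?F" "x : Om" using c(1) by (auto simp: M_def)
  hence "x : TX" using cl_sub by auto
  then obtain V where V: "openin X V" "x : V" "!!c'. c' : S ==> c' Int V ~= {} ==> x : cl c'"
    using cell_neighbourhood[of x] by metis
  have "?F Int (V Int Om) <= c"
  proof
   fix y assume y: "y : ?F Int (V Int Om)"
   then obtain c' where c': "c' : S" "y : c'" using frontier[OF less.prems(1)] by blast
   hence "x : cl c'" "c' : M" using V(3)[of c'] y by (auto simp: M_def)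
   hence "c' = c" using point_in_cl[OF cS c'(1) x(1)] c(2)[of c'] by auto
   thus "y : c" using c' by simp
  qed
  hence "Suc (dm c) = dm e"
   using frontier_open_part[OF less.prems(1) openin_Int[OF V(1) Om] cS refl] x V(2) by blast
  hence "c : K" using cS x by (auto simp: K_def)
  thus False using x cell_sub_cl[OF cS] by (auto simp: Om_def)
 qed
 show ?case
 proof (cases "e' = e")
  case True
  thus ?thesis using cell_sub_cl less.prems by simp
 next
  case False
  hence "e' Int ?F ~= {}" using less.prems disjoint by blast
  then obtain c where c: "c : K" "e' Int cl c ~= {}" using F_eq by blast
  hence "e' <= cl c" using less.hyps[of c] less.prems by (auto simp: K_def)
  also have "cl c <= ?F" using K_sub[OF c(1)] closure_of_minimal[OF _ Fc] by blast
  finally show ?thesis by blast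
 qed
qed

end

context finite_cells
begin

definition subcx :: "'a set set => bool" where
 "subcx L <-> L <= S & (ALL e:L. ALL e':S. e' <= cl e --> e' : L)"

lemma cell_nonempty: "e : S ==> e ~= {}"
proof -
 assume e: "e : S"
 have "(%_. 0) : UB (dm e) - unit_sphere (dm e)" by (simp add: UB_def unit_sphere_def)
 thus ?thesis using cell_map(2)[OF e] by blast
qed

lemma subcomplex_cl: "subcx L ==> e : L ==> cl e <= &&L"
proof
 fix x assume L: "subcx L" "e : L" and x: "x : cl e"
 then obtain c where c: "c : S" "x : c" using cell_of_point cl_sub by blast
 hence "c <= cl e" using normal[of e c] L x by (auto simp: subcx_def)
 thus "x : &&L" using L c by (auto simp: subcx_def)
qed

lemma closed_subcomplex: "subcx L ==> closedin X (&&L)"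
proof -
 assume L: "subcx L"
 have "&&L = &&(cl ` L)"
 proof
  show "&&L <= &&(cl ` L)" using cell_sub_cl L unfolding subcx_def by blast
 qed (use subcomplex_cl[OF L] in blast)
 moreover have "finite L" using L finS finite_subset by (auto simp: subcx_def)
 ultimately show ?thesis by (auto intro!: closedin_Union)
qed

lemma cl_mono: "e' <= cl e ==> cl e' <= cl e"
 by (rule closure_of_minimal) simp_all

lemma subcomplex_closure: "e : S ==> subcx {e' : S. e' <= cl e}"
 unfolding subcx_def using cl_mono order_trans by blast

lemma face_dim: "e : S ==> e' : S ==> e' <= cl e ==> e' ~= e ==> dm e' < dm e"
 using point_in_cl cell_nonempty by (metis subset_eq ex_in_conv)

lemma subcomplex_skeleton: "subcx L ==> subcx {e : L. int (dm e) <= q}"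
 unfolding subcx_def
proof (intro conjI ballI impI)
 fix e e' assume L: "L <= S & (ALL e:L. ALL e':S. e' <= cl e --> e' : L)"
  and e: "e : {e : L. int (dm e) <= q}" "e' : S" "e' <= cl e"
 hence "e' : L" by blast
 moreover have "int (dm e') <= q" using face_dim[of e e'] L e by (cases "e' = e") auto
 ultimately show "e' : {e : L. int (dm e) <= q}" by simp
qed blast

lemma subcomplex_Un: "subcx L ==> subcx M ==> subcx (L Un M)"
 unfolding subcx_def by blast

lemma subcomplex_empty: "subcx {}" by (simp add: subcx_def)

lemma subcomplex_all: "subcx S" by (simp add: subcx_def)

lemma subcomplex_star: "subcx {e : S. ~ s <= cl e}"
 unfolding subcx_def using cl_mono order_trans by blast

definition free_cell :: "'a set set => 'a set => bool" where
 "free_cell L t <-> t : L & (ALL e:L. t <= cl e --> e = t)"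

lemma subcomplex_remove: "subcx L ==> free_cell L t ==> subcx (L - {t})"
 by (auto simp: subcx_def free_cell_def)

lemma Union_remove: "subcx L ==> t : L ==> &&(L - {t}) = &&L - t"
proof -
 assume L: "subcx L" and t: "t : L"
 have "c Int t = {}" if "c : L - {t}" for c using disjoint[of c t] L t that by (auto simp: subcx_def)
 thus ?thesis by blast
qed

lemma attach_vanishes:
 assumes L: "subcx L" and t: "free_cell L t" and x: "x : cl t"
 shows "vanishes X p (&&L - {x}) (&&(L - {t}) - {x})"
proof -
 let ?Z = "subtop X (&&L)"
 have tL: "t : L" "t : S" using t L by (auto simp: free_cell_def subcx_def)
 have sub: "&&L <= TX" using L cover by (auto simp: subcx_def)
 have clt: "cl t <= &&L" by (rule subcomplex_cl[OF L tL(1)])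
 have "trivial_group (RHG p (subtop ?Z (- {x})) (&&(L - {t}) - {x}))"
 proof (rule attach_deformation)
  show "tsp ?Z = &&(L - {t}) Un cl t" using sub Union_remove[OF L tL(1)] clt cell_sub_cl[OF tL(2)] by auto
  show "closedin ?Z (&&(L - {t}))"
   using closed_subcomplex[OF subcomplex_remove[OF L t]] Union_remove[OF L tL(1)] by (auto simp: closedin_subset_topspace intro!: closedin_subset_topspace)
  show "closedin ?Z (cl t)" using clt by (auto intro!: closedin_subset_topspace)
  show "homeomorphic_map (CB (dm t)) (subtop ?Z (cl t)) (cell_map t)"
   using cell_map(1)[OF tL(2)] clt by (simp add: subtopology_subtopology inf.absorb2)
  show "&&(L - {t}) Int cl t = cell_map t ` unit_sphere (dm t)"
   using cell_map(5)[OF tL(2)] Union_remove[OF L tL(1)] clt by auto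
  show "x : cl t" by fact
 qed
 moreover have "subtop ?Z (- {x}) = subtop X (&&L - {x})" by (simp add: subtopology_subtopology Diff_eq)
 ultimately show ?thesis by (simp add: vanishes_iff_trivial)
qed

definition centre :: "'a set => 'a" where "centre t = cell_map t (%_. 0)"

abbreviation "LG t == RH X (int (dm t)) t (t - {centre t})"

lemma centre: "t : S ==> centre t : t"
proof -
 assume t: "t : S"
 have "(%_. 0) : UB (dm t) - unit_sphere (dm t)" by (simp add: UB_def unit_sphere_def)
 thus ?thesis using cell_map(2)[OF t] unfolding centre_def by blast
qed

lemma cell_local:
 assumes t: "t : S"
 shows "vanishes X j t (t - {centre t}) <-> j ~= int (dm t)" "infinite_cyclic (LG t)"
proof -
 let ?k = "dm t" let ?z = "%_::nat. 0::real"
 let ?E = "EU ?k" and ?O = "UB (dm t) - unit_sphere (dm t)"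
 have Osub: "?O <= UB ?k" "?O <= tsp ?E" "?z : ?O" by (auto simp: UB_def unit_sphere_def topspace_Euclidean_space)
 have O_open: "openin ?E ?O"
 proof -
  have "open {x::nat => real. (SUM i<?k. (x i)\<^sup>2) < 1}"
   by (intro open_Collect_less continuous_intros continuous_on_coordinate)
  moreover have "?O = {x. ALL i>=?k. x i = 0} Int {x::nat => real. (SUM i<?k. (x i)\<^sup>2) < 1}" by (auto simp: UB_def unit_sphere_def)
  ultimately show ?thesis unfolding Euclidean_space_eu openin_open by blast
 qed
 have "homeomorphic_map (subtop (CB ?k) ?O) (subtop (subtop X (cl t)) t) (cell_map t)"
  by (rule homeomorphic_map_subtopologies[OF cell_map(1)[OF t]])
   (use cell_map(2)[OF t] Osub cell_sub[OF t] cell_sub_cl[OF t] in "simp add: Int_absorb1 Int_absorb2 cl_sub")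
 moreover have "subtop (CB ?k) ?O = subtop ?E ?O"
 proof -
  have "UB ?k Int ?O = {x. ALL i>=?k. x i = 0} Int ?O" by (auto simp: UB_def)
  thus ?thesis by (simp add: closed_ball_space_eu Euclidean_space_eu subtopology_subtopology)
 qed
 moreover have "subtop (subtop X (cl t)) t = subtop X t" using cell_sub_cl[OF t] by (simp add: subtopology_subtopology inf.absorb2)
 ultimately have h: "homeomorphic_map (subtop ?E ?O) (subtop X t) (cell_map t)" by simp
 have im: "cell_map t ` (?O - {?z}) = t - {centre t}"
 proof -
  have "?O - {?z} <= UB ?k" "{?z} <= UB ?k" using Osub by blast+
  from inj_on_image_set_diff[OF cell_map(4)[OF t] this] show ?thesis by (simp add: cell_map(2)[OF t] centre_def)
 qed
 let ?h = "%j. hom_induced j (subtop ?E ?O) (?O - {?z}) (subtop X t) (t - {centre t}) (cell_map t)"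
 have H: "?h j : hom (RH ?E j ?O (?O - {?z})) (RH X j t (t - {centre t}))"
  "bij_betw (?h j) (car (RH ?E j ?O (?O - {?z}))) (car (RH X j t (t - {centre t})))" for j
  using rel_hom_homeo[OF h _ im] Osub by auto
 have op: "openin ?E (tsp ?E - {?z})"
  using t1_space_closedin_singleton[of ?E] Hausdorff_imp_t1_space[OF Hausdorff_Euclidean_space[of ?k]] Osub by (intro openin_diff) auto
 have "bij_betw (incl ?E j (tsp ?E - (tsp ?E - ?O)) (tsp ?E - {?z} - (tsp ?E - ?O)) (tsp ?E) (tsp ?E - {?z}))
   (car (RH ?E j (tsp ?E - (tsp ?E - ?O)) (tsp ?E - {?z} - (tsp ?E - ?O)))) (car (RH ?E j (tsp ?E) (tsp ?E - {?z})))" for j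
  by (rule excision_closed) (use O_open op Osub in auto)
 moreover have "tsp ?E - (tsp ?E - ?O) = ?O" "tsp ?E - {?z} - (tsp ?E - ?O) = ?O - {?z}" using Osub by blast+
 ultimately have ex: "bij_betw (incl ?E j ?O (?O - {?z}) (tsp ?E) (tsp ?E - {?z}))
   (car (RH ?E j ?O (?O - {?z}))) (car (RH ?E j (tsp ?E) (tsp ?E - {?z})))" for j by simp
 have U: "RH ?E j UNIV B = RH ?E j (tsp ?E) B" for j B by (simp add: RH_def)
 have "vanishes ?E j ?O (?O - {?z}) <-> j ~= int ?k"
  using vanishes_iso[OF ex] euclidean_local(1)[of ?k j] by (simp add: vanishes_def U)
 thus "vanishes X j t (t - {centre t}) <-> j ~= int ?k" using vanishes_iso[OF H(2)] by simp
 have "infinite_cyclic (RH ?E (int ?k) ?O (?O - {?z}))"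
  using incl_bij_infinite_cyclic[OF ex] euclidean_local(2)[of ?k] by (simp add: U)
 thus "infinite_cyclic (RH X (int ?k) t (t - {centre t}))"
  using infinite_cyclic_iso[OF H] by simp
qed

definition cell_iso :: "'a set => 'a chain set => int" where
 "cell_iso t = (SOME ps. addi (LG t) ps &
   bij_betw ps (car (LG t)) UNIV)"

lemma cell_iso:
 assumes "t : S"
 shows "addi (LG t) (cell_iso t)"
  "bij_betw (cell_iso t) (car (LG t)) UNIV"
 using someI_ex[OF cell_local(2)[OF assms, unfolded infinite_cyclic_def]] by (auto simp: cell_iso_def)

definition coord :: "'a set => 'a set => 'a set => 'a chain set => int" where
 "coord P Q t z = cell_iso t (inv_into (car (LG t))
   (incl X (int (dm t)) t (t - {centre t}) P (P - {centre t})) (incl X (int (dm t)) P Q P (P - {centre t}) z))"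

lemma coord_excision:
 assumes L: "subcx L" and t: "free_cell L t"
 shows "bij_betw (incl X j t (t - {centre t}) (&&L) (&&L - {centre t}))
  (car (RH X j t (t - {centre t}))) (car (RH X j (&&L) (&&L - {centre t})))"
proof -
 have tL: "t : L" "t : S" using t L by (auto simp: free_cell_def subcx_def)
 have sub: "&&L <= TX" using L cover by (auto simp: subcx_def)
 have "bij_betw (incl X j (&&L - &&(L - {t})) (&&L - {centre t} - &&(L - {t})) (&&L) (&&L - {centre t}))
  (car (RH X j (&&L - &&(L - {t})) (&&L - {centre t} - &&(L - {t})))) (car (RH X j (&&L) (&&L - {centre t})))"
 proof (rule excision_closed)
  show "closedin (subtop X (&&L)) (&&(L - {t}))"
   using closed_subcomplex[OF subcomplex_remove[OF L t]] by (auto intro!: closedin_subset_topspace)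
  have "centre t : TX" using centre cell_sub tL by blast
  hence "closedin X {centre t}" using Hausdorff_imp_t1_space[OF Hausdorff] by (simp add: t1_space_closedin_singleton)
  hence "closedin (subtop X (&&L)) {centre t}"
   using centre[OF tL(2)] tL(1) by (intro closedin_subset_topspace) auto
  moreover have "tsp (subtop X (&&L)) = &&L" using sub by auto
  ultimately show "openin (subtop X (&&L)) (&&L - {centre t})" by (metis openin_diff openin_topspace)
  show "&&(L - {t}) <= &&L - {centre t}" using Union_remove[OF L tL(1)] centre[OF tL(2)] by auto
 qed
 moreover have "&&L - &&(L - {t}) = t" "&&L - {centre t} - &&(L - {t}) = t - {centre t}"
  using Union_remove[OF L tL(1)] tL(1) by auto
 ultimately show ?thesis by simp
qed

lemma coord_eqI:
 assumes L: "subcx L" and t: "free_cell L t"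
  and w: "w : car (LG t)"
  and e: "incl X (int (dm t)) t (t - {centre t}) (&&L) (&&L - {centre t}) w = incl X (int (dm t)) (&&L) Q (&&L) (&&L - {centre t}) z"
 shows "coord (&&L) Q t z = cell_iso t w"
 unfolding coord_def e[symmetric] using bij_betw_inv_into_left[OF coord_excision[OF L t] w] by simp

lemma coord_witness:
 assumes L: "subcx L" and t: "free_cell L t"
 shows "EX w:car (LG t).
  incl X (int (dm t)) t (t - {centre t}) (&&L) (&&L - {centre t}) w = incl X (int (dm t)) (&&L) Q (&&L) (&&L - {centre t}) z &
  coord (&&L) Q t z = cell_iso t w"
proof -
 have "incl X (int (dm t)) (&&L) Q (&&L) (&&L - {centre t}) z :
   incl X (int (dm t)) t (t - {centre t}) (&&L) (&&L - {centre t}) ` car (LG t)"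
  using coord_excision[OF L t, of "int (dm t)"] incl_closed by (simp add: bij_betw_def)
 then obtain w where "w : car (LG t)"
  "incl X (int (dm t)) (&&L) Q (&&L) (&&L - {centre t}) z = incl X (int (dm t)) t (t - {centre t}) (&&L) (&&L - {centre t}) w"
  by (rule imageE)
 thus ?thesis using coord_eqI[OF L t] by (intro bexI[of _ w]) simp_all
qed

lemma coord_natural:
 assumes L: "subcx L" and t: "free_cell L t" and L': "subcx L'" and t': "free_cell L' t" and sub: "L <= L'"
  and Q: "Q <= Q'" "Q <= &&L - {centre t}" "Q' <= &&L' - {centre t}"
 shows "coord (&&L') Q' t (incl X (int (dm t)) (&&L) Q (&&L') Q' z) = coord (&&L) Q t z"
proof -
 let ?k = "int (dm t)" let ?c = "{centre t}"
 obtain w where w: "w : car (RH X ?k t (t - ?c))"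
  "incl X ?k t (t - ?c) (&&L) (&&L - ?c) w = incl X ?k (&&L) Q (&&L) (&&L - ?c) z" "coord (&&L) Q t z = cell_iso t w"
  using coord_witness[OF L t] by blast
 have tL: "t <= &&L" "&&L <= &&L'" using t sub by (auto simp: free_cell_def)
 have "incl X ?k t (t - ?c) (&&L') (&&L' - ?c) w = incl X ?k (&&L) (&&L - ?c) (&&L') (&&L' - ?c) (incl X ?k t (t - ?c) (&&L) (&&L - ?c) w)"
  using tL by (subst incl_incl) auto
 also have "... = incl X ?k (&&L') Q' (&&L') (&&L' - ?c) (incl X ?k (&&L) Q (&&L') Q' z)"
  unfolding w(2) using tL Q by (subst incl_incl, blast, blast, blast, blast) (subst incl_incl, blast, blast, blast, blast, rule refl)
 finally show ?thesis using coord_eqI[OF L' t' w(1)] w(3) by metis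
qed

lemma coord_outside:
 assumes L: "subcx L" and t: "free_cell L t" and P: "P <= &&L - {centre t}" and Q: "Q <= &&L - {centre t}" "R <= Q" "R <= P"
 shows "coord (&&L) Q t (incl X (int (dm t)) P R (&&L) Q z) = 0"
proof -
 let ?k = "int (dm t)" let ?c = "{centre t}"
 have tS: "t : S" using t L by (auto simp: free_cell_def subcx_def)
 have "incl X ?k (&&L) Q (&&L) (&&L - ?c) (incl X ?k P R (&&L) Q z) =
   incl X ?k (&&L - ?c) (&&L - ?c) (&&L) (&&L - ?c) (incl X ?k P R (&&L - ?c) (&&L - ?c) z)"
  using P Q by (subst incl_incl, blast, blast, blast, blast) (subst incl_incl, blast, blast, blast, blast, rule refl)
 also have "... = e1 (RH X ?k (&&L) (&&L - ?c))"
  using vanishesD[OF vanishes_self incl_closed] incl_one by metis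
 also have "... = incl X ?k t (t - ?c) (&&L) (&&L - ?c) (e1 (RH X ?k t (t - ?c)))" by simp
 finally have "coord (&&L) Q t (incl X ?k P R (&&L) Q z) = cell_iso t (e1 (RH X ?k t (t - ?c)))"
  by (intro coord_eqI[OF L t]) (simp_all add: group.is_monoid)
 thus ?thesis using additive_on_one[OF _ cell_iso(1)[OF tS]] by simp
qed

lemma coord_additive:
 assumes L: "subcx L" and t: "free_cell L t"
 shows "addi (RH X (int (dm t)) (&&L) Q) (coord (&&L) Q t)"
 unfolding addi_def
proof (intro ballI)
 let ?k = "int (dm t)" let ?c = "{centre t}" let ?i = "incl X ?k t (t - ?c) (&&L) (&&L - ?c)"
 have tS: "t : S" using t L by (auto simp: free_cell_def subcx_def)
 fix x y assume xy: "x : car (RH X ?k (&&L) Q)" "y : car (RH X ?k (&&L) Q)"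
 obtain v where v: "v : car (RH X ?k t (t - ?c))" "?i v = incl X ?k (&&L) Q (&&L) (&&L - ?c) x" "coord (&&L) Q t x = cell_iso t v"
  using coord_witness[OF L t] by blast
 obtain w where w: "w : car (RH X ?k t (t - ?c))" "?i w = incl X ?k (&&L) Q (&&L) (&&L - ?c) y" "coord (&&L) Q t y = cell_iso t w"
  using coord_witness[OF L t] by blast
 have c: "v *[RH X ?k t (t - ?c)] w : car (RH X ?k t (t - ?c))"
  using v(1) w(1) by simp
 have "?i (v *[RH X ?k t (t - ?c)] w) = incl X ?k (&&L) Q (&&L) (&&L - ?c) (x *[RH X ?k (&&L) Q] y)"
  unfolding incl_mult[OF v(1) w(1)] incl_mult[OF xy] v(2) w(2) ..
 hence "coord (&&L) Q t (x *[RH X ?k (&&L) Q] y) = cell_iso t (v *[RH X ?k t (t - ?c)] w)"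
  by (rule coord_eqI[OF L t c])
 thus "coord (&&L) Q t (x *[RH X ?k (&&L) Q] y) = coord (&&L) Q t x + coord (&&L) Q t y"
  using additive_onD[OF cell_iso(1)[OF tS] v(1) w(1)] v(3) w(3) by simp
qed

lemma attach_cell:
 assumes L: "subcx L" and t: "free_cell L t"
 shows "VU j L (L - {t}) <-> j ~= int (dm t)"
  "bij_betw (coord (&&L) (&&(L - {t})) t) (car (RU (int (dm t)) L (L - {t}))) UNIV"
proof -
 let ?c = "{centre t}" and ?k = "int (dm t)"
 have tL: "t : L" "t : S" using t L by (auto simp: free_cell_def subcx_def)
 have c: "centre t : t" by (rule centre[OF tL(2)])
 have s: "&&(L - {t}) <= &&L - ?c" "&&(L - {t}) - ?c = &&(L - {t})" using Union_remove[OF L tL(1)] c by auto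
 have v: "vanishes X p (&&L - ?c) (&&(L - {t}))" for p
  using attach_vanishes[OF L t, of "centre t" p] c cell_sub_cl[OF tL(2)] s(2) by auto
 have b: "bij_betw (incl X p (&&L) (&&(L - {t})) (&&L) (&&L - ?c)) (car (RU p L (L - {t}))) (car (RH X p (&&L) (&&L - ?c)))" for p
  by (rule incl_iso_absolute[OF s(1) _ v]) auto
 show "VU j L (L - {t}) <-> j ~= int (dm t)"
  using vanishes_iso[OF b] vanishes_iso[OF coord_excision[OF L t]] cell_local(1)[OF tL(2)] by metis
 have "bij_betw (cell_iso t o (inv_into (car (RH X ?k t (t - ?c))) (incl X ?k t (t - ?c) (&&L) (&&L - ?c)) o
   incl X ?k (&&L) (&&(L - {t})) (&&L) (&&L - ?c))) (car (RU ?k L (L - {t}))) UNIV"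
  by (rule bij_betw_trans[OF bij_betw_trans[OF b bij_betw_inv_into[OF coord_excision[OF L t]]] cell_iso(2)[OF tL(2)]])
 thus "bij_betw (coord (&&L) (&&(L - {t})) t) (car (RU ?k L (L - {t}))) UNIV"
  by (simp add: coord_def comp_def cong: bij_betw_cong)
qed

lemma maximal_free_cell:
 assumes "subcx L" "subcx M" "M <= L" "t : L - M" "!!e. e : L - M ==> dm e <= dm t"
 shows "free_cell L t"
 unfolding free_cell_def
proof (intro conjI ballI impI)
 fix e assume e: "e : L" "t <= cl e"
 have "e ~: M" using assms e by (auto simp: subcx_def)
 hence "dm e <= dm t" using assms e by auto
 thus "e = t" using face_dim[of e t] assms e by (force simp: subcx_def)
qed (use assms in auto)

lemma subcomplex_induct [consumes 3, case_names base attach]: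
 assumes "subcx L" "subcx M" "M <= L" and base: "P M"
  and attach: "!!L t. subcx L ==> M <= L ==> t : L - M ==> free_cell L t ==> (!!e. e : L - M ==> dm e <= dm t) ==>
   subcx (L - {t}) ==> M <= L - {t} ==> P (L - {t}) ==> P L"
 shows "P L"
 using assms(1,3)
proof (induction "card L" arbitrary: L rule: less_induct)
 case less
 have fin: "finite L" using less.prems finS finite_subset by (auto simp: subcx_def)
 show ?case
 proof (cases "L = M")
  case False
  hence f: "finite (dm ` (L - M))" "dm ` (L - M) ~= {}" using fin less.prems by auto
  obtain t where t: "t : L - M" "dm t = Max (dm ` (L - M))" using Max_in[OF f] by fastforce
  hence t: "t : L - M" "!!e. e : L - M ==> dm e <= dm t" using Max_ge[OF f(1)] by auto
  have f: "free_cell L t" by (rule maximal_free_cell[OF less.prems(1) assms(2) less.prems(2) t])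
  have s: "subcx (L - {t})" by (rule subcomplex_remove[OF less.prems(1) f])
  have M: "M <= L - {t}" using t less.prems by blast
  have card: "card (L - {t}) < card L" by (rule card_Diff1_less[OF fin]) (use t in blast)
  show ?thesis
   by (rule attach[OF less.prems t(1) f t(2) s M less.hyps[OF card s M]])
 qed (use base in simp)
qed

lemma cellular_vanishes:
 assumes "subcx L" "subcx M" "M <= L" "!!e. e : L - M ==> int (dm e) ~= j"
 shows "VU j L M"
 using assms
proof (induction rule: subcomplex_induct)
 case base show ?case by (rule vanishes_self)
next
 case (attach L t)
 show ?case
  by (rule vanishes_triple[OF _ _ attach_cell(1)[OF attach(1,4), THEN iffD2] attach.IH])
   (use attach.prems[OF attach(3)] attach(7) attach.prems in auto)
qed

lemma coords:
 assumes "subcx L" "subcx M" "M <= L" "!!e. e : L - M ==> int (dm e) = k"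
 shows "int_coords (RU k L M) (L - M) (%z t. if t : L - M then coord (&&L) (&&M) t z else 0)"
 using assms
proof (induction rule: subcomplex_induct)
 case base
 show ?case using vanishesD[OF vanishes_self] by (auto simp: int_coords_def addi_def intro!: exI[of _ "e1 (RU k M M)"] monoid.one_closed group.is_monoid)
next
 case (attach L t)
 let ?L0 = "L - {t}" and ?G = "RU k L M"
 have dimt: "int (dm t) = k" by (rule attach.prems[OF attach(3)])
 have M: "subcx M" by fact
 have cM: "centre s : s" "s Int &&M = {}" if "s : L - M" for s
 proof -
  have s: "s : S" "s : L" "s ~: M" and MS: "M <= S" using that attach(1) M by (auto simp: subcx_def)
  show "centre s : s" by (rule centre[OF s(1)])
  have "s Int c = {}" if "c : M" for c using disjoint[of s c] s MS that by blast
  thus "s Int &&M = {}" by blast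
 qed
 have sub: "&&M <= &&?L0" "&&?L0 <= &&L" using attach by auto
 have free: "free_cell L s" if "s : L - M" for s
  by (rule maximal_free_cell[OF attach(1) M attach(2) that]) (use attach that in "metis of_nat_eq_iff order_refl")
 have free0: "free_cell ?L0 s" if "s : ?L0 - M" for s
  using free[of s] that by (auto simp: free_cell_def)
 have IH: "int_coords (RU k ?L0 M) (?L0 - M) (%z s. if s : ?L0 - M then coord (&&?L0) (&&M) s z else 0)"
  by (rule attach.IH) (use attach in blast)
 have nat0: "coord (&&L) (&&M) s (IU k ?L0 M L M z) = coord (&&?L0) (&&M) s z" if s: "s : ?L0 - M" for s z
 proof -
  have sk: "k = int (dm s)" using attach s by blast
  show ?thesis unfolding sk
   by (rule coord_natural[OF attach(6) free0[OF s] attach(1) free]) (use s cM[of s] sub in auto)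
 qed
 have nat1: "coord (&&L) (&&?L0) t (IU k L M L ?L0 z) = coord (&&L) (&&M) t z" for z
  unfolding dimt[symmetric]
  by (rule coord_natural[OF attach(1,4,1,4)]) (use attach(3) cM[of t] sub Union_remove[OF attach(1), of t] in auto)
 have out: "coord (&&L) (&&M) t (IU k ?L0 M L M z) = 0" for z
  unfolding dimt[symmetric]
  by (rule coord_outside[OF attach(1,4)]) (use attach(3) cM[of t] sub Union_remove[OF attach(1), of t] in auto)
 have add: "addi ?G (coord (&&L) (&&M) s)" if "s : L - M" for s
  using coord_additive[OF attach(1) free[OF that]] attach.prems[OF that] by simp
 have top: "bij_betw (coord (&&L) (&&?L0) t) (car (RU k L ?L0)) UNIV"
  using attach_cell(2)[OF attach(1,4)] by (simp add: dimt)
 have addt: "addi (RU k L ?L0) (coord (&&L) (&&?L0) t)"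
  using coord_additive[OF attach(1,4)] by (simp add: dimt)
 show ?case
  unfolding int_coords_def
 proof (intro conjI allI ballI impI)
  show "finite (L - M)" using attach(1) finS finite_subset by (auto simp: subcx_def)
  show "addi ?G (%x. if s : L - M then coord (&&L) (&&M) s x else 0)" for s
  proof (cases "s : L - M")
   case True
   thus ?thesis using add by simp
  next
   case False
   show ?thesis unfolding if_not_P[OF False] by (simp add: addi_def)
  qed
  show "(if s : L - M then coord (&&L) (&&M) s x else 0) = 0" if "s ~: L - M" for s x by (rule if_not_P[OF that])
  fix z assume z: "z : car ?G" and 0: "ALL s:L - M. (if s : L - M then coord (&&L) (&&M) s z else 0) = 0"
  let ?z = "IU k L M L ?L0 z"
  have "coord (&&L) (&&?L0) t ?z = 0" using nat1 0 attach(3) by simp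
  moreover have "coord (&&L) (&&?L0) t (e1 (RU k L ?L0)) = 0" by (rule additive_on_one[OF group_rel_hom addt])
  ultimately have "?z = e1 (RU k L ?L0)"
   using bij_betw_imp_inj_on[OF top] by (metis (no_types, lifting) inj_onD incl_closed group.is_monoid group_rel_hom monoid.one_closed)
  from triple_exact_3(2)[OF sub z this] obtain w where w: "w : car (RU k ?L0 M)" "z = IU k ?L0 M L M w" by blast
  have "w = e1 (RU k ?L0 M)"
  proof (rule int_coordsD(4)[OF IH w(1)])
   show "(if s : ?L0 - M then coord (&&?L0) (&&M) s w else 0) = 0" if "s : ?L0 - M" for s
    using nat0[OF that, of w] 0 that w(2) by auto
  qed
  thus "z = e1 ?G" using w(2) by simp
 next
  fix n :: "'a set => int"
  obtain y where y: "y : car (RU k L ?L0)" "coord (&&L) (&&?L0) t y = n t"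
  proof -
   have "n t : coord (&&L) (&&?L0) t ` car (RU k L ?L0)" by (simp add: bij_betw_imp_surj_on[OF top])
   then obtain y where "n t = coord (&&L) (&&?L0) t y" "y : car (RU k L ?L0)" by (rule imageE)
   thus ?thesis by (intro that[of y]) simp_all
  qed
  have "VU (k - 1) ?L0 M"
   by (rule cellular_vanishes[OF attach(6) M attach(7)]) (use attach.prems in fastforce)
  from incl_surj[OF sub this y(1)] obtain z1 where z1: "z1 : car ?G" "y = IU k L M L ?L0 z1" by blast
  obtain w where w: "w : car (RU k ?L0 M)"
   "ALL s:?L0 - M. (if s : ?L0 - M then coord (&&?L0) (&&M) s w else 0) = n s - coord (&&L) (&&M) s z1"
   using int_coordsD(5)[OF IH, of "%s. n s - coord (&&L) (&&M) s z1"] by blast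
  let ?w = "IU k ?L0 M L M w"
  show "EX x:car ?G. ALL s:L - M. (if s : L - M then coord (&&L) (&&M) s x else 0) = n s"
  proof (intro bexI[of _ "z1 *[?G] ?w"] ballI)
   show "z1 *[?G] ?w : car ?G" using z1(1) by simp
   fix s assume s: "s : L - M"
   have "coord (&&L) (&&M) s (z1 *[?G] ?w) = coord (&&L) (&&M) s z1 + coord (&&L) (&&M) s ?w"
    by (rule additive_onD[OF add[OF s] z1(1)]) simp
   also have "... = n s"
   proof (cases "s = t")
    case True
    thus ?thesis using out[of w] nat1[of z1] y(2) z1(2) by simp
   next
    case False
    hence "s : ?L0 - M" using s by auto
    thus ?thesis using nat0 w(2) by auto
   qed
   finally show "(if s : L - M then coord (&&L) (&&M) s (z1 *[?G] ?w) else 0) = n s" using s by simp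
  qed
 qed
qed

lemma top_separated:
 assumes "subcx L" "subcx M" "M <= L" "!!e. e : L - M ==> int (dm e) <= k"
 shows "int_separated (RU k L M)"
proof -
 let ?K = "M Un {e : L. int (dm e) <= k - 1}"
 have K: "subcx ?K" "M <= ?K" "?K <= L"
  by (rule subcomplex_Un[OF assms(2) subcomplex_skeleton[OF assms(1)]]) (use assms(3) in auto)
 have v: "VU k ?K M" by (rule cellular_vanishes[OF K(1) assms(2) K(2)]) auto
 have "int_coords (RU k L ?K) (L - ?K) (%z t. if t : L - ?K then coord (&&L) (&&?K) t z else 0)"
  by (rule coords[OF assms(1) K(1,3)]) (use assms(4) in fastforce)
 hence sep: "int_separated (RU k L ?K)" by (rule int_coords_separated)
 have inj: "inj_on (IU k L M L ?K) (car (RU k L M))"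
  by (rule incl_inj[OF _ _ v]) (use K in auto)
 show ?thesis
  unfolding int_separated_def
 proof (intro ballI impI)
  fix x assume x: "x : car (RU k L M)"
   and h: "ALL f :: _ => int. addi (RU k L M) f --> f x = 0"
  let ?i = "IU k L M L ?K"
  have "?i x = e1 (RU k L ?K)"
  proof -
   have "f (?i x) = 0" if p: "addi (RU k L ?K) f" for f :: "_ => int"
   proof -
    have "addi (RU k L M) (%y. f (?i y))"
     using p incl_mult[of _ X k "&&L" "&&M"] by (simp add: addi_def)
    thus ?thesis using h by blast
   qed
   thus ?thesis using sep incl_closed unfolding int_separated_def by blast
  qed
  hence "?i x = ?i (e1 (RU k L M))" by simp
  thus "x = e1 (RU k L M)"
   by (rule inj_onD[OF inj _ x RH_one])
 qed
qed

end

lemma group_complex_filtration: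
 assumes "!!q. F q <= F (q + 1)"
 shows "group_complex (%q. RH X q (F q) (F (q - 1))) (%q. bdry X q (F q) (F (q - 1)) (F (q - 2)))"
proof (rule group_complex.intro)
 have F: "F (q - 1) <= F q" "F (q - 2) <= F (q - 1)" for q using assms[of "q - 1"] assms[of "q - 2"] by simp_all
 show "comm_group (RH X q (F q) (F (q - 1)))" for q by simp
 show "bdry X q (F q) (F (q - 1)) (F (q - 2)) : hom (RH X q (F q) (F (q - 1))) (RH X (q - 1) (F (q - 1)) (F (q - 1 - 1)))" for q
  using bdry_hom[OF F(1), where X = X and p = q and C = "F (q - 2)"] by simp
 fix q x
 assume x: "x : car (RH X (q + 1) (F (q + 1)) (F (q + 1 - 1)))"
 have m: "F (q - 2) <= F (q - 1)" "F (q - 1) <= F q" "F q <= F (q + 1)" using F[of q] assms[of q] by simp_all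
 have "bdry X (q + 1) (F (q + 1)) (F q) (F (q - 1)) x = incl X q (F q) (F (q - 2)) (F q) (F (q - 1)) (bdry X (q + 1) (F (q + 1)) (F q) (F (q - 2)) x)"
  using bdry_incl[of "F (q + 1)" "F (q + 1)" "F q" "F q" "F (q - 2)" "F (q - 1)" X "q + 1" x] m incl_id x by simp
 thus "bdry X q (F q) (F (q - 1)) (F (q - 2)) (bdry X (q + 1) (F (q + 1)) (F (q + 1 - 1)) (F (q + 1 - 2)) x) = e1 (RH X (q - 1) (F (q - 1)) (F (q - 1 - 1)))"
  using triple_exact_1(1)[OF m(1,2), of "bdry X (q + 1) (F (q + 1)) (F q) (F (q - 2)) x" X q] m(3) bdry_closed[OF m(3), where X = X and p = "q + 1"] by (simp add: diff_diff_eq)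
qed

lemma filtration_corr:
 assumes F: "A <= F2" "F2 <= F1" "F1 <= F0" "F0 <= F'"
  and v: "vanishes X (q - 1) F2 A" "vanishes X q F1 A" "vanishes X q F' F0"
 shows "corr_grp (RH X q F0 F1) {z : car (RH X q F0 F1). bdry X q F0 F1 F2 z = e1 (RH X (q - 1) F1 F2)} (bdry X (q + 1) F' F0 F1 ` car (RH X (q + 1) F' F0)) (RH X q F' A)
   (%z x. EX w:car (RH X q F0 A). z = incl X q F0 A F0 F1 w & x = incl X q F0 A F' A w)"
proof (rule group_corrI)
 have A1: "A <= F1" "A <= F0" using F by auto
 have b: "bdry X q F0 F1 F2 z = incl X (q - 1) F1 A F1 F2 (bdry X q F0 F1 A z)" if "z : car (RH X q F0 F1)" for z
  using bdry_incl[of F0 F0 F1 F1 A F2 X q z] F incl_id that by simp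
 have b': "bdry X (q + 1) F' F0 F1 y = incl X q F0 A F0 F1 (bdry X (q + 1) F' F0 A y)" if "y : car (RH X (q + 1) F' F0)" for y
  using bdry_incl[of F' F' F0 F0 A F1 X "q + 1" y] F incl_id that A1 by simp
 have bc: "bdry X (q + 1) F' F0 A y : car (RH X q F0 A)" for y
  using bdry_closed[OF F(4), where X = X and p = "q + 1" and C = A and x = y] by simp
 let ?R = "%z x. EX w:car (RH X q F0 A). z = incl X q F0 A F0 F1 w & x = incl X q F0 A F' A w"
 fix z x assume "?R z x"
 then obtain w where w: "w : car (RH X q F0 A)" "z = incl X q F0 A F0 F1 w" "x = incl X q F0 A F' A w" by blast
 have "bdry X q F0 F1 F2 z = e1 (RH X (q - 1) F1 F2)"
  using b[of z] w triple_exact_1(1)[OF A1(1) F(3) w(1)] by simp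
 thus "z : {z : car (RH X q F0 F1). bdry X q F0 F1 F2 z = e1 (RH X (q - 1) F1 F2)}" using w by simp
 show "x : car (RH X q F' A)" using w by simp
 show "x : {e1 (RH X q F' A)}" if h: "z : bdry X (q + 1) F' F0 F1 ` car (RH X (q + 1) F' F0)"
 proof -
  obtain y where y: "y : car (RH X (q + 1) F' F0)" "z = bdry X (q + 1) F' F0 F1 y" using h by blast
  hence "incl X q F0 A F0 F1 w = incl X q F0 A F0 F1 (bdry X (q + 1) F' F0 A y)" using b' w by simp
  hence "w = bdry X (q + 1) F' F0 A y"
   using inj_onD[OF incl_inj[OF A1(1) F(3) v(2)]] w(1) bc by blast
  thus ?thesis using triple_exact_2(1)[OF A1(2) F(4) y(1)] w(3) by simp
 qed
 show "z : bdry X (q + 1) F' F0 F1 ` car (RH X (q + 1) F' F0)" if h: "x : {e1 (RH X q F' A)}"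
 proof -
  have "EX y:car (RH X (q + 1) F' F0). w = bdry X (q + 1) F' F0 A y"
   using triple_exact_2(2)[OF A1(2) F(4), of w X "q + 1"] w h by simp
  thus ?thesis using b' w(2) by blast
 qed
next
 let ?R = "%z x. EX w:car (RH X q F0 A). z = incl X q F0 A F0 F1 w & x = incl X q F0 A F' A w"
 fix z x z' x' assume "?R z x" "?R z' x'"
 then obtain w w' where w: "w : car (RH X q F0 A)" "z = incl X q F0 A F0 F1 w" "x = incl X q F0 A F' A w"
  "w' : car (RH X q F0 A)" "z' = incl X q F0 A F0 F1 w'" "x' = incl X q F0 A F' A w'" by blast
 thus "?R (z *[RH X q F0 F1] z') (x *[RH X q F' A] x')"
  by (intro bexI[of _ "w *[RH X q F0 A] w'"]) (simp_all add: incl_mult)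
next
 have A1: "A <= F1" "A <= F0" using F by auto
 fix z assume "z : {z : car (RH X q F0 F1). bdry X q F0 F1 F2 z = e1 (RH X (q - 1) F1 F2)}"
 hence z: "z : car (RH X q F0 F1)" "bdry X q F0 F1 F2 z = e1 (RH X (q - 1) F1 F2)" by auto
 have "incl X (q - 1) F1 A F1 F2 (bdry X q F0 F1 A z) = incl X (q - 1) F1 A F1 F2 (e1 (RH X (q - 1) F1 A))"
  using bdry_incl[of F0 F0 F1 F1 A F2 X q z] F incl_id[OF z(1)] z(2) by simp
 hence "bdry X q F0 F1 A z = e1 (RH X (q - 1) F1 A)"
  using inj_onD[OF incl_inj[OF F(1,2) v(1)]] bdry_closed[OF F(3)] RH_one by blast
 from triple_exact_1(2)[OF A1(1) F(3) z(1) this]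
 show "EX x. EX w:car (RH X q F0 A). z = incl X q F0 A F0 F1 w & x = incl X q F0 A F' A w" by blast
next
 have A1: "A <= F1" "A <= F0" using F by auto
 fix x assume x: "x : car (RH X q F' A)"
 show "EX z. EX w:car (RH X q F0 A). z = incl X q F0 A F0 F1 w & x = incl X q F0 A F' A w"
  using incl_surj'[OF A1(2) F(4) v(3) x] by blast
qed

context finite_cells
begin

definition skel :: "'a set set => 'a set set => int => 'a set set" where
 "skel L A q = A Un {e : L. int (dm e) <= q}"

lemma subcomplex_skel: "subcx L ==> subcx A ==> subcx (skel L A q)"
 unfolding skel_def by (intro subcomplex_Un subcomplex_skeleton)

lemma skel_mono: "q <= q' ==> skel L A q <= skel L A q'" by (auto simp: skel_def)

abbreviation CH :: "'a set set => 'a set set => int => 'a chain set monoid" where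
 "CH L A q == RU q (skel L A q) (skel L A (q - 1))"

abbreviation cbd :: "'a set set => 'a set set => int => 'a chain set => 'a chain set" where
 "cbd L A q == BU q (skel L A q) (skel L A (q - 1)) (skel L A (q - 2))"

abbreviation "ZL L A q == {z : car (CH L A q). cbd L A q z = e1 (CH L A (q - 1))}"
abbreviation "BL L A q == cbd L A (q + 1) ` car (CH L A (q + 1))"

definition cells :: "'a set set => 'a set set => int => 'a set set" where
 "cells L A q = {e : L - A. int (dm e) = q}"

definition ccoord :: "'a set set => 'a set set => int => 'a chain set => 'a set => int" where
 "ccoord L A q z t = (if t : cells L A q then coord (&&(skel L A q)) (&&(skel L A (q - 1))) t z else 0)"

lemma cells_skel: "skel L A q - skel L A (q - 1) = cells L A q"
 by (auto simp: skel_def cells_def)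

lemma chain_coords:
 assumes "subcx L" "subcx A"
 shows "int_coords (CH L A q) (cells L A q) (ccoord L A q)"
proof -
 have "int_coords (CH L A q) (skel L A q - skel L A (q - 1))
   (%z t. if t : skel L A q - skel L A (q - 1) then coord (&&(skel L A q)) (&&(skel L A (q - 1))) t z else 0)"
  by (rule coords[OF subcomplex_skel[OF assms] subcomplex_skel[OF assms] skel_mono]) (auto simp: cells_skel cells_def)
 thus ?thesis unfolding cells_skel ccoord_def[abs_def] .
qed

lemma skel_free:
 assumes "subcx L" "subcx A" "t : cells L A q"
 shows "free_cell (skel L A q) t"
 by (rule maximal_free_cell[OF subcomplex_skel[OF assms(1,2), of q] subcomplex_skel[OF assms(1,2), of "q - 1"]])
  (use assms in "auto simp: cells_skel cells_def skel_def")

lemma skel_centre: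
 assumes "subcx L" "subcx A" "t : cells L A q"
 shows "&&(skel L A (q - 1)) <= &&(skel L A q) - {centre t}"
proof -
 have t: "t : S" "t ~: skel L A (q - 1)" using assms by (auto simp: cells_def subcx_def skel_def)
 have "centre t ~: &&(skel L A (q - 1))"
  using cell_unique[OF t(1) _ centre[OF t(1)]] t(2) subcomplex_skel[OF assms(1,2), of "q - 1"] by (auto simp: subcx_def)
 moreover have "&&(skel L A (q - 1)) <= &&(skel L A q)" by (intro Union_mono skel_mono) simp
 ultimately show ?thesis by blast
qed

lemma chain_coord_incl:
 assumes L: "subcx L" "subcx A" and L': "subcx L'" "subcx A'" and sub: "L <= L'" "A <= A'"
  and t: "t : cells L' A' q" and A: "A <= L"
 shows "ccoord L' A' q (IU q (skel L A q) (skel L A (q - 1)) (skel L' A' q) (skel L' A' (q - 1)) z) t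
   = ccoord L A q z t"
proof -
 have q: "q = int (dm t)" "t ~: A'" "t : S" using t L' by (auto simp: cells_def subcx_def)
 have m: "skel L A r <= skel L' A' r" for r using sub by (auto simp: skel_def)
 show ?thesis
 proof (cases "t : L")
  case True
  hence tc: "t : cells L A q" using q sub by (auto simp: cells_def)
  show ?thesis
   using coord_natural[OF subcomplex_skel[OF L] skel_free[OF L tc] subcomplex_skel[OF L'] skel_free[OF L' t] m Union_mono[OF m] skel_centre[OF L tc] skel_centre[OF L' t]]
   using q(1) t tc by (simp add: ccoord_def)
 next
  case False
  hence "t ~: skel L A q" using A by (auto simp: skel_def)
  hence "centre t ~: &&(skel L A q)"
   using cell_unique[OF q(3) _ centre[OF q(3)]] subcomplex_skel[OF L, of q] by (auto simp: subcx_def)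
  hence "&&(skel L A q) <= &&(skel L' A' q) - {centre t}" using Union_mono[OF m[of q]] by blast
  hence "coord (&&(skel L' A' q)) (&&(skel L' A' (q - 1))) t (IU (int (dm t)) (skel L A q) (skel L A (q - 1)) (skel L' A' q) (skel L' A' (q - 1)) z) = 0"
   by (intro coord_outside[OF subcomplex_skel[OF L'] skel_free[OF L' t] _ skel_centre[OF L' t]] Union_mono m skel_mono) auto
  thus ?thesis using t False q(1) by (simp add: ccoord_def cells_def)
 qed
qed

definition ccells :: "'a set => 'a set set" where "ccells t = {e : S. e <= cl t}"

definition gen :: "'a set => 'a chain set" where
 "gen t = (SOME g. g : car (CH (ccells t) {} (int (dm t))) &
   (ALL s:cells (ccells t) {} (int (dm t)). ccoord (ccells t) {} (int (dm t)) g s = (if s = t then 1 else 0)))"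

lemma subcomplex_closed_cells: "t : S ==> subcx (ccells t)"
 unfolding ccells_def by (rule subcomplex_closure)

lemma gen:
 assumes t: "t : S"
 shows "gen t : car (CH (ccells t) {} (int (dm t)))"
  "ccoord (ccells t) {} (int (dm t)) (gen t) s = (if s = t then 1 else 0)"
proof -
 let ?K = "ccells t" and ?q = "int (dm t)"
 note co = chain_coords[OF subcomplex_closed_cells[OF t] subcomplex_empty, of ?q]
 have tc: "t : cells ?K {} ?q" using t cell_sub_cl by (auto simp: cells_def ccells_def)
 have "EX g. g : car (CH ?K {} ?q) & (ALL s:cells ?K {} ?q. ccoord ?K {} ?q g s = (if s = t then 1 else 0))"
  using int_coordsD(5)[OF co, of "%s. if s = t then 1 else 0"] by blast
 from someI_ex[OF this] have *: "gen t : car (CH ?K {} ?q)"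
  "!!s. s : cells ?K {} ?q ==> ccoord ?K {} ?q (gen t) s = (if s = t then 1 else 0)" unfolding gen_def by blast+
 show "gen t : car (CH ?K {} ?q)" by fact
 show "ccoord ?K {} ?q (gen t) s = (if s = t then 1 else 0)"
  using *(2)[of s] tc by (cases "s : cells ?K {} ?q") (auto simp: ccoord_def)
qed

text \<open>The incidence numbers are read off from the closed cell, so that the same matrix computes the
  boundary in every pair of subcomplexes.\<close>

definition inc :: "'a set => 'a set => int" where
 "inc t s = (if t : S then ccoord (ccells t) {} (int (dm t) - 1) (cbd (ccells t) {} (int (dm t)) (gen t)) s else 0)"

lemma inc_supp: "inc t s ~= 0 ==> t : S & s : S & s <= cl t & dm t = Suc (dm s)"
 by (auto simp: inc_def ccoord_def cells_def ccells_def split: if_splits)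

lemma chain_bd_closed: "cbd L A q z : car (CH L A (q - 1))"
 using bdry_closed[OF Union_mono[OF skel_mono[of "q - 1" q L A]], where X = X and p = q and C = "&&(skel L A (q - 2))" and x = z] by (simp add: diff_diff_eq)

lemma chain_bd_hom: "cbd L A q : hom (CH L A q) (CH L A (q - 1))"
 using bdry_hom[OF Union_mono[OF skel_mono[of "q - 1" q L A]], where X = X and p = q and C = "&&(skel L A (q - 2))"] by (simp add: diff_diff_eq)

lemma chain_bd_coord:
 assumes L: "subcx L" "subcx A" "A <= L" and z: "z : car (CH L A q)" and s: "s : cells L A (q - 1)"
 shows "ccoord L A (q - 1) (cbd L A q z) s = (SUM t:cells L A q. inc t s * ccoord L A q z t)"
proof -
 note co = chain_coords[OF L(1,2)]
 define g where "g t = IU q (skel (ccells t) {} q) (skel (ccells t) {} (q - 1)) (skel L A q) (skel L A (q - 1)) (gen t)" for t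
 have g: "g t : car (CH L A q)" "ccoord L A q (g t) r = (if r = t then 1 else 0)"
  "ccoord L A (q - 1) (cbd L A q (g t)) s = inc t s" if t: "t : cells L A q" for t r
 proof -
  have tS: "t : S" "q = int (dm t)" using t L by (auto simp: cells_def subcx_def)
  have K: "subcx (ccells t)" "ccells t <= L" using subcomplex_closed_cells[OF tS(1)] t L(1) by (auto simp: ccells_def cells_def subcx_def)
  show "g t : car (CH L A q)" by (simp add: g_def)
  show "ccoord L A q (g t) r = (if r = t then 1 else 0)"
  proof (cases "r : cells L A q")
   case True
   thus ?thesis unfolding g_def
    using chain_coord_incl[OF K(1) subcomplex_empty L(1,2) K(2) empty_subsetI True empty_subsetI] gen(2)[OF tS(1)] tS(2) by simp
  next
   case False
   thus ?thesis using t by (auto simp: ccoord_def)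
  qed
  have m: "skel (ccells t) {} r <= skel L A r" for r using K(2) by (auto simp: skel_def)
  have "cbd L A q (g t) = IU (q - 1) (skel (ccells t) {} (q - 1)) (skel (ccells t) {} (q - 1 - 1)) (skel L A (q - 1)) (skel L A (q - 1 - 1))
    (cbd (ccells t) {} q (gen t))"
   unfolding g_def using bdry_incl[OF Union_mono[OF m[of q]] Union_mono[OF m[of "q - 1"]] Union_mono[OF m[of "q - 2"]]
     Union_mono[OF skel_mono[of "q - 1" q]] Union_mono[OF skel_mono[of "q - 1" q]], where X = X and p = q]
   by (simp add: diff_diff_eq)
  thus "ccoord L A (q - 1) (cbd L A q (g t)) s = inc t s"
   using chain_coord_incl[OF K(1) subcomplex_empty L(1,2) K(2) empty_subsetI s empty_subsetI] tS by (simp add: inc_def)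
 qed
 have F: "addi (CH L A q) (%z. real_of_int (ccoord L A (q - 1) (cbd L A q z) s))"
 proof -
  have "addi (CH L A (q - 1)) (%z. ccoord L A (q - 1) z s)" by (rule int_coordsD(2)[OF co])
  thus ?thesis
   using hom_mult[OF chain_bd_hom[where L = L and A = A and q = q]] chain_bd_closed[where L = L and A = A and q = q] by (simp add: addi_def)
 qed
 have "real_of_int (ccoord L A (q - 1) (cbd L A q z) s) =
   (SUM t:cells L A q. ccoord L A q z t *z real_of_int (ccoord L A (q - 1) (cbd L A q (g t)) s))"
  by (rule int_coords_expand[OF comm_group_rel_hom co F]) (use g z in auto)
 also have "... = of_int (SUM t:cells L A q. inc t s * ccoord L A q z t)"
  by (simp add: g(3) mult.commute)
 finally show ?thesis using of_int_eq_iff by blast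
qed

lemma chain_group_complex: "group_complex (CH L A) (cbd L A)"
 using group_complex_filtration[of "%q. &&(skel L A q)" X] Union_mono[OF skel_mono] by (simp add: skel_mono)

lemma inc_inc:
 shows "(SUM t:S. inc r t * inc t s) = 0"
proof (cases "r : S & s : S & dm r = Suc (Suc (dm s))")
 case False
 have "inc r t * inc t s = 0" for t using False inc_supp[of r t] inc_supp[of t s] by force
 thus ?thesis by (intro sum.neutral ballI)
next
 case True
 let ?q = "int (dm r)"
 interpret group_complex "CH S {}" "cbd S {}" by (rule chain_group_complex)
 note L = subcomplex_all subcomplex_empty
 have rc: "r : cells S {} ?q" "s : cells S {} (?q - 1 - 1)" using True by (auto simp: cells_def)
 obtain z where z: "z : car (CH S {} ?q)" "!!t. t : cells S {} ?q ==> ccoord S {} ?q z t = (if t = r then 1 else 0)"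
  using int_coordsD(5)[OF chain_coords[OF L], of ?q "%t. if t = r then 1 else 0"] by blast
 have fin: "finite (cells S {} q)" for q using finS by (auto simp: cells_def)
 have 1: "ccoord S {} (?q - 1) (cbd S {} ?q z) t = inc r t" if "t : cells S {} (?q - 1)" for t
  using chain_bd_coord[OF L _ z(1) that] rc(1) fin by (simp add: z(2) if_distrib[of "(*) _"] sum.delta cong: if_cong)
 have "cbd S {} (?q - 1) (cbd S {} ?q z) = e1 (CH S {} (?q - 1 - 1))"
  using dd[of z "?q - 1"] z(1) by simp
 hence "ccoord S {} (?q - 1 - 1) (cbd S {} (?q - 1) (cbd S {} ?q z)) s = 0"
  by (simp only: additive_on_one[OF group_rel_hom int_coordsD(2)[OF chain_coords[OF L]]])
 moreover have "ccoord S {} (?q - 1 - 1) (cbd S {} (?q - 1) (cbd S {} ?q z)) s = (SUM t:cells S {} (?q - 1). inc t s * inc r t)"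
  using chain_bd_coord[OF L _ chain_bd_closed rc(2)] 1 by simp
 moreover have "(SUM t:cells S {} (?q - 1). inc t s * inc r t) = (SUM t:S. inc r t * inc t s)"
 proof (rule sum.mono_neutral_cong_left[OF finS])
  show "ALL t:S - cells S {} (?q - 1). inc r t * inc t s = 0"
   using inc_supp[of r] by (force simp: cells_def)
 qed (auto simp: cells_def)
 ultimately show ?thesis by simp
qed

lemma pair_corr:
 assumes L: "subcx L" "subcx A" "A <= L"
 shows "EX R. corr_grp (CH L A q) (ZL L A q) (BL L A q) (RU q L A) R &
   (ALL z x. R z x --> (EX w:car (RU q (skel L A q) A). z = IU q (skel L A q) A (skel L A q) (skel L A (q - 1)) w &
    x = IU q (skel L A q) A L A w))"
proof -
 note sk = subcomplex_skel[OF L(1,2)]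
 have m: "A <= skel L A (q - 2)" "skel L A (q - 2) <= skel L A (q - 1)" "skel L A (q - 1) <= skel L A q" "skel L A q <= skel L A (q + 1)"
  "skel L A (q + 1) <= L" "A <= skel L A (q + 1)" using L(3) by (auto simp: skel_def)
 have v: "VU (q - 1) (skel L A (q - 2)) A" "VU q (skel L A (q - 1)) A" "VU q (skel L A (q + 1)) (skel L A q)"
  by (rule cellular_vanishes[OF sk L(2) m(1)], force simp: skel_def)
   (rule cellular_vanishes[OF sk L(2)], use m in blast, force simp: skel_def, rule cellular_vanishes[OF sk sk m(4)], force simp: skel_def)
 let ?F1 = "&&(skel L A (q + 1))"
 let ?R = "%z x. EX w:car (RU q (skel L A q) A). z = IU q (skel L A q) A (skel L A q) (skel L A (q - 1)) w & x = incl X q (&&(skel L A q)) (&&A) ?F1 (&&A) w"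
 have 1: "corr_grp (CH L A q) (ZL L A q) (BL L A q) (RH X q ?F1 (&&A)) ?R"
  using filtration_corr[OF Union_mono[OF m(1)] Union_mono[OF m(2)] Union_mono[OF m(3)] Union_mono[OF m(4)] v] by (simp add: diff_diff_eq)
 have w: "vanishes X q (&&L) ?F1" "vanishes X (q + 1) (&&L) ?F1"
  by (rule cellular_vanishes[OF L(1) sk m(5)], force simp: skel_def)+
 let ?i = "incl X q ?F1 (&&A) (&&L) (&&A)"
 have inj: "inj_on ?i (car (RH X q ?F1 (&&A)))" by (rule incl_inj'[OF Union_mono[OF m(6)] Union_mono[OF m(5)] w(2)])
 have surj: "EX x:car (RH X q ?F1 (&&A)). y = ?i x" if "y : car (RU q L A)" for y
  by (rule incl_surj'[OF Union_mono[OF m(6)] Union_mono[OF m(5)] w(1) that])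
 have 2: "corr_grp (RH X q ?F1 (&&A)) (car (RH X q ?F1 (&&A))) {e1 (RH X q ?F1 (&&A))} (RU q L A) (%x y. x : car (RH X q ?F1 (&&A)) & y = ?i x)"
  using surj inj_onD[OF inj, of _ "e1 (RH X q ?F1 (&&A))"]
  by (intro group_corrI) (auto simp: incl_mult)
 have ii: "?i (incl X q (&&(skel L A q)) (&&A) ?F1 (&&A) w) = IU q (skel L A q) A L A w" for w
  by (rule incl_incl[OF Union_mono[OF m(4)] order_refl Union_mono[OF m(5)] order_refl])
 show ?thesis
 proof (intro exI conjI allI impI)
  show "corr_grp (CH L A q) (ZL L A q) (BL L A q) (RU q L A)
   (%z y. EX x. ?R z x & (x : car (RH X q ?F1 (&&A)) & y = ?i x))"
   by (rule group_corr_trans[OF 1 2])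
 qed (use ii in force)
qed

lemma inc_exact:
 assumes L: "subcx L" "subcx A" "A <= L" and v: "VU q L A"
  and n: "!!s. s : cells L A (q - 1) ==> (SUM t:cells L A q. inc t s * n t) = 0"
 shows "EX k. ALL t:cells L A q. n t = (SUM r:cells L A (q + 1). inc r t * k r)"
proof -
 obtain R where R: "corr_grp (CH L A q) (ZL L A q) (BL L A q) (RU q L A) R"
  using pair_corr[OF L] by blast
 note co = chain_coords[OF L(1,2)]
 obtain z where z: "z : car (CH L A q)" "!!t. t : cells L A q ==> ccoord L A q z t = n t"
  using int_coordsD(5)[OF co, of q n] by blast
 have "cbd L A q z = e1 (CH L A (q - 1))"
 proof (rule int_coordsD(4)[OF co chain_bd_closed])
  show "ccoord L A (q - 1) (cbd L A q z) s = 0" if "s : cells L A (q - 1)" for s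
   using chain_bd_coord[OF L z(1) that] n[OF that] by (simp add: z(2))
 qed
 then obtain x where x: "R z x" using group_corrD(5)[OF R, of z] z by blast
 hence "x = e1 (RU q L A)" using group_corrD(2)[OF R x] vanishesD[OF v] by blast
 then obtain y where y: "y : car (CH L A (q + 1))" "z = cbd L A (q + 1) y" using group_corrD(3)[OF R x] by blast
 have "n t = (SUM r:cells L A (q + 1). inc r t * ccoord L A (q + 1) y r)" if t: "t : cells L A q" for t
  using chain_bd_coord[OF L y(1), of t] t z(2)[OF t] y(2) by simp
 thus ?thesis by blast
qed

end

lemma hom_induced_homotopy:
 assumes "cmap (ptop (top_of_set {0..1::real}) X) Y (%(t, x). H t x)"
  and "!!t x. t : {0..1} ==> x : A ==> H t x : B"
 shows "hom_induced p X A Y B (H 0) = hom_induced p X A Y B (H 1)"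
proof (rule homology_homotopy_axiom)
 show "homotopic_with (%h. h : A \<rightarrow> B) X Y (H 0) (H 1)"
  unfolding homotopic_with_def by (intro exI[of _ "%(t, x). H t x"]) (use assms in auto)
qed

lemma hom_induced_straight_line:
 fixes f g :: "'a => 'b::real_normed_vector"
 assumes f: "cmap X euclidean f" and g: "cmap X euclidean g"
  and nz: "!!t x. 0 <= t ==> t <= 1 ==> x : A ==> (1 - t) *R f x + t *R g x ~= 0"
 shows "hom_induced p X A euclidean (- {0}) f = hom_induced p X A euclidean (- {0}) g"
proof -
 let ?I = "top_of_set {0..1::real}" and ?P = "%(t, u, v). (1 - t) *R u + t *R v :: 'b"
 have 1: "cmap (ptop ?I X) euclideanreal fst"
  using continuous_map_fst[of ?I X] continuous_map_into_fulltopology by blast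
 have 2: "cmap (ptop ?I X) euclidean (f o snd)" "cmap (ptop ?I X) euclidean (g o snd)"
  by (rule continuous_map_compose[OF continuous_map_snd f] continuous_map_compose[OF continuous_map_snd g])+
 have 3: "cmap (ptop ?I X) euclidean (%z. (fst z, (f o snd) z, (g o snd) z))"
  using continuous_map_pairedI[OF 1 continuous_map_pairedI[OF 2]] by simp
 have "continuous_on UNIV ?P" by (auto simp: case_prod_unfold intro!: continuous_intros)
 hence "cmap euclidean euclidean ?P" by simp
 from continuous_map_compose[OF 3 this]
 have "cmap (ptop ?I X) euclidean (%(t, x). (1 - t) *R f x + t *R g x)"
  by (simp add: comp_def case_prod_unfold)
 from hom_induced_homotopy[OF this, of A "- {0}" p] nz show ?thesis by (simp add: eta_contract_eq)
qed

definition local_group :: "'b::real_normed_vector itself => int => 'b chain set monoid" where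
 "local_group T p = RH euclidean p UNIV (- {0})"

definition act :: "int => ('b::real_normed_vector => 'b) => 'b chain set => 'b chain set" where
 "act p f = hom_induced p euclidean (- {0}) euclidean (- {0}) f"

lemma act_closed: "act p f z : car (local_group T p)"
 by (simp add: act_def local_group_def RH_def hom_induced_carrier)

lemma act_id: "z : car (local_group T p) ==> act p (%x. x) z = z"
 using hom_induced_id[of z p euclidean "- {0}"] by (simp add: act_def local_group_def RH_def id_def)

lemma act_compose:
 assumes "continuous_on UNIV f" "continuous_on UNIV g" "!!x. x ~= 0 ==> f x ~= 0" "!!x. x ~= 0 ==> g x ~= 0"
 shows "act p (f o g) z = act p f (act p g z)"
 using hom_induced_compose'[of euclidean euclidean g "- {0}" "- {0}" euclidean f "- {0}" p z] assms by (simp add: act_def Pi_iff)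

lemma act_homotopy:
 fixes H :: "real => 'b::real_normed_vector => 'b"
 assumes "continuous_on ({0..1} >< UNIV) (%(t, x). H t x)" "!!t x. t : {0..1} ==> x ~= 0 ==> H t x ~= 0"
 shows "act p (H 0) = act p (H 1)"
proof -
 have "ptop (top_of_set {0..1}) (euclidean :: 'b topology) = top_of_set ({0..1::real} >< UNIV)"
  using prod_topology_subtopology_eu[of "{0..1::real}" "UNIV :: 'b set"] by simp
 thus ?thesis
  unfolding act_def using assms by (intro hom_induced_homotopy) auto
qed

definition refl :: "'b::real_inner => 'b => 'b" where "refl v x = x - (2 * (v \<bullet> x) / (v \<bullet> v)) *R v"

lemma refl_refl: "v ~= 0 ==> refl v (refl v x) = x"
 by (simp add: refl_def inner_diff_right algebra_simps)

lemma refl_nonzero: "v ~= 0 ==> x ~= 0 ==> refl v x ~= 0"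
 using refl_refl[of v x] by (auto simp: refl_def)

lemma refl_scale: "c ~= 0 ==> refl (c *R v) = refl v"
 by (auto simp: refl_def fun_eq_iff)

lemma refl_continuous: "continuous_on UNIV (refl v)"
 unfolding refl_def[abs_def] by (cases "v = 0") (auto intro!: continuous_intros)

lemma act_refl:
 assumes "v ~= 0" "w ~= 0"
 shows "act p (refl v) = act p (refl w)"
proof (cases "EX t:{0..1}. (1 - t) *R v + t *R w = 0")
 case True
 then obtain t where t: "t : {0..1}" "(1 - t) *R v = (- t) *R w" by (auto simp: add_eq_0_iff)
 hence "t ~= 0" "t ~= 1" using assms by auto
 hence "refl v = refl ((1 - t) *R v)" "refl w = refl ((- t) *R w)" using refl_scale by (metis add.inverse_neutral diff_0 eq_iff_diff_eq_0 minus_minus)+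
 thus ?thesis using t by simp
next
 case False
 let ?v = "%t. (1 - t) *R v + t *R w"
 have "act p (refl (?v 0)) = act p (refl (?v 1))"
 proof (rule act_homotopy)
  show "continuous_on ({0..1} >< UNIV) (%(t, x). refl (?v t) x)"
   unfolding refl_def case_prod_unfold using False by (intro continuous_intros) auto
 qed (use False refl_nonzero in blast)
 thus ?thesis by simp
qed

definition sign_flip :: "'m set => real^'m => real^'m" where "sign_flip J x = (\<chi> i. if i : J then - x $ i else x $ i)"

lemma refl_axis:
 fixes x :: "real^'m"
 shows "refl (axis j 1) x = (\<chi> i. if i = j then - x $ i else x $ i)"
proof -
 have "axis j 1 \<bullet> x = x $ j" "axis j 1 \<bullet> axis j (1::real) = 1" by (simp_all add: inner_axis')
 thus ?thesis by (simp add: refl_def vec_eq_iff) (simp add: axis_def)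
qed

lemma act_refl_twice: "e ~= 0 ==> z : car (local_group T p) ==> act p (refl e) (act p (refl e) z) = z"
 using act_compose[of "refl e" "refl e" p z] refl_nonzero[of e] refl_continuous[of e] refl_refl[of e] act_id[of z T p]
 by (simp add: comp_def)

lemma act_sign_flip:
 fixes J :: "'m::finite set" and e :: "real^'m"
 assumes e: "e ~= 0" and z: "z : car (local_group T p)"
 shows "act p (sign_flip J) z = (if even (card J) then z else act p (refl e) z)"
 using finite[of J]
proof (induction J)
 case empty
 have "sign_flip {} = (%x. x :: real^'m)" by (simp add: sign_flip_def fun_eq_iff)
 thus ?case using act_id[OF z] by simp
next
 case (insert j J)
 have eq: "sign_flip (insert j J) = refl (axis j 1) o sign_flip J"
  using insert(2) by (auto simp: fun_eq_iff sign_flip_def refl_axis vec_eq_iff)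
 have "linear (sign_flip J)" by (auto simp: linear_iff sign_flip_def vec_eq_iff)
 hence c: "continuous_on UNIV (sign_flip J)" by (simp add: linear_continuous_on linear_conv_bounded_linear)
 have nz: "sign_flip J x ~= 0" if "x ~= 0" for x using that by (auto simp: sign_flip_def vec_eq_iff split: if_splits)
 have a: "axis j (1::real) ~= 0" by (simp add: axis_eq_0_iff)
 have "act p (sign_flip (insert j J)) z = act p (refl (axis j 1)) (act p (sign_flip J) z)"
  unfolding eq by (rule act_compose) (use c nz refl_nonzero[OF a] refl_continuous in auto)
 also have "... = act p (refl e) (act p (sign_flip J) z)" using act_refl[OF a e] by simp
 finally have 1: "act p (sign_flip (insert j J)) z = act p (refl e) (act p (sign_flip J) z)" .
 have "act p (refl e) (act p (refl e) z) = z" by (rule act_refl_twice[OF e z])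
 thus ?case using insert 1 by simp
qed

lemma act_linear:
 fixes f :: "real^'m => real^'m" and e :: "real^'m"
 assumes lin: "linear f" and e: "e ~= 0"
 shows "(det (matrix f) > 0 --> (ALL z:car (local_group TYPE(real^'m) p). act p f z = z)) &
  (det (matrix f) < 0 --> (ALL z:car (local_group TYPE(real^'m) p). act p f z = act p (refl e) z))"
proof -
 let ?C = "car (local_group TYPE(real^'m) p)"
 define P where "P f <-> linear f & (det (matrix f) > 0 --> (ALL z:?C. act p f z = z)) &
  (det (matrix f) < 0 --> (ALL z:?C. act p f z = act p (refl e) z))" for f :: "real^'m => real^'m"
 have nz: "f x ~= 0" if "linear f" "det (matrix f) ~= 0" "x ~= 0" for f :: "real^'m => real^'m" and x
  using that det_nz_iff_inj[of f] linear_injective_0[of f] by auto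
 have cont: "continuous_on UNIV f" if "linear f" for f :: "real^'m => real^'m"
  using that by (simp add: linear_continuous_on linear_conv_bounded_linear)
 note rr = act_refl_twice[OF e]
 have diag_det: "matrix (%x :: real^'m. \<chi> i. c i * x $ i) = (\<chi> i j. if i = j then c i else 0)" for c
  by (simp add: matrix_def vec_eq_iff axis_def)
 have "P f"
 proof (rule induct_linear_elementary[OF lin])
  fix f g :: "real^'m => real^'m"
  assume fg: "linear f" "linear g" "P f" "P g"
  have d: "det (matrix (f o g)) = det (matrix f) * det (matrix g)" by (simp add: matrix_compose[OF fg(2,1)] det_mul)
  have c: "act p (f o g) z = act p f (act p g z)" if "det (matrix (f o g)) ~= 0" for z
   by (rule act_compose) (use cont fg nz that d in auto)
  have cl: "act p g z : ?C" "act p (refl e) z : ?C" for z by (rule act_closed)+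
  have "act p (f o g) z = z" if h: "det (matrix (f o g)) > 0" and z: "z : ?C" for z
  proof -
   consider "det (matrix f) > 0" "det (matrix g) > 0" | "det (matrix f) < 0" "det (matrix g) < 0"
    using h unfolding d zero_less_mult_iff by blast
   thus ?thesis by cases (use c[of z] h fg(3,4) z cl rr in "simp_all add: P_def")
  qed
  moreover have "act p (f o g) z = act p (refl e) z" if h: "det (matrix (f o g)) < 0" and z: "z : ?C" for z
  proof -
   consider "det (matrix f) > 0" "det (matrix g) < 0" | "det (matrix f) < 0" "det (matrix g) > 0"
    using h unfolding d mult_less_0_iff by blast
   thus ?thesis by cases (use c[of z] h fg(3,4) z cl in "simp_all add: P_def")
  qed
  ultimately show "P (f o g)" unfolding P_def using fg by (simp add: linear_compose)
 next
  fix f :: "real^'m => real^'m" and i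
  assume f: "linear f" "!!x. f x $ i = 0"
  have "row i (matrix f) = 0" by (simp add: row_def matrix_def vec_eq_iff f(2))
  hence "det (matrix f) = 0" by (rule det_zero_row)
  thus "P f" using f(1) by (simp add: P_def)
 next
  fix c :: "'m => real"
  let ?f = "%x :: real^'m. \<chi> i. c i * x $ i" and ?J = "{i. c i < 0}"
  have lf: "linear ?f" by (auto simp: linear_iff vec_eq_iff algebra_simps)
  have dt: "det (matrix ?f) = (PROD i:UNIV. c i)" by (simp add: diag_det det_diagonal)
  show "P ?f"
  proof (cases "EX i. c i = 0")
   case True
   hence "det (matrix ?f) = 0" unfolding dt by simp
   thus ?thesis using lf by (simp add: P_def)
  next
   case False
   have a: "act p ?f = act p (sign_flip ?J)"
    unfolding act_def
   proof (rule hom_induced_straight_line)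
    show "cmap euclidean euclidean ?f" using cont[OF lf] by simp
    have "linear (sign_flip ?J)" by (auto simp: linear_iff sign_flip_def vec_eq_iff)
    thus "cmap euclidean euclidean (sign_flip ?J)" using cont by simp
    fix t :: real and x :: "real^'m" assume t: "0 <= t" "t <= 1" and x: "x : - {0}"
    then obtain i where i: "x $ i ~= 0" by (auto simp: vec_eq_iff)
    define k where "k = (1 - t) * c i + t * (if c i < 0 then -1 else 1)"
    have "k ~= 0"
    proof (cases "c i < 0")
     case True
     hence "(1 - t) * c i <= 0" using t by (simp add: mult_le_0_iff)
     thus ?thesis using t True by (cases "t = 0") (auto simp: k_def)
    next
     case cp: False
     hence "c i > 0" using False by (metis linorder_neqE_linordered_idom)
     obtain s where s: "s = (1 - t) * c i" by blast
     hence "s >= 0" "k = s + t" using t `c i > 0` cp by (simp_all add: k_def)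
     moreover have "s > 0" if "t = 0" using that s `c i > 0` by simp
     ultimately have "k > 0" using t by linarith
     thus ?thesis by simp
    qed
    moreover have "((1 - t) *R ?f x + t *R sign_flip ?J x) $ i = k * x $ i"
     by (simp add: sign_flip_def k_def algebra_simps)
    ultimately show "(1 - t) *R ?f x + t *R sign_flip ?J x ~= 0" using i by (metis mult_eq_0_iff zero_index)
   qed
   have "(PROD i:UNIV. c i) = (PROD i:UNIV. \<bar>c i\<bar> * (if i : ?J then -1 else 1))" by (rule prod.cong) auto
   also have "... = (PROD i:UNIV. \<bar>c i\<bar>) * (- 1) ^ card ?J"
    by (simp add: prod.distrib prod.If_cases)
   finally have "det (matrix ?f) = (PROD i:UNIV. \<bar>c i\<bar>) * (- 1) ^ card ?J" unfolding dt .
   moreover have "(PROD i:UNIV. \<bar>c i\<bar>) > 0" using False by (intro prod_pos) auto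
   ultimately show ?thesis
    unfolding P_def a using lf act_sign_flip[OF e, of _ _ p ?J] by (cases "even (card ?J)") auto
  qed
 next
  fix m n :: 'm assume mn: "m ~= n"
  let ?f = "%x :: real^'m. \<chi> i. x $ Transposition.transpose m n i"
  have lf: "linear ?f" by (auto simp: linear_iff vec_eq_iff)
  have "matrix ?f = (\<chi> i. mat 1 $ Transposition.transpose m n i)" by (simp add: matrix_def vec_eq_iff mat_def axis_def)
  hence "det (matrix ?f) = of_int (sign (Transposition.transpose m n)) * det (mat 1 :: real^'m^'m)"
   by (simp only: det_permute_rows[OF permutes_swap_id[OF UNIV_I UNIV_I]])
  hence dt: "det (matrix ?f) = -1" using mn by (simp add: sign_swap_id)
  have ne: "axis m 1 - axis n (1::real) ~= 0" using mn by (simp add: axis_eq_axis)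
  have "?f = refl (axis m 1 - axis n 1)"
  proof
   fix x
   have a0: "axis m (1::real) $ n = 0" "axis n (1::real) $ m = 0" using mn by (simp_all add: axis_def)
   have "(axis m 1 - axis n 1) \<bullet> x = x $ m - x $ n" "(axis m 1 - axis n (1::real)) \<bullet> (axis m 1 - axis n 1) = 2"
    using a0 by (simp_all add: inner_diff_left inner_axis')
   hence "refl (axis m 1 - axis n 1) x = x - (x $ m - x $ n) *R (axis m 1 - axis n 1)"
    by (simp add: refl_def)
   also have "... = ?f x" using mn by (simp add: vec_eq_iff axis_def Transposition.transpose_def)
   finally show "?f x = refl (axis m 1 - axis n 1) x" ..
  qed
  thus "P ?f" unfolding P_def using lf dt act_refl[OF ne e] by simp
 next
  fix m n :: 'm assume mn: "m ~= n"
  let ?g = "%t x :: real^'m. x + (t * x $ n) *R axis m 1"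
  let ?f = "%x :: real^'m. \<chi> i. if i = m then x $ m + x $ n else x $ i"
  have lf: "linear ?f" by (auto simp: linear_iff vec_eq_iff algebra_simps)
  have "matrix ?f = (\<chi> i. if i = m then row m (mat 1) + 1 *s row n (mat 1) else row i (mat 1))"
   by (auto simp: matrix_def vec_eq_iff mat_def axis_def row_def)
  hence dt: "det (matrix ?f) = 1" using det_row_operation[OF mn, of "mat 1" 1] by simp
  have "act p (?g 0) = act p (?g 1)"
  proof (rule act_homotopy)
   show "continuous_on ({0..1} >< UNIV) (%(t, x). ?g t x)"
    unfolding case_prod_unfold by (intro continuous_intros)
   fix t :: real and x :: "real^'m" assume x: "x ~= 0"
   show "?g t x ~= 0"
   proof
    assume g0: "?g t x = 0"
    have "x $ i = 0" if "i ~= m" for i using arg_cong[OF g0, of "%v. v $ i"] that by (simp add: axis_def)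
    moreover from this have "x $ m = 0" using arg_cong[OF g0, of "%v. v $ m"] mn by simp
    ultimately show False using x by (metis vec_eq_iff zero_index)
   qed
  qed
  moreover have "?g 0 = (%x. x)" "?g 1 = ?f" by (auto simp: vec_eq_iff fun_eq_iff axis_def)
  ultimately have "act p ?f z = z" if "z : ?C" for z using act_id[OF that] by simp
  thus "P ?f" unfolding P_def using lf dt by simp
 qed
 thus ?thesis unfolding P_def by blast
qed

lemma act_det_pos:
 fixes f :: "real^'m => real^'m"
 assumes "linear f" "det (matrix f) > 0" "z : car (local_group TYPE(real^'m) p)"
 shows "act p f z = z"
 using act_linear[OF assms(1), of "axis undefined 1" p] assms(2,3) by (auto simp: axis_eq_0_iff)

lemma local_group_real:
 "vanishes (euclidean :: (real^'m) topology) j UNIV (- {0}) <-> j ~= int CARD('m)"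
 "infinite_cyclic (local_group TYPE(real^'m) (int CARD('m)))"
proof -
 let ?E = "EU CARD('m)" and ?z = "%_::nat. 0::real"
 obtain f :: "(nat => real) => real^'m" and g where fg: "homeomorphic_maps (EU DIM(real^'m)) euclidean f g"
  using homeomorphic_maps_Euclidean_space_euclidean by blast
 hence h: "homeomorphic_map ?E euclidean f" using homeomorphic_maps_map by fastforce
 have tr: "homeomorphic_map euclidean euclidean (%y. y - f ?z)"
  using homeomorphic_map_maps[of euclidean euclidean "%y. y - f ?z"]
  by (auto simp: homeomorphic_maps_def intro!: exI[of _ "%y. y + f ?z"] continuous_intros)
 let ?h = "(%y. y - f ?z) o f"
 have hh: "homeomorphic_map ?E euclidean ?h" by (rule homeomorphic_map_compose[OF h tr])
 have s: "?h ` tsp ?E = UNIV" "inj_on ?h (tsp ?E)" "?z : tsp ?E"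
  using homeomorphic_imp_surjective_map[OF hh] homeomorphic_imp_injective_map[OF hh] by (auto simp: topspace_Euclidean_space)
 have "?h ` (tsp ?E - {?z}) = ?h ` tsp ?E - ?h ` {?z}"
  using s by (intro inj_on_image_set_diff[OF s(2)]) auto
 hence im: "?h ` (tsp ?E - {?z}) = - {0}" unfolding s(1) by auto
 have "homeomorphic_map (subtop ?E UNIV) (subtop euclidean UNIV) ?h" using hh by simp
 note H = rel_hom_homeo[OF this _ im]
 show "vanishes (euclidean :: (real^'m) topology) j UNIV (- {0}) <-> j ~= int CARD('m)"
  using vanishes_iso[OF H(2), of j] euclidean_local(1)[of "CARD('m)" j] by auto
 show "infinite_cyclic (local_group TYPE(real^'m) (int CARD('m)))"
  unfolding local_group_def using infinite_cyclic_iso[OF H] euclidean_local(2)[of "CARD('m)"] by auto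
qed

abbreviation (input) mm where "mm (B :: ('a set >< ('a => real^'m)) set) == int CARD('m)"
abbreviation (input) "RW W B X Y == RH W (mm B) X Y"
abbreviation (input) "IW W B X Y Z V == incl W (mm B) X Y Z V"

locale oriented_manifold =
 fixes W :: "'a topology" and \<A> :: "('a set >< ('a => real^'m)) set"
 assumes oriented: "oriented_smooth_manifold W \<A>"
begin

abbreviation M :: "'a set" where "M == tsp W"

abbreviation loc :: "int => 'a set => 'a set => ('a => real^'m) => 'a chain set => (real^'m) chain set" where
 "loc p B A h == hom_induced p (subtop W B) A euclidean (- {0}) h"

lemma Hausdorff: "Hausdorff_space W" using oriented by (simp add: oriented_smooth_manifold_def)

lemma chartD:
 assumes "(U, f) : \<A>"
 shows "openin W U" "open (f ` U)" "homeomorphic_map (subtop W U) (top_of_set (f ` U)) f" "U <= M"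
  "inj_on f U" "cmap (subtop W U) euclidean f"
proof -
 have c: "chart W (U, f)" using oriented assms by (auto simp: oriented_smooth_manifold_def)
 thus o: "openin W U" "open (f ` U)" and h: "homeomorphic_map (subtop W U) (top_of_set (f ` U)) f"
  by (auto simp: chart_def)
 show s: "U <= M" using o(1) openin_subset by blast
 show "inj_on f U" using homeomorphic_imp_injective_map[OF h] s by (simp add: Int_absorb1)
 show "cmap (subtop W U) euclidean f"
  using homeomorphic_imp_continuous_map[OF h] continuous_map_into_fulltopology by blast
qed

lemma chart_exists: "x : M ==> EX U f. (U, f) : \<A> & x : U"
 using oriented by (fastforce simp: oriented_smooth_manifold_def)

lemma chart_preimage:
 assumes "(U, f) : \<A>" "open V"
 shows "openin W {y : U. f y : V}"
proof -
 note c = chartD[OF assms(1)]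
 have "openin (subtop W U) {y : tsp (subtop W U). f y : V}"
  by (rule openin_continuous_map_preimage[OF c(6)]) (use assms in auto)
 thus ?thesis using openin_trans_full[OF _ c(1)] c(4) by (simp add: Int_absorb1)
qed

lemma loc_incl:
 assumes "cmap (subtop W U) euclidean h" "B <= U" "A' <= A" "!!y. y : A ==> h y ~= 0"
 shows "loc p U A h (incl W p B A' U A z) = loc p B A' h z"
 unfolding incl_def using hom_induced_compose'[OF continuous_id_sub[OF assms(2)] _ assms(1), of A' A "- {0}" p z] assms(3,4)
 by (simp add: Pi_iff subset_iff)

lemma chart_diff_continuous:
 assumes "(U, f) : \<A>" "B <= U"
 shows "cmap (subtop W B) euclidean (%y. f y - a)"
 by (intro continuous_map_diff continuous_map_from_subtopology_mono[OF chartD(6)[OF assms(1)] assms(2)]) simp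

lemma M_excision:
 assumes B: "openin W B" and x: "x : B"
 shows "bij_betw (incl W p B (B - {x}) M (M - {x})) (car (RH W p B (B - {x}))) (car (RH W p M (M - {x})))"
proof -
 have BM: "B <= M" using B openin_subset by blast
 have "closedin W {x}" using Hausdorff_imp_t1_space[OF Hausdorff] x BM by (auto simp: t1_space_closedin_singleton)
 hence "bij_betw (incl W p (M - (M - B)) (M - {x} - (M - B)) M (M - {x}))
   (car (RH W p (M - (M - B)) (M - {x} - (M - B)))) (car (RH W p M (M - {x})))"
  by (intro excision_closed) (use B x in auto)
 moreover have "M - (M - B) = B" "M - {x} - (M - B) = B - {x}" using BM by auto
 ultimately show ?thesis by simp
qed

lemma chart_local_iso:
 assumes c: "(U, f) : \<A>" and x: "x : U"
 shows "bij_betw (loc p U (U - {x}) (%y. f y - f x)) (car (RH W p U (U - {x}))) (car (local_group TYPE(real^'m) p))"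
proof -
 note cD = chartD[OF c]
 define h where "h = (%y. f y - f x)"
 let ?V = "h ` U"
 have tr: "homeomorphic_map euclidean euclidean (%y. y - f x)"
  using homeomorphic_map_maps[of euclidean euclidean "%y. y - f x"]
  by (auto simp: homeomorphic_maps_def intro!: exI[of _ "%y. y + f x"] continuous_intros)
 have hV: "?V = (%y. y - f x) ` f ` U" by (auto simp: h_def)
 have "homeomorphic_map (top_of_set (f ` U)) (top_of_set ?V) (%y. y - f x)"
  unfolding hV by (rule homeomorphic_map_subtopologies[OF tr]) simp
 from homeomorphic_map_compose[OF cD(3) this]
 have hh: "homeomorphic_map (subtop W U) (top_of_set ?V) h" by (simp add: h_def comp_def)
 have inj: "inj_on h U" using cD(5) by (auto simp: h_def inj_on_def)
 have im: "h ` (U - {x}) = ?V - {0}"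
  using inj_on_image_set_diff[OF inj, of U "{x}"] x by (simp add: h_def)
 note H = rel_hom_homeo[OF hh _ im, of p]
 have V_open: "open ?V" unfolding hV using open_translation_subtract[OF cD(2)] by simp
 have "bij_betw (incl euclidean p (UNIV - - ?V) (- {0} - - ?V) UNIV (- {0}))
   (car (RH euclidean p (UNIV - - ?V) (- {0} - - ?V))) (car (RH euclidean p UNIV (- {0})))"
  by (rule excision_closed) (use V_open x in "auto simp: h_def")
 moreover have "UNIV - - ?V = ?V" "- {0} - - ?V = ?V - {0}" by auto
 ultimately have ex: "bij_betw (incl euclidean p ?V (?V - {0}) UNIV (- {0})) (car (RH euclidean p ?V (?V - {0}))) (car (local_group TYPE(real^'m) p))"
  by (simp add: local_group_def)
 have nz: "h y ~= 0" if "y : U - {x}" for y using that inj_onD[OF inj, of y x] x by (auto simp: h_def)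
 have comp: "loc p U (U - {x}) h z = incl euclidean p ?V (?V - {0}) UNIV (- {0}) (hom_induced p (subtop W U) (U - {x}) (top_of_set ?V) (?V - {0}) h z)" for z
  unfolding incl_def
  using hom_induced_compose'[OF homeomorphic_imp_continuous_map[OF hh], of "U - {x}" "?V - {0}" "subtop euclidean UNIV" id "- {0}" p z] im nz
  by (simp add: Pi_iff)
 have "bij_betw (incl euclidean p ?V (?V - {0}) UNIV (- {0}) o hom_induced p (subtop W U) (U - {x}) (top_of_set ?V) (?V - {0}) h)
   (car (RH W p U (U - {x}))) (car (local_group TYPE(real^'m) p))"
  by (rule bij_betw_trans[OF H(2) ex]) (use cD(4) in auto)
 thus ?thesis unfolding h_def[symmetric] by (simp add: comp comp_def cong: bij_betw_cong)
qed

lemma change_of_chart: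
 assumes c: "(U, f) : \<A>" and c': "(U', f') : \<A>" and x: "x : U" "x : U'"
 shows "EX B. openin W B & x : B & B <= U Int U' &
  (ALL p z. loc p B (B - {x}) (%y. f y - f x) z = loc p B (B - {x}) (%y. f' y - f' x) z)"
proof -
 define s where "s = f' o inv_into U f"
 let ?a = "f x"
 define D where "D = frechet_derivative s (at ?a)"
 have comp: "smooth_map_on s (f ` (U Int U'))" "det (matrix D) > 0"
  using oriented c c' x unfolding oriented_smooth_manifold_def oriented_compatible_def D_def s_def by (fastforce simp: Let_def)+
 hence "C_k_on (Suc 0) s (f ` (U Int U'))" by (simp add: smooth_map_on_def)
 hence "s differentiable (at ?a)" using x by simp
 hence D: "(s has_derivative D) (at ?a)" using frechet_derivative_works D_def by blast
 have lin: "linear D" using D has_derivative_linear by blast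
 have "inj D" using comp(2) det_nz_iff_inj[OF lin] by simp
 then obtain k where k: "k > 0" "!!v. k * norm v <= norm (D v)" using linear_inj_bounded_below_pos[OF lin] by blast
 obtain d where d: "d > 0" "!!y. norm (y - ?a) < d ==> norm (s y - s ?a - D (y - ?a)) <= k / 2 * norm (y - ?a)"
  using D[unfolded has_derivative_at_alt] k(1) by (metis half_gt_zero)
 have Dc: "continuous_on UNIV D" using lin by (simp add: linear_continuous_on linear_conv_bounded_linear)
 define B where "B = {y : U. f y : ball ?a d} Int U'"
 have B: "openin W B" "x : B" "B <= U" "B <= U'"
  using chart_preimage[OF c, of "ball ?a d"] chartD(1)[OF c'] x d(1) unfolding B_def by auto
 have inv: "s (f y) = f' y" if "y : U" for y using that chartD(5)[OF c] by (simp add: s_def)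
 let ?h = "%y. f y - f x" and ?h' = "%y. f' y - f' x"
 have nz: "?h y ~= 0" if "y : B - {x}" for y
  using that B x inj_onD[OF chartD(5)[OF c], of y x] by auto
 have "loc p B (B - {x}) (D o ?h) = loc p B (B - {x}) ?h'" for p
 proof (rule hom_induced_straight_line)
  show "cmap (subtop W B) euclidean (D o ?h)"
   by (rule continuous_map_compose[OF chart_diff_continuous[OF c B(3)]]) (use Dc in simp)
  show "cmap (subtop W B) euclidean ?h'" by (rule chart_diff_continuous[OF c' B(4)])
  fix t :: real and y assume t: "0 <= t" "t <= 1" and y: "y : B - {x}"
  have "norm (f y - ?a) < d" using y by (auto simp: B_def dist_norm norm_minus_commute)
  from d(2)[OF this] have e: "norm (?h' y - D (?h y)) <= k / 2 * norm (?h y)" using inv y x B by auto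
  have "t * norm (?h' y - D (?h y)) <= 1 * (k / 2 * norm (?h y))" using t e by (intro mult_mono) auto
  also have "... < k * norm (?h y)" using k(1) nz[OF y] by simp
  also have "... <= norm (D (?h y))" by (rule k(2))
  finally have "norm (t *R (?h' y - D (?h y))) < norm (D (?h y))" using t by simp
  hence "D (?h y) ~= - (t *R (?h' y - D (?h y)))" by (metis norm_minus_cancel order_less_irrefl)
  hence "D (?h y) + t *R (?h' y - D (?h y)) ~= 0" by (simp add: eq_neg_iff_add_eq_0)
  moreover have "(1 - t) *R (D o ?h) y + t *R ?h' y = D (?h y) + t *R (?h' y - D (?h y))"
   by (simp add: algebra_simps)
  ultimately show "(1 - t) *R (D o ?h) y + t *R ?h' y ~= 0" by simp
 qed
 moreover have "loc p B (B - {x}) (D o ?h) z = loc p B (B - {x}) ?h z" for p z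
 proof -
  have "loc p B (B - {x}) (D o ?h) z = act p D (loc p B (B - {x}) ?h z)"
   unfolding act_def
   by (rule hom_induced_compose'[symmetric, OF chart_diff_continuous[OF c B(3)]])
    (use nz Dc `inj D` lin linear_injective_0 in auto)
  also have "... = loc p B (B - {x}) ?h z"
   by (rule act_det_pos[OF lin comp(2)]) (simp add: local_group_def RH_def hom_induced_carrier)
  finally show ?thesis .
 qed
 ultimately show ?thesis using B by (intro exI[of _ B]) (auto simp: Int_greatest)
qed

definition ps :: "(real^'m) chain set => int" where
 "ps = (SOME f. addi (local_group TYPE(real^'m) (mm \<A>)) f & bij_betw f (car (local_group TYPE(real^'m) (mm \<A>))) UNIV)"

lemma ps: "addi (local_group TYPE(real^'m) (mm \<A>)) ps" "bij_betw ps (car (local_group TYPE(real^'m) (mm \<A>))) UNIV"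
 using someI_ex[OF local_group_real(2)[unfolded infinite_cyclic_def]] by (auto simp: ps_def)

definition chart_at :: "'a => 'a set >< ('a => real^'m)" where
 "chart_at x = (SOME c. c : \<A> & x : fst c)"

definition om :: "'a => 'a chain set => int" where
 "om x z = (case chart_at x of (U, f) => ps (loc (mm \<A>) U (U - {x}) (%y. f y - f x)
   (inv_into (car (RW W \<A> U (U - {x}))) (IW W \<A> U (U - {x}) M (M - {x})) z)))"

lemma chart_at: "x : M ==> EX U f. chart_at x = (U, f) & (U, f) : \<A> & x : U"
proof -
 assume "x : M"
 hence "EX c. c : \<A> & x : fst c" using chart_exists[of x] by force
 from someI_ex[OF this] show ?thesis by (cases "chart_at x") (auto simp: chart_at_def)
qed

lemma om_eq:
 assumes c: "(U, f) : \<A>" and x: "x : U" and w: "w : car (RW W \<A> U (U - {x}))"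
 shows "om x (IW W \<A> U (U - {x}) M (M - {x}) w) = ps (loc (mm \<A>) U (U - {x}) (%y. f y - f x) w)"
proof -
 have xM: "x : M" using x chartD(4)[OF c] by blast
 obtain U0 f0 where c0: "chart_at x = (U0, f0)" "(U0, f0) : \<A>" "x : U0" using chart_at[OF xM] by blast
 obtain B where B: "openin W B" "x : B" "B <= U" "B <= U0"
  "!!p z. loc p B (B - {x}) (%y. f y - f x) z = loc p B (B - {x}) (%y. f0 y - f0 x) z"
  using change_of_chart[OF c c0(2) x c0(3)] by (metis le_inf_iff)
 let ?z = "IW W \<A> U (U - {x}) M (M - {x}) w"
 note ex = M_excision[OF _ _, of _ x "mm \<A>"]
 have "?z : IW W \<A> B (B - {x}) M (M - {x}) ` car (RW W \<A> B (B - {x}))"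
  unfolding bij_betw_imp_surj_on[OF ex[OF B(1,2)]] by (rule incl_closed)
 then obtain v where v: "?z = IW W \<A> B (B - {x}) M (M - {x}) v" "v : car (RW W \<A> B (B - {x}))" by (rule imageE)
 have up: "IW W \<A> V (V - {x}) M (M - {x}) (IW W \<A> B (B - {x}) V (V - {x}) v) = ?z" if "B <= V" "V <= M" for V
  unfolding v(1) using that by (intro incl_incl) auto
 have wv: "w = IW W \<A> B (B - {x}) U (U - {x}) v"
  by (rule inj_onD[OF bij_betw_imp_inj_on[OF ex[OF chartD(1)[OF c] x]] up[OF B(3) chartD(4)[OF c], symmetric] w]) simp
 have inv: "inv_into (car (RW W \<A> U0 (U0 - {x}))) (IW W \<A> U0 (U0 - {x}) M (M - {x})) ?z = IW W \<A> B (B - {x}) U0 (U0 - {x}) v"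
  using bij_betw_inv_into_left[OF ex[OF chartD(1)[OF c0(2)] c0(3)]] up[OF B(4) chartD(4)[OF c0(2)]] incl_closed by metis
 have nz: "f' y - f' x ~= 0" if "(V, f') : \<A>" "x : V" "y : V - {x}" for V f' y
  using that inj_onD[OF chartD(5)[OF that(1)], of y x] by auto
 have "loc (mm \<A>) U (U - {x}) (%y. f y - f x) w = loc (mm \<A>) B (B - {x}) (%y. f y - f x) v"
  unfolding wv by (rule loc_incl[OF chart_diff_continuous[OF c order_refl] B(3)]) (use B nz[OF c x] in blast)+
 moreover have "loc (mm \<A>) U0 (U0 - {x}) (%y. f0 y - f0 x) (IW W \<A> B (B - {x}) U0 (U0 - {x}) v) = loc (mm \<A>) B (B - {x}) (%y. f0 y - f0 x) v"
  by (rule loc_incl[OF chart_diff_continuous[OF c0(2) order_refl] B(4)]) (use B nz[OF c0(2,3)] in blast)+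
 ultimately show ?thesis by (simp add: om_def c0(1) inv B(5))
qed

lemma om_lift:
 assumes x: "x : M"
 obtains U f where "(U, f) : \<A>" "x : U"
  "!!z. z : car (RW W \<A> M (M - {x})) ==> EX w:car (RW W \<A> U (U - {x})). z = IW W \<A> U (U - {x}) M (M - {x}) w"
proof -
 obtain U f where c: "(U, f) : \<A>" "x : U" using chart_exists[OF x] by blast
 show ?thesis
  by (rule that[OF c]) (use bij_betw_imp_surj_on[OF M_excision[OF chartD(1)[OF c(1)] c(2)]] in blast)
qed

lemma om_additive:
 assumes x: "x : M"
 shows "addi (RW W \<A> M (M - {x})) (om x)"
proof -
 obtain U f where c: "(U, f) : \<A>" "x : U"
  and l: "!!z. z : car (RW W \<A> M (M - {x})) ==> EX w:car (RW W \<A> U (U - {x})). z = IW W \<A> U (U - {x}) M (M - {x}) w"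
  by (rule om_lift[OF x]) (rule that)
 let ?i = "IW W \<A> U (U - {x}) M (M - {x})" and ?l = "loc (mm \<A>) U (U - {x}) (%y. f y - f x)"
 have hom: "?l : hom (RW W \<A> U (U - {x})) (local_group TYPE(real^'m) (mm \<A>))"
  by (simp add: RH_def local_group_def hom_induced_hom)
 show ?thesis
  unfolding addi_def
 proof (intro ballI)
  fix z z' assume "z : car (RW W \<A> M (M - {x}))" "z' : car (RW W \<A> M (M - {x}))"
  then obtain w w' where w: "w : car (RW W \<A> U (U - {x}))" "z = ?i w" "w' : car (RW W \<A> U (U - {x}))" "z' = ?i w'"
   using l by meson
  have ww: "w *[RW W \<A> U (U - {x})] w' : car (RW W \<A> U (U - {x}))"
   using w by simp
  have "om x (z *[RW W \<A> M (M - {x})] z') = ps (?l (w *[RW W \<A> U (U - {x})] w'))"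
   unfolding w(2,4) incl_mult[OF w(1,3), symmetric] by (rule om_eq[OF c ww])
  also have "... = ps (?l w) + ps (?l w')"
   unfolding hom_mult[OF hom w(1,3)] by (rule additive_onD[OF ps(1)]) (rule hom_carrier[OF hom, THEN subsetD, OF imageI], rule w)+
  finally show "om x (z *[RW W \<A> M (M - {x})] z') = om x z + om x z'"
   unfolding w(2,4) om_eq[OF c w(1)] om_eq[OF c w(3)] .
 qed
qed

lemma om_bij:
 assumes x: "x : M"
 shows "bij_betw (om x) (car (RW W \<A> M (M - {x}))) UNIV"
proof -
 obtain U f where c: "chart_at x = (U, f)" "(U, f) : \<A>" "x : U" using chart_at[OF x] by blast
 have "bij_betw (ps o (loc (mm \<A>) U (U - {x}) (%y. f y - f x) o
   inv_into (car (RW W \<A> U (U - {x}))) (IW W \<A> U (U - {x}) M (M - {x})))) (car (RW W \<A> M (M - {x}))) UNIV"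
  by (rule bij_betw_trans[OF bij_betw_trans[OF bij_betw_inv_into[OF M_excision[OF chartD(1)[OF c(2)] c(3)]] chart_local_iso[OF c(2,3)]] ps(2)])
 thus ?thesis by (simp add: om_def c(1) comp_def cong: bij_betw_cong)
qed

lemma local_vanishes:
 assumes x: "x : M"
 shows "vanishes W j M (M - {x}) <-> j ~= (mm \<A>)"
proof -
 obtain U f where c: "(U, f) : \<A>" "x : U" using chart_exists[OF x] by blast
 have "vanishes W j U (U - {x}) <-> vanishes (euclidean :: (real^'m) topology) j UNIV (- {0})"
  using vanishes_iso[OF chart_local_iso[OF c, of j, unfolded local_group_def]] .
 thus ?thesis
  using vanishes_iso[OF M_excision[OF chartD(1)[OF c(1)] c(2)], of j] local_group_real(1)[where 'm='m, of j] by simp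
qed

lemma om_locally_constant:
 assumes K: "openin W K" and x: "x : K" and z: "z : car (RW W \<A> M (M - K))"
 shows "EX B. openin W B & x : B & B <= K &
  (ALL y:B. om y (IW W \<A> M (M - K) M (M - {y}) z) = om x (IW W \<A> M (M - K) M (M - {x}) z))"
proof -
 have "x : M" using K x openin_subset by blast
 then obtain U f where c: "(U, f) : \<A>" "x : U" using chart_exists by blast
 note cD = chartD[OF c(1)]
 let ?a = "f x"
 have "openin (subtop W U) (U Int K)" using K openin_subtopology by blast
 hence "openin (top_of_set (f ` U)) (f ` (U Int K))"
  using homeomorphic_map_openness_eq[OF cD(3)] by blast
 hence "open (f ` (U Int K))" using cD(2) openin_open_trans by blast
 then obtain r where r: "r > 0" "cball ?a r <= f ` (U Int K)" using open_contains_cball c(2) x by (metis IntI imageI)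
 define B where "B = {y : U. f y : ball ?a r}"
 define C where "C = {y : U. f y : cball ?a r}"
 have Bo: "openin W B" unfolding B_def by (rule chart_preimage[OF c(1) open_ball])
 have BC: "B <= C" "C <= U" "x : B" using r(1) c(2) by (auto simp: B_def C_def)
 have CK: "C <= K"
 proof
  fix y assume y: "y : C"
  then obtain y' where "y' : U Int K" "f y = f y'" using r(2) by (auto simp: C_def)
  thus "y : K" using inj_onD[OF cD(5), of y y'] y by (auto simp: C_def)
 qed
 have C_closed: "closedin W C"
 proof -
  obtain g where g: "homeomorphic_maps (subtop W U) (top_of_set (f ` U)) f g" using cD(3) homeomorphic_map_maps by blast
  hence gc: "cmap (top_of_set (f ` U)) (subtop W U) g" and gi: "!!y. y : U ==> g (f y) = y"
   using cD(4) by (auto simp: homeomorphic_maps_def)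
  have sub: "cball ?a r <= f ` U" using r(2) by blast
  hence "compactin (top_of_set (f ` U)) (cball ?a r)" by (simp add: compactin_subtopology)
  hence "compactin W (g ` cball ?a r)" using image_compactin[OF _ gc] by (auto simp: compactin_subtopology)
  moreover have "g ` cball ?a r = C" using sub gi by (force simp: C_def)
  ultimately show ?thesis using compactin_imp_closedin[OF Hausdorff] by simp
 qed
 have "bij_betw (IW W \<A> (M - (M - U)) (M - B - (M - U)) M (M - B))
   (car (RW W \<A> (M - (M - U)) (M - B - (M - U)))) (car (RW W \<A> M (M - B)))"
 proof (rule excision)
  have "closedin W (M - U)" using cD(1) by blast
  hence "subtop W M clo (M - U) = M - U" by (simp add: closure_of_closedin)
  also have "... <= M - C" using BC by auto
  also have "... <= subtop W M interior_of (M - B)" using BC C_closed by (intro interior_of_maximal) auto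
  finally show "subtop W M clo (M - U) <= subtop W M interior_of (M - B)" .
 qed auto
 moreover have "M - (M - U) = U" "M - B - (M - U) = U - B" using cD(4) by auto
 ultimately have ex: "bij_betw (IW W \<A> U (U - B) M (M - B)) (car (RW W \<A> U (U - B))) (car (RW W \<A> M (M - B)))" by simp
 have "IW W \<A> M (M - K) M (M - B) z : IW W \<A> U (U - B) M (M - B) ` car (RW W \<A> U (U - B))"
  unfolding bij_betw_imp_surj_on[OF ex] by (rule incl_closed)
 then obtain w where w: "IW W \<A> M (M - K) M (M - B) z = IW W \<A> U (U - B) M (M - B) w" "w : car (RW W \<A> U (U - B))" by (rule imageE)
 have val: "om y (IW W \<A> M (M - K) M (M - {y}) z) = ps (loc (mm \<A>) U (U - B) (%u. f u - f y) w)" if y: "y : B" for y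
 proof -
  have yU: "y : U" "y : K" using y BC CK by auto
  have "IW W \<A> M (M - K) M (M - {y}) z = IW W \<A> M (M - B) M (M - {y}) (IW W \<A> M (M - K) M (M - B) z)"
   using y BC CK by (subst incl_incl) auto
  also have "... = IW W \<A> U (U - {y}) M (M - {y}) (IW W \<A> U (U - B) U (U - {y}) w)"
   unfolding w(1) using y cD(4) by (subst incl_incl, blast, blast, blast, blast) (subst incl_incl, blast, blast, blast, blast, rule refl)
  finally have "om y (IW W \<A> M (M - K) M (M - {y}) z) = ps (loc (mm \<A>) U (U - {y}) (%u. f u - f y) (IW W \<A> U (U - B) U (U - {y}) w))"
   using om_eq[OF c(1) yU(1) incl_closed] by simp
  also have "loc (mm \<A>) U (U - {y}) (%u. f u - f y) (IW W \<A> U (U - B) U (U - {y}) w) = loc (mm \<A>) U (U - B) (%u. f u - f y) w"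
  proof (rule loc_incl[OF chart_diff_continuous[OF c(1) order_refl] order_refl])
   show "f u - f y ~= 0" if "u : U - {y}" for u using that yU(1) inj_onD[OF cD(5), of u y] by auto
  qed (use y in blast)
  finally show ?thesis .
 qed
 have same: "loc (mm \<A>) U (U - B) (%u. f u - f y) = loc (mm \<A>) U (U - B) (%u. f u - f x)" if y: "y : B" for y
 proof (rule hom_induced_straight_line)
  fix t :: real and u assume t: "0 <= t" "t <= 1" and u: "u : U - B"
  have "(1 - t) *R f y + t *R f x : ball ?a r"
   using y BC(3) t convex_ball[of ?a r] unfolding B_def convex_alt by auto
  moreover have "f u ~: ball ?a r" using u by (auto simp: B_def)
  moreover have "(1 - t) *R (f u - f y) + t *R (f u - f x) = f u - ((1 - t) *R f y + t *R f x)"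
   by (simp add: algebra_simps)
  ultimately show "(1 - t) *R (f u - f y) + t *R (f u - f x) ~= 0" by (metis eq_iff_diff_eq_0)
 qed (rule chart_diff_continuous[OF c(1) order_refl])+
 show ?thesis
 proof (intro exI conjI ballI)
  show "om y (IW W \<A> M (M - K) M (M - {y}) z) = om x (IW W \<A> M (M - K) M (M - {x}) z)" if "y : B" for y
   unfolding val[OF that] val[OF BC(3)] same[OF that] ..
 qed (use Bo BC CK in auto)
qed

end

definition point_space :: "unit topology" where "point_space = discrete_topology UNIV"

lemma topspace_point_space [simp]: "tsp point_space = UNIV" by (simp add: point_space_def)

lemma point_homology:
 "vanishes point_space j UNIV {} <-> j ~= 0" "infinite_cyclic (RH point_space 0 UNIV {})"
proof -
 let ?z = "%_::nat. 0::real"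
 have t0: "tsp (EU 0) = {?z}" by (auto simp: topspace_Euclidean_space)
 have tp: "tsp point_space = {()}" by (auto simp: point_space_def)
 have "homeomorphic_map (EU 0) point_space (%_. ())"
  using homeomorphic_map_maps[of "EU 0" point_space "%_. ()"]
  by (auto simp: homeomorphic_maps_def t0 tp intro!: exI[of _ "%_. ?z"])
 hence "homeomorphic_map (subtop (EU 0) UNIV) (subtop point_space UNIV) (%_. ())" by simp
 note H = rel_hom_homeo[OF this, of "tsp (EU 0) - {?z}" "{}"]
 have e: "(%_. ()) ` (tsp (EU 0) - {?z}) = {}" using t0 by simp
 show "vanishes point_space j UNIV {} <-> j ~= 0"
  using vanishes_iso[OF H(2), of j] euclidean_local(1)[of 0 j] e t0 by simp
 show "infinite_cyclic (RH point_space 0 UNIV {})"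
  using infinite_cyclic_iso[OF H, of 0] euclidean_local(2)[of 0] e t0 by simp
qed

definition point_degree :: "unit chain set => int" where
 "point_degree = (SOME f. addi (RH point_space 0 UNIV {}) f & bij_betw f (car (RH point_space 0 UNIV {})) UNIV)"

lemma point_degree: "addi (RH point_space 0 UNIV {}) point_degree"
  "bij_betw point_degree (car (RH point_space 0 UNIV {})) UNIV"
 using someI_ex[OF point_homology(2)[unfolded infinite_cyclic_def]] by (auto simp: point_degree_def)

definition to_point :: "'a topology => int => 'a set => 'a chain set => unit chain set" where
 "to_point X p A = hom_induced p (subtop X A) {} (subtop point_space UNIV) {} (%_. ())"

lemma continuous_to_point: "cmap X point_space (%_. ())"
 by (simp add: point_space_def)

lemma to_point_hom: "to_point X p A : hom (RH X p A {}) (RH point_space p UNIV {})"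
 by (simp add: to_point_def RH_def hom_induced_hom)

lemma to_point_incl: "A <= B ==> to_point X p B (incl X p A {} B {} z) = to_point X p A z"
 unfolding to_point_def incl_def
 using hom_induced_compose'[OF continuous_id_sub[where A = A and B = B and X = X], of "{}" "{}" "subtop point_space UNIV" "%_. ()" "{}" p z]
 by (simp add: continuous_to_point comp_def)

lemma to_point_bij:
 assumes "contractible_space (subtop X A)" "tsp (subtop X A) ~= {}"
 shows "bij_betw (to_point X p A) (car (RH X p A {})) (car (RH point_space p UNIV {}))"
proof -
 let ?Y = "subtop X A"
 obtain a where a: "homotopic_with (%x. True) ?Y ?Y id (%x. a)" using assms(1) by (auto simp: contractible_space_def)
 obtain b where b: "b : tsp ?Y" using assms(2) by blast
 have "cmap ?Y ?Y (%x. a)" using homotopic_with_imp_continuous_maps[OF a] by blast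
 hence aY: "a : tsp ?Y" using continuous_map_image_subset_topspace b by blast
 have "hom_induced p ?Y {} point_space {} (%_. ()) : iso (RHG p ?Y {}) (RHG p point_space {})"
 proof (rule homotopy_equivalence_relative_homology_group_isomorphism[where g = "%_. a"])
  show "homotopic_with (%h. h : {} \<rightarrow> {}) ?Y ?Y ((%_. a) o (%_. ())) id"
   using a by (simp add: comp_def homotopic_with_sym)
  have "(%_. ()) o (%_::unit. a) = id" by auto
  thus "homotopic_with (%k. k : {} \<rightarrow> {}) point_space point_space ((%_. ()) o (%_. a)) id" by simp
 qed (use aY continuous_to_point in auto)
 thus ?thesis by (simp add: to_point_def RH_def iso_def)
qed

lemma contractible_closed_ball: "contractible_space (CB k)"
proof -
 have 0: "(%_. 0) : UB k" by (simp add: UB_def)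
 define h where "h = (%(t::real, x::nat => real) i. (1 - t) * x i)"
 have "continuous_on ({0..1} >< UB k) (%z. h z i)" for i
  unfolding h_def case_prod_unfold
  by (intro continuous_intros continuous_on_compose2[OF continuous_on_coordinate[of UNIV i]]) auto
 hence c: "continuous_on ({0..1} >< UB k) h" by (rule continuous_on_coordinatewise_then_product)
 have im: "h (t, x) : UB k" if "t : {0..1}" "x : UB k" for t x
  using unit_ball_convex[OF that(2) 0, of t] that(1) by (simp add: h_def)
 have "homotopic_with (%x. True) (CB k) (CB k) id (%x. (%_. 0))"
  unfolding homotopic_with_def
  by (intro exI[of _ h]) (use c im in "auto simp: closed_ball_space_eu h_def")
 thus ?thesis unfolding contractible_space_def by blast
qed

locale oriented_cells = finite_cells X S dm
 for X :: "'a topology" and S :: "'a set set" and dm :: "'a set => nat" +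
 fixes m :: nat and om :: "'a => 'a chain set => int"
 assumes local_vanishes: "!!x j. x : TX ==> vanishes X j TX (TX - {x}) <-> j ~= int m"
  and om_additive: "!!x. x : TX ==> addi (RH X (int m) TX (TX - {x})) (om x)"
  and om_bij: "!!x. x : TX ==> bij_betw (om x) (car (RH X (int m) TX (TX - {x}))) UNIV"
  and om_locally_constant: "!!K x z. openin X K ==> x : K ==> z : car (RH X (int m) TX (TX - K)) ==>
   EX B. openin X B & x : B & B <= K & (ALL y:B. om y (incl X (int m) TX (TX - K) TX (TX - {y}) z) =
    om x (incl X (int m) TX (TX - K) TX (TX - {x}) z))"
begin

definition outer :: "'a set => 'a set set" where "outer s = {e : S. ~ s <= cl e}"

abbreviation "star s == &&{e : S. s <= cl e}"
abbreviation "HS s == RH X (int m) TX (&&(outer s))"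
abbreviation "ix s x == incl X (int m) TX (&&(outer s)) TX (TX - {x})"
abbreviation "sk s == skel S (outer s) (int m - 1)"
abbreviation "ce s == cells S (outer s) (int m)"
abbreviation "cH s == CH S (outer s) (int m)"
abbreviation "cb s == cbd S (outer s) (int m)"
abbreviation "cc s == ccoord S (outer s) (int m)"

lemma subcomplex_outer: "subcx (outer s)" unfolding outer_def by (rule subcomplex_star)

lemma outer_sub: "outer s <= S" by (auto simp: outer_def)

lemma outer_mono: "s <= cl t ==> outer s <= outer t"
 unfolding outer_def using cl_mono order_trans by blast

lemma Union_complement:
 assumes "A <= S"
 shows "&&(S - A) = TX - &&A"
proof (intro equalityI subsetI)
 fix x assume "x : &&(S - A)"
 then obtain c where c: "c : S" "c ~: A" "x : c" by blast
 have "x ~: a" if "a : A" for a using cell_unique[OF c(1) _ c(3)] that assms c(2) by blast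
 thus "x : TX - &&A" using c cell_sub[OF c(1)] by blast
next
 fix x assume x: "x : TX - &&A"
 then obtain c where "c : S" "x : c" using cell_of_point by blast
 thus "x : &&(S - A)" using x by blast
qed

lemma outer_Union: "&&(outer s) = TX - star s"
proof -
 have "outer s = S - {e : S. s <= cl e}" by (auto simp: outer_def)
 thus ?thesis using Union_complement[of "{e : S. s <= cl e}"] by simp
qed

lemma open_star: "openin X (star s)"
proof -
 have "star s = TX - &&(outer s)"
 proof -
  have "S - outer s = {e : S. s <= cl e}" by (auto simp: outer_def)
  thus ?thesis using Union_complement[OF outer_sub[of s]] by simp
 qed
 thus ?thesis using closed_subcomplex[OF subcomplex_outer] by auto
qed

lemma connected_star:
 assumes "s : S"
 shows "connectedin X (star s)"
proof -
 have "connectedin X (t Un s)" if "t : S" "s <= cl t" for t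
  by (rule connectedin_intermediate_closure_of[OF connected_cell[OF that(1)]]) (use cell_sub_cl that in auto)
 hence "connectedin X (&&((%t. t Un s) ` {e : S. s <= cl e}))"
  by (intro connectedin_Union) (use cell_nonempty[OF assms] in auto)
 moreover have "&&((%t. t Un s) ` {e : S. s <= cl e}) = star s"
  using assms cell_sub_cl[OF assms] by blast
 ultimately show ?thesis by simp
qed

lemma outer_point:
 assumes s: "s : S" and x: "x : star s"
 shows "&&(outer s) <= TX - {x}"
 using x unfolding outer_Union by blast

lemma star_local:
 assumes s: "s : S" and x: "x : s"
 shows "bij_betw (incl X p TX (&&(outer s)) TX (TX - {x}))
   (car (RH X p TX (&&(outer s)))) (car (RH X p TX (TX - {x})))"
proof -
 have xs: "x : star s" using s x cell_sub_cl[OF s] by blast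
 obtain A where A: "A = outer s" by blast
 have sA: "subcx A" "A <= S" unfolding A by (rule subcomplex_outer outer_sub)+
 have op: "&&A <= TX - {x}" unfolding A by (rule outer_point[OF s xs])
 have v: "vanishes X p (&&S - {x}) (&&A)" for p
  using subcomplex_all sA
 proof (induction rule: subcomplex_induct)
  case base
  have "&&A - {x} = &&A" using op by auto
  thus ?case using vanishes_self by metis
 next
  case (attach L t)
  have "s <= cl t" using attach(1,3) by (auto simp: A outer_def subcx_def)
  hence "x : cl t" using x by blast
  from attach_vanishes[OF attach(1,4) this, of p]
  show ?case
   by (intro vanishes_triple[OF _ _ _ attach.IH]) (use op attach(7) in auto)
 qed
 show ?thesis
  by (rule incl_iso_absolute[OF outer_point[OF s xs]]) (use v cover A in auto)
qed

lemma star_vanishes: "s : S ==> vanishes X j TX (&&(outer s)) <-> j ~= int m"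
proof -
 assume s: "s : S"
 obtain x where x: "x : s" using cell_nonempty[OF s] by blast
 show ?thesis using vanishes_iso[OF star_local[OF s x], of j] local_vanishes[of x j] x cell_sub[OF s] by blast
qed

lemma maximal_cell:
 assumes "s : S"
 shows "EX t:S. s <= cl t & free_cell S t"
proof -
 let ?T = "{e : S. s <= cl e}"
 have f: "finite (dm ` ?T)" "dm ` ?T ~= {}" using finS assms cell_sub_cl[OF assms] by auto
 obtain t where t: "t : ?T" "dm t = Max (dm ` ?T)" using Max_in[OF f] by fastforce
 have "e = t" if e: "e : S" "t <= cl e" for e
 proof (rule ccontr)
  assume "e ~= t"
  hence "dm t < dm e" using face_dim[of e t] e t(1) by auto
  moreover have "e : ?T" using e t(1) cl_mono[OF e(2)] by auto
  hence "dm e <= dm t" using t(2) Max_ge[OF f(1)] by auto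
  ultimately show False by simp
 qed
 thus ?thesis using t by (auto simp: free_cell_def)
qed

lemma outer_free: "free_cell S t ==> outer t = S - {t}"
 using cell_sub_cl by (auto simp: free_cell_def outer_def)

lemma free_dim: "free_cell S t ==> dm t = m"
proof -
 assume t: "free_cell S t"
 hence tS: "t : S" by (simp add: free_cell_def)
 have "vanishes X j TX (&&(outer t)) <-> j ~= int (dm t)" for j
  using attach_cell(1)[OF subcomplex_all t, of j] by (simp add: outer_free[OF t] cover)
 thus ?thesis using star_vanishes[OF tS, of "int m"] by simp
qed

lemma dm_le: "e : S ==> dm e <= m"
proof -
 assume e: "e : S"
 obtain t where t: "t : S" "e <= cl t" "free_cell S t" using maximal_cell[OF e] by blast
 thus ?thesis using free_dim[OF t(3)] face_dim[OF t(1) e t(2)] by (cases "e = t") auto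
qed

lemma top_free: "e : S ==> dm e = m ==> free_cell S e"
proof -
 assume e: "e : S" "dm e = m"
 have "e' = e" if "e' : S" "e <= cl e'" for e'
  using face_dim[OF that(1) e(1) that(2)] dm_le[OF that(1)] e(2) by (cases "e' = e") auto
 thus ?thesis using e by (simp add: free_cell_def)
qed

definition oclass :: "'a set => 'a chain set" where
 "oclass s = (SOME z. z : car (HS s) &
   (ALL x:star s. om x (ix s x z) = 1))"

lemma oclass:
 assumes s: "s : S"
 shows "oclass s : car (HS s)"
  "!!x. x : star s ==> om x (ix s x (oclass s)) = 1"
proof -
 let ?K = "star s" and ?H = "HS s"
 let ?i = "%x. ix s x"
 obtain x0 where x0: "x0 : s" using cell_nonempty[OF s] by blast
 hence x0K: "x0 : ?K" "x0 : TX" using s cell_sub_cl[OF s] cell_sub[OF s] by blast+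
 have "1 : om x0 ` car (RH X (int m) TX (TX - {x0}))"
  using bij_betw_imp_surj_on[OF om_bij[OF x0K(2)]] by simp
 then obtain y where y: "1 = om x0 y" "y : car (RH X (int m) TX (TX - {x0}))" by (rule imageE)
 have "y : ?i x0 ` car ?H" using bij_betw_imp_surj_on[OF star_local[OF s x0]] y(2) by simp
 then obtain z where z: "y = ?i x0 z" "z : car ?H" by (rule imageE)
 have lc: "EX B. openin X B & x : B & B <= ?K & (ALL y:B. om y (?i y z) = om x (?i x z))" if "x : ?K" for x
  using om_locally_constant[OF open_star that, of z] z(2) unfolding outer_Union .
 have op: "openin X {x : ?K. om x (?i x z) : T}" for T
 proof (subst openin_subopen, rule ballI)
  fix x assume x: "x : {x : ?K. om x (?i x z) : T}"
  then obtain B where B: "openin X B" "x : B" "B <= ?K" "ALL y:B. om y (?i y z) = om x (?i x z)" using lc[of x] by blast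
  have "B <= {x : ?K. om x (?i x z) : T}" using B(3,4) x by (simp add: subset_iff)
  thus "EX B. openin X B & x : B & B <= {x : ?K. om x (?i x z) : T}" using B by blast
 qed
 have "ALL x:?K. om x (?i x z) = 1"
 proof (rule ccontr)
  assume "~ ?thesis"
  then obtain y where y': "y : ?K" "om y (?i y z) ~= 1" by blast
  show False
  proof (rule connectedinD[OF connected_star[OF s] op[of "{1}"] op[of "- {1}"]])
   show "{x : ?K. om x (?i x z) : {1}} Int ?K ~= {}" using x0K(1) y(1) z(1) by (auto simp del: Union_iff)
   show "{x : ?K. om x (?i x z) : - {1}} Int ?K ~= {}" using y' by (auto simp del: Union_iff)
  qed (auto simp del: Union_iff)
 qed
 hence "EX z. z : car ?H & (ALL x:?K. om x (?i x z) = 1)" using z(2) by blast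
 from someI_ex[OF this] show "oclass s : car ?H" "!!x. x : ?K ==> om x (?i x (oclass s)) = 1"
  unfolding oclass_def by blast+
qed

lemma oclass_incl:
 assumes s: "s : S" and t: "t : S" "s <= cl t"
 shows "incl X (int m) TX (&&(outer s)) TX (&&(outer t)) (oclass s) = oclass t"
proof -
 obtain x where x: "x : t" using cell_nonempty[OF t(1)] by blast
 hence xt: "x : TX" "x : star t" "x : star s"
  using t cell_sub[OF t(1)] cell_sub_cl[OF t(1)] by blast+
 let ?i = "ix t x"
 let ?y = "incl X (int m) TX (&&(outer s)) TX (&&(outer t)) (oclass s)"
 have "?i ?y = ix s x (oclass s)"
  by (rule incl_incl[OF order_refl Union_mono[OF outer_mono[OF t(2)]] order_refl outer_point[OF t(1) xt(2)]])
 hence "om x (?i ?y) = om x (?i (oclass t))" using oclass(2)[OF s xt(3)] oclass(2)[OF t(1) xt(2)] by simp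
 hence "?i ?y = ?i (oclass t)" by (rule inj_onD[OF bij_betw_imp_inj_on[OF om_bij[OF xt(1)]]]) simp_all
 thus ?thesis by (rule inj_onD[OF bij_betw_imp_inj_on[OF star_local[OF t(1) x]]]) (simp_all add: oclass(1)[OF t(1)])
qed

lemma oclass_power:
 assumes s: "s : S" and w: "w : car (HS s)"
 shows "EX k::int. w = oclass s ^[HS s] k"
proof -
 let ?H = "HS s"
 interpret group ?H by simp
 obtain x where x: "x : s" using cell_nonempty[OF s] by blast
 hence xs: "x : TX" "x : star s" using s cell_sub[OF s] cell_sub_cl[OF s] by blast+
 let ?i = "ix s x"
 have add: "addi ?H (%z. real_of_int (om x (?i z)))"
  using om_additive[OF xs(1)] by (simp add: addi_def incl_mult)
 let ?k = "om x (?i w)"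
 have "real_of_int (om x (?i (oclass s ^[?H] ?k))) = real_of_int ?k"
  using additive_on_int_pow[OF is_group add oclass(1)[OF s], of ?k] oclass(2)[OF s xs(2)] by simp
 hence "om x (?i (oclass s ^[?H] ?k)) = ?k" using of_int_eq_iff by blast
 hence "?i (oclass s ^[?H] ?k) = ?i w" by (rule inj_onD[OF bij_betw_imp_inj_on[OF om_bij[OF xs(1)]]]) simp_all
 hence "oclass s ^[?H] ?k = w"
  by (rule inj_onD[OF bij_betw_imp_inj_on[OF star_local[OF s x]]]) (simp_all add: w oclass(1)[OF s])
 thus ?thesis by metis
qed

definition ov :: "'a set => int" where
 "ov t = (if t : S & dm t = m then coord TX (&&(outer t)) t (oclass t) else 0)"

lemma ov_supp: "ov t ~= 0 ==> t : S & dm t = m" by (auto simp: ov_def split: if_splits)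

lemma coord_oclass:
 assumes s: "s : S" and t: "t : S" "s <= cl t" "dm t = m"
 shows "coord TX (&&(outer s)) t (oclass s) = ov t"
proof -
 note f = top_free[OF t(1,3)]
 have c: "&&(outer t) <= &&S - {centre t}"
  using outer_point[OF t(1), of "centre t"] centre[OF t(1)] cell_sub_cl[OF t(1)] t(1) cover by blast
 have "coord (&&S) (&&(outer t)) t (IU (int (dm t)) S (outer s) S (outer t) (oclass s)) = coord (&&S) (&&(outer s)) t (oclass s)"
  using c Union_mono[OF outer_mono[OF t(2)]] by (intro coord_natural[OF subcomplex_all f subcomplex_all f]) auto
 thus ?thesis using oclass_incl[OF s t(1,2)] t by (simp add: cover ov_def)
qed

lemma ov_nonzero:
 assumes t: "t : S" "dm t = m"
 shows "ov t ~= 0"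
proof
 assume "ov t = 0"
 let ?H = "HS t"
 note f = top_free[OF t]
 have b: "bij_betw (coord TX (&&(outer t)) t) (car ?H) UNIV"
  using attach_cell(2)[OF subcomplex_all f] by (simp add: outer_free[OF f] cover t)
 have "addi ?H (coord TX (&&(outer t)) t)"
  using coord_additive[OF subcomplex_all f] by (simp add: cover t)
 hence "coord TX (&&(outer t)) t (e1 ?H) = 0" by (rule additive_on_one[OF group_rel_hom])
 hence "coord TX (&&(outer t)) t (oclass t) = coord TX (&&(outer t)) t (e1 ?H)"
  using `ov t = 0` t by (simp add: ov_def)
 hence o1: "oclass t = e1 ?H"
  by (rule inj_onD[OF bij_betw_imp_inj_on[OF b]]) (simp_all add: oclass(1)[OF t(1)] group.is_monoid)
 obtain x where x: "x : t" using cell_nonempty[OF t(1)] by blast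
 hence xt: "x : TX" "x : star t" using t cell_sub[OF t(1)] cell_sub_cl[OF t(1)] by blast+
 have "om x (ix t x (oclass t)) = 0"
  unfolding o1 incl_one by (rule additive_on_one[OF group_rel_hom om_additive[OF xt(1)]])
 thus False using oclass(2)[OF t(1) xt(2)] by simp
qed

lemma skel_top: "skel S (outer s) (int m) = S"
 using dm_le outer_sub by (auto simp: skel_def)

lemma star_coord:
 assumes s: "s : S" and t: "t : ce s"
  and w: "w : car (HS s)"
 shows "cc s (incl X (int m) TX (&&(outer s)) TX (&&(sk s)) w) t
  = coord TX (&&(outer s)) t w"
proof -
 have tt: "t : S" "dm t = m" using t by (auto simp: cells_def)
 note f = top_free[OF tt]
 have c: "&&(sk s) <= &&S - {centre t}"
  using skel_centre[OF subcomplex_all subcomplex_outer t] unfolding skel_top .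
 have o: "&&(outer s) <= &&(sk s)" by (auto simp: skel_def)
 have "coord (&&S) (&&(sk s)) t (IU (int (dm t)) S (outer s) S (sk s) w) = coord (&&S) (&&(outer s)) t w"
  by (rule coord_natural[OF subcomplex_all f subcomplex_all f order_refl o]) (use c o in auto)
 thus ?thesis using t tt by (simp add: ccoord_def skel_top cover)
qed

lemma ov_cycle: "(SUM t:S. inc t s * ov t) = 0"
proof (cases "s : S & Suc (dm s) = m")
 case False
 have "inc t s * ov t = 0" for t using False inc_supp[of t s] ov_supp[of t] by force
 thus ?thesis by (intro sum.neutral ballI)
next
 case True
 hence s: "s : S" and d: "int (dm s) = int m - 1" by auto
 note L = subcomplex_all subcomplex_outer[of s] outer_sub[of s]
 let ?z = "incl X (int m) TX (&&(outer s)) TX (&&(sk s)) (oclass s)"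
 have o: "&&(outer s) <= &&(sk s)" "&&(outer s) <= &&(skel S (outer s) (int m - 2))"
  "&&(skel S (outer s) (int m - 2)) <= &&(sk s)" "&&(sk s) <= TX"
  unfolding cover[symmetric] by (intro Union_mono; auto simp: skel_def outer_def)+
 have z: "?z : car (cH s)" by (simp add: skel_top cover)
 have "cb s ?z = IU (int m - 1) (sk s) (outer s) (sk s) (skel S (outer s) (int m - 2))
   (bdry X (int m) TX (&&(sk s)) (&&(outer s)) ?z)"
  using bdry_incl[OF order_refl order_refl o(2) o(4) o(4), where X = X and p = "int m" and x = ?z] incl_id[of ?z X "int m"] z
  by (simp add: skel_top cover)
 also have "bdry X (int m) TX (&&(sk s)) (&&(outer s)) ?z = e1 (RU (int m - 1) (sk s) (outer s))"
  by (rule triple_exact_1(1)[OF o(1,4) oclass(1)[OF s]])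
 finally have "cb s ?z = e1 (CH S (outer s) (int m - 1))" by (simp add: diff_diff_eq)
 hence "ccoord S (outer s) (int m - 1) (cb s ?z) s = 0"
  by (simp only: additive_on_one[OF group_rel_hom int_coordsD(2)[OF chain_coords[OF L(1,2)]]])
 moreover have "s : cells S (outer s) (int m - 1)" using s d cell_sub_cl[OF s] by (auto simp: cells_def outer_def)
 ultimately have "(SUM t:ce s. inc t s * cc s ?z t) = 0"
  using chain_bd_coord[OF L z] by simp
 also have "(SUM t:ce s. inc t s * cc s ?z t) = (SUM t:ce s. inc t s * ov t)"
  by (rule sum.cong[OF refl]) (use star_coord[OF s _ oclass(1)[OF s]] coord_oclass[OF s] in "auto simp: cells_def outer_def")
 also have "... = (SUM t:S. inc t s * ov t)"
 proof (rule sum.mono_neutral_left[OF finS])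
  show "ALL t:S - ce s. inc t s * ov t = 0"
   using inc_supp[of _ s] ov_supp by (fastforce simp: cells_def outer_def)
 qed (auto simp: cells_def)
 finally show ?thesis .
qed

lemma star_top_int:
 assumes s: "s : S" and n: "!!r. r : cells S (outer s) (int m - 1) ==> (SUM t:ce s. inc t r * n t) = 0"
 shows "EX k. ALL t:ce s. n t = k * ov t"
proof -
 note L = subcomplex_all subcomplex_outer[of s] outer_sub[of s]
 note co = chain_coords[OF L(1,2)]
 obtain R where R: "corr_grp (cH s) (ZL S (outer s) (int m)) (BL S (outer s) (int m)) (RU (int m) S (outer s)) R"
  and R': "!!z x. R z x ==> EX w:car (RU (int m) (skel S (outer s) (int m)) (outer s)).
    z = IU (int m) (skel S (outer s) (int m)) (outer s) (skel S (outer s) (int m)) (sk s) w"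
  using pair_corr[OF L, of "int m"] by (elim exE conjE) (rule that, assumption, blast)
 obtain z where z: "z : car (cH s)" "!!t. t : ce s ==> cc s z t = n t"
  using int_coordsD(5)[OF co, of "int m" n] by blast
 have "cb s z = e1 (CH S (outer s) (int m - 1))"
 proof (rule int_coordsD(4)[OF co chain_bd_closed])
  show "ccoord S (outer s) (int m - 1) (cb s z) r = 0" if "r : cells S (outer s) (int m - 1)" for r
   using chain_bd_coord[OF L z(1) that] n[OF that] by (simp add: z(2))
 qed
 then obtain x where "R z x" using group_corrD(5)[OF R, of z] z by blast
 then obtain w where w: "w : car (HS s)"
  "z = incl X (int m) TX (&&(outer s)) TX (&&(sk s)) w"
  using R' unfolding skel_top cover by blast
 obtain k :: int where k: "w = oclass s ^[HS s] k" using oclass_power[OF s w(1)] by blast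
 have "n t = k * ov t" if t: "t : ce s" for t
 proof -
  have tt: "t : S" "dm t = m" "s <= cl t" using t by (auto simp: cells_def outer_def)
  have "addi (HS s) (%y. real_of_int (coord TX (&&(outer s)) t y))"
   using coord_additive[OF subcomplex_all top_free[OF tt(1,2)], of "&&(outer s)"] by (simp add: addi_def cover tt)
  from additive_on_int_pow[OF group_rel_hom this oclass(1)[OF s], of k]
  have "real_of_int (coord TX (&&(outer s)) t w) = real_of_int (k * coord TX (&&(outer s)) t (oclass s))" by (simp add: k)
  hence "coord TX (&&(outer s)) t w = k * ov t" using coord_oclass[OF s tt(1,3,2)] of_int_eq_iff by metis
  thus ?thesis using star_coord[OF s t w(1)] z(2)[OF t] w(2) by metis
 qed
 thus ?thesis by blast
qed

end

context finite_cells
begin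

abbreviation aug :: "'a set => 'a chain set => int" where "aug A z == point_degree (to_point X 0 A z)"

abbreviation "au L == aug (&&(skel L {} 0))"

lemma aug_additive: "addi (RH X 0 A {}) (aug A)"
 by (rule additive_on_compose[OF point_degree(1) to_point_hom])

lemma skel_neg: "q < 0 ==> skel L {} q = {}" by (auto simp: skel_def)

definition vsign :: "'a set => int" where
 "vsign v = (if v : S & dm v = 0 then aug (&&(skel (ccells v) {} 0)) (gen v) else 0)"

lemma aug_coord:
 assumes L: "subcx L" and z: "z : car (CH L {} 0)"
 shows "au L z = (SUM v:cells L {} 0. vsign v * ccoord L {} 0 z v)"
proof -
 note co = chain_coords[OF L subcomplex_empty, of 0]
 have sk: "skel L' {} (0 - 1) = {}" for L' by (simp add: skel_neg)
 define g where "g t = IU 0 (skel (ccells t) {} 0) (skel (ccells t) {} (0 - 1)) (skel L {} 0) (skel L {} (0 - 1)) (gen t)" for t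
 have g: "g t : car (CH L {} 0)" "ccoord L {} 0 (g t) r = (if r = t then 1 else 0)"
  "au L (g t) = vsign t" if t: "t : cells L {} 0" for t r
 proof -
  have tS: "t : S" "0 = int (dm t)" using t L by (auto simp: cells_def subcx_def)
  have K: "subcx (ccells t)" "ccells t <= L" using subcomplex_closed_cells[OF tS(1)] t L(1) by (auto simp: ccells_def cells_def subcx_def)
  show "g t : car (CH L {} 0)" by (simp only: g_def incl_closed)
  show "ccoord L {} 0 (g t) r = (if r = t then 1 else 0)"
  proof (cases "r : cells L {} 0")
   case True
   thus ?thesis unfolding g_def
    using chain_coord_incl[OF K(1) subcomplex_empty L subcomplex_empty K(2) empty_subsetI True empty_subsetI, of "gen t"] gen(2)[OF tS(1)] tS(2) by simp
  next
   case False
   thus ?thesis using t by (auto simp: ccoord_def)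
  qed
  have "skel (ccells t) {} 0 <= skel L {} 0" using K(2) by (auto simp: skel_def)
  thus "au L (g t) = vsign t"
   unfolding g_def sk using to_point_incl[OF Union_mono, of "skel (ccells t) {} 0" "skel L {} 0" X 0 "gen t"] tS by (simp add: vsign_def)
 qed
 have F: "addi (CH L {} 0) (%z. real_of_int (au L z))"
  using aug_additive[of "&&(skel L {} 0)"] by (simp add: addi_def skel_neg)
 have "real_of_int (au L z) = (SUM t:cells L {} 0. ccoord L {} 0 z t *z real_of_int (au L (g t)))"
  by (rule int_coords_expand[OF comm_group_rel_hom co F]) (use g z in auto)
 also have "... = of_int (SUM t:cells L {} 0. vsign t * ccoord L {} 0 z t)"
  by (simp add: g(3) mult.commute)
 finally show ?thesis using of_int_eq_iff by blast
qed

lemma aug_bd: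
 assumes "z : car (CH L {} 1)"
 shows "au L (cbd L {} 1 z) = 0"
proof -
 have s: "&&(skel L {} 0) <= &&(skel L {} 1)" by (intro Union_mono skel_mono) simp
 have sk: "skel L {} (1 - 2) = {}" by (simp add: skel_neg)
 have z: "z : car (RU 1 (skel L {} 1) (skel L {} 0))" using assms by simp
 have "incl X (1 - 1) (&&(skel L {} 0)) {} (&&(skel L {} 1)) {} (bdry X 1 (&&(skel L {} 1)) (&&(skel L {} 0)) {} z) = e1 (RH X (1 - 1) (&&(skel L {} 1)) {})"
  by (rule triple_exact_2(1)[OF empty_subsetI s z])
 hence "aug (&&(skel L {} 1)) (incl X 0 (&&(skel L {} 0)) {} (&&(skel L {} 1)) {} (bdry X 1 (&&(skel L {} 1)) (&&(skel L {} 0)) {} z)) = 0"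
  using additive_on_one[OF group_rel_hom aug_additive] by simp
 thus ?thesis by (simp only: to_point_incl[OF s] sk Union_empty diff_self cancel_comm_monoid_add_class.diff_cancel)
qed

lemma vsign_cocycle: "(SUM s:S. inc r s * vsign s) = 0"
proof (cases "r : S & dm r = 1")
 case False
 have "inc r s * vsign s = 0" for s using False inc_supp[of r s] by (force simp: vsign_def)
 thus ?thesis by (intro sum.neutral ballI)
next
 case True
 note L = subcomplex_all subcomplex_empty empty_subsetI[of S]
 have rc: "r : cells S {} 1" using True by (auto simp: cells_def)
 obtain z where z: "z : car (CH S {} 1)" "!!t. t : cells S {} 1 ==> ccoord S {} 1 z t = (if t = r then 1 else 0)"
  using int_coordsD(5)[OF chain_coords[OF L(1,2)], of 1 "%t. if t = r then 1 else 0"] by blast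
 have fin: "finite (cells S {} q)" for q using finS by (auto simp: cells_def)
 have 1: "ccoord S {} (1 - 1) (cbd S {} 1 z) t = inc r t" if "t : cells S {} (1 - 1)" for t
  using chain_bd_coord[OF L z(1) that] rc fin by (simp add: z(2) if_distrib[of "(*) _"] sum.delta cong: if_cong)
 have "0 = (SUM v:cells S {} 0. vsign v * ccoord S {} 0 (cbd S {} 1 z) v)"
  using aug_coord[OF L(1), of "cbd S {} 1 z"] aug_bd[OF z(1)] chain_bd_closed[where L = S and A = "{}" and q = 1] by simp
 also have "... = (SUM v:cells S {} 0. inc r v * vsign v)" using 1 by (intro sum.cong) (auto simp: mult.commute)
 also have "... = (SUM s:S. inc r s * vsign s)"
  by (rule sum.mono_neutral_left[OF finS]) (auto simp: cells_def vsign_def)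
 finally show ?thesis by simp
qed

lemma closed_cells_Union: "t : S ==> &&(ccells t) = cl t"
 using subcomplex_cl[OF subcomplex_closed_cells, of t t] cell_sub_cl[of t] by (auto simp: ccells_def)

lemma closed_cell_contractible: "t : S ==> contractible_space (subtop X (cl t))"
 using homeomorphic_space_contractibility[of "CB (dm t)"] cell_map(1) contractible_closed_ball homeomorphic_map_imp_homeomorphic_space by blast

lemma closed_cell_to_point:
 assumes t: "t : S"
 shows "bij_betw (to_point X p (&&(ccells t))) (car (RH X p (&&(ccells t)) {})) (car (RH point_space p UNIV {}))"
 unfolding closed_cells_Union[OF t]
proof (rule to_point_bij[OF closed_cell_contractible[OF t]])
 show "tsp (subtop X (cl t)) ~= {}" using cell_nonempty[OF t] cell_sub_cl[OF t] cell_sub[OF t] by auto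
qed

lemma closed_cell_vanishes: "t : S ==> j ~= 0 ==> VU j (ccells t) {}"
 using vanishes_iso[OF closed_cell_to_point, of t j] point_homology(1)[of j] by simp

text \<open>A cochain of a closed cell is regarded as an additive map on the chain group.\<close>

definition cochain :: "'a set set => int => ('a set => 'v::real_vector) => 'a chain set => 'v" where
 "cochain L q f z = (SUM r:cells L {} q. ccoord L {} q z r *z f r)"

lemma cochain_additive:
 assumes "subcx L"
 shows "addi (CH L {} q) (cochain L q f)"
 using int_coordsD(2)[OF chain_coords[OF assms subcomplex_empty, of q]]
 by (simp add: addi_def cochain_def scaleR_left_distrib sum.distrib)

lemma finite_cells_set: "subcx L ==> finite (cells L A q)"
 using finS finite_subset[of _ S] by (auto simp: cells_def subcx_def)

lemma cochain_bd:
 fixes f :: "'a set => 'v::real_vector"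
 assumes L: "subcx L" and f: "!!s. s : cells L {} (q + 1) ==> (SUM r:cells L {} q. inc s r *z f r) = 0"
  and y: "y : car (CH L {} (q + 1))"
 shows "cochain L q f (cbd L {} (q + 1) y) = 0"
proof -
 have "cochain L q f (cbd L {} (q + 1) y) = (SUM r:cells L {} q. SUM s:cells L {} (q + 1). (ccoord L {} (q + 1) y s) *z inc s r *z f r)"
  unfolding cochain_def
  by (rule sum.cong[OF refl]) (use chain_bd_coord[OF L subcomplex_empty empty_subsetI y] in "simp add: scaleR_sum_left mult.commute")
 also have "... = (SUM s:cells L {} (q + 1). (ccoord L {} (q + 1) y s) *z (SUM r:cells L {} q. inc s r *z f r))"
  by (subst sum.swap) (simp add: scaleR_sum_right)
 also have "... = 0" using f by simp
 finally show ?thesis .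
qed

lemma closed_sum:
 fixes f :: "'a set => 'v::real_vector"
 assumes t: "t : S" and f: "!!s. f s ~= 0 ==> s : S & s <= cl t & int (dm s) = q"
 shows "(SUM r:S. inc s r *z f r) = (SUM r:cells (ccells t) {} q. inc s r *z f r)"
proof (rule sum.mono_neutral_right[OF finS])
 show "ALL r:S - cells (ccells t) {} q. inc s r *z f r = 0"
  using f by (fastforce simp: cells_def ccells_def)
qed (auto simp: cells_def ccells_def)

lemma closed_cell_exact:
 fixes f :: "'a set => 'v::real_vector"
 assumes t: "t : S" and f: "!!s. f s ~= 0 ==> s : S & s <= cl t & dm s = Suc i"
  and df: "!!s. s : S ==> s <= cl t ==> (SUM r:S. inc s r *z f r) = 0"
 shows "EX w. (ALL s. w s ~= 0 --> s : S & s <= cl t & dm s = i) &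
  (ALL s:S. s <= cl t --> f s = (SUM r:S. inc s r *z w r))"
proof -
 let ?L = "ccells t" and ?q = "int i + 1"
 note L = subcomplex_closed_cells[OF t]
 note co = chain_coords[OF L subcomplex_empty]
 have fs: "f s ~= 0 ==> s : S & s <= cl t & int (dm s) = ?q" for s using f by fastforce
 have cs: "(SUM r:S. inc s r *z f r) = (SUM r:cells ?L {} ?q. inc s r *z f r)" for s
  by (rule closed_sum[OF t fs])
 have f1: "(SUM r:cells ?L {} ?q. inc s r *z f r) = 0" if "s : cells ?L {} (?q + 1)" for s
  unfolding cs[symmetric] by (rule df) (use that in "auto simp: cells_def ccells_def")
 have f0: "cochain ?L ?q f (cbd ?L {} (?q + 1) y) = 0" if "y : car (CH ?L {} (?q + 1))" for y
  by (rule cochain_bd[OF L f1 that])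
 obtain R where R: "corr_grp (CH ?L {} ?q) (ZL ?L {} ?q) (BL ?L {} ?q) (RU ?q ?L {}) R"
  using pair_corr[OF L subcomplex_empty empty_subsetI, of ?q] by (elim exE conjE) (rule that)
 have "cochain ?L ?q f z = 0" if z: "z : car (CH ?L {} ?q)" "cbd ?L {} ?q z = e1 (CH ?L {} (?q - 1))" for z
 proof -
  obtain x where x: "R z x" using group_corrD(5)[OF R, of z] z by blast
  have "x = e1 (RU ?q ?L {})"
   using group_corrD(2)[OF R x] vanishesD[OF closed_cell_vanishes[OF t]] by simp
  then obtain y where "y : car (CH ?L {} (?q + 1))" "z = cbd ?L {} (?q + 1) y" using group_corrD(3)[OF R x] by blast
  thus ?thesis using f0 by simp
 qed
 then obtain F' where F': "addi (CH ?L {} (?q - 1)) F'" "!!z. z : car (CH ?L {} ?q) ==> F' (cbd ?L {} ?q z) = cochain ?L ?q f z"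
  by (rule additive_factor_extend[OF comm_group_rel_hom comm_group_rel_hom int_coords_separated[OF co] chain_bd_hom cochain_additive[OF L]]) (assumption+, rule that, assumption, blast)
 obtain g where g: "!!r. r : cells ?L {} (?q - 1) ==> g r : car (CH ?L {} (?q - 1))"
  "!!r s. r : cells ?L {} (?q - 1) ==> ccoord ?L {} (?q - 1) (g r) s = (if s = r then 1 else 0)"
  by (rule int_coords_basis[OF co]) (rule that)
 define w where "w r = (if r : cells ?L {} (?q - 1) then F' (g r) else 0)" for r
 have ws: "w s ~= 0 ==> s : S & s <= cl t & int (dm s) = ?q - 1" for s
  by (auto simp: w_def cells_def ccells_def split: if_splits)
 have "f s = (SUM r:S. inc s r *z w r)" if s: "s : S" "s <= cl t" for s
 proof (cases "s : cells ?L {} ?q")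
  case False
  hence "int (dm s) ~= ?q" using s by (auto simp: cells_def ccells_def)
  hence "f s = 0" "!!r. inc s r *z w r = 0" using fs[of s] ws inc_supp[of s] by fastforce+
  thus ?thesis by (simp only: sum.neutral_const)
 next
  case True
  obtain z where z: "z : car (CH ?L {} ?q)" "!!r. r : cells ?L {} ?q ==> ccoord ?L {} ?q z r = (if r = s then 1 else 0)"
   using int_coordsD(5)[OF co, of ?q "%r. if r = s then 1 else 0"] by blast
  have "f s = cochain ?L ?q f z"
   using True finite_cells_set[OF L] by (simp add: cochain_def z(2) if_distrib[of "%k. k *z _"] sum.delta cong: if_cong)
  also have "... = F' (cbd ?L {} ?q z)" using F'(2)[OF z(1)] by simp
  also have "... = (SUM r:cells ?L {} (?q - 1). (ccoord ?L {} (?q - 1) (cbd ?L {} ?q z) r) *z F' (g r))"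
   by (rule int_coords_expand[OF comm_group_rel_hom co F'(1) g chain_bd_closed])
  also have "... = (SUM r:cells ?L {} (?q - 1). inc s r *z w r)"
  proof (rule sum.cong[OF refl])
   fix r assume r: "r : cells ?L {} (?q - 1)"
   have "ccoord ?L {} (?q - 1) (cbd ?L {} ?q z) r = inc s r"
    using chain_bd_coord[OF L subcomplex_empty empty_subsetI z(1) r] True finite_cells_set[OF L]
    by (simp add: z(2) if_distrib[of "(*) _"] sum.delta cong: if_cong)
   thus "(ccoord ?L {} (?q - 1) (cbd ?L {} ?q z) r) *z F' (g r) = inc s r *z w r"
    using r by (simp add: w_def)
  qed
  also have "... = (SUM r:S. inc s r *z w r)" by (rule closed_sum[OF t ws, symmetric])
  finally show ?thesis .
 qed
 thus ?thesis using ws by (intro exI[of _ w]) auto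
qed

lemma closed_cell_degree:
 assumes t: "t : S"
 obtains z0 where "z0 : car (CH (ccells t) {} 0)" "aug (&&(skel (ccells t) {} 0)) z0 = 1"
  "!!z. z : car (CH (ccells t) {} 0) ==> aug (&&(skel (ccells t) {} 0)) z = 0 ==>
   z : cbd (ccells t) {} 1 ` car (CH (ccells t) {} 1)"
proof -
 let ?L = "ccells t"
 note L = subcomplex_closed_cells[OF t]
 have sk: "skel L' {} (0 - 1) = {}" "skel L' {} (0 - 2) = {}" "skel L' {} (- 1) = {}" for L' by (simp_all add: skel_neg)
 obtain R where R: "corr_grp (CH ?L {} 0) (ZL ?L {} 0) (BL ?L {} 0) (RU 0 ?L {}) R"
  and R': "!!z x. R z x ==> EX w:car (RU 0 (skel ?L {} 0) {}). z = IU 0 (skel ?L {} 0) {} (skel ?L {} 0) (skel ?L {} (0 - 1)) w &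
    x = IU 0 (skel ?L {} 0) {} ?L {} w"
  using pair_corr[OF L subcomplex_empty empty_subsetI, of 0] by (elim exE conjE) (rule that, assumption, blast)
 have sub: "&&(skel ?L {} 0) <= &&?L" by (intro Union_mono) (auto simp: skel_def)
 have aug_eq: "au ?L z = aug (&&?L) x" if h: "R z x" for z x
 proof -
  obtain w where w: "w : car (RH X 0 (&&(skel ?L {} 0)) {})" "z = incl X 0 (&&(skel ?L {} 0)) {} (&&(skel ?L {} 0)) {} w"
   "x = incl X 0 (&&(skel ?L {} 0)) {} (&&?L) {} w" using R'[OF h] unfolding sk by auto
  have "z = w" unfolding w(2) by (rule incl_id[OF w(1)])
  thus ?thesis using to_point_incl[OF sub, of X 0 w] w(3) by simp
 qed
 have bij: "bij_betw (aug (&&?L)) (car (RH X 0 (&&?L) {})) UNIV"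
  using bij_betw_trans[OF closed_cell_to_point[OF t, of 0] point_degree(2)] by (simp add: comp_def)
 have "1 : aug (&&?L) ` car (RH X 0 (&&?L) {})" using bij_betw_imp_surj_on[OF bij] by simp
 then obtain x1 where x1: "1 = aug (&&?L) x1" "x1 : car (RH X 0 (&&?L) {})" by (rule imageE)
 obtain z0 where z0: "R z0 x1" using group_corrD(6)[OF R, of x1] x1(2) by auto
 show ?thesis
 proof (rule that)
  show "z0 : car (CH ?L {} 0)" using group_corrD(1)[OF R z0] by blast
  show "au ?L z0 = 1" using aug_eq[OF z0] x1(1) by simp
  fix z assume z: "z : car (CH ?L {} 0)" "au ?L z = 0"
  have "VU (0 - 1) (skel ?L {} (0 - 1)) (skel ?L {} (0 - 1 - 1))" by (rule vanishes_neg) simp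
  from vanishesD[OF this chain_bd_closed] have "cbd ?L {} 0 z = e1 (CH ?L {} (0 - 1))" .
  then obtain x where x: "R z x" using group_corrD(5)[OF R, of z] z(1) by blast
  have "aug (&&?L) x = aug (&&?L) (e1 (RH X 0 (&&?L) {}))"
   using aug_eq[OF x] z(2) additive_on_one[OF group_rel_hom aug_additive] by simp
  hence "x = e1 (RH X 0 (&&?L) {})"
   by (rule inj_onD[OF bij_betw_imp_inj_on[OF bij]]) (use group_corrD(2)[OF R x] in "simp_all add: group.is_monoid")
  thus "z : cbd ?L {} 1 ` car (CH ?L {} 1)" using group_corrD(3)[OF R x] by simp
 qed
qed

lemma vsign_nonzero:
 assumes t: "t : S"
 shows "EX s. s <= cl t & vsign s ~= 0"
proof (rule ccontr)
 assume n: "~ ?thesis"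
 obtain z0 where z0: "z0 : car (CH (ccells t) {} 0)" "aug (&&(skel (ccells t) {} 0)) z0 = 1"
  by (rule closed_cell_degree[OF t])
 have "vsign v = 0" if "v : cells (ccells t) {} 0" for v using n that by (auto simp: cells_def ccells_def)
 thus False using aug_coord[OF subcomplex_closed_cells[OF t] z0(1)] z0(2) by simp
qed

lemma closed_cell_bottom:
 fixes f :: "'a set => 'v::real_vector"
 assumes t: "t : S" and f: "!!s. f s ~= 0 ==> s : S & s <= cl t & dm s = 0"
  and df: "!!s. s : S ==> s <= cl t ==> (SUM r:S. inc s r *z f r) = 0"
 shows "EX v. ALL s:S. s <= cl t --> f s = vsign s *z v"
proof -
 let ?L = "ccells t"
 note L = subcomplex_closed_cells[OF t]
 note co = chain_coords[OF L subcomplex_empty]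
 obtain z0 where z0: "z0 : car (CH ?L {} 0)" "au ?L z0 = 1"
  "!!z. z : car (CH ?L {} 0) ==> au ?L z = 0 ==> z : cbd ?L {} 1 ` car (CH ?L {} 1)"
  by (rule closed_cell_degree[OF t]) (rule that)
 interpret group "CH ?L {} 0" by simp
 have fs: "f s ~= 0 ==> s : S & s <= cl t & int (dm s) = 0" for s using f by fastforce
 have cs: "(SUM r:S. inc s r *z f r) = (SUM r:cells ?L {} 0. inc s r *z f r)" for s
  by (rule closed_sum[OF t fs])
 have f1: "(SUM r:cells ?L {} 0. inc s r *z f r) = 0" if "s : cells ?L {} (0 + 1)" for s
  unfolding cs[symmetric] by (rule df) (use that in "auto simp: cells_def ccells_def")
 have f0: "cochain ?L 0 f (cbd ?L {} (0 + 1) y) = 0" if "y : car (CH ?L {} (0 + 1))" for y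
  by (rule cochain_bd[OF L f1 that])
 have addf: "addi (CH ?L {} 0) (cochain ?L 0 f)" by (rule cochain_additive[OF L])
 have sk: "skel ?L {} (0 - 1) = {}" by (simp add: skel_neg)
 have adda: "addi (CH ?L {} 0) (%z. real_of_int (au ?L z))"
  using aug_additive[of "&&(skel ?L {} 0)"] by (simp add: addi_def skel_neg)
 have main: "cochain ?L 0 f z = au ?L z *z cochain ?L 0 f z0" if z: "z : car (CH ?L {} 0)" for z
 proof -
  let ?k = "- au ?L z"
  have p: "z0 ^[CH ?L {} 0] ?k : car (CH ?L {} 0)" by (rule int_pow_closed[OF z0(1)])
  have "real_of_int (au ?L (z *[CH ?L {} 0] z0 ^[CH ?L {} 0] ?k)) = 0"
   using additive_onD[OF adda z p] additive_on_int_pow[OF is_group adda z0(1), of ?k] z0(2) by simp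
  hence "au ?L (z *[CH ?L {} 0] z0 ^[CH ?L {} 0] ?k) = 0" using of_int_eq_0_iff by blast
  hence "z *[CH ?L {} 0] z0 ^[CH ?L {} 0] ?k : cbd ?L {} 1 ` car (CH ?L {} 1)"
   by (rule z0(3)[OF m_closed[OF z p]])
  hence "cochain ?L 0 f (z *[CH ?L {} 0] z0 ^[CH ?L {} 0] ?k) = 0" using f0 by auto
  thus ?thesis using additive_onD[OF addf z p] additive_on_int_pow[OF is_group addf z0(1), of ?k] by simp
 qed
 have "f s = vsign s *z cochain ?L 0 f z0" if s: "s : S" "s <= cl t" for s
 proof (cases "s : cells ?L {} 0")
  case False
  hence "dm s ~= 0" using s by (auto simp: cells_def ccells_def)
  thus ?thesis using f[of s] by (auto simp: vsign_def)
 next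
  case True
  obtain z where z: "z : car (CH ?L {} 0)" "!!r. r : cells ?L {} 0 ==> ccoord ?L {} 0 z r = (if r = s then 1 else 0)"
   using int_coordsD(5)[OF co, of 0 "%r. if r = s then 1 else 0"] by blast
  have "f s = cochain ?L 0 f z"
   using True finite_cells_set[OF L] by (simp add: cochain_def z(2) if_distrib[of "%k. k *z _"] sum.delta cong: if_cong)
  moreover have "au ?L z = vsign s"
   using True finite_cells_set[OF L] by (simp add: aug_coord[OF L z(1)] z(2) if_distrib[of "(*) _"] sum.delta cong: if_cong)
  ultimately show ?thesis using main[OF z(1)] by simp
 qed
 thus ?thesis by blast
qed

end

context oriented_cells
begin

lemma star_cells: "cells S (outer s) (int j) = {t : S. s <= cl t & dm t = j}"
 by (auto simp: cells_def outer_def)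

lemma star_sum:
 fixes f :: "'a set => 'v::real_vector"
 assumes f: "!!t. f t ~= 0 ==> t : S & s <= cl t & dm t = j"
 shows "(SUM r:S. inc r t *z f r) = (SUM r:cells S (outer s) (int j). inc r t *z f r)"
 by (rule sum.mono_neutral_right[OF finS]) (use f in "auto simp: star_cells")

lemma star_decompose:
 fixes f :: "'a set => 'v::real_vector"
 assumes f: "!!t. f t ~= 0 ==> t : S & s <= cl t & dm t = j"
  and df: "!!t. t : S ==> s <= cl t ==> (SUM r:S. inc r t *z f r) = 0"
 obtains E c where "finite E" "!!t. t : cells S (outer s) (int j) ==> f t = (SUM e:E. c t e *z e)"
  "!!e r. e : E ==> r : cells S (outer s) (int j - 1) ==> (SUM t:cells S (outer s) (int j). inc t r * c t e) = 0"
proof -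
 let ?C = "cells S (outer s) (int j)"
 have fin: "finite ?C" using finS by (auto simp: cells_def)
 obtain E c where E: "finite E" "!!x. x : f ` ?C ==> x = (SUM e:E. c x e *z e)"
  "!!n :: 'v => int. (SUM e:E. n e *z e) = 0 ==> ALL e:E. n e = 0"
  by (rule finite_Z_span[of "f ` ?C"]) (use fin in blast)+
 show ?thesis
 proof (rule that[OF E(1), of "%t. c (f t)"])
  show fe: "f t = (SUM e:E. c (f t) e *z e)" if "t : ?C" for t using E(2) that by blast
  fix e r assume e: "e : E" and r: "r : cells S (outer s) (int j - 1)"
  have "(SUM t:S. inc t r *z f t) = (SUM t:?C. inc t r *z f t)" by (rule star_sum[OF f])
  moreover have "(SUM t:S. inc t r *z f t) = 0" by (rule df) (use r in "auto simp: cells_def outer_def")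
  ultimately have "0 = (SUM t:?C. inc t r *z f t)" by simp
  also have "... = (SUM t:?C. SUM e:E. (inc t r * c (f t) e) *z e)"
   by (rule sum.cong[OF refl]) (subst fe, assumption, simp add: scaleR_sum_right)
  also have "... = (SUM e:E. (SUM t:?C. inc t r * c (f t) e) *z e)"
   by (subst sum.swap) (simp add: scaleR_sum_left)
  finally show "(SUM t:?C. inc t r * c (f t) e) = 0"
   using E(3)[of "%e. SUM t:?C. inc t r * c (f t) e"] e by simp
 qed
qed

lemma star_exact_vector:
 fixes f :: "'a set => 'v::real_vector"
 assumes s: "s : S" and j: "j ~= m" and f: "!!t. f t ~= 0 ==> t : S & s <= cl t & dm t = j"
  and df: "!!t. t : S ==> s <= cl t ==> (SUM r:S. inc r t *z f r) = 0"
 shows "EX w. (ALL t. w t ~= 0 --> t : S & s <= cl t & dm t = Suc j) &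
  (ALL t:S. s <= cl t --> f t = (SUM r:S. inc r t *z w r))"
proof -
 let ?C = "cells S (outer s) (int j)" and ?D = "cells S (outer s) (int j + 1)"
 note L = subcomplex_all subcomplex_outer[of s] outer_sub[of s]
 obtain E c where E: "finite E" "!!t. t : ?C ==> f t = (SUM e:E. c t e *z e)"
  "!!e r. e : E ==> r : cells S (outer s) (int j - 1) ==> (SUM t:?C. inc t r * c t e) = 0"
  by (rule star_decompose[OF f df]) (assumption | rule that)+
 have "VU (int j) S (outer s)" using star_vanishes[OF s] j by (simp add: cover)
 from inc_exact[OF L this, OF E(3)] have "ALL e:E. EX k. ALL t:?C. c t e = (SUM r:?D. inc r t * k r)" by blast
 then obtain k where k: "!!e t. e : E ==> t : ?C ==> c t e = (SUM r:?D. inc r t * k e r)" by metis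
 define w where "w r = (if r : ?D then SUM e:E. k e r *z e else 0)" for r
 have ws: "w t ~= 0 ==> t : S & s <= cl t & dm t = Suc j" for t by (auto simp: w_def cells_def outer_def split: if_splits)
 have D: "?D = cells S (outer s) (int (Suc j))" by (simp add: add.commute)
 have "f t = (SUM r:S. inc r t *z w r)" if t: "t : S" "s <= cl t" for t
 proof (cases "t : ?C")
  case True
  have "f t = (SUM e:E. (SUM r:?D. inc r t * k e r) *z e)" unfolding E(2)[OF True] using k[OF _ True] by simp
  also have "... = (SUM e:E. SUM r:?D. inc r t *z k e r *z e)" by (simp add: scaleR_sum_left)
  also have "... = (SUM r:?D. inc r t *z w r)"
   by (subst sum.swap) (simp add: w_def scaleR_sum_right)
  also have "... = (SUM r:S. inc r t *z w r)" unfolding D by (rule star_sum[OF ws, symmetric])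
  finally show ?thesis .
 next
  case False
  hence "dm t ~= j" using t by (auto simp: star_cells)
  hence "f t = 0" "!!r. inc r t *z w r = 0" using f[of t] ws inc_supp[of _ t] by fastforce+
  thus ?thesis by (simp only: sum.neutral_const)
 qed
 thus ?thesis using ws by blast
qed

lemma star_top_vector:
 fixes f :: "'a set => 'v::real_vector"
 assumes s: "s : S" and f: "!!t. f t ~= 0 ==> t : S & s <= cl t & dm t = m"
  and df: "!!t. t : S ==> s <= cl t ==> (SUM r:S. inc r t *z f r) = 0"
 shows "EX v. ALL t:S. s <= cl t --> f t = ov t *z v"
proof -
 let ?C = "cells S (outer s) (int m)"
 obtain E c where E: "finite E" "!!t. t : ?C ==> f t = (SUM e:E. c t e *z e)"
  "!!e r. e : E ==> r : cells S (outer s) (int m - 1) ==> (SUM t:?C. inc t r * c t e) = 0"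
  by (rule star_decompose[OF f df]) (assumption | rule that)+
 have "ALL e:E. EX k. ALL t:?C. c t e = k * ov t" using star_top_int[OF s E(3)] by blast
 then obtain k where k: "!!e t. e : E ==> t : ?C ==> c t e = k e * ov t" by metis
 have "f t = ov t *z (SUM e:E. k e *z e)" if t: "t : S" "s <= cl t" for t
 proof (cases "t : ?C")
  case True
  thus ?thesis using E(2)[OF True] k[OF _ True] by (simp add: scaleR_sum_right mult.commute)
 next
  case False
  hence "dm t ~= m" using t by (auto simp: star_cells)
  thus ?thesis using f[of t] ov_supp[of t] by fastforce
 qed
 thus ?thesis by blast
qed

lemma dual_cells: "dual_cells TYPE('v::real_vector) S dm (%s t. s <= cl t) inc vsign ov m"
proof (rule dual_cells.intro)
 show "finite S" by (rule finS)
 show "!!x y z. x <= cl y ==> y <= cl z ==> x <= cl z" using cl_mono order_trans by blast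
 show "!!t s. inc t s ~= 0 ==> t : S & s : S & s <= cl t & dm t = Suc (dm s)" by (rule inc_supp)
 show "!!s. vsign s ~= 0 ==> s : S & dm s = 0" by (auto simp: vsign_def split: if_splits)
 show "EX t. s <= cl t & ov t ~= 0" if "s : S" for s
  using maximal_cell[OF that] free_dim ov_nonzero by (metis free_cell_def)
qed (fact ov_supp inc_inc vsign_cocycle ov_cycle vsign_nonzero star_exact_vector star_top_vector closed_cell_exact closed_cell_bottom)+

end

lemma open_ball_dense: "CB k clo OB k = UB k"
proof
 show "CB k clo OB k <= UB k"
  using closure_of_subset_topspace[of "CB k"] by simp
 show "UB k <= CB k clo OB k"
 proof
  fix x assume x: "x : UB k"
  define g where "g t = (%i. t * x i)" for t :: real
  have nrm: "(SUM i<k. (g t i)\<^sup>2) = t\<^sup>2 * (SUM i<k. (x i)\<^sup>2)" for t by (simp add: g_def power_mult_distrib sum_distrib_left)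
  have le: "t\<^sup>2 * (SUM i<k. (x i)\<^sup>2) <= t\<^sup>2" for t
   using mult_left_mono[of "SUM i<k. (x i)\<^sup>2" 1 "t\<^sup>2"] x by (simp add: UB_def)
  have "g t : UB k" if "t : {0..1}" for t
   using that x le[of t] power_le_one[of t 2] by (auto simp: UB_def nrm) (auto simp: g_def)
  moreover have "continuous_on {0..1} g" unfolding g_def by (intro continuous_on_coordinatewise_then_product continuous_intros)
  ultimately have cm: "cmap (top_of_set {0..1}) (CB k) g" by (auto simp: closed_ball_space_eu)
  have "g t : OB k" if "t : {0..<1}" for t
  proof -
   have "t\<^sup>2 < 1" using that by (simp add: abs_square_less_1)
   thus ?thesis using le[of t] x nrm[of t] by (auto simp: open_ball_set_def topspace_Euclidean_space UB_def g_def)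
  qed
  hence "g ` {0..<1} <= OB k" by blast
  moreover have "top_of_set {0..1} clo {0..<1::real} = {0..1}"
   using closure_of_subtopology[of euclidean "{0..1::real}" "{0..<1}"] by (simp add: closure_of_subtopology Int_absorb1 subset_eq)
  hence "g 1 : CB k clo (g ` {0..<1})"
   using continuous_map_image_closure_subset[OF cm, of "{0..<1}"] by auto
  ultimately have "g 1 : CB k clo OB k" using closure_of_mono by blast
  thus "x : CB k clo OB k" by (simp add: g_def)
 qed
qed

lemma regular_cellI:
 assumes X: "Hausdorff_space X" and h: "cmap (CB k) X h" and inj: "inj_on h (UB k)"
 shows "regular_cell X k (h ` OB k)" "X clo (h ` OB k) = h ` UB k"
proof -
 have "compactin X (h ` UB k)"
  using image_compactin[OF _ h, of "UB k"] compact_unit_ball[of k] by (simp add: compact_space_def)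
 hence cl: "closedin X (h ` UB k)" using compactin_imp_closedin[OF X] by blast
 have sub: "OB k <= UB k" by (auto simp: open_ball_set_eq)
 have "h ` UB k <= X clo (h ` OB k)"
  using continuous_map_image_closure_subset[OF h, of "OB k"] by (simp add: open_ball_dense)
 moreover have "X clo (h ` OB k) <= h ` UB k"
  by (rule closure_of_minimal[OF image_mono[OF sub] cl])
 ultimately show eq: "X clo (h ` OB k) = h ` UB k" by blast
 have im: "h ` UB k <= tsp X" using cl closedin_subset by blast
 have "homeomorphic_map (CB k) (subtop X (h ` UB k)) h"
  by (rule continuous_imp_homeomorphic_map)
   (use compact_unit_ball h inj im X Hausdorff_space_subtopology in "auto simp: continuous_map_in_subtopology")
 thus "regular_cell X k (h ` OB k)"
  unfolding regular_cell_def eq using im sub by blast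
qed

lemma coned_ball:
 obtains P :: "(nat => real) >< real => nat => real" where
  "continuous_on (UB k >< {0..1}) P" "P ` (UB k >< {0..1}) = UB (Suc k)"
  "!!x t x' t'. x : UB k ==> x' : UB k ==> t : {0..1} ==> t' : {0..1} ==>
   P (x, t) = P (x', t') <-> t = t' & (t = 0 \<or> x = x')"
  "!!x t. x : UB k ==> t : {0..1} ==> P (x, t) : OB (Suc k) <-> x : OB k & 0 < t & t < 1"
proof -
 define q where "q x = (SUM i<k. (x i)\<^sup>2)" for x :: "nat => real"
 define \<rho> where "\<rho> t = sqrt (1 - (1 - t)\<^sup>2)" for t :: real
 define R where "R t x = sqrt (1 - (\<rho> t)\<^sup>2 * q x)" for t x
 define P where "P = (%(x, t) i. if i < k then \<rho> t * x i else if i = k then R t x - 2 * (1 - t) else 0)"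
 have q0: "q x >= 0" for x by (simp add: q_def sum_nonneg)
 have ball: "x : UB k <-> (ALL i>=k. x i = 0) & q x <= 1" for x by (simp add: UB_def q_def)
 have oball: "x : OB k <-> (ALL i>=k. x i = 0) & q x < 1" for x by (simp add: open_ball_set_def topspace_Euclidean_space q_def)
 have s2: "(\<rho> t)\<^sup>2 = 1 - (1 - t)\<^sup>2" if "t : {0..1}" for t
  using that power_le_one[of "1 - t" 2] by (simp add: \<rho>_def)
 have rle: "(\<rho> t)\<^sup>2 * q x <= (\<rho> t)\<^sup>2" if "q x <= 1" for t x using that mult_left_mono[of "q x" 1 "(\<rho> t)\<^sup>2"] by simp
 have r0: "\<rho> t = 0 <-> t = 0" if "t : {0..1}" for t
 proof -
  have "\<rho> t = 0 <-> (1 - t)\<^sup>2 = 1" using s2[OF that] by (metis diff_0_right diff_self eq_iff_diff_eq_0 zero_eq_power2)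
  thus ?thesis using that by (auto simp: power2_eq_1_iff)
 qed
 have R2: "(R t x)\<^sup>2 = 1 - (\<rho> t)\<^sup>2 * q x" "R t x >= 1 - t" "R t x >= 0" "R t x <= 1" if t: "t : {0..1}" and x: "q x <= 1" for t x
 proof -
  have 1: "(1 - t)\<^sup>2 <= 1 - (\<rho> t)\<^sup>2 * q x" using rle[OF x, of t] s2[OF t] by linarith
  thus "R t x >= 1 - t" unfolding R_def by (rule real_le_rsqrt)
  have 2: "0 <= 1 - (\<rho> t)\<^sup>2 * q x" using 1 by (meson order_trans zero_le_power2)
  thus "(R t x)\<^sup>2 = 1 - (\<rho> t)\<^sup>2 * q x" "R t x >= 0" by (simp_all add: R_def)
  show "R t x <= 1" unfolding R_def using q0[of x] by (simp add: mult_nonneg_nonneg)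
 qed
 have sumP: "(SUM i<Suc k. (P (x, t) i)\<^sup>2) = (\<rho> t)\<^sup>2 * q x + (R t x - 2 * (1 - t))\<^sup>2" for x t
  by (simp add: P_def q_def power_mult_distrib sum_distrib_left)
 have R_neg: "(R t x - 2 * (1 - t))\<^sup>2 = (R t x)\<^sup>2 - 4 * (1 - t) * (R t x - (1 - t))" for t x
  by (simp add: power2_eq_square algebra_simps)
 have sum1: "(SUM i<Suc k. (P (x, t) i)\<^sup>2) = 1 - 4 * ((1 - t) * (R t x - (1 - t)))" if "t : {0..1}" "q x <= 1" for x t
  unfolding sumP R_neg R2(1)[OF that] by simp
 have support: "P (x, t) i = 0" if "i >= Suc k" for x t i using that by (simp add: P_def)
 have cont: "continuous_on (UB k >< {0..1}) P"
 proof (rule continuous_on_coordinatewise_then_product)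
  fix i
  have c: "continuous_on (UB k >< {0..1}) (%z. fst z j)" for j
   by (rule continuous_on_compose2[OF continuous_on_coordinate[of UNIV j] continuous_on_fst[OF continuous_on_id]]) simp
  consider "i < k" | "i = k" | "i > k" by linarith
  thus "continuous_on (UB k >< {0..1}) (%z. P z i)"
  proof cases
   case 1
   thus ?thesis by (simp add: P_def case_prod_unfold \<rho>_def) (intro continuous_intros c)
  next
   case 2
   thus ?thesis by (simp add: P_def case_prod_unfold R_def \<rho>_def q_def) (intro continuous_intros c)
  qed (simp add: P_def case_prod_unfold)
 qed
 have inj: "P (x, t) = P (x', t') <-> t = t' & (t = 0 \<or> x = x')"
  if x: "x : UB k" "x' : UB k" and t: "t : {0..1}" "t' : {0..1}" for x t x' t'
 proof
  assume e: "P (x, t) = P (x', t')"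
  have y: "\<rho> t * x i = \<rho> t' * x' i" if "i < k" for i using fun_cong[OF e, of i] that by (simp add: P_def)
  have s: "R t x - 2 * (1 - t) = R t' x' - 2 * (1 - t')" using fun_cong[OF e, of k] by (simp add: P_def)
  have "(\<rho> t)\<^sup>2 * q x = (SUM i<k. (\<rho> t * x i)\<^sup>2)" by (simp add: q_def power_mult_distrib sum_distrib_left)
  also have "... = (SUM i<k. (\<rho> t' * x' i)\<^sup>2)" using y by simp
  also have "... = (\<rho> t')\<^sup>2 * q x'" by (simp add: q_def power_mult_distrib sum_distrib_left)
  finally have "R t x = R t' x'" by (simp add: R_def)
  hence tt: "t = t'" using s by simp
  have "x = x'" if "t ~= 0"
  proof
   fix i show "x i = x' i" using y[of i] r0[OF t(1)] that tt x by (cases "i < k") (auto simp: ball)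
  qed
  thus "t = t' & (t = 0 \<or> x = x')" using tt by blast
 next
  assume "t = t' & (t = 0 \<or> x = x')"
  thus "P (x, t) = P (x', t')" by (elim conjE disjE) (auto simp: P_def R_def \<rho>_def)
 qed
 have im: "P (x, t) : UB (Suc k)" if "x : UB k" "t : {0..1}" for x t
 proof -
  have "0 <= (1 - t) * (R t x - (1 - t))" using R2(2)[of t x] that by (intro mult_nonneg_nonneg) (auto simp: ball)
  moreover have "q x <= 1" using that by (simp add: ball)
  ultimately have "(SUM i<Suc k. (P (x, t) i)\<^sup>2) <= 1" using sum1[OF that(2)] by simp
  thus ?thesis using support unfolding UB_def by blast
 qed
 have surj: "y : P ` (UB k >< {0..1})" if y: "y : UB (Suc k)" for y
 proof -
  have y': "q y + (y k)\<^sup>2 <= 1" "!!i. i > k ==> y i = 0" using y by (auto simp: UB_def q_def)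
  define r where "r = sqrt (1 - q y)"
  have "q y <= 1" using y'(1) zero_le_power2[of "y k"] by linarith
  hence r2: "r\<^sup>2 = 1 - q y" "r >= 0" by (simp_all add: r_def)
  have "(y k)\<^sup>2 <= r\<^sup>2" using y'(1) r2(1) by simp
  hence yk: "\<bar>y k\<bar> <= r" using r2(2) by (metis abs_of_nonneg abs_le_square_iff)
  have r1: "r <= 1" using q0[of y] by (simp add: r_def)
  define t where "t = 1 - (r - y k) / 2"
  have t: "t : {0..1}" using yk r1 by (auto simp: t_def abs_le_iff field_simps)
  have u: "1 - t <= r" using yk by (auto simp: t_def abs_le_iff)
  show ?thesis
  proof (cases "t = 0")
   case True
   hence "r = 1" "y k = -1" using u r1 by (auto simp: t_def)
   hence "q y = 0" using r2(1) by simp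
   hence "y i = 0" if "i < k" for i using that by (auto simp: q_def sum_nonneg_eq_0_iff)
   hence "y = P (%_. 0, 0)" using `y k = -1` y'(2) by (auto simp: P_def R_def \<rho>_def q_def fun_eq_iff not_less le_less)
   moreover have "(%_. 0) : UB k" by (simp add: UB_def)
   ultimately show ?thesis by (intro image_eqI[of _ _ "(%_. 0, 0)"]) auto
  next
   case False
   hence rt: "\<rho> t ~= 0" using r0[OF t] by simp
   define x where "x = (%i. if i < k then y i / \<rho> t else 0)"
   have "q x = q y / (\<rho> t)\<^sup>2" by (simp add: q_def x_def power_divide sum_divide_distrib)
   hence qx: "(\<rho> t)\<^sup>2 * q x = q y" using rt by simp
   have "q y <= (\<rho> t)\<^sup>2"
    unfolding s2[OF t] using power_mono[OF u, of 2] r2(1) t by auto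
   hence "q x <= 1" using qx rt by (metis mult_cancel_left1 mult_left_le_imp_le mult.right_neutral zero_less_power2)
   hence xb: "x : UB k" by (simp add: ball x_def)
   have "R t x = r" by (simp add: R_def qx r_def)
   hence tk: "y k = R t x - 2 * (1 - t)" by (simp add: t_def field_simps)
   have "y = P (x, t)"
   proof
    fix i
    consider "i < k" | "i = k" | "i > k" by linarith
    thus "y i = P (x, t) i"
    proof cases
     case 1 thus ?thesis using rt by (simp add: P_def x_def)
    next
     case 2 thus ?thesis using tk by (simp add: P_def)
    next
     case 3 thus ?thesis using y'(2) by (simp add: P_def)
    qed
   qed
   thus ?thesis using xb t by blast
  qed
 qed
 have op: "P (x, t) : OB (Suc k) <-> x : OB k & 0 < t & t < 1" if x: "x : UB k" and t: "t : {0..1}" for x t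
 proof -
  have qx: "q x <= 1" using x by (simp add: ball)
  have "P (x, t) : OB (Suc k) <-> 0 < (1 - t) * (R t x - (1 - t))"
   using sum1[OF t qx] support by (auto simp: open_ball_set_def topspace_Euclidean_space)
  also have "... <-> t < 1 & 1 - t < R t x"
   using R2(2)[OF t qx] t by (auto simp: zero_less_mult_iff)
  also have "1 - t < R t x <-> (1 - t)\<^sup>2 < (R t x)\<^sup>2"
   using power_strict_mono[of "1 - t" "R t x" 2] power2_less_imp_less[of "1 - t" "R t x"] R2(3)[OF t qx] t by auto
  also have "... <-> (\<rho> t)\<^sup>2 * q x < (\<rho> t)\<^sup>2" unfolding R2(1)[OF t qx] using s2[OF t] by linarith
  also have "... <-> t ~= 0 & q x < 1" using r0[OF t] by (auto simp: mult_less_cancel_left1)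
  finally show ?thesis using t x by (auto simp: oball ball)
 qed
 show ?thesis by (rule that[OF cont _ inj op]) (use im surj in auto)
qed

primrec cone_height :: "'a cone => real" where
 "cone_height Apex = 0"
| "cone_height (Pt x t) = t"

lemma cone_height_proj: "cone_height (cone_proj (x, t)) = t" by (simp add: cone_proj_def)

lemma cone_proj_eq: "cone_proj (x, t) = cone_proj (y, s) <-> t = s & (t = 0 \<or> x = y)"
 by (auto simp: cone_proj_def)

lemma topspace_cylinder [simp]: "tsp (cylinder W) = tsp W >< {0..1}" by (simp add: cylinder_def)

lemma continuous_cone_proj: "cmap (cylinder W) (CS W) cone_proj"
 by (rule quotient_imp_continuous_map[OF quotient_map_cone_proj])

lemma continuous_cone_height:
 fixes W :: "'a topology"
 shows "cmap (CS W) euclideanreal cone_height"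
proof (rule continuous_compose_quotient_map[OF quotient_map_cone_proj])
 have "cone_height o cone_proj = (snd :: 'a >< real => real)" by (auto simp: cone_height_proj fun_eq_iff)
 moreover have "cmap (cylinder W) euclideanreal snd"
  unfolding cylinder_def using continuous_map_snd continuous_map_into_fulltopology by blast
 ultimately show "cmap (cylinder W) euclideanreal (cone_height o cone_proj)" by simp
qed

lemma Hausdorff_cone:
 assumes W: "Hausdorff_space W"
 shows "Hausdorff_space (CS W)"
 unfolding Hausdorff_space_def
proof (intro allI impI)
 fix a b assume ab: "a : tsp (CS W) & b : tsp (CS W) & a ~= b"
 show "EX U V. openin (CS W) U & openin (CS W) V & a : U & b : V & disjnt U V"
 proof (cases "cone_height a = cone_height b")
  case False
  then obtain U V where UV: "open U" "open V" "cone_height a : U" "cone_height b : V" "U Int V = {}" using hausdorff by metis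
  show ?thesis
   by (rule exI[of _ "{z : tsp (CS W). cone_height z : U}"], rule exI[of _ "{z : tsp (CS W). cone_height z : V}"])
    (use UV ab openin_continuous_map_preimage[OF continuous_cone_height] in "auto simp: disjnt_def")
 next
  case True
  obtain x t where a: "a = cone_proj (x, t)" "x : tsp W" "t : {0..1}" using ab by (auto simp: topspace_cone_space)
  obtain y s where b: "b = cone_proj (y, s)" "y : tsp W" "s : {0..1}" using ab by (auto simp: topspace_cone_space)
  have ts: "t = s" "t ~= 0" "x ~= y" using True ab a(1) b(1) by (auto simp: cone_height_proj cone_proj_eq)
  obtain U V where UV: "openin W U" "openin W V" "x : U" "y : V" "disjnt U V" using W a(2) b(2) ts(3) unfolding Hausdorff_space_def by metis
  have op: "openin (CS W) (cone_proj ` (U' >< {0<..1}))" if "openin W U'" for U'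
  proof -
   have sub: "U' <= tsp W" using that openin_subset by blast
   hence "{z : tsp (cylinder W). cone_proj z : cone_proj ` (U' >< {0<..1})} = U' >< {0<..1}"
    by (auto simp: cone_proj_eq)
   moreover have "openin (top_of_set {0..1}) {0<..1::real}"
   proof -
    have "{0<..1} = {0..1} Int {0::real<..}" by auto
    thus ?thesis using openin_open_Int[OF open_greaterThan, of "{0..1::real}" 0] by simp
   qed
   ultimately show ?thesis
    unfolding openin_cone_space using that sub by (auto simp: cylinder_def openin_prod_Times_iff)
  qed
  show ?thesis
  proof (intro exI conjI)
   show "disjnt (cone_proj ` (U >< {0<..1})) (cone_proj ` (V >< {0<..1}))"
    using UV(5) by (auto simp: disjnt_def cone_proj_eq)
   show "a : cone_proj ` (U >< {0<..1})" "b : cone_proj ` (V >< {0<..1})" using a b ts UV by auto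
  qed (rule op[OF UV(1)], rule op[OF UV(2)])
 qed
qed

lemma contractible_cone: "contractible_space (CS W)"
proof -
 let ?I = "top_of_set {0..1::real}" and ?C = "CS W"
 define h where "h = (%(s :: real, c :: 'a cone). case c of Apex => Apex | Pt x t => cone_proj (x, (1 - s) * t))"
 have hp: "h (s, cone_proj (x, t)) = cone_proj (x, (1 - s) * t)" for s x t
  by (auto simp: h_def cone_proj_def)
 have q: "quotient_map (ptop ?I (cylinder W)) (ptop ?I ?C) (%(s, z). (s, cone_proj z))"
  by (rule quotient_map_prod_right[OF _ _ quotient_map_cone_proj])
   (auto intro!: compact_imp_locally_compact_space compact_space_subtopology Hausdorff_space_subtopology)
 have "cmap (ptop ?I ?C) ?C h"
 proof (rule continuous_compose_quotient_map[OF q])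
  have "h o (%(s, z). (s, cone_proj z)) = cone_proj o (%z. (fst (snd z), (1 - fst z) * snd (snd z)))"
   by (auto simp: fun_eq_iff hp)
  moreover have sc: "cmap (ptop ?I (cylinder W)) (cylinder W) (%z. (fst (snd z), (1 - fst z) * snd (snd z)))"
  proof -
   let ?P = "ptop ?I (ptop W ?I)"
   have s: "cmap ?P (ptop W ?I) snd" by (rule continuous_map_snd)
   have 1: "cmap ?P W (%z. fst (snd z))" using continuous_map_compose[OF s continuous_map_fst] by (simp add: comp_def)
   have 2: "cmap ?P euclideanreal fst" using continuous_map_fst continuous_map_into_fulltopology by blast
   have 3: "cmap ?P euclideanreal (%z. snd (snd z))"
    using continuous_map_compose[OF s continuous_map_snd] continuous_map_into_fulltopology by (fastforce simp: comp_def)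
   have "cmap ?P euclideanreal (%z. (1 - fst z) * snd (snd z))" by (intro continuous_intros 2 3) simp
   hence "cmap ?P ?I (%z. (1 - fst z) * snd (snd z))"
    by (rule continuous_map_into_subtopology) (auto simp: mult_le_one)
   thus ?thesis unfolding cylinder_def using 1 by (intro continuous_map_pairedI)
  qed
  ultimately show "cmap (ptop ?I (cylinder W)) ?C (h o (%(s, z). (s, cone_proj z)))"
   using continuous_map_compose[OF sc continuous_cone_proj] by simp
 qed
 moreover have "h (0, c) = c" if "c : tsp ?C" for c
  using that by (auto simp: topspace_cone_space hp)
 moreover have "h (1, c) = Apex" for c
  by (cases c) (auto simp: h_def cone_proj_def)
 ultimately have "homotopic_with (%x. True) ?C ?C id (%x. Apex)"
  by (subst homotopic_with) (auto intro!: exI[of _ h])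
 thus ?thesis unfolding contractible_space_def by blast
qed

lemma base_embedding:
 assumes W: "Hausdorff_space W" "compact_space W"
 shows "homeomorphic_map W (subtop (CS W) (cone_base W)) (%x. Pt x 1)"
proof (rule continuous_imp_homeomorphic_map)
 show "compact_space W" by fact
 have e: "(%x. Pt x 1) = cone_proj o (%x. (x, 1))" by (auto simp: cone_proj_def fun_eq_iff)
 have im: "(%x. Pt x 1) ` tsp W = cone_base W" by (force simp: cone_base_def cone_proj_def image_iff)
 have sub: "cone_base W <= tsp (CS W)" unfolding cone_base_def topspace_cone_space by (intro image_mono) auto
 have "cmap W (cylinder W) (%x. (x, 1))" unfolding cylinder_def by (intro continuous_map_pairedI) auto
 from continuous_map_compose[OF this continuous_cone_proj]
 have "cmap W (CS W) (%x. Pt x 1)" unfolding e .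
 thus "cmap W (subtop (CS W) (cone_base W)) (%x. Pt x 1)"
  by (rule continuous_map_into_subtopology) (use im in blast)
 show "Hausdorff_space (subtop (CS W) (cone_base W))" by (rule Hausdorff_space_subtopology[OF Hausdorff_cone[OF W(1)]])
 show "(%x. Pt x 1) ` tsp W = tsp (subtop (CS W) (cone_base W))" using im sub by auto
qed (auto simp: inj_on_def)

lemma cone_base_cell:
 assumes W: "Hausdorff_space W" "compact_space W" and e: "regular_cell W k e"
 shows "regular_cell (CS W) k (cone_proj ` (e >< {1}))"
  "CS W clo (cone_proj ` (e >< {1})) = cone_proj ` ((W clo e) >< {1})"
proof -
 obtain f where f: "homeomorphic_map (CB k) (subtop W (W clo e)) f" "f ` OB k = e"
  using e by (auto simp: regular_cell_def)
 let ?b = "%x. Pt x 1 :: 'a cone"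
 have fi: "f ` UB k = W clo e"
  using homeomorphic_imp_surjective_map[OF f(1)] closure_of_subset_topspace[of W e] by (auto simp: Int_absorb1)
 have "cmap (CB k) W f"
  using homeomorphic_imp_continuous_map[OF f(1)] continuous_map_into_fulltopology by blast
 moreover have "cmap W (CS W) ?b"
  using homeomorphic_imp_continuous_map[OF base_embedding[OF W]] continuous_map_into_fulltopology by blast
 ultimately have c: "cmap (CB k) (CS W) (?b o f)" by (rule continuous_map_compose)
 have "inj_on (?b o f) (UB k)" using homeomorphic_imp_injective_map[OF f(1)] by (auto simp: inj_on_def)
 note R = regular_cellI[OF Hausdorff_cone[OF W(1)] c this]
 have im: "(?b o f) ` A = cone_proj ` ((f ` A) >< {1})" for A by (force simp: cone_proj_def image_iff)
 show "regular_cell (CS W) k (cone_proj ` (e >< {1}))"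
  "CS W clo (cone_proj ` (e >< {1})) = cone_proj ` ((W clo e) >< {1})"
  using R unfolding im f(2) fi by auto
qed

lemma cone_open_cell:
 assumes W: "Hausdorff_space W" "compact_space W" and e: "regular_cell W k e"
 shows "regular_cell (CS W) (Suc k) (cone_proj ` (e >< {0<..<1}))"
  "CS W clo (cone_proj ` (e >< {0<..<1})) = cone_proj ` ((W clo e) >< {0..1})"
proof -
 obtain f where f: "homeomorphic_map (CB k) (subtop W (W clo e)) f" "f ` OB k = e"
  using e by (auto simp: regular_cell_def)
 have fi: "f ` UB k = W clo e" and finj: "inj_on f (UB k)"
  using homeomorphic_imp_surjective_map[OF f(1)] homeomorphic_imp_injective_map[OF f(1)] closure_of_subset_topspace[of W e] by (auto simp: Int_absorb1)
 have fc: "cmap (CB k) W f"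
  using homeomorphic_imp_continuous_map[OF f(1)] continuous_map_into_fulltopology by blast
 obtain P :: "(nat => real) >< real => nat => real" where P: "continuous_on (UB k >< {0..1}) P" "P ` (UB k >< {0..1}) = UB (Suc k)"
  "!!x t x' t'. x : UB k ==> x' : UB k ==> t : {0..1} ==> t' : {0..1} ==> P (x, t) = P (x', t') <-> t = t' & (t = 0 \<or> x = x')"
  "!!x t. x : UB k ==> t : {0..1} ==> P (x, t) : OB (Suc k) <-> x : OB k & 0 < t & t < 1"
  by (rule coned_ball[of k]) (rule that)
 let ?K = "ptop (CB k) (top_of_set {0..1::real})"
 have K: "?K = top_of_set (UB k >< {0..1})" by (simp add: closed_ball_space_eu)
 have tK: "tsp ?K = UB k >< {0..1}" by simp
 have Kc: "compact_space ?K" by (simp add: compact_space_prod_topology compact_unit_ball compact_space_subtopology)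
 have Pc: "cmap ?K (CB (Suc k)) P" unfolding K closed_ball_space_eu using P(1,2) by auto
 have Hb: "Hausdorff_space (CB (Suc k))" by (simp add: closed_ball_space_eu Hausdorff_space_subtopology)
 have q: "quotient_map ?K (CB (Suc k)) P"
  by (rule continuous_closed_imp_quotient_map[OF Pc continuous_imp_closed_map_gen[OF Kc Hausdorff_imp_kc_space[OF Hb] Pc]]) (use P(2) in "simp add: tK")
 define g where "g = (%(x, t). cone_proj (f x, t))"
 have "cmap ?K (cylinder W) (%(x, t). (f x, t))"
  unfolding cylinder_def using continuous_map_prod_top[of "CB k" "top_of_set {0..1::real}" W "top_of_set {0..1}" f "%t. t"] fc by simp
 from continuous_map_compose[OF this continuous_cone_proj]
 have gc: "cmap ?K (CS W) g" by (simp add: g_def comp_def case_prod_unfold)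
 have fib: "g z = g z' <-> P z = P z'" if "z : UB k >< {0..1}" "z' : UB k >< {0..1}" for z z'
  using that P(3) inj_on_eq_iff[OF finj] by (auto simp: g_def cone_proj_eq)
 define h where "h = g o inv_into (UB k >< {0..1}) P"
 have hP: "h (P z) = g z" if "z : UB k >< {0..1}" for z
  using fib[of "inv_into (UB k >< {0..1}) P (P z)" z] that
  by (simp add: h_def inv_into_into f_inv_into_f)
 have "cmap ?K (CS W) (h o P)"
  by (rule continuous_map_eq[OF gc]) (use hP in "simp add: tK")
 hence hc: "cmap (CB (Suc k)) (CS W) h" by (rule continuous_compose_quotient_map[OF q])
 have "inj_on h (UB (Suc k))"
  unfolding P(2)[symmetric] by (rule inj_onI) (use hP fib in auto)
 note R = regular_cellI[OF Hausdorff_cone[OF W(1)] hc this]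
 have b: "h ` UB (Suc k) = cone_proj ` ((W clo e) >< {0..1})"
  unfolding P(2)[symmetric] fi[symmetric] using hP by (force simp: g_def image_iff)
 have "OB (Suc k) = P ` (OB k >< {0<..<1})"
 proof -
  have s: "OB j <= UB j" for j by (auto simp: open_ball_set_eq)
  show ?thesis
  proof (intro equalityI subsetI)
   fix y assume y: "y : OB (Suc k)"
   hence "y : P ` (UB k >< {0..1})" using s P(2) by blast
   then obtain x t where "x : UB k" "t : {0..1}" "y = P (x, t)" by blast
   thus "y : P ` (OB k >< {0<..<1})" using P(4) y by auto
  qed (use P(4) s in force)
 qed
 moreover have "h ` P ` (OB k >< {0<..<1}) = cone_proj ` (e >< {0<..<1})"
 proof -
  have "h (P z) = g z" if "z : OB k >< {0<..<1}" for z using hP[of z] that by (auto simp: open_ball_set_eq)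
  hence "h ` P ` (OB k >< {0<..<1}) = g ` (OB k >< {0<..<1})" by (simp add: image_image cong: image_cong)
  also have "... = cone_proj ` (e >< {0<..<1})" unfolding f(2)[symmetric] by (force simp: g_def image_iff)
  finally show ?thesis .
 qed
 ultimately have o: "h ` OB (Suc k) = cone_proj ` (e >< {0<..<1})" by simp
 show "regular_cell (CS W) (Suc k) (cone_proj ` (e >< {0<..<1}))"
  "CS W clo (cone_proj ` (e >< {0<..<1})) = cone_proj ` ((W clo e) >< {0..1})"
  using R unfolding o b by auto
qed

lemma apex_cell:
 assumes W: "Hausdorff_space W" "tsp W ~= {}"
 shows "regular_cell (CS W) 0 {Apex}" "CS W clo {Apex} = {Apex}"
proof -
 obtain x where "x : tsp W" using W(2) by blast
 hence a: "Apex : tsp (CS W)" by (auto simp: topspace_cone_space cone_proj_def image_iff intro!: bexI[of _ "(x, 0)"])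
 have u: "UB 0 = {%_. 0}" "OB 0 = {%_. 0}" by (auto simp: UB_def open_ball_set_def topspace_Euclidean_space)
 have "cmap (CB 0) (CS W) (%_. Apex)" using a by simp
 from regular_cellI[OF Hausdorff_cone[OF W(1)] this]
 show "regular_cell (CS W) 0 {Apex}" "CS W clo {Apex} = {Apex}" by (simp_all add: u)
qed

definition cell_dim :: "(nat => 'a set set) => 'a set => nat" where
 "cell_dim N e = (THE k. e : N k)"

lemma regular_cell_nonempty: "regular_cell X k e ==> e ~= {}"
proof -
 assume "regular_cell X k e"
 moreover have "(%_. 0) : OB k" by (simp add: open_ball_set_def topspace_Euclidean_space)
 ultimately show ?thesis unfolding regular_cell_def by blast
qed

lemma finite_cellsI:
 assumes X: "Hausdorff_space X" and fin: "finite {(k, e). e : N k}"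
  and reg: "!!k e. e : N k ==> regular_cell X k e"
  and disj: "!!k l e e'. e : N k ==> e' : N l ==> (k, e) ~= (l, e') ==> e Int e' = {}"
  and cover: "(UN k. &&(N k)) = tsp X"
  and frontier: "!!k e. e : N k ==> X clo e - e <= (UN l<k. &&(N l))"
 shows "finite_cells X (UN k. N k) (cell_dim N)" "!!k e. e : N k ==> cell_dim N e = k"
proof -
 show dim: "cell_dim N e = k" if e: "e : N k" for k e
  unfolding cell_dim_def
 proof (rule the_equality)
  show "e : N k" by (rule e)
  fix l assume "e : N l"
  thus "l = k" using disj[OF e, of e l] regular_cell_nonempty[OF reg[OF e]] by auto
 qed
 show "finite_cells X (UN k. N k) (cell_dim N)"
 proof (rule finite_cells.intro[OF X])
  have "(UN k. N k) = snd ` {(k, e). e : N k}" by force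
  thus "finite (UN k. N k)" using fin by simp
  show "regular_cell X (cell_dim N e) e" if "e : (UN k. N k)" for e using that reg dim by auto
  show "e Int e' = {}" if "e : (UN k. N k)" "e' : (UN k. N k)" "e ~= e'" for e e' using that disj by blast
  have "&&(UN k. N k) = (UN k. &&(N k))" by blast
  thus "&&(UN k. N k) = tsp X" using cover by simp
  show "X clo e - e <= &&{e' : (UN k. N k). cell_dim N e' < cell_dim N e}" if "e : (UN k. N k)" for e
  proof
   fix x assume x: "x : X clo e - e"
   obtain k where k: "e : N k" using `e : (UN k. N k)` by blast
   then obtain l e' where l: "l < k" "e' : N l" "x : e'" using frontier[OF k] x by blast
   hence "e' : {e' : (UN k. N k). cell_dim N e' < cell_dim N e}" using dim[OF k] dim[OF l(2)] by auto
   thus "x : &&{e' : (UN k. N k). cell_dim N e' < cell_dim N e}" using l(3) by blast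
  qed
 qed
qed

lemma decompositionD:
 assumes "regular_cell_decomposition X N"
 shows "Hausdorff_space X" "e : N k ==> regular_cell X k e"
  "e : N k ==> e' : N l ==> (k, e) ~= (l, e') ==> e Int e' = {}"
  "(UN k. &&(N k)) = tsp X"
  "e : N k ==> X clo e - e <= (UN l<k. &&(N l))"
  "e : N k ==> finite {(l, e'). e' : N l & e' Int X clo e ~= {}}"
  "A <= tsp X ==> (!!k e. e : N k ==> closedin X (A Int X clo e)) ==> closedin X A"
proof -
 note D = assms[unfolded regular_cell_decomposition_def]
 note D2 = D[THEN conjunct2] note D3 = D2[THEN conjunct2] note D4 = D3[THEN conjunct2]
 note D5 = D4[THEN conjunct2] note D6 = D5[THEN conjunct2]
 show "Hausdorff_space X" by (rule D[THEN conjunct1])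
 show "e : N k ==> regular_cell X k e" using D2[THEN conjunct1] by blast
 show "e : N k ==> e' : N l ==> (k, e) ~= (l, e') ==> e Int e' = {}" using D3[THEN conjunct1] by blast
 show "(UN k. &&(N k)) = tsp X" by (rule D4[THEN conjunct1])
 show "e : N k ==> X clo e - e <= (UN l<k. &&(N l))" using D5[THEN conjunct1] by blast
 show "e : N k ==> finite {(l, e'). e' : N l & e' Int X clo e ~= {}}" using D6[THEN conjunct1] by blast
 show "A <= tsp X ==> (!!k e. e : N k ==> closedin X (A Int X clo e)) ==> closedin X A" using D6[THEN conjunct2] by blast
qed

text \<open>Choosing one point in each cell gives a closed discrete subset, which is finite by compactness.\<close>

lemma decomposition_finite:
 assumes X: "compact_space X" and N: "regular_cell_decomposition X N"
 shows "finite {(k, e). e : N k}"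
proof -
 note D = decompositionD[OF N]
 let ?I = "{(k, e). e : N k}"
 note H = D(1)
 have ne: "e ~= {}" "e <= tsp X" if "e : N k" for k e
 proof -
  have "regular_cell X k e" by (rule D(2)[OF that])
  thus "e ~= {}" "e <= tsp X" using regular_cell_nonempty by (auto simp: regular_cell_def)
 qed
 have disj: "e Int e' = {}" if "e : N k" "e' : N l" "(k, e) ~= (l, e')" for k l e e' by (rule D(3)[OF that])
 define pt where "pt e = (SOME x. x : e)" for e :: "'a set"
 have pt: "pt e : e" if "e : N k" for k e using ne[OF that] unfolding pt_def by (simp add: some_in_eq)
 have inj: "inj_on (%(k, e). pt e) ?I"
 proof (rule inj_onI, clarify)
  fix k e l e' assume h: "e : N k" "e' : N l" "pt e = pt e'"
  show "k = l & e = e'" using disj[OF h(1,2)] pt[OF h(1)] pt[OF h(2)] h(3) by auto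
 qed
 let ?P = "(%(k, e). pt e) ` ?I"
 have P: "?P <= tsp X" using pt ne by fastforce
 have closed: "closedin X A" if A: "A <= ?P" for A
 proof -
  have "closedin X (A Int X clo e)" if e: "e : N k" for k e
  proof -
   have "finite {(l, e'). e' : N l & e' Int X clo e ~= {}}" by (rule D(6)[OF e])
   moreover have "A Int X clo e <= (%(k, e). pt e) ` {(l, e'). e' : N l & e' Int X clo e ~= {}}"
   proof
    fix x assume x: "x : A Int X clo e"
    then obtain l e' where "e' : N l" "x = pt e'" using A by auto
    thus "x : (%(k, e). pt e) ` {(l, e'). e' : N l & e' Int X clo e ~= {}}"
     using x pt[of e' l] by (intro image_eqI[of _ _ "(l, e')"]) auto
   qed
   ultimately have "finite (A Int X clo e)" using finite_surj by blast
   moreover have "A Int X clo e <= tsp X" using A P by blast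
   ultimately show ?thesis using Hausdorff_imp_t1_space[OF H] by (simp add: t1_space_closedin_finite)
  qed
  thus ?thesis by (rule D(7)[OF order_trans[OF A P]])
 qed
 have "compactin X ?P" using closed[OF order_refl] X closedin_compact_space by blast
 moreover have "openin X (tsp X - (?P - {x}))" for x using closed[of "?P - {x}"] by auto
 moreover have "?P <= &&((%x. tsp X - (?P - {x})) ` ?P)" using P by auto
 ultimately obtain F where F: "finite F" "F <= (%x. tsp X - (?P - {x})) ` ?P" "?P <= &&F"
  using compactinD[of X ?P "(%x. tsp X - (?P - {x})) ` ?P"] by blast
 from finite_subset_image[OF F(1,2)] obtain Q where Q: "finite Q" "F = (%x. tsp X - (?P - {x})) ` Q" by blast
 have "?P <= Q"
 proof
  fix x assume x: "x : ?P"
  then obtain y where "y : Q" "x : tsp X - (?P - {y})" using F(3) unfolding Q(2) by blast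
  thus "x : Q" using x by blast
 qed
 thus ?thesis using finite_imageD[OF finite_subset[OF _ Q(1)] inj] by blast
qed

lemma decomposition_cells:
 assumes "compact_space X" "regular_cell_decomposition X N"
 shows "finite_cells X (UN k. N k) (cell_dim N)" "!!k e. e : N k ==> cell_dim N e = k"
proof -
 note D = decompositionD[OF assms(2)] and fin = decomposition_finite[OF assms]
 show "finite_cells X (UN k. N k) (cell_dim N)" by (rule finite_cellsI(1)[OF D(1) fin D(2,3,4,5)])
 show "cell_dim N e = k" if "e : N k" for k e by (rule finite_cellsI(2)[OF D(1) fin D(2,3,4,5) that])
qed

abbreviation bcell :: "'a set => 'a cone set" where "bcell e == cone_proj ` (e >< {1})"
abbreviation ccell :: "'a set => 'a cone set" where "ccell e == cone_proj ` (e >< {0<..<1})"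

lemma cell_mem: "Apex ~: bcell e" "Apex ~: ccell e" "Pt x t : bcell e <-> x : e & t = 1" "Pt x t : ccell e <-> x : e & 0 < t & t < 1"
 by (force simp: cone_proj_def image_iff split: if_splits)+

lemma cone_cells_cases:
 assumes "c : cone_cells N k"
 obtains "k = 0" "c = {Apex}" | e where "e : N k" "c = bcell e" | j e where "k = Suc j" "e : N j" "c = ccell e"
 using assms by (cases k) (auto simp: cone_cells_def)

lemma cone_cellsI: "{Apex} : cone_cells N 0" "e : N k ==> bcell e : cone_cells N k" "e : N k ==> ccell e : cone_cells N (Suc k)"
 by (auto simp: cone_cells_def)

locale cone_decomposition =
 fixes W :: "'a topology" and N :: "nat => 'a set set"
 assumes compactW: "compact_space W" and decW: "regular_cell_decomposition W N" and nonempty: "tsp W ~= {}"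
begin

sublocale W: finite_cells W "UN k. N k" "cell_dim N"
 by (rule decomposition_cells(1)[OF compactW decW])

lemma dimW: "e : N k ==> cell_dim N e = k" by (rule decomposition_cells(2)[OF compactW decW])

lemmas regN = decompositionD(2)[OF decW]

lemma closure_cells:
 "CS W clo {Apex} = {Apex}"
 "e : N k ==> CS W clo bcell e = bcell (W clo e)"
 "e : N k ==> CS W clo ccell e = cone_proj ` ((W clo e) >< {0..1})"
 using apex_cell(2)[OF W.Hausdorff nonempty] cone_base_cell(2)[OF W.Hausdorff compactW regN] cone_open_cell(2)[OF W.Hausdorff compactW regN] by auto

lemma frontierN: "e : N k ==> x : W clo e ==> x : e \<or> (EX l<k. EX e':N l. x : e')"
 using decompositionD(5)[OF decW, of e k] by blast

lemma cone_disjoint: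
 assumes "c : cone_cells N k" "c' : cone_cells N l" "(k, c) ~= (l, c')"
 shows "c Int c' = {}"
proof (rule ccontr)
 assume "c Int c' ~= {}"
 then obtain p where p: "p : c" "p : c'" by blast
 have d: "k = l & e = e'" if "e : N k" "e' : N l" "x : e" "x : e'" for k l e e' x
  using decompositionD(3)[OF decW that(1,2)] that(3,4) by blast
 from assms(1) have "k = l & c = c'"
 proof (cases rule: cone_cells_cases)
  case 1
  hence pA: "p = Apex" using p by simp
  from assms(2) show ?thesis by (cases rule: cone_cells_cases) (use 1 p pA in "auto simp: cell_mem")
 next
  case (2 e)
  then obtain x where x: "p = Pt x 1" "x : e" using p(1) by (auto simp: cone_proj_def)
  from assms(2) show ?thesis
  proof (cases rule: cone_cells_cases)
   case (2 e')
   thus ?thesis using d[OF `e : N k`, of e' l x] x p(2) `c = bcell e` by (auto simp: cell_mem)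
  qed (use x p(2) in "auto simp: cell_mem")
 next
  case (3 j e)
  then obtain x t where x: "p = Pt x t" "x : e" "0 < t" "t < 1" using p(1) by (auto simp: cone_proj_def)
  from assms(2) show ?thesis
  proof (cases rule: cone_cells_cases)
   case (3 j' e')
   thus ?thesis using d[OF `e : N j`, of e' j' x] x p(2) `c = ccell e` `k = Suc j` by (auto simp: cell_mem)
  qed (use x p(2) in "auto simp: cell_mem")
 qed
 thus False using assms(3) by simp
qed

lemma cone_cover: "(UN k. &&(cone_cells N k)) = tsp (CS W)"
proof (intro equalityI subsetI)
 fix p assume "p : (UN k. &&(cone_cells N k))"
 then obtain k c where c: "c : cone_cells N k" "p : c" by blast
 have s: "e <= tsp W" if "e : N j" for e j using W.cell_sub that by blast
 obtain w where w: "w : tsp W" using nonempty by blast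
 from c(1) show "p : tsp (CS W)"
 proof (cases rule: cone_cells_cases)
  case 1
  hence "p = cone_proj (w, 0)" using c(2) by (simp add: cone_proj_def)
  thus ?thesis using w unfolding topspace_cone_space by auto
 next
  case (2 e)
  thus ?thesis using c(2) s[of e k] unfolding topspace_cone_space by auto
 next
  case (3 j e)
  thus ?thesis using c(2) s[of e j] unfolding topspace_cone_space by force
 qed
next
 fix p assume "p : tsp (CS W)"
 then obtain x t where p: "p = cone_proj (x, t)" "x : tsp W" "0 <= t" "t <= 1" unfolding topspace_cone_space by auto
 obtain e k where e: "e : N k" "x : e" using W.cell_of_point[OF p(2)] by blast
 consider "t = 0" | "t = 1" | "0 < t" "t < 1" using p by linarith
 thus "p : (UN k. &&(cone_cells N k))"
 proof cases
  case 1
  thus ?thesis using p cone_cellsI(1)[of N] by (fastforce simp: cone_proj_def)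
 next
  case 2
  hence "p : bcell e" using p e by blast
  thus ?thesis using cone_cellsI(2)[of e N k, OF e(1)] by blast
 next
  case 3
  hence "p : ccell e" using p e by auto
  thus ?thesis using cone_cellsI(3)[of e N k, OF e(1)] by blast
 qed
qed

lemma cone_frontier:
 assumes c: "c : cone_cells N k"
 shows "CS W clo c - c <= (UN l<k. &&(cone_cells N l))"
proof
 fix p assume p: "p : CS W clo c - c"
 from c show "p : (UN l<k. &&(cone_cells N l))"
 proof (cases rule: cone_cells_cases)
  case 1
  thus ?thesis using p closure_cells(1) by simp
 next
  case (2 e)
  then obtain x where x: "p = cone_proj (x, 1)" "x : W clo e" "x ~: e" using p closure_cells(2)[of e k] by auto
  then obtain l e' where l: "l < k" "e' : N l" "x : e'" using frontierN[OF `e : N k`] by blast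
  have "p : bcell e'" using x(1) l(3) by blast
  thus ?thesis using cone_cellsI(2)[of e' N l, OF l(2)] l(1) by blast
 next
  case (3 j e)
  then obtain x t where x: "p = cone_proj (x, t)" "x : W clo e" "0 <= t" "t <= 1" using p closure_cells(3)[of e j] by auto
  obtain l e' where l: "l <= j" "e' : N l" "x : e'" "l = j ==> e' = e" using frontierN[OF `e : N j` x(2)] `e : N j` by (metis le_eq_less_or_eq order.irrefl)
  consider "t = 0" | "t = 1" | "0 < t" "t < 1" using x by linarith
  thus ?thesis
  proof cases
   case 1
   thus ?thesis using x(1) cone_cellsI(1)[of N] `k = Suc j` by (fastforce simp: cone_proj_def)
  next
   case 2
   hence "p : bcell e'" using x l by blast
   moreover have "l < k" using l(1) `k = Suc j` by simp
   ultimately show ?thesis using cone_cellsI(2)[of e' N l, OF l(2)] by blast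
  next
   case t: 3
   hence pe: "p : ccell e'" using x l by auto
   hence "l ~= j" using p l(4) `c = ccell e` by auto
   hence "Suc l < k" using l(1) `k = Suc j` by simp
   thus ?thesis using cone_cellsI(3)[of e' N l, OF l(2)] pe by blast
  qed
 qed
qed

lemma cone_finite: "finite {(k, c). c : cone_cells N k}"
proof -
 let ?I = "{(k, e). e : N k}"
 have "{(k, c). c : cone_cells N k} <= insert (0, {Apex}) ((%(k, e). (k, bcell e)) ` ?I Un (%(k, e). (Suc k, ccell e)) ` ?I)"
 proof
  fix p assume "p : {(k, c). c : cone_cells N k}"
  then obtain k c where p: "p = (k, c)" "c : cone_cells N k" by blast
  from p(2) show "p : insert (0, {Apex}) ((%(k, e). (k, bcell e)) ` ?I Un (%(k, e). (Suc k, ccell e)) ` ?I)"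
  proof (cases rule: cone_cells_cases)
   case 1
   thus ?thesis using p(1) by simp
  next
   case (2 e)
   hence "p : (%(k, e). (k, bcell e)) ` ?I" using p(1) by (intro image_eqI[of _ _ "(k, e)"]) simp_all
   thus ?thesis by blast
  next
   case (3 j e)
   hence "p : (%(k, e). (Suc k, ccell e)) ` ?I" using p(1) by (intro image_eqI[of _ _ "(j, e)"]) simp_all
   thus ?thesis by blast
  qed
 qed
 moreover have "finite ?I" by (rule decomposition_finite[OF compactW decW])
 ultimately show ?thesis by (meson finite_Un finite_imageI finite_insert finite_subset)
qed

lemma cone_regular: "c : cone_cells N k ==> regular_cell (CS W) k c"
 by (erule cone_cells_cases)
  (use apex_cell(1)[OF W.Hausdorff nonempty] cone_base_cell(1)[OF W.Hausdorff compactW regN] cone_open_cell(1)[OF W.Hausdorff compactW regN] in auto)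

sublocale C: finite_cells "CS W" "UN k. cone_cells N k" "cell_dim (cone_cells N)"
 by (rule finite_cellsI(1)[OF Hausdorff_cone[OF W.Hausdorff] cone_finite cone_regular cone_disjoint cone_cover cone_frontier])

lemma dimC: "c : cone_cells N k ==> cell_dim (cone_cells N) c = k"
 by (rule finite_cellsI(2)[OF Hausdorff_cone[OF W.Hausdorff] cone_finite cone_regular cone_disjoint cone_cover cone_frontier])

definition base :: "'a cone set set" where "base = {c : (UN k. cone_cells N k). Apex ~: C.cl c}"

lemma base_iff: "c : base & cell_dim (cone_cells N) c = k <-> (EX e:N k. c = bcell e)"
proof
 assume h: "c : base & cell_dim (cone_cells N) c = k"
 then obtain j where j: "c : cone_cells N j" "Apex ~: C.cl c" by (auto simp: base_def)
 have "j = k" using dimC[OF j(1)] h by simp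
 from j(1) show "EX e:N k. c = bcell e"
 proof (cases rule: cone_cells_cases)
  case 1
  thus ?thesis using j(2) closure_cells(1) by simp
 next
  case (2 e)
  thus ?thesis using `j = k` by blast
 next
  case (3 i e)
  obtain x where "x : W clo e" using W.cell_nonempty[of e] W.cell_sub_cl[of e] 3(2) by blast
  hence "cone_proj (x, 0) : C.cl c" using closure_cells(3)[OF 3(2)] 3(3) by auto
  thus ?thesis using j(2) by (simp add: cone_proj_def)
 qed
next
 assume "EX e:N k. c = bcell e"
 then obtain e where e: "e : N k" "c = bcell e" by blast
 have "c : cone_cells N k" unfolding e(2) by (rule cone_cellsI(2)[of e N k, OF e(1)])
 moreover have "Apex ~: C.cl c" using closure_cells(2)[OF e(1)] e(2) by (simp add: cell_mem)
 ultimately show "c : base & cell_dim (cone_cells N) c = k" using dimC by (auto simp: base_def)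
qed

lemma base_sub: "base <= (UN k. cone_cells N k)" by (auto simp: base_def)

lemma subcomplex_base: "C.subcx base"
 unfolding C.subcx_def
proof (intro conjI ballI impI base_sub)
 fix c c' assume "c : base" "c' : (UN k. cone_cells N k)" "c' <= C.cl c"
 thus "c' : base" using C.cl_mono unfolding base_def by blast
qed

lemma base_skeleton: "&&{c : base. int (cell_dim (cone_cells N) c) <= q} = (%x. Pt x 1) ` &&(W.skel (UN k. N k) {} q)"
proof -
 have b: "bcell e = (%x. Pt x 1) ` e" for e :: "'a set" by (force simp: cone_proj_def image_iff)
 have "{c : base. int (cell_dim (cone_cells N) c) <= q} = bcell ` W.skel (UN k. N k) {} q"
 proof (intro equalityI subsetI)
  fix c assume "c : {c : base. int (cell_dim (cone_cells N) c) <= q}"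
  then obtain e where "e : N (cell_dim (cone_cells N) c)" "c = bcell e" "int (cell_dim (cone_cells N) c) <= q" using base_iff[of c "cell_dim (cone_cells N) c"] by blast
  thus "c : bcell ` W.skel (UN k. N k) {} q" using dimW[of e] by (auto simp: W.skel_def)
 next
  fix c assume "c : bcell ` W.skel (UN k. N k) {} q"
  then obtain e k where "e : N k" "c = bcell e" "int (cell_dim N e) <= q" by (auto simp: W.skel_def)
  thus "c : {c : base. int (cell_dim (cone_cells N) c) <= q}" using base_iff[of c k] dimW[of e k] by auto
 qed
 thus ?thesis by (simp add: b image_Union)
qed

lemma base_Union: "&&base = cone_base W"
proof (intro equalityI subsetI)
 fix p assume "p : &&base"
 then obtain c where "c : base" "p : c" by blast
 then obtain e where "e : N (cell_dim (cone_cells N) c)" "p : bcell e" using base_iff[of c "cell_dim (cone_cells N) c"] by blast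
 thus "p : cone_base W" using W.cell_sub[of e] by (auto simp: cone_base_def)
next
 fix p assume "p : cone_base W"
 then obtain x where x: "p = cone_proj (x, 1)" "x : tsp W" by (auto simp: cone_base_def)
 obtain e k where e: "e : N k" "x : e" using W.cell_of_point[OF x(2)] by blast
 hence "bcell e : base" using base_iff[of "bcell e" k] by blast
 thus "p : &&base" using e x by blast
qed

definition icells :: "int => 'a cone set set => int => 'a cone set set" where
 "icells a A q = A Un {c : (UN k. cone_cells N k). int (cell_dim (cone_cells N) c) <= q & (q < a --> c : base)}"

lemma ic_skeleton_eq: "ic_skeleton n p W N q = &&(icells (int n - p n) {} q)"
proof -
 have "{e. (EX k. int k <= q & e : cone_cells N k) & (CS W clo e Int {Apex} ~= {} --> 0 <= q - int n + p n)} = icells (int n - p n) {} q"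
 proof (intro equalityI subsetI)
  fix e assume "e : {e. (EX k. int k <= q & e : cone_cells N k) & (CS W clo e Int {Apex} ~= {} --> 0 <= q - int n + p n)}"
  then obtain k where "int k <= q" "e : cone_cells N k" "Apex : C.cl e --> 0 <= q - int n + p n" by auto
  thus "e : icells (int n - p n) {} q" using dimC[of e k] by (auto simp: icells_def base_def)
 next
  fix e assume "e : icells (int n - p n) {} q"
  then obtain k where "e : cone_cells N k" "int (cell_dim (cone_cells N) e) <= q" "q < int n - p n --> Apex ~: C.cl e" by (auto simp: icells_def base_def)
  thus "e : {e. (EX k. int k <= q & e : cone_cells N k) & (CS W clo e Int {Apex} ~= {} --> 0 <= q - int n + p n)}"
   using dimC[of e k] by auto
 qed
 thus ?thesis unfolding ic_skeleton_def by simp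
qed

lemma icells_Un: "icells a {} q Un A = icells a A q" by (auto simp: icells_def)

lemma subcomplex_icells:
 assumes "C.subcx A"
 shows "C.subcx (icells a A q)"
 unfolding icells_def
proof (rule C.subcomplex_Un[OF assms])
 let ?K = "if q < a then base else (UN k. cone_cells N k)"
 have "C.subcx {c : ?K. int (cell_dim (cone_cells N) c) <= q}"
  using C.subcomplex_skeleton[OF subcomplex_base, of q] C.subcomplex_skeleton[OF C.subcomplex_all, of q] by (cases "q < a") simp_all
 moreover have "{c : ?K. int (cell_dim (cone_cells N) c) <= q} = {c : (UN k. cone_cells N k). int (cell_dim (cone_cells N) c) <= q & (q < a --> c : base)}"
  using base_sub by auto
 ultimately show "C.subcx {c : (UN k. cone_cells N k). int (cell_dim (cone_cells N) c) <= q & (q < a --> c : base)}" by simp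
qed

lemma icells_mono: "q <= q' ==> icells a A q <= icells a A q'" by (auto simp: icells_def base_def)

end

lemma group_corr_iso:
 assumes h: "h : hom G H" "bij_betw h (car G) (car H)" and G: "group G" and H: "group H"
 shows "corr_grp G (car G) {e1 G} H (%x y. x : car G & y = h x)"
proof -
 interpret group_hom G H h using h G H by (simp add: group_hom_def group_hom_axioms_def)
 have "x = e1 G" if "x : car G" "h x = e1 H" for x
  using inj_onD[OF bij_betw_imp_inj_on[OF h(2)], of x "e1 G"] that by simp
 moreover have "EX x. x : car G & y = h x" if "y : car H" for y
  using bij_betw_imp_surj_on[OF h(2)] that by (metis imageE)
 ultimately show ?thesis by (intro group_corrI) auto
qed

lemma int_coords_iso:
 assumes h: "h : hom G H" "bij_betw h (car G) (car H)" and G: "group G" and H: "group H" and co: "int_coords G S F"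
 shows "int_coords H S (%y. F (inv_into (car G) h y))"
proof -
 interpret group_hom G H h using h G H by (simp add: group_hom_def group_hom_axioms_def)
 have "h : iso G H" using h by (simp add: iso_def)
 hence "inv_into (car G) h : hom H G" using group.iso_set_sym[OF G `h : iso G H`] unfolding iso_def by blast
 hence add: "addi H (%y. F (inv_into (car G) h y) t)" for t
  using additive_on_compose[OF int_coordsD(2)[OF co]] by blast
 have cl: "inv_into (car G) h y : car G" "h (inv_into (car G) h y) = y" if "y : car H" for y
  using that bij_betw_imp_surj_on[OF h(2)] by (simp_all add: inv_into_into f_inv_into_f)
 show ?thesis
  unfolding int_coords_def
 proof (intro conjI allI ballI impI)
  show "finite S" by (rule int_coordsD(1)[OF co])
  show "F (inv_into (car G) h y) t = 0" if "y : car H" "t ~: S" for y t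
   by (rule int_coordsD(3)[OF co cl(1)[OF that(1)] that(2)])
  fix y assume y: "y : car H" "ALL t:S. F (inv_into (car G) h y) t = 0"
  have "inv_into (car G) h y = e1 G" using int_coordsD(4)[OF co cl(1)[OF y(1)]] y(2) by blast
  thus "y = e1 H" using cl(2)[OF y(1)] hom_one by simp
 next
  fix n
  obtain x where x: "x : car G" "ALL t:S. F x t = n t" using int_coordsD(5)[OF co, of n] by blast
  have "inv_into (car G) h (h x) = x" by (rule bij_betw_inv_into_left[OF h(2) x(1)])
  thus "EX y:car H. ALL t:S. F (inv_into (car G) h y) t = n t" using x by (intro bexI[of _ "h x"]) auto
 qed (rule add)
qed

lemma filtration_exact:
 assumes F: "A <= F2" "F2 <= F1" "F1 <= F0" "F0 <= F'"
  and v: "vanishes X (q - 1) F2 A" "vanishes X q F' A"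
  and z: "z : car (RH X q F0 F1)" "bdry X q F0 F1 F2 z = e1 (RH X (q - 1) F1 F2)"
 shows "EX y:car (RH X (q + 1) F' F0). z = bdry X (q + 1) F' F0 F1 y"
proof -
 have A1: "A <= F1" "A <= F0" using F by auto
 have "incl X (q - 1) F1 A F1 F2 (bdry X q F0 F1 A z) = incl X (q - 1) F1 A F1 F2 (e1 (RH X (q - 1) F1 A))"
  using bdry_incl[of F0 F0 F1 F1 A F2 X q z] F incl_id[OF z(1)] z(2) by simp
 hence "bdry X q F0 F1 A z = e1 (RH X (q - 1) F1 A)"
  using inj_onD[OF incl_inj[OF F(1,2) v(1)]] bdry_closed[OF F(3)] RH_one by blast
 from triple_exact_1(2)[OF A1(1) F(3) z(1) this]
 obtain w where w: "w : car (RH X q F0 A)" "z = incl X q F0 A F0 F1 w" by blast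
 have "incl X q F0 A F' A w = e1 (RH X q F' A)" by (rule vanishesD[OF v(2) incl_closed])
 hence "EX y:car (RH X (q + 1) F' F0). w = bdry X (q + 1) F' F0 A y"
  using triple_exact_2(2)[OF A1(2) F(4), of w X "q + 1"] w(1) by simp
 then obtain y where y: "y : car (RH X (q + 1) F' F0)" "w = bdry X (q + 1) F' F0 A y" by blast
 have "bdry X (q + 1) F' F0 F1 y = incl X q F0 A F0 F1 (bdry X (q + 1) F' F0 A y)"
  using bdry_incl[of F' F' F0 F0 A F1 X "q + 1" y] F incl_id[OF y(1)] A1 by simp
 thus ?thesis using y w(2) by metis
qed

context oriented_cells
begin

lemma chain_sets:
 fixes V :: "'v::real_vector itself"
 defines "coch == dual_cells.coch S dm :: nat => ('a set => 'v) set"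
  and "bd == dual_cells.bd S inc :: ('a set => 'v) => _"
  and "cobd == dual_cells.cobd S inc :: ('a set => 'v) => _"
 shows "{f. (ALL t. t ~: cells S {} (int q) --> f t = 0) & (ALL s:cells S {} (int q - 1). (SUM t:cells S {} (int q). inc t s *z f t) = 0)}
   = {x : coch q. bd x = (%_. 0)}" (is "?Z = _")
  and "{f. EX g. f = (%t. if t : cells S {} (int q) then SUM r:cells S {} (int q + 1). inc r t *z g r else 0)}
   = bd ` coch (Suc q)" (is "?B = _")
  and "{y. (ALL t. t ~: cells S {} (int q) --> y t = 0) & (ALL r:cells S {} (int q + 1). (SUM t:cells S {} (int q). inc r t *z y t) = 0)}
   = {y : coch q. cobd y = (%_. 0)}" (is "?Z' = _")
  and "q > 0 ==> {y. EX y'. y = (%t. if t : cells S {} (int q) then SUM s:cells S {} (int q - 1). inc t s *z y' s else 0)}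
   = cobd ` coch (q - 1)" (is "_ ==> ?B' = _")
proof -
 interpret dual: dual_cells S dm "%s t. s <= cl t" inc vsign ov m V by (rule dual_cells)
 have C: "x : coch j <-> (ALL t. t ~: cells S {} (int j) --> x t = 0)" for x j
  by (auto simp: coch_def dual.coch_def cells_def)
 have bd: "bd x s = (SUM t:cells S {} (int j). inc t s *z x t)" if "x : coch j" for x j s
  unfolding bd_def dual.bd_def by (rule sum.mono_neutral_right[OF finS]) (use that C in "auto simp: cells_def")
 have cobd: "cobd x r = (SUM t:cells S {} (int j). inc r t *z x t)" if "x : coch j" for x j r
  unfolding cobd_def dual.cobd_def by (rule sum.mono_neutral_right[OF finS]) (use that C in "auto simp: cells_def")
 have low: "inc t s = 0" if "t : cells S {} (int j)" "s ~: cells S {} (int j - 1)" for t s j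
  by (rule ccontr) (use that in "auto dest!: inc_supp simp: cells_def")
 have high: "inc r t = 0" if "t : cells S {} (int j)" "r ~: cells S {} (int j + 1)" for t r j
  by (rule ccontr) (use that in "auto dest!: inc_supp simp: cells_def")
 have bd0: "bd x s = 0" if "x : coch j" "s ~: cells S {} (int j - 1)" for x j s
  unfolding bd[OF that(1)] using low[OF _ that(2)] by simp
 have cobd0: "cobd x r = 0" if "x : coch j" "r ~: cells S {} (int j + 1)" for x j r
  unfolding cobd[OF that(1)] using high[OF _ that(2)] by simp
 show "?Z = {x : coch q. bd x = (%_. 0)}"
 proof (rule Set.set_eqI)
  fix f
  have "(bd f = (%_. 0)) = (ALL s:cells S {} (int q - 1). (SUM t:cells S {} (int q). inc t s *z f t) = 0)" if f: "f : coch q"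
   using bd0[OF f] bd[OF f] by (metis (mono_tags, lifting) ext)
  thus "f : ?Z <-> f : {x : coch q. bd x = (%_. 0)}" using C[of f q] by blast
 qed
 show "?Z' = {y : coch q. cobd y = (%_. 0)}"
 proof (rule Set.set_eqI)
  fix f
  have "(cobd f = (%_. 0)) = (ALL r:cells S {} (int q + 1). (SUM t:cells S {} (int q). inc r t *z f t) = 0)" if f: "f : coch q"
   using cobd0[OF f] cobd[OF f] by (metis (mono_tags, lifting) ext)
  thus "f : ?Z' <-> f : {y : coch q. cobd y = (%_. 0)}" using C[of f q] by blast
 qed
 have S1: "int (Suc q) = int q + 1" by simp
 define cut where "cut j g = (%r. if r : cells S {} (int j) then g r else (0::'v))" for j and g :: "'a set => 'v"
 have cut: "cut j g : coch j" "(SUM r:cells S {} (int j). c r *R cut j g r) = (SUM r:cells S {} (int j). c r *R g r)" for j g c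
  by (auto simp: C cut_def intro: sum.cong)
 have e: "(%t. if t : cells S {} (int q) then SUM r:cells S {} (int q + 1). inc r t *z g r else 0) = bd (cut (Suc q) g)" for g
  using bd0[OF cut(1), of _ "Suc q" g] by (auto simp: fun_eq_iff bd[OF cut(1)] cut(2) S1[symmetric] simp del: of_nat_Suc) (simp_all add: S1)
 have e': "bd g = (%t. if t : cells S {} (int q) then SUM r:cells S {} (int q + 1). inc r t *z g r else 0)" if "g : coch (Suc q)" for g
  using bd0[OF that] bd[OF that] by (auto simp: fun_eq_iff add.commute)
 show "?B = bd ` coch (Suc q)"
 proof (intro equalityI subsetI)
  fix f assume "f : ?B"
  then obtain g where "f = bd (cut (Suc q) g)" using e by blast
  thus "f : bd ` coch (Suc q)" using cut(1) by blast
 next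
  fix f assume "f : bd ` coch (Suc q)"
  then obtain g where "g : coch (Suc q)" "f = bd g" by blast
  thus "f : ?B" using e' by blast
 qed
 show "?B' = cobd ` coch (q - 1)" if q: "q > 0"
 proof -
  obtain j where j: "q = Suc j" using q by (cases q) auto
  have e: "(%t. if t : cells S {} (int q) then SUM r:cells S {} (int q - 1). inc t r *z g r else 0) = cobd g" if "g : coch (q - 1)" for g
   using that cobd0[of g j] cobd[of g j] unfolding j by (auto simp: fun_eq_iff add.commute)
  have "(%t. if t : cells S {} (int q) then SUM r:cells S {} (int q - 1). inc t r *z g r else 0) = cobd (cut (q - 1) g)" for g
   using cut(2)[of _ j g] unfolding e[OF cut(1), symmetric] unfolding j by (auto simp: fun_eq_iff)
  hence e2: "f : cobd ` coch (q - 1)" if "f : ?B'" for f using that cut(1)[of "q - 1"] by blast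
  show ?thesis
  proof (intro equalityI subsetI)
   fix f assume "f : cobd ` coch (q - 1)"
   then obtain g where g: "g : coch (q - 1)" "f = cobd g" by blast
   show "f : ?B'" by (intro CollectI exI[of _ g] trans[OF g(2) e[OF g(1), symmetric]])
  qed (rule e2)
 qed
qed

end

context group_complex
begin

lemma dual_homology_trivial:
 assumes eq: "(ZT q :: ('g, 'v::real_vector) tfrag set set) = BT q"
 shows "car (dual_space (homology_space (T :: int => ('g, 'v) tmod) D q)) =
  {e0 (dual_space (homology_space (T :: int => ('g, 'v) tmod) D q))}"
proof -
 interpret sq: subquotient "T q :: ('g, 'v) tmod" "ZT q" "BT q" by (rule subquotient)
 have "L = e0 (dual_space sq.Q)" if L: "L : car (dual_space sq.Q)" for L
 proof -
  have "L (sq.K x) = 0" if "x : ZT q" for x using sq.dual_quotientD(3)[OF L] that eq by simp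
  thus ?thesis
   using L unfolding dual_space_simps sq.quotient_carrier by (intro ext) (auto simp: extensional_def restrict_def)
 qed
 moreover interpret D: abelian_group "dual_space sq.Q" by (rule sq.abelian_group_dual_quotient)
 have "e0 (dual_space sq.Q) : car (dual_space sq.Q)" by simp
 ultimately show ?thesis unfolding homology_space_eq by blast
qed

lemma homology_trivial_iso:
 assumes eq: "(ZT q :: ('g, 'v::real_vector) tfrag set set) = BT q"
  and M': "abelian_group (dual_space M)" "car (dual_space M) = {e0 (dual_space M)}"
 shows "linearly_isomorphic (homology_space (T :: int => ('g, 'v) tmod) D q) (dual_space M)"
proof -
 interpret sq: subquotient "T q :: ('g, 'v) tmod" "ZT q" "BT q" by (rule subquotient)
 interpret M': abelian_group "dual_space M" by fact
 have "lin_corr_by (T q) (ZT q) (BT q) (dual_space M) (car (dual_space M)) {e0 (dual_space M)}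
  (%x y. (x :: ('g, 'v) tfrag set) : ZT q & y = e0 (dual_space M))"
 proof (rule lin_corr_byI)
  show "r .[T q] x : ZT q & r .[dual_space M] x' = e0 (dual_space M)" if "x : ZT q & x' = e0 (dual_space M)" for r and x :: "('g, 'v) tfrag set" and x'
   using sq.Zsm[of x r] that by (auto simp: dual_space_simps restrict_def fun_eq_iff)
 qed (use eq M'(2) sq.Zadd sq.B0 in auto)
 hence "lin_corr (T q :: ('g, 'v) tmod) (ZT q) (BT q) (dual_space M) (car (dual_space M)) {e0 (dual_space M)}"
  unfolding lin_corr_def by blast
 thus ?thesis unfolding homology_space_eq by (rule sq.linearly_isomorphic_quotientI[OF M'(1)])
qed

lemma tensor_exact_trivial:
 assumes "car (C q) = {e1 (C q)}" "int_separated (C (q - 1))"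
 shows "ZT q = BT q"
proof (rule tensor_exact[OF _ assms(2)])
 fix z assume "z : car (C q)"
 hence "z = e1 (C q)" using assms(1) by blast
 moreover have "d (q + 1) (e1 (C (q + 1))) = e1 (C q)" using hom_one[OF d_hom' comm_group.axioms(2)[OF comm] comm_group.axioms(2)[OF comm]] .
 ultimately show "EX w:car (C (q + 1)). z = d (q + 1) w"
  using monoid.one_closed[OF group.is_monoid[OF comm_group.axioms(2)[OF comm]]] by metis
qed

end

lemma filtration_homology_eq:
 "filtration_homology (V :: 'v::real_vector itself) X F q = homology_space (%q. tensor_space (RH X q (F q) (F (q - 1))) :: (real, ('a, 'v) tensor_chain) module)
   (%q. tensor_map (RH X (q - 1) (F (q - 1)) (F (q - 1 - 1))) (bdry X q (F q) (F (q - 1)) (F (q - 2)))) q"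
 by (simp add: filtration_homology_def filtration_chain_group_def filtration_boundary_def RH_def bdry_def)

context cone_decomposition
begin

abbreviation X0 :: "'a cone topology" where "X0 == CS W"
abbreviation SW :: "'a set set" where "SW == (UN k. N k)"
abbreviation SC :: "'a cone set set" where "SC == (UN k. cone_cells N k)"
abbreviation cdim :: "'a cone set => nat" where "cdim == cell_dim (cone_cells N)"

abbreviation CG :: "int => 'a cone set set => int => 'a cone chain set monoid" where
 "CG a A q == C.RU q (icells a A q) (icells a A (q - 1))"
abbreviation Cd :: "int => 'a cone set set => int => 'a cone chain set => 'a cone chain set" where
 "Cd a A q == C.BU q (icells a A q) (icells a A (q - 1)) (icells a A (q - 2))"

abbreviation HS :: "'v::real_vector itself => int => 'a cone set set => int => (real, ('a cone, 'v) tensor_chain set) module" where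
 "HS V a A q == homology_space (%q. tensor_space (CG a A q) :: (real, ('a cone, 'v) tensor_chain) module)
   (%q. tensor_map (CG a A (q - 1)) (Cd a A q)) q"

lemma cone_group_complex: "group_complex (CG a A) (Cd a A)"
 by (rule group_complex_filtration[of "%q. &&(icells a A q)"]) (intro Union_mono icells_mono, simp)

lemma cone_homology_eq:
 "intersection_homology_cone (V :: 'v::real_vector itself) n p W N q = HS TYPE('v) (int n - p n) {} q"
 "relative_intersection_homology_cone V n p W N q = HS TYPE('v) (int n - p n) base q"
proof -
 have 1: "&&(icells (int n - p n) {} j) = ic_skeleton n p W N j" for j by (rule ic_skeleton_eq[symmetric])
 have 2: "&&(icells (int n - p n) base j) = ic_skeleton n p W N j Un cone_base W" for j
  unfolding ic_skeleton_eq base_Union[symmetric] Union_Un_distrib[symmetric] icells_Un ..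
 show "intersection_homology_cone V n p W N q = HS TYPE('v) (int n - p n) {} q"
  unfolding intersection_homology_cone_def filtration_homology_eq 1 by (simp add: diff_diff_eq)
 show "relative_intersection_homology_cone V n p W N q = HS TYPE('v) (int n - p n) base q"
  unfolding relative_intersection_homology_cone_def filtration_homology_eq 2 by (simp add: diff_diff_eq)
qed

lemma cone_separated: "C.subcx A ==> int_separated (CG a A q)"
 by (rule C.top_separated[OF subcomplex_icells subcomplex_icells icells_mono]) (auto simp: icells_def)

lemma cone_vanishes: "j >= 1 ==> C.VU j SC {}"
proof -
 assume j: "j >= 1"
 have "tsp X0 ~= {}" using nonempty by (auto simp: topspace_cone_space)
 hence "vanishes X0 j (tsp X0) {} <-> vanishes point_space j UNIV {}"
  by (intro vanishes_iso[OF to_point_bij]) (simp_all add: contractible_cone)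
 thus ?thesis using point_homology(1)[of j] j by (simp add: C.cover)
qed

lemma icells_low:
 assumes "C.subcx A" "j > q"
 shows "C.VU j (icells a A q) A"
 by (rule C.cellular_vanishes[OF subcomplex_icells[OF assms(1)] assms(1)]) (use assms(2) in "auto simp: icells_def")

lemma icells_high:
 assumes A: "C.subcx A" "A <= SC" and q: "a <= q" "j <= q"
 shows "C.VU j SC (icells a A q)"
 by (rule C.cellular_vanishes[OF C.subcomplex_all subcomplex_icells[OF A(1)]]) (use A q in "auto simp: icells_def")

lemma icells_sub: "A <= SC ==> icells a A q <= SC" by (auto simp: icells_def)

lemma absolute_exact:
 assumes a: "2 <= a" and q: "a - 1 <= q"
  and z: "z : car (CG a {} q)" "Cd a {} q z = e1 (CG a {} (q - 1))"
 shows "EX w:car (CG a {} (q + 1)). z = Cd a {} (q + 1) w"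
proof -
 note e = C.subcomplex_empty
 have m: "&&{} <= &&(icells a {} (q - 2))" "&&(icells a {} (q - 2)) <= &&(icells a {} (q - 1))"
  "&&(icells a {} (q - 1)) <= &&(icells a {} q)" "&&(icells a {} q) <= &&(icells a {} (q + 1))"
  by (rule Union_mono, simp) (rule Union_mono[OF icells_mono], simp)+
 have s: "&&(icells a {} (q + 1)) <= &&SC" by (rule Union_mono[OF icells_sub]) simp
 have inj: "inj_on (C.IU q (icells a {} (q + 1)) {} SC {}) (car (C.RU q (icells a {} (q + 1)) {}))"
  by (rule incl_inj'[OF _ s icells_high[OF e]]) (use q in auto)
 have "C.VU q (icells a {} (q + 1)) {}"
 proof (rule vanishesI)
  fix x assume x: "x : car (C.RU q (icells a {} (q + 1)) {})"
  have "C.VU q SC {}" by (rule cone_vanishes) (use a q in simp)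
  from vanishesD[OF this incl_closed]
  have "C.IU q (icells a {} (q + 1)) {} SC {} x = C.IU q (icells a {} (q + 1)) {} SC {} (e1 (C.RU q (icells a {} (q + 1)) {}))"
   by (simp only: incl_one)
  thus "x = e1 (C.RU q (icells a {} (q + 1)) {})"
   by (rule inj_onD[OF inj _ x RH_one])
 qed
 from filtration_exact[OF m icells_low[OF e] this, of z] z show ?thesis by (simp add: diff_diff_eq)
qed

definition bmap :: "int => 'a set => 'a set => 'a chain set => 'a cone chain set" where
 "bmap p A B = hom_induced p (subtop W A) B (subtop X0 ((%x. Pt x 1) ` A)) ((%x. Pt x 1) ` B) (%x. Pt x 1)"

lemma base_homeo:
 assumes A: "A <= tsp W"
 shows "homeomorphic_map (subtop W A) (subtop X0 ((%x. Pt x 1) ` A)) (%x. Pt x 1)"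
proof -
 let ?b = "%x. Pt x 1 :: 'a cone"
 note h = base_embedding[OF W.Hausdorff compactW]
 have t: "?b ` tsp W = tsp (subtop X0 (cone_base W))" by (rule homeomorphic_imp_surjective_map[OF h])
 have sub: "?b ` A <= cone_base W" using image_mono[OF A, of ?b] unfolding t by auto
 have "homeomorphic_map (subtop W A) (subtop (subtop X0 (cone_base W)) (?b ` A)) ?b"
  by (rule homeomorphic_map_subtopologies[OF h]) (use A t in blast)
 thus ?thesis using sub by (simp add: subtopology_subtopology Int_absorb1)
qed

lemma bmap_iso:
 assumes "B <= A" "A <= tsp W"
 shows "bmap p A B : hom (RH W p A B) (RH X0 p ((%x. Pt x 1) ` A) ((%x. Pt x 1) ` B))"
  "bij_betw (bmap p A B) (car (RH W p A B)) (car (RH X0 p ((%x. Pt x 1) ` A) ((%x. Pt x 1) ` B)))"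
 using rel_hom_homeo[OF base_homeo[OF assms(2)] _ refl, of B p] assms by (auto simp: bmap_def)

lemma bmap_bdry:
 assumes "C <= B" "B <= A" "A <= tsp W"
 shows "bdry X0 p ((%x. Pt x 1) ` A) ((%x. Pt x 1) ` B) ((%x. Pt x 1) ` C) (bmap p A B z) = bmap (p - 1) B C (bdry W p A B C z)"
proof -
 let ?b = "%x. Pt x 1 :: 'a cone"
 have c: "cmap (subtop W A) (subtop X0 (?b ` A)) ?b"
  by (rule homeomorphic_imp_continuous_map[OF base_homeo[OF assms(3)]])
 have "?b : B \<rightarrow> ?b ` B" "?b : C \<rightarrow> ?b ` C" by auto
 from fun_cong[OF naturality_hom_induced_relboundary[OF c this, of p], of z]
 show ?thesis using assms image_mono[OF assms(2), of ?b]
  by (simp add: bdry_def bmap_def subtopology_subtopology inf.absorb2 comp_def)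
qed

abbreviation WG :: "int => 'a chain set monoid" where "WG == W.CH SW {}"

lemma icells_base:
 assumes "j < a"
 shows "&&(icells a {} j) = (%x. Pt x 1) ` &&(W.skel SW {} j)"
proof -
 have "icells a {} j = {c : base. int (cdim c) <= j}" using assms base_sub by (auto simp: icells_def)
 thus ?thesis using base_skeleton[of j] by simp
qed

definition bcoord :: "int => 'a cone chain set => 'a set => int" where
 "bcoord q y = W.ccoord SW {} q (inv_into (car (WG q)) (bmap q (&&(W.skel SW {} q)) (&&(W.skel SW {} (q - 1)))) y)"

lemma skel_sub: "&&(W.skel SW {} (q - 1)) <= &&(W.skel SW {} q)" "&&(W.skel SW {} q) <= tsp W"
 "&&(W.skel SW {} (q - 2)) <= &&(W.skel SW {} (q - 1))"
proof -
 show "&&(W.skel SW {} (q - 1)) <= &&(W.skel SW {} q)" "&&(W.skel SW {} (q - 2)) <= &&(W.skel SW {} (q - 1))"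
  by (rule Union_mono[OF W.skel_mono], simp)+
 show "&&(W.skel SW {} q) <= tsp W" unfolding W.cover[symmetric] by (rule Union_mono) (auto simp: W.skel_def)
qed

lemma bcoord_int_coords:
 assumes "q < a"
 shows "int_coords (CG a {} q) (W.cells SW {} q) (bcoord q)"
proof -
 have e: "&&(icells a {} (q - 1)) = (%x. Pt x 1) ` &&(W.skel SW {} (q - 1))" by (rule icells_base) (use assms in simp)
 show ?thesis
  unfolding bcoord_def[abs_def] icells_base[OF assms] e
  by (rule int_coords_iso[OF bmap_iso[OF skel_sub(1,2)] group_rel_hom group_rel_hom W.chain_coords[OF W.subcomplex_all W.subcomplex_empty]])
qed

lemma bcoord_bd:
 assumes q: "q < a" and x: "x : car (CG a {} q)" and s: "s : W.cells SW {} (q - 1)"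
 shows "bcoord (q - 1) (Cd a {} q x) s = (SUM t:W.cells SW {} q. W.inc t s * bcoord q x t)"
proof -
 let ?N = "%j. &&(W.skel SW {} j)"
 have e: "&&(icells a {} q) = (%x. Pt x 1) ` ?N q" "&&(icells a {} (q - 1)) = (%x. Pt x 1) ` ?N (q - 1)"
  "&&(icells a {} (q - 2)) = (%x. Pt x 1) ` ?N (q - 2)"
  by (rule icells_base, use q in simp)+
 note b = bmap_iso[OF skel_sub(1,2)]
 have "x : bmap q (?N q) (?N (q - 1)) ` car (WG q)" using x unfolding e bij_betw_imp_surj_on[OF b(2)] .
 then obtain z where z: "x = bmap q (?N q) (?N (q - 1)) z" "z : car (WG q)" by (rule imageE)
 have 1: "bcoord q x = W.ccoord SW {} q z"
  unfolding bcoord_def z(1) bij_betw_inv_into_left[OF b(2) z(2)] ..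
 have "Cd a {} q x = bmap (q - 1) (?N (q - 1)) (?N (q - 2)) (W.cbd SW {} q z)"
  unfolding e z(1) by (rule bmap_bdry[OF skel_sub(3,1,2)])
 moreover have "q - 2 = q - 1 - 1" by simp
 ultimately have "Cd a {} q x = bmap (q - 1) (?N (q - 1)) (?N (q - 1 - 1)) (W.cbd SW {} q z)" by metis
 hence "bcoord (q - 1) (Cd a {} q x) = W.ccoord SW {} (q - 1) (W.cbd SW {} q z)"
  unfolding bcoord_def using bij_betw_inv_into_left[OF b(2)[of "q - 1" "q - 1"] W.chain_bd_closed] by metis
 thus ?thesis using W.chain_bd_coord[OF W.subcomplex_all W.subcomplex_empty empty_subsetI z(2) s] 1 by simp
qed

lemma relative_corr:
 assumes k: "1 <= k" "a <= k + 1"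
 shows "EX R. group_corr (RH W k (tsp W) {}) (car (RH W k (tsp W) {})) {e1 (RH W k (tsp W) {})}
  (CG a base (k + 1)) {z : car (CG a base (k + 1)). Cd a base (k + 1) z = e1 (CG a base (k + 1 - 1))}
  (Cd a base (k + 1 + 1) ` car (CG a base (k + 1 + 1))) R"
proof -
 let ?r = "k + 1"
 note b = subcomplex_base
 have m: "&&base <= &&(icells a base (?r - 2))" "&&(icells a base (?r - 2)) <= &&(icells a base (?r - 1))"
  "&&(icells a base (?r - 1)) <= &&(icells a base ?r)" "&&(icells a base ?r) <= &&(icells a base (?r + 1))"
  "&&base <= &&(icells a base (?r + 1))"
  by (rule Union_mono, force simp: icells_def) (rule Union_mono[OF icells_mono], simp, rule Union_mono[OF icells_mono], simp,
   rule Union_mono[OF icells_mono], simp, rule Union_mono, force simp: icells_def)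
 have s: "&&(icells a base (?r + 1)) <= &&SC" by (rule Union_mono[OF icells_sub[OF base_sub]])
 have v: "C.VU ?r (icells a base (?r + 1)) (icells a base ?r)"
  by (rule C.cellular_vanishes[OF subcomplex_icells[OF b] subcomplex_icells[OF b] icells_mono]) (use k in "auto simp: icells_def")
 have "EX R. corr_grp (CG a base ?r) {z : car (CG a base ?r). Cd a base ?r z = e1 (CG a base (?r - 1))} (Cd a base (?r + 1) ` car (CG a base (?r + 1))) (C.RU ?r (icells a base (?r + 1)) base) R"
 proof -
  have 0: "C.VU (?r - 1) (icells a base (?r - 2)) base" "C.VU ?r (icells a base (?r - 1)) base"
   by (rule icells_low[OF b], simp)+
  have 1: "?r + 1 - 1 = ?r" "?r + 1 - 2 = ?r - 1" "?r - 1 - 1 = ?r - 2" by simp_all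
  show ?thesis unfolding 1 by (rule exI) (rule filtration_corr[OF m(1-4) 0 v])
 qed
 then obtain R1 where R1: "corr_grp (CG a base ?r) {z : car (CG a base ?r). Cd a base ?r z = e1 (CG a base (?r - 1))} (Cd a base (?r + 1) ` car (CG a base (?r + 1))) (C.RU ?r (icells a base (?r + 1)) base) R1" by blast
 let ?i = "C.IU ?r (icells a base (?r + 1)) base SC base"
 have ih: "C.VU j SC (icells a base (?r + 1))" if "j <= ?r + 1" for j
  by (rule icells_high[OF b base_sub]) (use k that in auto)
 have "bij_betw ?i (car (C.RU ?r (icells a base (?r + 1)) base)) (car (C.RU ?r SC base))"
 proof (rule bij_betw_imageI[OF incl_inj'[OF m(5) s ih]])
  show "?i ` car (C.RU ?r (icells a base (?r + 1)) base) = car (C.RU ?r SC base)"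
   using incl_surj'[OF m(5) s ih] by (intro equalityI subsetI) (auto simp del: incl_id simp: image_iff Bex_def)
 qed simp
 note R2 = group_corr_iso[OF incl_hom this group_rel_hom group_rel_hom]
 have bs: "&&{} <= &&base" "&&base <= &&SC" by simp (rule Union_mono[OF base_sub])
 let ?d = "C.BU ?r SC base {}"
 have dh: "?d : hom (C.RU ?r SC base) (C.RU k base {})" using bdry_hom[OF bs(2), of X0 ?r "&&{}"] by simp
 have cv: "C.VU ?r SC {}" "C.VU k SC {}" by (rule cone_vanishes, use k in simp)+
 have dk: "y = e1 (C.RU ?r SC base)" if y: "y : car (C.RU ?r SC base)" "?d y = e1 (C.RU k base {})" for y
 proof -
  have "EX x:car (C.RU ?r SC {}). y = C.IU ?r SC {} SC base x"
   by (rule triple_exact_1(2)[OF bs y(1)]) (use y(2) in simp)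
  thus ?thesis using vanishesD[OF cv(1)] incl_one by metis
 qed
 interpret dg: group_hom "C.RU ?r SC base" "C.RU k base {}" ?d
  using dh by (simp add: group_hom_def group_hom_axioms_def)
 have "bij_betw ?d (car (C.RU ?r SC base)) (car (C.RU k base {}))"
 proof (rule bij_betw_imageI)
  show "inj_on ?d (car (C.RU ?r SC base))" using dk dg.inj_on_one_iff by blast
  show "?d ` car (C.RU ?r SC base) = car (C.RU k base {})"
  proof (intro equalityI subsetI)
   fix z assume z: "z : car (C.RU k base {})"
   have "EX y:car (C.RU ?r SC base). z = ?d y"
    using triple_exact_2(2)[OF bs, of z X0 ?r] z vanishesD[OF cv(2) incl_closed] by simp
   thus "z : ?d ` car (C.RU ?r SC base)" by blast
  qed (use dg.hom_closed in blast)
 qed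
 note R3 = group_corr_iso[OF dh this group_rel_hom group_rel_hom]
 have bt: "(%x. Pt x 1) ` tsp W = &&base" unfolding base_Union by (force simp: cone_base_def cone_proj_def image_iff)
 have "bmap k (tsp W) {} : hom (RH W k (tsp W) {}) (C.RU k base {})"
  "bij_betw (bmap k (tsp W) {}) (car (RH W k (tsp W) {})) (car (C.RU k base {}))"
  using bmap_iso[of "{}" "tsp W" k] by (simp_all add: bt)
 note R4 = group_corr_iso[OF this group_rel_hom group_rel_hom]
 show ?thesis
  using group_corr_trans[OF R4 group_corr_sym[OF group_corr_trans[OF R1 group_corr_trans[OF R2 R3]]]] by blast
qed

lemma relative_trivial:
 assumes "r < a \<or> (ALL c:SC. int (cdim c) ~= r)"
 shows "C.VU r (icells a base r) (icells a base (r - 1))"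
proof (rule C.cellular_vanishes[OF subcomplex_icells[OF subcomplex_base] subcomplex_icells[OF subcomplex_base] icells_mono])
 show "int (cdim e) ~= r" if "e : icells a base r - icells a base (r - 1)" for e
  using that assms base_sub by (auto simp: icells_def)
qed simp

lemma cone_dim_le:
 assumes m: "!!e. e : SW ==> cell_dim N e <= m" and c: "c : SC"
 shows "cdim c <= Suc m"
proof -
 obtain k where k: "c : cone_cells N k" using c by blast
 hence "k <= Suc m"
 proof (cases rule: cone_cells_cases)
  case (2 e)
  have "e : SW" using 2 by blast
  thus ?thesis using m[of e] dimW[of e k] 2 by simp
 next
  case (3 j e)
  thus ?thesis using m[of e] dimW[of e j] by auto
 qed simp
 thus ?thesis using dimC[OF k] by simp
qed

end

lemma (in group_complex) trivial_dual_iso: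
 fixes C' :: "int => 'h monoid"
 assumes eq: "(ZT q :: ('g, 'v::real_vector) tfrag set set) = BT q"
  and C': "group_complex C' d'" "(group_complex.ZT C' d' r :: ('h, 'v) tfrag set set) = group_complex.BT C' d' r"
 shows "linearly_isomorphic (homology_space (T :: int => ('g, 'v) tmod) D q)
  (dual_space (homology_space (%q. tensor_space (C' q) :: ('h, 'v) tmod) (%q. tensor_map (C' (q - 1)) (d' q)) r))"
proof -
 interpret C': group_complex C' d' by fact
 show ?thesis
  by (rule homology_trivial_iso[OF eq _ C'.dual_homology_trivial[OF C'(2)]])
   (unfold C'.homology_space_eq, rule subquotient.abelian_group_dual_quotient[OF C'.subquotient])
qed

lemma empty_complex:
 assumes X: "tsp X = {}" and F: "!!q. F q <= F (q + 1)"
 defines "C == %q. RH X q (F q) (F (q - 1))" and "d == %q. bdry X q (F q) (F (q - 1)) (F (q - 2))"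
 shows "group_complex C d" "(group_complex.ZT C d q :: ((_ >< 'v::real_vector) \<Rightarrow>\<^sub>0 int) set set) = group_complex.BT C d q"
proof -
 show C: "group_complex C d" unfolding C_def d_def by (rule group_complex_filtration[of F X, OF F])
 have "car (C q) = {e1 (C q)}" for q
  using trivial_relative_homology_group_empty[of "subtop X (F q)" q "F (q - 1)"] X
  by (simp add: C_def RH_def trivial_group_def)
 thus "(group_complex.ZT C d q :: ((_ >< 'v::real_vector) \<Rightarrow>\<^sub>0 int) set set) = group_complex.BT C d q"
  by (intro group_complex.tensor_exact_trivial[OF C]) (simp_all add: int_separated_def)
qed

lemma empty_duality:
 assumes "tsp W = {}"
 shows "linearly_isomorphic (intersection_homology_cone TYPE('v::real_vector) n p W N q)
  (dual_space (relative_intersection_homology_cone TYPE('v) n p' W N' r))"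
proof -
 have e: "tsp (CS W) = {}" using assms by (simp add: topspace_cone_space cylinder_def)
 have m: "ic_skeleton n p W N q <= ic_skeleton n p W N (q + 1)" "ic_skeleton n p' W N' q Un cone_base W <= ic_skeleton n p' W N' (q + 1) Un cone_base W" for q
  by (force simp: ic_skeleton_def)+
 note A = empty_complex[where F = "ic_skeleton n p W N", OF e m(1)]
  and B = empty_complex[where F = "%q. ic_skeleton n p' W N' q Un cone_base W", OF e m(2)]
 show ?thesis
  using group_complex.trivial_dual_iso[OF A B]
  unfolding intersection_homology_cone_def relative_intersection_homology_cone_def filtration_homology_eq by (simp add: diff_diff_eq)
qed

lemma perversity_bounds:
 assumes "perversity n p" "2 <= j" "j <= n"
 shows "0 <= p j & p j <= int j - 2"
 using assms(2,3)
proof (induction j rule: dec_induct)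
 case (step j)
 hence "p (Suc j) : {p j, p j + 1}" using assms(1) by (simp add: perversity_def)
 thus ?case using step by auto
qed (use assms(1) in "simp add: perversity_def")

context cone_decomposition
begin

lemma absolute_trivial:
 assumes "2 <= a" "a - 1 <= q \<or> q < 0"
 shows "(group_complex.ZT (CG a {}) (Cd a {}) q :: (('a cone chain set >< 'v::real_vector) \<Rightarrow>\<^sub>0 int) set set) = group_complex.BT (CG a {}) (Cd a {}) q"
 using assms(2)
proof
 assume "a - 1 <= q"
 thus ?thesis
  using group_complex.tensor_exact[OF cone_group_complex absolute_exact[OF assms(1)] cone_separated[OF C.subcomplex_empty]] by blast
next
 assume "q < 0"
 thus ?thesis
  using group_complex.tensor_exact_trivial[OF cone_group_complex _ cone_separated[OF C.subcomplex_empty]] vanishes_neg[unfolded vanishes_def] by blast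
qed

lemma relative_trivial':
 assumes "r < a \<or> (ALL c:SC. int (cdim c) ~= r)"
 shows "(group_complex.ZT (CG a base) (Cd a base) r :: (('a cone chain set >< 'v::real_vector) \<Rightarrow>\<^sub>0 int) set set) = group_complex.BT (CG a base) (Cd a base) r"
 by (rule group_complex.tensor_exact_trivial[OF cone_group_complex relative_trivial[OF assms, unfolded vanishes_def] cone_separated[OF subcomplex_base]])

end

lemma middle_duality:
 fixes W :: "'a topology" and B :: "'v::real_vector set"
 assumes D: "cone_decomposition W N" and D': "cone_decomposition W N'" and O: "oriented_cells W (UN k. N k) (cell_dim N) m om"
  and B: "finite_dimensional_vector_space ((*R) :: real => 'v => 'v) B"
  and q: "int q + 1 < a" "q < m" "a' <= int (m - q) + 1"
 shows "linearly_isomorphic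
  (cone_decomposition.HS W N TYPE('v) a {} (int q))
  (dual_space (cone_decomposition.HS W N' TYPE('v) a' (cone_decomposition.base W N') (int (m - q) + 1)))"
proof -
 interpret D: cone_decomposition W N by fact
 interpret D': cone_decomposition W N' by fact
 interpret O: oriented_cells W "UN k. N k" "cell_dim N" m om by fact
 let ?S = "UN k. N k" and ?k = "m - q"
 interpret dual: dual_cells ?S "cell_dim N" "%s t. s <= D.W.cl t" D.W.inc D.W.vsign O.ov m "TYPE('v)" by (rule O.dual_cells)
 interpret G: group_complex "D.CG a {}" "D.Cd a {}" by (rule D.cone_group_complex)
 interpret H: group_complex "D'.CG a' D'.base" "D'.Cd a' D'.base" by (rule D'.cone_group_complex)
 note e = D.W.subcomplex_all D.W.subcomplex_empty empty_subsetI
 obtain R1 where R1: "corr_grp (D.WG (int ?k)) (group_complex.ZC D.WG (D.W.cbd ?S {}) (int ?k)) (group_complex.BC D.WG (D.W.cbd ?S {}) (int ?k)) (RH W (int ?k) (tsp W) {}) R1"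
  using D.W.pair_corr[OF e, of "int ?k"] unfolding group_complex.ZC_def[OF D.W.chain_group_complex] group_complex.BC_def[OF D.W.chain_group_complex] D.W.cover Union_empty by blast
 have k1: "1 <= int ?k" and k0: "0 < ?k" using q(2) by simp_all
 obtain R2 where R2: "group_corr (RH W (int ?k) (tsp W) {}) (car (RH W (int ?k) (tsp W) {})) {e1 (RH W (int ?k) (tsp W) {})}
  (D'.CG a' D'.base (int ?k + 1)) (H.ZC (int ?k + 1)) (H.BC (int ?k + 1)) R2"
  using D'.relative_corr[OF k1 q(3)] unfolding H.ZC_def H.BC_def by blast
 have 1: "lin_corr (G.T (int q) :: (real, ('a cone, 'v) tensor_chain) module) (G.ZT (int q)) (G.BT (int q)) FS
   {x : dual.coch q. dual.bd x = (%_. 0)} (dual.bd ` dual.coch (Suc q))"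
  unfolding O.chain_sets(1,2)[symmetric]
 proof (rule G.tensor_homology_coords[OF D.bcoord_int_coords D.bcoord_int_coords D.bcoord_int_coords D.bcoord_bd])
  show "D.bcoord (int q) (D.Cd a {} (int q + 1) x) t = (SUM r:D.W.cells ?S {} (int q + 1). D.W.inc r t * D.bcoord (int q + 1) x r)"
   if "x : car (D.CG a {} (int q + 1))" "t : D.W.cells ?S {} (int q)" for x t
   using D.bcoord_bd[of "int q + 1" a x t] that q(1) by simp
 qed (use q(1) in simp_all)
 interpret sq: subquotient "G.T (int q) :: (real, ('a cone, 'v) tensor_chain) module" "G.ZT (int q)" "G.BT (int q)" by (rule G.subquotient)
 show ?thesis
 proof (rule finite_dimensional_self_dual[OF B])
  fix ip :: "'v => 'v => real"
  assume ip: "!!u v w. ip (u + v) w = ip u w + ip v w" "!!u v w. ip u (v + w) = ip u v + ip u w"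
   "!!r v w. ip (r *R v) w = r * ip v w" "!!r v w. ip v (r *R w) = r * ip v w"
   "!!l. (!!v w. l (v + w) = l v + l w) ==> (!!r v. l (r *R v) = r * l v) ==> EX v. ALL w. l w = ip v w"
   "!!v. (!!w. ip v w = 0) ==> v = 0"
  have 2: "lin_corr FS {y : dual.coch ?k. dual.cobd y = (%_. 0)} (dual.cobd ` dual.coch (?k - 1))
    (dual_space (homology_space (H.T :: int => (real, ('a cone, 'v) tensor_chain) module) H.D (int ?k + 1)))
    (car (dual_space (homology_space (H.T :: int => (real, ('a cone, 'v) tensor_chain) module) H.D (int ?k + 1))))
    {e0 (dual_space (homology_space (H.T :: int => (real, ('a cone, 'v) tensor_chain) module) H.D (int ?k + 1)))}"
   unfolding O.chain_sets(3)[symmetric] O.chain_sets(4)[symmetric, of ?k, OF k0]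
  proof (rule H.cochain_dual_corr[OF ip D.W.chain_group_complex D.W.chain_coords[OF e(1,2)] D.W.chain_coords[OF e(1,2)] D.W.chain_coords[OF e(1,2)]
     D.W.chain_bd_coord[OF e] _ D'.cone_separated[OF D'.subcomplex_base] D'.cone_separated[OF D'.subcomplex_base] group_corr_trans[OF R1 R2]])
   show "D.W.ccoord ?S {} (int ?k) (D.W.cbd ?S {} (int ?k + 1) x) t = (SUM r:D.W.cells ?S {} (int ?k + 1). D.W.inc r t * D.W.ccoord ?S {} (int ?k + 1) x r)"
    if "x : car (D.WG (int ?k + 1))" "t : D.W.cells ?S {} (int ?k)" for x t
    using D.W.chain_bd_coord[OF e, of x "int ?k + 1" t] that by simp
  qed
  show ?thesis
   unfolding G.homology_space_eq
   by (rule sq.linearly_isomorphic_quotientI[OF _ lin_corr_trans[OF 1 lin_corr_trans[OF dual.chain_cochain_corr[OF q(2)] 2]]])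
    (unfold H.homology_space_eq, rule subquotient.abelian_group_dual_quotient[OF H.subquotient])
 qed
qed

theorem theorem8p2:
  fixes W :: "'a topology"
    and \<A> :: "('a set \<times> ('a \<Rightarrow> real^'m)) set"
    and p :: "nat \<Rightarrow> int"
    and N N' :: "nat \<Rightarrow> 'a set set"
    and B :: "'v::real_vector set"
    and q :: int
  assumes "oriented_smooth_manifold W \<A>" and "compact_space W" and "connected_space W"
    and "perversity (CARD('m) + 1) p"
    and "finite_dimensional_vector_space ((*\<^sub>R) :: real \<Rightarrow> 'v \<Rightarrow> 'v) B"
    and "regular_cell_decomposition W N" and "regular_cell_decomposition W N'"
  shows "linearly_isomorphic
     (intersection_homology_cone TYPE('v) (CARD('m) + 1) p W N q)
     (dual_space (relative_intersection_homology_cone TYPE('v) (CARD('m) + 1)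
        (complementary_perversity p) W N' (int CARD('m) + 1 - q)))"
proof (cases "tsp W = {}")
 case False
 interpret oriented_manifold W \<A> by unfold_locales fact
 interpret D: cone_decomposition W N by unfold_locales fact+
 interpret D': cone_decomposition W N' by unfold_locales fact+
 note o = local_vanishes om_additive om_bij om_locally_constant
 have O: "oriented_cells W (UN k. N k) (cell_dim N) CARD('m) om"
  by (intro oriented_cells.intro D.W.finite_cells_axioms oriented_cells_axioms.intro o)
 interpret O': oriented_cells W "UN k. N' k" "cell_dim N'" "CARD('m)" om
  by (intro oriented_cells.intro D'.W.finite_cells_axioms oriented_cells_axioms.intro o)
 define n where "n = CARD('m) + 1"
 define a where "a = int n - p n"
 define a' where "a' = int n - complementary_perversity p n"
 have pb: "0 <= p n" "p n <= int n - 2" using perversity_bounds[OF assms(4), of n] by (simp_all add: n_def Suc_le_eq)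
 have a: "2 <= a" "a <= int n" "a' = int n + 2 - a" using pb by (simp_all add: a_def a'_def complementary_perversity_def)
 show ?thesis
  unfolding n_def[symmetric] D.cone_homology_eq D'.cone_homology_eq a_def[symmetric] a'_def[symmetric]
 proof (cases "a - 1 <= q \<or> q < 0")
  case True
  have "int CARD('m) + 1 - q < a' \<or> (ALL c:D'.SC. int (D'.cdim c) ~= int CARD('m) + 1 - q)"
   using True D'.cone_dim_le[OF O'.dm_le] a(3) by (force simp: n_def)
  thus "linearly_isomorphic (D.HS TYPE('v) a {} q)
   (dual_space (D'.HS TYPE('v) a' D'.base (int CARD('m) + 1 - q)))"
   by (intro group_complex.trivial_dual_iso[OF D.cone_group_complex D.absolute_trivial[OF a(1) True] D'.cone_group_complex D'.relative_trivial'])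
 next
  case False
  then obtain j where j: "q = int j" "int j + 1 < a" using nonneg_int_cases[of q] by force
  have jm: "j < CARD('m)" "a' <= int (CARD('m) - j) + 1" and qj: "int CARD('m) + 1 - q = int (CARD('m) - j) + 1" using j a by (auto simp: n_def)
  show "linearly_isomorphic (D.HS TYPE('v) a {} q)
   (dual_space (D'.HS TYPE('v) a' D'.base (int CARD('m) + 1 - q)))"
   unfolding qj unfolding j(1)
   by (rule middle_duality[OF D.cone_decomposition_axioms D'.cone_decomposition_axioms O assms(5) j(2) jm])
 qed
qed (rule empty_duality)

end
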